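(* Let $m_e\in M$ be a relative equilibrium of the Hamiltonian system $(M,\omega,h,G,\mathbf{J}:M\to\mathfrak{g}^* )$, where the Lie group $G$ acts properly on the manifold $M$, and let $\mu=\mathbf{J}(m_e)$. Suppose that there is a generator $\xi\in\mathfrak{g}$ of $m_e$ and a nontrivial vector subspace $V_0\subset T_{m_e}M$ for which $$\ker D^2(h-\mathbf{J}^\xi)(m_e)=\mathfrak{g}_\mu\cdot m_e\oplus V_0,$$ where $D^2(h-\mathbf{J}^\xi)(m_e)$ is regarded as a bilinear form on $\ker D\mathbf{J}(m_e)$. Then, generically, for any maximal isotropy subgroup $K\subset G_\xi\cap G_{m_e}$ of the $G_\xi\cap G_{m_e}$-action on $V_0$ for which $\dim(V_0^K)=1$ and the rigid residual equation $\rho=0$ is satisfied on $(\mathfrak{m}^* )^K\times V_0^K\times\{0\}$, a branch of relative equilibria with isotropy subgroup $K$ bifurcates from $m_e$. If $N_{G_\xi\cap G_{m_e}}(K)/K\simeq\{\mathrm{Id}\}$, the bifurcation is a saddle–node; if $N_{G_\xi\cap G_{m_e}}(K)/K\simeq\mathbb{Z}_2$, it is a pitchfork.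
   Context: Setting. $(M,\omega)$ is symplectic, the $G$-action is Hamiltonian with equivariant momentum map, $\mathbf{J}(g\cdot m)=\mathrm{Ad}^*_{g^{-1}}\mathbf{J}(m)$, and $h$ is $G$-invariant. Relative equilibrium with generator $\xi$: $F_t(m_e)=\exp(t\xi)\cdot m_e$ ($F_t$ the flow of $X_h$), equivalently $D(h-\mathbf{J}^\xi)(m_e)=0$, $\mathbf{J}^\xi=\langle\mathbf{J},\xi\rangle$. $\langle\mathrm{ad}^*_\zeta\nu,\eta\rangle=\langle\nu,[\zeta,\eta]\rangle$; $\mathfrak{s}\cdot m=\{\zeta_M(m):\zeta\in\mathfrak{s}\}$. $G_{m_e},G_\mu,G_\xi$ are isotropy subgroups (for the action on $M$, the coadjoint and the adjoint action), $\mathfrak{g}_{m_e},\mathfrak{g}_\mu$ the Lie algebras of the first two. Superscript $K$ denotes $K$-fixed points; $N_L(K)$ is the normalizer of $K$ in $L$. $\mathfrak{g}=\mathfrak{g}_{m_e}\oplus\mathfrak{m}\oplus\mathfrak{q}$ is a $G_{m_e}\cap G_\xi$-invariant splitting with $\mathfrak{g}_\mu=\mathfrak{g}_{m_e}\oplus\mathfrak{m}$; $i,\mathbb{P}$ with subscripts are the associated injections and projections. Slice mapping. A slice mapping at $m_e$ is a smooth map $\Psi:\mathcal{U}\to M$ on an open neighborhood $\mathcal{U}$ of $(0,0)$ in $\mathfrak{m}^*\times V$ ($V$ a vector space), a diffeomorphism onto its image, with (SM1) $\Psi(0,0)=m_e$; (SM2) $T_{\Psi(\eta,v)}M=(\mathfrak{m}\oplus\mathfrak{q})\cdot\Psi(\eta,v)+T_{(\eta,v)}\Psi\cdot(\mathfrak{m}^*\times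 V)$ for all $(\eta,v)\in\mathcal{U}$; (SM3) $D(\mathbf{J}\circ\Psi)(0,0)(\delta\eta,\delta v)=\mathbb{P}_{\mathfrak{m}}^*\delta\eta$. It is taken $G_{m_e}\cap G_\xi$-equivariant, for the coadjoint action on $\mathfrak{m}^*$ and a linear action on $V$. Reduced equations. Put $\mathcal{H}:=h\circ\Psi$, $\mathbf{j}:=\mathbf{J}\circ\Psi$. The functions $\gamma,\beta,v_1$ below are defined near the origin, vanish at the origin and are the unique local solutions given by the Implicit Function Theorem. Step 1: $\gamma(\eta,v,\alpha,\beta)\in\mathfrak{q}$ (with $\alpha\in\mathfrak{g}_{m_e}$, $\beta\in\mathfrak{m}$) solves $i_{\mathfrak{q}}^*\,\mathrm{ad}^*_{\xi+\alpha+\beta+\gamma}\mathbf{j}(\eta,v)=0$; $\omega_1(\eta,v,\alpha,\beta)=\xi+\alpha+\beta+\gamma(\eta,v,\alpha,\beta)$. Step 2: $\beta(\eta,v,\alpha)\in\mathfrak{m}$ solves $D_{\mathfrak{m}^*}(\mathcal{H}-\mathbf{j}^\zeta)(\eta,v)|_{\zeta=\omega_1(\eta,v,\alpha,\beta)}=0$; $\omega_2(\eta,v,\alpha)=\omega_1(\eta,v,\alpha,\beta(\eta,v,\alpha))$. Step 3: $\mathcal{L}:V\to V^*$, $\langle\mathcal{L}v,w\rangle=D_{VV}(\mathcal{H}-\mathbf{j}^\xi)(0,0)(v,w)$ (Fredholm, $V$ Hilbert, if infinite dimensional); $\ker\mathcal{L}$ is identified with $V_0$ through $T_{(0,0)}\Psi$;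 $V=V_0\oplus V_1$, $V^*=\mathrm{range}\,\mathcal{L}\oplus V_2$ with $V_1,V_2$ closed and $G_{m_e}\cap G_\xi$-invariant; $\mathbb{P}:V^*\to V_2$ the projection; $V_2\simeq V_0$ via an invariant inner product; $v_1(\eta,v_0,\alpha)\in V_1$ solves $(\mathbb{I}-\mathbb{P})D_V(\mathcal{H}-\mathbf{j}^\zeta)(\eta,v_0+v_1)|_{\zeta=\omega_2(\eta,v_0+v_1,\alpha)}=0$. With $\Xi(\eta,v_0,\alpha)=\omega_2(\eta,v_0+v_1(\eta,v_0,\alpha),\alpha)$, for $(\eta,v_0,\alpha)\in\mathfrak{m}^*\times V_0\times\mathfrak{g}_{m_e}$ near the origin, put $B(\eta,v_0,\alpha)=\mathbb{P}D_V(\mathcal{H}-\mathbf{j}^\zeta)(\eta,v_0+v_1(\eta,v_0,\alpha))|_{\zeta=\Xi(\eta,v_0,\alpha)}\in V_2$ (bifurcation equation $B=0$) and $\rho(\eta,v_0,\alpha)=i_{\mathfrak{m}}^*\,\mathrm{ad}^*_{\Xi(\eta,v_0,\alpha)}\mathbf{j}(\eta,v_0+v_1(\eta,v_0,\alpha))\in\mathfrak{m}^*$ (rigid residual equation $\rho=0$). Near the origin, solutions of $B=0$, $\rho=0$ correspond to the relative equilibria $\Psi(\eta,v_0+v_1(\eta,v_0,\alpha))$ with generator $\Xi(\eta,v_0,\alpha)$. The maps $B,\rho,\Xi,v_1$ are $G_{m_e}\cap G_\xi$-equivariant, so $B$ restricts to $B^K:(\mathfrak{m}^* )^K\times V_0^K\times\mathfrak{g}_{m_e}^K\to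 V_2^K$. Meaning of "generically". The paper's convention: a property of a system is generic if it is true unless additional constraints are added to the system. Concretely, in this setting $N_{G_\xi\cap G_{m_e}}(K)/K$ is $\{\mathrm{Id}\}$ or $\mathbb{Z}_2$, the leading Taylor terms of $B^K(\eta,v_0,0)$ are written respectively as $\kappa\cdot\eta+v_0^2c+\cdots$ and $v_0(\kappa\cdot\eta+v_0^2c+\cdots)$, and the coefficients $\kappa$ (linear on $(\mathfrak{m}^* )^K$) and $c\in\mathbb{R}$ are generically nonzero. The bifurcation parameter is $\eta\in(\mathfrak{m}^* )^K$ and the branch is sought among solutions with $\alpha=0$. *)

theory Defs
  imports
    "HOL-Analysis.Analysis"
    "HOL-Library.Landau_Symbols"
    "HOL-Algebra.Group_Action"
    "HOL-Algebra.Elementary_Groups"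
begin

section \<open>Smooth maps between open subsets of normed spaces\<close>

text \<open>Iterated Frechet differentiability, the derivative being tested in every fixed direction.
  Asking this for all orders is ordinary smoothness; between Banach spaces the directional
  formulation agrees with the operator-norm one by the uniform boundedness principle.\<close>

fun Ck_on :: "nat \<Rightarrow> 'x::real_normed_vector set \<Rightarrow> ('x \<Rightarrow> 'y::real_normed_vector) \<Rightarrow> bool" where
  "Ck_on 0 W f \<longleftrightarrow> continuous_on W f"
| "Ck_on (Suc k) W f \<longleftrightarrow> (\<forall>x\<in>W. f differentiable (at x)) \<and>
     (\<forall>u. Ck_on k W (\<lambda>x. frechet_derivative f (at x) u))"

definition smooth_on :: "'x::real_normed_vector set \<Rightarrow> ('x \<Rightarrow> 'y::real_normed_vector) \<Rightarrow> bool" where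
  "smooth_on W f \<longleftrightarrow> (\<forall>k. Ck_on k W f)"


section \<open>Manifolds\<close>

text \<open>A manifold is a Hausdorff topological type with an atlas of charts into a normed space;
  a chart is a pair of a domain and a map, of which only the restriction to the domain matters.\<close>

type_synonym ('p, 'e) chart = "'p set \<times> ('p \<Rightarrow> 'e)"

definition chart_inv :: "('p, 'e) chart \<Rightarrow> 'e \<Rightarrow> 'p" where
  "chart_inv c = inv_into (fst c) (snd c)"

definition smooth_atlas :: "('p::topological_space, 'e::real_normed_vector) chart set \<Rightarrow> bool" where
  "smooth_atlas A \<longleftrightarrow>
     (\<Union>c\<in>A. fst c) = UNIV \<and>
     (\<forall>c\<in>A. open (fst c) \<and> open (snd c ` fst c) \<and>
        homeomorphism (fst c) (snd c ` fst c) (snd c) (chart_inv c)) \<and>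
     (\<forall>c\<in>A. \<forall>d\<in>A. smooth_on (snd c ` (fst c \<inter> fst d)) (snd d \<circ> chart_inv c))"

definition model_atlas :: "('x::real_normed_vector, 'x) chart set" where
  "model_atlas = {(UNIV, \<lambda>x. x)}"

definition prod_atlas :: "('p, 'e) chart set \<Rightarrow> ('q, 'f) chart set \<Rightarrow> ('p \<times> 'q, 'e \<times> 'f) chart set" where
  "prod_atlas A B = (\<lambda>(c, d). (fst c \<times> fst d, map_prod (snd c) (snd d))) ` (A \<times> B)"

text \<open>Smoothness on an arbitrary subset: a smooth extension to an open set exists near each of
  its points.\<close>

definition smooth_map ::
  "('p::topological_space, 'e::real_normed_vector) chart set \<Rightarrow>
   ('q::topological_space, 'f::real_normed_vector) chart set \<Rightarrow> 'p set \<Rightarrow> ('p \<Rightarrow> 'q) \<Rightarrow> bool" where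
  "smooth_map A B X f \<longleftrightarrow>
     (\<forall>p\<in>X. \<exists>W F. open W \<and> p \<in> W \<and> (\<forall>x\<in>W \<inter> X. F x = f x) \<and> continuous_on W F \<and>
        (\<forall>c\<in>A. \<forall>d\<in>B. smooth_on (snd c ` {x \<in> fst c \<inter> W. F x \<in> fst d}) (snd d \<circ> F \<circ> chart_inv c)))"

abbreviation smooth_in :: "'x::real_normed_vector set \<Rightarrow> ('x \<Rightarrow> 'y::real_normed_vector) \<Rightarrow> bool" where
  "smooth_in \<equiv> smooth_map model_atlas model_atlas"

definition diffeo_onto_image ::
  "('p::topological_space, 'e::real_normed_vector) chart set \<Rightarrow>
   ('q::topological_space, 'f::real_normed_vector) chart set \<Rightarrow> 'p set \<Rightarrow> ('p \<Rightarrow> 'q) \<Rightarrow> bool" where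
  "diffeo_onto_image A B X f \<longleftrightarrow>
     smooth_map A B X f \<and> inj_on f X \<and> smooth_map B A (f ` X) (inv_into X f)"

text \<open>Each point carries a preferred chart, through which its tangent space is identified with
  the model space. All tangent vectors below are expressed in preferred charts.\<close>

definition chart_at :: "('p, 'e) chart set \<Rightarrow> 'p \<Rightarrow> ('p, 'e) chart" where
  "chart_at A p = (SOME c. c \<in> A \<and> p \<in> fst c)"

definition tangent_map ::
  "('p, 'e::real_normed_vector) chart set \<Rightarrow> ('q, 'f::real_normed_vector) chart set \<Rightarrow>
   ('p \<Rightarrow> 'q) \<Rightarrow> 'p \<Rightarrow> 'e \<Rightarrow> 'f" where
  "tangent_map A B f p =
     frechet_derivative (snd (chart_at B (f p)) \<circ> f \<circ> chart_inv (chart_at A p))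
       (at (snd (chart_at A p) p))"

definition velocity :: "('p, 'e::real_normed_vector) chart set \<Rightarrow> (real \<Rightarrow> 'p) \<Rightarrow> real \<Rightarrow> 'e" where
  "velocity A c t = tangent_map model_atlas A c t 1"

text \<open>The second derivative at \<open>p\<close> in the preferred chart. It is intrinsic at critical points
  of \<open>f\<close>, and only used there.\<close>

definition hessian ::
  "('p, 'e::real_normed_vector) chart set \<Rightarrow> ('p \<Rightarrow> real) \<Rightarrow> 'p \<Rightarrow> 'e \<Rightarrow> 'e \<Rightarrow> real" where
  "hessian A f p u w =
     frechet_derivative
       (\<lambda>x. frechet_derivative (f \<circ> chart_inv (chart_at A p)) (at x) w)
       (at (snd (chart_at A p) p)) u"

definition internal_sum :: "'x::real_vector set \<Rightarrow> 'x set \<Rightarrow> 'x set \<Rightarrow> bool" where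
  "internal_sum X Y Z \<longleftrightarrow> subspace Y \<and> subspace Z \<and>
     X = {y + z | y z. y \<in> Y \<and> z \<in> Z} \<and> Y \<inter> Z = {0}"


section \<open>Hamiltonian systems with symmetry\<close>

record (overloaded) ('a, 'g, 'p, 'e) ham_system =
  grp :: "'a monoid"
  atlG :: "('a, 'g) chart set"
  lexp :: "'g \<Rightarrow> 'a"
  atlM :: "('p, 'e) chart set"
  form :: "'p \<Rightarrow> 'e \<Rightarrow> 'e \<Rightarrow> real"
  act :: "'a \<Rightarrow> 'p \<Rightarrow> 'p"
  ham :: "'p \<Rightarrow> real"
  mom :: "'p \<Rightarrow> ('g \<Rightarrow>\<^sub>L real)"

text \<open>The Lie algebra is the tangent space at the identity, that is the model space \<open>'g\<close> of the
  group; its bracket is the derivative of the adjoint representation.\<close>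

definition Ad :: "('a, 'g::euclidean_space, 'p, 'e) ham_system \<Rightarrow> 'a \<Rightarrow> 'g \<Rightarrow> 'g" where
  "Ad S g = tangent_map (atlG S) (atlG S)
     (\<lambda>x. g \<otimes>\<^bsub>grp S\<^esub> x \<otimes>\<^bsub>grp S\<^esub> inv\<^bsub>grp S\<^esub> g) \<one>\<^bsub>grp S\<^esub>"

definition bracket :: "('a, 'g::euclidean_space, 'p, 'e) ham_system \<Rightarrow> 'g \<Rightarrow> 'g \<Rightarrow> 'g" where
  "bracket S \<zeta> \<eta> = tangent_map (atlG S) model_atlas (\<lambda>g. Ad S g \<eta>) \<one>\<^bsub>grp S\<^esub> \<zeta>"

definition coAd :: "('a, 'g::euclidean_space, 'p, 'e) ham_system \<Rightarrow> 'a \<Rightarrow> ('g \<Rightarrow>\<^sub>L real) \<Rightarrow> ('g \<Rightarrow>\<^sub>L real)" where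
  "coAd S g \<nu> = Blinfun (\<lambda>\<eta>. \<nu> (Ad S (inv\<^bsub>grp S\<^esub> g) \<eta>))"

definition coad :: "('a, 'g::euclidean_space, 'p, 'e) ham_system \<Rightarrow> 'g \<Rightarrow> ('g \<Rightarrow>\<^sub>L real) \<Rightarrow> ('g \<Rightarrow>\<^sub>L real)" where
  "coad S \<zeta> \<nu> = Blinfun (\<lambda>\<eta>. \<nu> (bracket S \<zeta> \<eta>))"

text \<open>The last condition determines \<open>lexp\<close> uniquely as the exponential map of the group.\<close>

definition lie_group :: "('a::t2_space, 'g::euclidean_space, 'p, 'e) ham_system \<Rightarrow> bool" where
  "lie_group S \<longleftrightarrow>
     group (grp S) \<and> carrier (grp S) = UNIV \<and> smooth_atlas (atlG S) \<and>
     smooth_map (prod_atlas (atlG S) (atlG S)) (atlG S) UNIV (\<lambda>(g, k). g \<otimes>\<^bsub>grp S\<^esub> k) \<and>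
     smooth_map (atlG S) (atlG S) UNIV (\<lambda>g. inv\<^bsub>grp S\<^esub> g) \<and>
     (\<forall>\<zeta>. smooth_map model_atlas (atlG S) UNIV (\<lambda>t. lexp S (t *\<^sub>R \<zeta>)) \<and>
        (\<forall>s t. lexp S ((s + t) *\<^sub>R \<zeta>) = lexp S (s *\<^sub>R \<zeta>) \<otimes>\<^bsub>grp S\<^esub> lexp S (t *\<^sub>R \<zeta>)) \<and>
        velocity (atlG S) (\<lambda>t. lexp S (t *\<^sub>R \<zeta>)) 0 = \<zeta>)"

text \<open>The form in a chart, as a function of the coordinates and of two coordinate vectors.\<close>

definition local_form :: "('a, 'g, 'p, 'e::real_normed_vector) ham_system \<Rightarrow> ('p, 'e) chart \<Rightarrow>
    'e \<Rightarrow> 'e \<Rightarrow> 'e \<Rightarrow> real" where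
  "local_form S c x u w =
     (let p = chart_inv c x;
          T = frechet_derivative (snd (chart_at (atlM S) p) \<circ> chart_inv c) (at x)
      in form S p (T u) (T w))"

definition symplectic_manifold :: "('a, 'g, 'p::t2_space, 'e::banach) ham_system \<Rightarrow> bool" where
  "symplectic_manifold S \<longleftrightarrow>
     smooth_atlas (atlM S) \<and>
     (\<forall>p. bounded_bilinear (form S p) \<and>
        (\<forall>u w. form S p u w = - form S p w u) \<and>
        (\<forall>u. (\<forall>w. form S p u w = 0) \<longrightarrow> u = 0)) \<and>
     (\<forall>c\<in>atlM S. \<forall>u w. smooth_on (snd c ` fst c) (\<lambda>x. local_form S c x u w)) \<and>
     (\<forall>c\<in>atlM S. \<forall>x\<in>snd c ` fst c. \<forall>u v w.
        frechet_derivative (\<lambda>y. local_form S c y v w) (at x) u +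
        frechet_derivative (\<lambda>y. local_form S c y w u) (at x) v +
        frechet_derivative (\<lambda>y. local_form S c y u v) (at x) w = 0)"

definition inf_gen :: "('a, 'g::euclidean_space, 'p, 'e::real_normed_vector) ham_system \<Rightarrow> 'g \<Rightarrow> 'p \<Rightarrow> 'e" where
  "inf_gen S \<zeta> p = velocity (atlM S) (\<lambda>t. act S (lexp S (t *\<^sub>R \<zeta>)) p) 0"

text \<open>Differential at \<open>p\<close> of a function with values in a vector space.\<close>

definition dM :: "('a, 'g, 'p, 'e::real_normed_vector) ham_system \<Rightarrow>
    ('p \<Rightarrow> 'y::real_normed_vector) \<Rightarrow> 'p \<Rightarrow> 'e \<Rightarrow> 'y" where
  "dM S f p = tangent_map (atlM S) model_atlas f p"

definition hamiltonian_G_system ::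
  "('a::t2_space, 'g::euclidean_space, 'p::t2_space, 'e::banach) ham_system \<Rightarrow> bool" where
  "hamiltonian_G_system S \<longleftrightarrow>
     lie_group S \<and> symplectic_manifold S \<and>
     \<comment> \<open>smooth symplectic action\<close>
     group_action (grp S) UNIV (act S) \<and>
     smooth_map (prod_atlas (atlG S) (atlM S)) (atlM S) UNIV (\<lambda>(g, p). act S g p) \<and>
     (\<forall>g p u w. form S (act S g p) (tangent_map (atlM S) (atlM S) (act S g) p u)
        (tangent_map (atlM S) (atlM S) (act S g) p w) = form S p u w) \<and>
     \<comment> \<open>equivariant momentum map\<close>
     smooth_map (atlM S) model_atlas UNIV (mom S) \<and>
     (\<forall>\<zeta> p u. dM S (\<lambda>m. mom S m \<zeta>) p u = form S p (inf_gen S \<zeta> p) u) \<and>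
     (\<forall>g p. mom S (act S g p) = coAd S g (mom S p)) \<and>
     \<comment> \<open>invariant Hamiltonian\<close>
     smooth_map (atlM S) model_atlas UNIV (ham S) \<and>
     (\<forall>g p. ham S (act S g p) = ham S p)"

definition proper_action :: "('a::t2_space, 'g, 'p::t2_space, 'e) ham_system \<Rightarrow> bool" where
  "proper_action S \<longleftrightarrow> proper_map euclidean euclidean (\<lambda>(g, p). (p, act S g p))"

text \<open>\<open>ham_vector S p X\<close>: \<open>X\<close> is the value at \<open>p\<close> of the Hamiltonian vector field of \<open>h\<close>; a motion is an
  integral curve of that vector field, i.e. an orbit of its flow.\<close>

definition ham_vector :: "('a, 'g, 'p, 'e::real_normed_vector) ham_system \<Rightarrow> 'p \<Rightarrow> 'e \<Rightarrow> bool" where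
  "ham_vector S p X \<longleftrightarrow> (\<forall>u. form S p X u = dM S (ham S) p u)"

definition motion :: "('a, 'g, 'p::topological_space, 'e::real_normed_vector) ham_system \<Rightarrow> (real \<Rightarrow> 'p) \<Rightarrow> bool" where
  "motion S c \<longleftrightarrow> smooth_map model_atlas (atlM S) UNIV c \<and>
     (\<forall>t. ham_vector S (c t) (velocity (atlM S) c t))"

definition relative_equilibrium ::
  "('a, 'g::euclidean_space, 'p::topological_space, 'e::real_normed_vector) ham_system \<Rightarrow> 'p \<Rightarrow> 'g \<Rightarrow> bool" where
  "relative_equilibrium S m \<zeta> \<longleftrightarrow>
     (\<exists>c. motion S c \<and> c 0 = m \<and> (\<forall>t. c t = act S (lexp S (t *\<^sub>R \<zeta>)) m))"

definition lie_algebra :: "('a, 'g::euclidean_space, 'p, 'e) ham_system \<Rightarrow> 'a set \<Rightarrow> 'g set" where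
  "lie_algebra S H = {\<zeta>. \<forall>t. lexp S (t *\<^sub>R \<zeta>) \<in> H}"

definition augmented :: "('a, 'g::euclidean_space, 'p, 'e) ham_system \<Rightarrow> 'g \<Rightarrow> 'p \<Rightarrow> real" where
  "augmented S \<zeta> p = ham S p - mom S p \<zeta>"

text \<open>Kernel of the second variation of the augmented Hamiltonian, regarded as a bilinear form on
  the kernel of the derivative of the momentum map.\<close>

definition second_variation_kernel ::
  "('a, 'g::euclidean_space, 'p, 'e::real_normed_vector) ham_system \<Rightarrow> 'g \<Rightarrow> 'p \<Rightarrow> 'e set" where
  "second_variation_kernel S \<zeta> m =
     (let N = {u. dM S (mom S) m u = 0}
      in {u \<in> N. \<forall>w\<in>N. hessian (atlM S) (augmented S \<zeta>) m u w = 0})"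


section \<open>Slice mappings and the reduced equations\<close>

text \<open>\<open>'m\<close> is a copy of the complement \<open>\<mm>\<close> (through the injection \<open>inm\<close>, with projection \<open>prm\<close>), so
  that its dual is the type \<open>'m \<Rightarrow>\<^sub>L real\<close>; the complement \<open>\<qq>\<close> is the set \<open>qq\<close>. Using a Euclidean space for
  \<open>'m\<close> excludes only \<open>\<mm> = 0\<close>, where there is no bifurcation parameter. \<open>lin\<close> is the linear action on
  the Hilbert space \<open>'v\<close>.\<close>

record (overloaded) ('a, 'g, 'p, 'm, 'v) slice_data =
  base :: 'p
  gen :: 'g
  inm :: "'m \<Rightarrow>\<^sub>L 'g"
  prm :: "'g \<Rightarrow>\<^sub>L 'm"
  qq :: "'g set"
  udom :: "(('m \<Rightarrow>\<^sub>L real) \<times> 'v) set"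
  Psi :: "('m \<Rightarrow>\<^sub>L real) \<times> 'v \<Rightarrow> 'p"
  lin :: "'a \<Rightarrow> 'v \<Rightarrow> 'v"
  V1 :: "'v set"
  V2 :: "('v \<Rightarrow>\<^sub>L real) set"
  gam :: "('m \<Rightarrow>\<^sub>L real) \<times> 'v \<times> 'g \<times> 'm \<Rightarrow> 'g"
  bet :: "('m \<Rightarrow>\<^sub>L real) \<times> 'v \<times> 'g \<Rightarrow> 'm"
  v1 :: "('m \<Rightarrow>\<^sub>L real) \<times> 'v \<times> 'g \<Rightarrow> 'v"

context
  fixes S :: "('a::t2_space, 'g::euclidean_space, 'p::t2_space, 'e::banach) ham_system"
    and D :: "('a, 'g, 'p, 'm::euclidean_space, 'v::{real_inner, complete_space}) slice_data"
begin

definition G_me :: "'a set" where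
  "G_me = stabilizer (grp S) (act S) (base D)"

definition G_mu :: "'a set" where
  "G_mu = stabilizer (grp S) (coAd S) (mom S (base D))"

definition G_xi :: "'a set" where
  "G_xi = stabilizer (grp S) (Ad S) (gen D)"

definition Gam :: "'a monoid" where
  "Gam = (grp S)\<lparr>carrier := G_xi \<inter> G_me\<rparr>"

definition splitting :: bool where
  "splitting \<longleftrightarrow>
     internal_sum (lie_algebra S G_mu) (lie_algebra S G_me) (range (inm D)) \<and>
     internal_sum UNIV (lie_algebra S G_mu) (qq D) \<and>
     (\<forall>b. prm D (inm D b) = b) \<and>
     (\<forall>\<zeta>\<in>lie_algebra S G_me \<union> qq D. prm D \<zeta> = 0) \<and>
     (\<forall>g\<in>carrier Gam. Ad S g ` range (inm D) \<subseteq> range (inm D) \<and> Ad S g ` qq D \<subseteq> qq D)"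

definition coAd_m :: "'a \<Rightarrow> ('m \<Rightarrow>\<^sub>L real) \<Rightarrow> ('m \<Rightarrow>\<^sub>L real)" where
  "coAd_m g \<eta> = Blinfun (\<lambda>b. \<eta> (prm D (Ad S (inv\<^bsub>grp S\<^esub> g) (inm D b))))"

definition TPsi :: "('m \<Rightarrow>\<^sub>L real) \<times> 'v \<Rightarrow> ('m \<Rightarrow>\<^sub>L real) \<times> 'v \<Rightarrow> 'e" where
  "TPsi = tangent_map model_atlas (atlM S) (Psi D)"

definition slice_mapping :: bool where
  "slice_mapping \<longleftrightarrow>
     open (udom D) \<and> (0, 0) \<in> udom D \<and>
     diffeo_onto_image model_atlas (atlM S) (udom D) (Psi D) \<and>
     Psi D (0, 0) = base D \<and>
     (\<forall>x\<in>udom D. UNIV =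
        {inf_gen S (inm D b + \<gamma>) (Psi D x) + TPsi x \<delta> | b \<gamma> \<delta>. \<gamma> \<in> qq D}) \<and>
     ((\<lambda>x. mom S (Psi D x)) has_derivative (\<lambda>(\<delta>\<eta>, \<delta>v). \<delta>\<eta> o\<^sub>L prm D)) (at (0, 0))"

text \<open>The inner product of \<open>'v\<close> is taken invariant; it is the one used to identify \<open>V2\<close> with the
  kernel of the linearised equation.\<close>

definition equivariant_slice :: bool where
  "equivariant_slice \<longleftrightarrow>
     group_action Gam UNIV (lin D) \<and>
     (\<forall>g\<in>carrier Gam. bounded_linear (lin D g) \<and> (\<forall>v w. lin D g v \<bullet> lin D g w = v \<bullet> w)) \<and>
     (\<forall>g\<in>carrier Gam. \<forall>(\<eta>, v)\<in>udom D. (coAd_m g \<eta>, lin D g v) \<in> udom D \<and>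
        Psi D (coAd_m g \<eta>, lin D g v) = act S g (Psi D (\<eta>, v)))"

definition jj :: "('m \<Rightarrow>\<^sub>L real) \<Rightarrow> 'v \<Rightarrow> ('g \<Rightarrow>\<^sub>L real)" where
  "jj \<eta> v = mom S (Psi D (\<eta>, v))"

definition HJ :: "'g \<Rightarrow> ('m \<Rightarrow>\<^sub>L real) \<Rightarrow> 'v \<Rightarrow> real" where
  "HJ \<zeta> \<eta> v = ham S (Psi D (\<eta>, v)) - jj \<eta> v \<zeta>"

definition Dm :: "'g \<Rightarrow> ('m \<Rightarrow>\<^sub>L real) \<Rightarrow> 'v \<Rightarrow> (('m \<Rightarrow>\<^sub>L real) \<Rightarrow>\<^sub>L real)" where
  "Dm \<zeta> \<eta> v = Blinfun (frechet_derivative (\<lambda>\<eta>'. HJ \<zeta> \<eta>' v) (at \<eta>))"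

definition DV :: "'g \<Rightarrow> ('m \<Rightarrow>\<^sub>L real) \<Rightarrow> 'v \<Rightarrow> ('v \<Rightarrow>\<^sub>L real)" where
  "DV \<zeta> \<eta> v = Blinfun (frechet_derivative (HJ \<zeta> \<eta>) (at v))"

definition LL :: "'v \<Rightarrow> ('v \<Rightarrow>\<^sub>L real)" where
  "LL = frechet_derivative (DV (gen D) 0) (at 0)"

definition kerL :: "'v set" where
  "kerL = {v. LL v = 0}"

definition om1 :: "('m \<Rightarrow>\<^sub>L real) \<Rightarrow> 'v \<Rightarrow> 'g \<Rightarrow> 'm \<Rightarrow> 'g" where
  "om1 \<eta> v \<alpha> b = gen D + \<alpha> + inm D b + gam D (\<eta>, v, \<alpha>, b)"

definition om2 :: "('m \<Rightarrow>\<^sub>L real) \<Rightarrow> 'v \<Rightarrow> 'g \<Rightarrow> 'g" where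
  "om2 \<eta> v \<alpha> = om1 \<eta> v \<alpha> (bet D (\<eta>, v, \<alpha>))"

definition PP :: "('v \<Rightarrow>\<^sub>L real) \<Rightarrow> ('v \<Rightarrow>\<^sub>L real)" where
  "PP \<phi> = (THE a. a \<in> V2 D \<and> \<phi> - a \<in> range LL)"

end

text \<open>\<open>f\<close> is the local solution of \<open>eqn x y\<close> (unknown \<open>y \<in> Y\<close>, variable \<open>x \<in> X\<close>) produced by the
  implicit function theorem at the origin: it is smooth, vanishes at the origin, and near the
  origin its graph is the whole solution set.\<close>

definition implicit_solution ::
  "'x::real_normed_vector set \<Rightarrow> 'y::real_normed_vector set \<Rightarrow> ('x \<Rightarrow> 'y \<Rightarrow> bool) \<Rightarrow> ('x \<Rightarrow> 'y) \<Rightarrow> bool" where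
  "implicit_solution X Y eqn f \<longleftrightarrow> f 0 = 0 \<and>
     (\<exists>U W. open U \<and> 0 \<in> U \<and> open W \<and> 0 \<in> W \<and> smooth_in (U \<inter> X) f \<and>
        (\<forall>x\<in>U \<inter> X. f x \<in> W \<inter> Y \<and> (\<forall>y\<in>W \<inter> Y. eqn x y \<longleftrightarrow> y = f x)))"

definition fredholm :: "('x::real_normed_vector \<Rightarrow> 'y::real_normed_vector) \<Rightarrow> bool" where
  "fredholm T \<longleftrightarrow> bounded_linear T \<and> closed (range T) \<and>
     (\<exists>F. finite F \<and> {x. T x = 0} \<subseteq> span F) \<and>
     (\<exists>F. finite F \<and> UNIV = {y + z | y z. y \<in> range T \<and> z \<in> span F})"

context
  fixes S :: "('a::t2_space, 'g::euclidean_space, 'p::t2_space, 'e::banach) ham_system"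
    and D :: "('a, 'g, 'p, 'm::euclidean_space, 'v::{real_inner, complete_space}) slice_data"
begin

definition step1 :: bool where
  "step1 \<longleftrightarrow> implicit_solution {(\<eta>, v, \<alpha>, b). \<alpha> \<in> lie_algebra S (G_me S D)} (qq D)
     (\<lambda>(\<eta>, v, \<alpha>, b) \<gamma>. \<forall>\<zeta>\<in>qq D. coad S (gen D + \<alpha> + inm D b + \<gamma>) (jj S D \<eta> v) \<zeta> = 0)
     (gam D)"

definition step2 :: bool where
  "step2 \<longleftrightarrow> implicit_solution {(\<eta>, v, \<alpha>). \<alpha> \<in> lie_algebra S (G_me S D)} UNIV
     (\<lambda>(\<eta>, v, \<alpha>) b. Dm S D (om1 D \<eta> v \<alpha> b) \<eta> v = 0)
     (bet D)"

definition step3 :: bool where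
  "step3 \<longleftrightarrow>
     fredholm (LL S D) \<and>
     internal_sum UNIV (kerL S D) (V1 D) \<and> closed (V1 D) \<and>
     internal_sum UNIV (range (LL S D)) (V2 D) \<and> closed (V2 D) \<and>
     (\<forall>g\<in>carrier (Gam S D). lin D g ` V1 D \<subseteq> V1 D \<and>
        (\<forall>\<phi>\<in>V2 D. Blinfun (\<lambda>w. \<phi> (lin D (inv\<^bsub>grp S\<^esub> g) w)) \<in> V2 D)) \<and>
     implicit_solution {(\<eta>, v0, \<alpha>). v0 \<in> kerL S D \<and> \<alpha> \<in> lie_algebra S (G_me S D)} (V1 D)
       (\<lambda>(\<eta>, v0, \<alpha>) y. let \<phi> = DV S D (om2 D \<eta> (v0 + y) \<alpha>) \<eta> (v0 + y) in \<phi> - PP S D \<phi> = 0)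
       (v1 D)"

definition Xi :: "('m \<Rightarrow>\<^sub>L real) \<Rightarrow> 'v \<Rightarrow> 'g \<Rightarrow> 'g" where
  "Xi \<eta> v0 \<alpha> = om2 D \<eta> (v0 + v1 D (\<eta>, v0, \<alpha>)) \<alpha>"

definition BB :: "('m \<Rightarrow>\<^sub>L real) \<Rightarrow> 'v \<Rightarrow> 'g \<Rightarrow> ('v \<Rightarrow>\<^sub>L real)" where
  "BB \<eta> v0 \<alpha> = PP S D (DV S D (Xi \<eta> v0 \<alpha>) \<eta> (v0 + v1 D (\<eta>, v0, \<alpha>)))"

definition rho :: "('m \<Rightarrow>\<^sub>L real) \<Rightarrow> 'v \<Rightarrow> 'g \<Rightarrow> ('m \<Rightarrow>\<^sub>L real)" where
  "rho \<eta> v0 \<alpha> = coad S (Xi \<eta> v0 \<alpha>) (jj S D \<eta> (v0 + v1 D (\<eta>, v0, \<alpha>))) o\<^sub>L inm D"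

definition red_point :: "('m \<Rightarrow>\<^sub>L real) \<Rightarrow> 'v \<Rightarrow> 'g \<Rightarrow> 'p" where
  "red_point \<eta> v0 \<alpha> = Psi D (\<eta>, v0 + v1 D (\<eta>, v0, \<alpha>))"

definition fix_m :: "'a set \<Rightarrow> ('m \<Rightarrow>\<^sub>L real) set" where
  "fix_m K = {\<eta>. \<forall>k\<in>K. coAd_m S D k \<eta> = \<eta>}"

definition fix_kerL :: "'a set \<Rightarrow> 'v set" where
  "fix_kerL K = {v \<in> kerL S D. \<forall>k\<in>K. lin D k v = v}"

text \<open>The action on the tangent space at the relative equilibrium.\<close>

definition tact :: "'a \<Rightarrow> 'e \<Rightarrow> 'e" where
  "tact g = tangent_map (atlM S) (atlM S) (act S g) (base D)"

definition fix_T :: "'e set \<Rightarrow> 'a set \<Rightarrow> 'e set" where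
  "fix_T V0 K = {w \<in> V0. \<forall>k\<in>K. tact k w = w}"

text \<open>Maximality is among the isotropy subgroups of nonzero vectors.\<close>

definition maximal_isotropy :: "'e set \<Rightarrow> 'a set \<Rightarrow> bool" where
  "maximal_isotropy V0 K \<longleftrightarrow>
     (\<exists>w\<in>V0 - {0}. K = stabilizer (Gam S D) tact w) \<and>
     (\<forall>w\<in>V0 - {0}. K \<subseteq> stabilizer (Gam S D) tact w \<longrightarrow> K = stabilizer (Gam S D) tact w)"

definition weyl_group :: "'a set \<Rightarrow> 'a set monoid" where
  "weyl_group K = (Gam S D)\<lparr>carrier := normalizer (Gam S D) K\<rparr> Mod K"

text \<open>The scalar form of the restricted bifurcation map. With \<open>e\<close> a unit vector spanning the line
  \<open>fix_kerL K\<close>, a vector of that line is \<open>s *\<^sub>R e\<close>, and \<open>V2\<close> is identified with the kernel by sending a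
  functional to the vector representing it for the inner product, whose coordinate along \<open>e\<close> is
  the value of the functional at \<open>e\<close>.\<close>

definition bK :: "'v \<Rightarrow> ('m \<Rightarrow>\<^sub>L real) \<Rightarrow> real \<Rightarrow> real" where
  "bK e \<eta> s = BB \<eta> (s *\<^sub>R e) 0 e"

definition rel_eq_set :: "'a set \<Rightarrow> 'v \<Rightarrow> (('m \<Rightarrow>\<^sub>L real) \<times> real) set" where
  "rel_eq_set K e = {(\<eta>, s). \<eta> \<in> fix_m K \<and>
     relative_equilibrium S (red_point \<eta> (s *\<^sub>R e) 0) (Xi \<eta> (s *\<^sub>R e) 0)}"

text \<open>A branch with isotropy \<open>K\<close> for the action of the intersection of the isotropy subgroups of the
  base point and of the generator; away from \<open>t = 0\<close> the component along the kernel does not vanish.\<close>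

definition branch_bifurcates :: "'a set \<Rightarrow> 'v \<Rightarrow> bool" where
  "branch_bifurcates K e \<longleftrightarrow>
     (\<exists>\<epsilon>>0. \<exists>(\<eta> :: real \<Rightarrow> _) s. smooth_on {-\<epsilon><..<\<epsilon>} \<eta> \<and> smooth_on {-\<epsilon><..<\<epsilon>} s \<and>
        \<eta> 0 = 0 \<and> s 0 = 0 \<and> red_point (\<eta> 0) (s 0 *\<^sub>R e) 0 = base D \<and>
        (\<forall>t\<in>{-\<epsilon><..<\<epsilon>}. (\<eta> t, s t) \<in> rel_eq_set K e \<and>
           (t \<noteq> 0 \<longrightarrow> s t \<noteq> 0 \<and> red_point (\<eta> t) (s t *\<^sub>R e) 0 \<noteq> base D \<and>
              stabilizer (Gam S D) (act S) (red_point (\<eta> t) (s t *\<^sub>R e) 0) = K)))"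

end


section \<open>Genericity and bifurcation types\<close>

text \<open>Leading Taylor terms \<open>\<kappa> \<cdot> \<eta> + c s\<^sup>2\<close>, respectively \<open>s (\<kappa> \<cdot> \<eta> + c s\<^sup>2)\<close>, with nonzero
  coefficients, of a function on the product of the parameter space \<open>P\<close> and the line. In the second
  form the remainder also carries the factor \<open>s\<close>, so \<open>s = 0\<close> is a zero for every parameter value.\<close>

definition generic_fold :: "'x::real_normed_vector set \<Rightarrow> ('x \<Rightarrow> real \<Rightarrow> real) \<Rightarrow> bool" where
  "generic_fold P b \<longleftrightarrow>
     (\<exists>(\<kappa> :: 'x \<Rightarrow>\<^sub>L real) c. (\<exists>\<eta>\<in>P. blinfun_apply \<kappa> \<eta> \<noteq> 0) \<and> c \<noteq> 0 \<and>
        (\<lambda>(\<eta>, s). b \<eta> s - (\<kappa> \<eta> + c * s\<^sup>2)) \<in>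
          o[at (0, 0) within P \<times> UNIV](\<lambda>(\<eta>, s). norm \<eta> + s\<^sup>2))"

definition generic_pitchfork :: "'x::real_normed_vector set \<Rightarrow> ('x \<Rightarrow> real \<Rightarrow> real) \<Rightarrow> bool" where
  "generic_pitchfork P b \<longleftrightarrow>
     (\<exists>(\<kappa> :: 'x \<Rightarrow>\<^sub>L real) c. (\<exists>\<eta>\<in>P. blinfun_apply \<kappa> \<eta> \<noteq> 0) \<and> c \<noteq> 0 \<and>
        (\<lambda>(\<eta>, s). b \<eta> s - s * (\<kappa> \<eta> + c * s\<^sup>2)) \<in>
          o[at (0, 0) within P \<times> UNIV](\<lambda>(\<eta>, s). s * (norm \<eta> + s\<^sup>2)))"

text \<open>One-parameter bifurcation diagrams at the origin, \<open>Q l s\<close> saying that \<open>s\<close> is a solution at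
  parameter value \<open>l\<close>: a smooth curve of solutions with a quadratic tangency to the line \<open>l = 0\<close>,
  and such a curve crossing the trivial branch \<open>s = 0\<close>.\<close>

definition fold_curve :: "real \<Rightarrow> (real \<Rightarrow> real) \<Rightarrow> bool" where
  "fold_curve \<delta> f \<longleftrightarrow> smooth_on {-\<delta><..<\<delta>} f \<and> f 0 = 0 \<and> deriv f 0 = 0 \<and> deriv (deriv f) 0 \<noteq> 0"

definition saddle_node_diagram :: "(real \<Rightarrow> real \<Rightarrow> bool) \<Rightarrow> bool" where
  "saddle_node_diagram Q \<longleftrightarrow>
     (\<exists>\<delta>>0. \<exists>r>0. \<exists>f. fold_curve \<delta> f \<and> (\<forall>s\<in>{-\<delta><..<\<delta>}. \<bar>f s\<bar> < r \<and>
        (\<forall>l\<in>{-r<..<r}. Q l s \<longleftrightarrow> l = f s)))"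

definition pitchfork_diagram :: "(real \<Rightarrow> real \<Rightarrow> bool) \<Rightarrow> bool" where
  "pitchfork_diagram Q \<longleftrightarrow>
     (\<exists>\<delta>>0. \<exists>r>0. \<exists>f. fold_curve \<delta> f \<and> (\<forall>s\<in>{-\<delta><..<\<delta>}. \<bar>f s\<bar> < r \<and>
        (\<forall>l\<in>{-r<..<r}. Q l s \<longleftrightarrow> s = 0 \<or> l = f s)))"

text \<open>With several parameters, the diagram is required along every smooth one-parameter path in
  \<open>P\<close> through the origin that crosses a fixed hyperplane transversally.\<close>

definition transversal_path :: "'x::real_normed_vector set \<Rightarrow> ('x \<Rightarrow>\<^sub>L real) \<Rightarrow> (real \<Rightarrow> 'x) \<Rightarrow> bool" where
  "transversal_path P \<kappa> p \<longleftrightarrow>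
     smooth_on UNIV p \<and> range p \<subseteq> P \<and> p 0 = 0 \<and> \<kappa> (vector_derivative p (at 0)) \<noteq> 0"

definition saddle_node :: "'x::real_normed_vector set \<Rightarrow> ('x \<times> real) set \<Rightarrow> bool" where
  "saddle_node P E \<longleftrightarrow>
     (\<exists>\<kappa> :: 'x \<Rightarrow>\<^sub>L real. (\<exists>\<eta>\<in>P. blinfun_apply \<kappa> \<eta> \<noteq> 0) \<and>
        (\<forall>p. transversal_path P \<kappa> p \<longrightarrow> saddle_node_diagram (\<lambda>l s. (p l, s) \<in> E)))"

definition pitchfork :: "'x::real_normed_vector set \<Rightarrow> ('x \<times> real) set \<Rightarrow> bool" where
  "pitchfork P E \<longleftrightarrow>
     (\<exists>\<kappa> :: 'x \<Rightarrow>\<^sub>L real. (\<exists>\<eta>\<in>P. blinfun_apply \<kappa> \<eta> \<noteq> 0) \<and>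
        (\<forall>p. transversal_path P \<kappa> p \<longrightarrow> pitchfork_diagram (\<lambda>l s. (p l, s) \<in> E)))"

end

theory Submission
  imports Defs "HOL-Algebra.Zassenhaus"
begin

text \<open>
  A point is a relative equilibrium with generator \<open>\<zeta>\<close> exactly when it is a critical point of the
  augmented Hamiltonian of \<open>\<zeta>\<close> (\<open>relative_equilibrium_iff_critical\<close>). At a point of the slice the tangent
  space consists of slice directions and of directions generated by the complements \<open>\<mm>\<close> and \<open>\<qq>\<close>. The
  derivative of the momentum component of \<open>\<zeta>\<close> along the direction generated by \<open>\<theta>\<close> is the value of the
  coadjoint expression of \<open>\<zeta>\<close> at \<open>\<theta>\<close> (\<open>dM_mom_inf_gen\<close>), so the directions from \<open>\<qq>\<close> are settled by the first step
  of the reduction and those from \<open>\<mm>\<close> by the rigid residual equation. The slice directions are settled by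
  the second and third steps together with the bifurcation equation
  (\<open>relative_equilibrium_on_slice\<close>). Near the base point, on the fixed points of \<open>K\<close>, the relative equilibria
  are therefore the zeros of the bifurcation map.

  This vector equation is one scalar equation. The implicitly defined functions are equivariant because
  they are unique (\<open>implicit_solution_equivariant\<close>), on one neighbourhood for all group elements; here
  properness of the action enters, as it makes the isotropy group compact and its adjoint action
  uniformly bounded (\<open>Ad_bounded\<close>). So at a point fixed by \<open>K\<close> the bifurcation map takes a value that is a
  \<open>K\<close>-invariant functional. The linearised operator is symmetric with closed range, hence a functional in
  the complement of its range is determined by its values on the kernel (\<open>V2_separated\<close>); there an invariant
  functional is represented by a fixed vector, that is by a multiple of \<open>e\<close>. It vanishes as soon as its
  value at \<open>e\<close> does (\<open>BB_zero_iff\<close>).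

  The scalar equation is smooth in finitely many variables, but only by composition through the
  infinite-dimensional model spaces. Smoothness is expressed by directional derivatives, and the chain
  rule for it rests on the uniform boundedness principle (\<open>Ck_on_apply_family\<close>). Along a path transversal to
  the kernel of the linear coefficient, the implicit function theorem solves the equation for the
  parameter as a function of the kernel coordinate, in the pitchfork case after division by this
  coordinate (\<open>smooth_divide_second\<close>). The leading terms force a quadratic tangency
  (\<open>fold_curve_from_expansion\<close>).

  The normalizer of \<open>K\<close> acts on the fixed line by isometries, and by maximality \<open>K\<close> is the isotropy subgroup of
  each of its nonzero vectors. Hence the Weyl group is trivial or of order two (\<open>weyl_group_cases\<close>), so one of
  the two genericity hypotheses always applies and produces the branch. Its points have isotropy \<open>K\<close>
  because the slice mapping is injective and equivariant (\<open>red_point_isotropy\<close>).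
\<close>

section \<open>Smooth calculus between Banach spaces\<close>

subsection \<open>Uniform boundedness\<close>

text \<open>The sublevel sets of the pointwise bounds are closed and exhaust the space, so by the Baire category
  theorem one of them contains a ball; linearity spreads the bound on this ball to all vectors.\<close>

theorem banach_steinhaus:
  fixes T :: "'i \<Rightarrow> 'x::{real_normed_vector,complete_space} \<Rightarrow> 'y::real_normed_vector"
  assumes lin: "\<And>i. i \<in> I \<Longrightarrow> bounded_linear (T i)"
    and pw: "\<And>x. \<exists>C. \<forall>i\<in>I. norm (T i x) \<le> C"
  shows "\<exists>C\<ge>0. \<forall>i\<in>I. \<forall>x. norm (T i x) \<le> C * norm x"
proof -
  define F where "F m = {x. \<forall>i\<in>I. norm (T i x) \<le> real m}" for m
  have clF: "closed (F m)" for m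
  proof -
    have "F m = (\<Inter>i\<in>I. {x. norm (T i x) \<le> real m})" by (auto simp: F_def)
    moreover have "closed {x. norm (T i x) \<le> real m}" if "i \<in> I" for i
      by (intro closed_Collect_le continuous_intros linear_continuous_on lin that)
    ultimately show ?thesis by auto
  qed
  have "(\<Union>m. F m) = UNIV"
  proof -
    have "x \<in> (\<Union>m. F m)" for x
    proof -
      obtain C where C: "\<forall>i\<in>I. norm (T i x) \<le> C" using pw by blast
      obtain m where "C \<le> real m" using real_arch_simple by blast
      then have "\<forall>i\<in>I. norm (T i x) \<le> real m" using C by (meson order_trans)
      then have "x \<in> F m" by (simp add: F_def)
      then show ?thesis by blast
    qed
    then show ?thesis by blast
  qed
  have "\<exists>m. interior (F m) \<noteq> {}"
  proof (rule ccontr)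
    assume "\<not> ?thesis"
    then have "euclidean interior_of (\<Union>(range F)) = {}"
      using clF by (intro Baire_category_alt) (auto simp: completely_metrizable_space_euclidean)
    then show False using \<open>(\<Union>m. F m) = UNIV\<close> by simp
  qed
  then obtain m x0 where "x0 \<in> interior (F m)" by blast
  then obtain r where r: "r > 0" "cball x0 r \<subseteq> F m"
    by (meson interior_subset open_interior open_contains_cball subset_trans)
  have "norm (T i x) \<le> (2 * real m / r) * norm x" if i: "i \<in> I" for i x
  proof (cases "x = 0")
    case True then show ?thesis using lin[OF i] by (simp add: linear_simps)
  next
    case False
    define z where "z = (r / norm x) *\<^sub>R x"
    have nz: "norm z = r" using False r by (simp add: z_def)
    have "x0 + z \<in> F m" "x0 \<in> F m" using r nz by (auto simp: dist_norm subset_iff)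
    then have "norm (T i (x0 + z)) \<le> m" "norm (T i x0) \<le> m" using i by (auto simp: F_def)
    moreover have "T i z = T i (x0 + z) - T i x0" using lin[OF i] by (simp add: linear_simps)
    ultimately have "norm (T i z) \<le> 2 * real m"
      using norm_triangle_ineq4[of "T i (x0 + z)" "T i x0"] by simp
    moreover have "T i z = (r / norm x) *\<^sub>R T i x" using lin[OF i] by (simp add: z_def linear_simps)
    ultimately show ?thesis using False r by (simp add: field_simps)
  qed
  then show ?thesis using r by (intro exI[of _ "2 * real m / r"]) auto
qed

text \<open>The uniform boundedness principle near a point, with a prescribed rate \<open>g\<close>. Pointwise bounds hold on
  neighbourhoods that depend on the vector, but a failure of the uniform bound would be witnessed
  along a sequence, and along a sequence the principle for a family of operators applies.\<close>

lemma uniform_bound_at: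
  fixes T :: "'x::metric_space \<Rightarrow> 'y::{real_normed_vector,complete_space} \<Rightarrow> 'z::real_normed_vector"
  assumes lin: "\<forall>\<^sub>F x in at x0. bounded_linear (T x)"
    and pos: "\<And>x. x \<noteq> x0 \<Longrightarrow> g x > 0"
    and pw: "\<And>u. \<exists>C. \<forall>\<^sub>F x in at x0. norm (T x u) \<le> C * g x"
  obtains C where "C \<ge> 0" "\<forall>\<^sub>F x in at x0. \<forall>u. norm (T x u) \<le> C * g x * norm u"
proof -
  have "\<exists>C\<ge>0. \<forall>\<^sub>F x in at x0. \<forall>u. norm (T x u) \<le> C * g x * norm u"
  proof (rule ccontr)
    assume neg: "\<not> ?thesis"
    obtain d where d: "d > 0" "\<And>x. x \<noteq> x0 \<Longrightarrow> dist x x0 < d \<Longrightarrow> bounded_linear (T x)"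
      using lin by (auto simp: eventually_at)
    have "\<exists>x. x \<noteq> x0 \<and> dist x x0 < min d (1 / real (Suc n)) \<and>
        (\<exists>u. norm (T x u) > real n * g x * norm u)" for n
    proof -
      have "\<not> (\<forall>\<^sub>F x in at x0. \<forall>u. norm (T x u) \<le> real n * g x * norm u)"
        using neg by auto
      moreover have "min d (1 / real (Suc n)) > 0" using d by simp
      ultimately show ?thesis unfolding eventually_at by (metis not_le UNIV_I)
    qed
    then obtain x where x: "\<And>n. x n \<noteq> x0" "\<And>n. dist (x n) x0 < min d (1 / real (Suc n))"
      "\<And>n. \<exists>u. norm (T (x n) u) > real n * g (x n) * norm u" by metis
    \<comment> \<open>Rescaled by the rate, the operators of the witnessing sequence are pointwise bounded.\<close>
    define S where "S n u = (1 / g (x n)) *\<^sub>R T (x n) u" for n u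
    have linS: "bounded_linear (S n)" for n unfolding S_def
      using d x(1,2) by (intro bounded_linear_scaleR_right[THEN bounded_linear_compose]) auto
    have lim: "filterlim x (at x0) sequentially"
    proof -
      have "(\<lambda>n. dist (x n) x0) \<longlonglongrightarrow> 0"
      proof (rule tendsto_sandwich[OF _ _ tendsto_const LIMSEQ_inverse_real_of_nat])
        show "\<forall>\<^sub>F n in sequentially. dist (x n) x0 \<le> inverse (real (Suc n))"
          using x(2) by (auto intro!: always_eventually less_imp_le simp: inverse_eq_divide)
      qed auto
      then show ?thesis using x(1) tendsto_dist_iff by (auto simp: filterlim_at)
    qed
    have "\<exists>C. \<forall>n\<in>UNIV. norm (S n u) \<le> C" for u
    proof -
      obtain C where "\<forall>\<^sub>F x in at x0. norm (T x u) \<le> C * g x" using pw by blast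
      then have "\<forall>\<^sub>F n in sequentially. norm (T (x n) u) \<le> C * g (x n)"
        using lim unfolding filterlim_iff by blast
      then obtain N where N: "\<And>n. n \<ge> N \<Longrightarrow> norm (T (x n) u) \<le> C * g (x n)"
        by (auto simp: eventually_sequentially)
      have "norm (S n u) \<le> max C (Max ((\<lambda>n. norm (S n u)) ` {..N}))" for n
      proof (cases "n \<le> N")
        case True then show ?thesis by (intro max.coboundedI2 Max_ge) auto
      next
        case False
        then have "norm (S n u) \<le> C" using N[of n] pos[OF x(1)[of n]] by (simp add: S_def field_simps)
        then show ?thesis by simp
      qed
      then show ?thesis by blast
    qed
    then obtain C where C: "\<And>n u. norm (S n u) \<le> C * norm u"
      using banach_steinhaus[of UNIV S] linS by blast
    obtain n where n: "C \<le> real n" using real_arch_simple by blast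
    obtain u where u: "norm (T (x n) u) > real n * g (x n) * norm u" using x(3) by blast
    have "norm (T (x n) u) \<le> C * norm u * g (x n)"
      using C[of n u] pos[OF x(1)[of n]] by (simp add: S_def field_simps)
    also have "\<dots> \<le> real n * norm u * g (x n)"
      using n pos[OF x(1)[of n]] by (intro mult_right_mono) auto
    finally show False using u by (simp add: algebra_simps)
  qed
  then show ?thesis using that by blast
qed

lemma has_derivative_lipschitz_at:
  assumes "(f has_derivative f') (at x0)"
  shows "\<exists>C. \<forall>\<^sub>F x in at x0. norm (f x - f x0) \<le> C * norm (x - x0)"
proof -
  interpret f': bounded_linear f' using assms by (rule has_derivative_bounded_linear)
  obtain K where K: "\<And>h. norm (f' h) \<le> norm h * K" using f'.bounded by blast
  have "\<forall>\<^sub>F y in at x0. norm (f y - f x0 - f' (y - x0)) \<le> 1 * norm (y - x0)"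
    using assms unfolding has_derivative_within_alt2 by (metis zero_less_one)
  then have "\<forall>\<^sub>F x in at x0. norm (f x - f x0) \<le> (K + 1) * norm (x - x0)"
  proof eventually_elim
    case (elim y)
    have "norm (f y - f x0) \<le> norm (f y - f x0 - f' (y - x0)) + norm (f' (y - x0))"
      by norm
    then show ?case using elim K[of "y - x0"] by (simp add: algebra_simps)
  qed
  then show ?thesis by blast
qed

text \<open>Operators tested on fixed vectors may be applied to a moving vector: near the point the operators are
  uniformly bounded, so moving the vector costs only a multiple of the distance.\<close>

lemma isCont_apply_family:
  fixes \<Phi> :: "'x::metric_space \<Rightarrow> 'y::{real_normed_vector,complete_space} \<Rightarrow> 'z::real_normed_vector"
  assumes lin: "\<forall>\<^sub>F x in at x0. bounded_linear (\<Phi> x)"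
    and cont: "\<And>u. isCont (\<lambda>x. \<Phi> x u) x0" and w: "isCont w x0"
  shows "isCont (\<lambda>x. \<Phi> x (w x)) x0"
proof -
  have "\<exists>C. \<forall>\<^sub>F x in at x0. norm (\<Phi> x u) \<le> C * 1" for u
  proof -
    have "((\<lambda>x. norm (\<Phi> x u)) \<longlongrightarrow> norm (\<Phi> x0 u)) (at x0)"
      using cont[of u] by (auto simp: isCont_def intro: tendsto_intros)
    then have "\<forall>\<^sub>F x in at x0. norm (\<Phi> x u) < norm (\<Phi> x0 u) + 1"
      by (rule order_tendstoD) simp
    then show ?thesis by (intro exI[of _ "norm (\<Phi> x0 u) + 1"]) (auto elim: eventually_mono)
  qed
  then obtain C where C: "C \<ge> 0" "\<forall>\<^sub>F x in at x0. \<forall>u. norm (\<Phi> x u) \<le> C * 1 * norm u"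
    using uniform_bound_at[OF lin, of "\<lambda>_. 1"] by auto
  have "((\<lambda>x. \<Phi> x (w x - w x0)) \<longlongrightarrow> 0) (at x0)"
  proof (rule Lim_null_comparison)
    show "\<forall>\<^sub>F x in at x0. norm (\<Phi> x (w x - w x0)) \<le> C * norm (w x - w x0)"
      using C(2) by (auto elim: eventually_mono)
    have "((\<lambda>x. C * norm (w x - w x0)) \<longlongrightarrow> C * norm (w x0 - w x0)) (at x0)"
      using w unfolding isCont_def by (intro tendsto_intros)
    then show "((\<lambda>x. C * norm (w x - w x0)) \<longlongrightarrow> 0) (at x0)" by simp
  qed
  then have "((\<lambda>x. \<Phi> x (w x - w x0) + \<Phi> x (w x0)) \<longlongrightarrow> 0 + \<Phi> x0 (w x0)) (at x0)"
    using cont by (intro tendsto_intros) (auto simp: isCont_def)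
  then show ?thesis unfolding isCont_def add_0
  proof (rule Lim_transform_eventually)
    show "\<forall>\<^sub>F x in at x0. \<Phi> x (w x - w x0) + \<Phi> x (w x0) = \<Phi> x (w x)"
      using lin by eventually_elim (simp add: linear_simps)
  qed
qed

text \<open>The product rule for a family of operators of which only the values on fixed vectors are known to be
  differentiable. Differentiability on each vector makes the family Lipschitz at the point in the
  operator norm, which is what the mixed term needs.\<close>

lemma has_derivative_apply_family:
  fixes \<Phi> :: "'x::real_normed_vector \<Rightarrow> 'y::{real_normed_vector,complete_space} \<Rightarrow> 'z::real_normed_vector"
  assumes lin: "\<forall>\<^sub>F x in at x0. bounded_linear (\<Phi> x)" and lin0: "bounded_linear (\<Phi> x0)"
    and \<Phi>: "\<And>u. ((\<lambda>x. \<Phi> x u) has_derivative \<Phi>' u) (at x0)" and w: "(w has_derivative w') (at x0)"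
  shows "((\<lambda>x. \<Phi> x (w x)) has_derivative (\<lambda>h. \<Phi>' (w x0) h + \<Phi> x0 (w' h))) (at x0)"
proof -
  define T where "T = (\<lambda>x u. \<Phi> x u - \<Phi> x0 u)"
  have linT: "\<forall>\<^sub>F x in at x0. bounded_linear (T x)"
    using lin by eventually_elim (unfold T_def, rule bounded_linear_sub[OF _ lin0])
  obtain C where C: "C \<ge> 0" "\<forall>\<^sub>F x in at x0. \<forall>u. norm (T x u) \<le> C * norm (x - x0) * norm u"
  proof (rule uniform_bound_at[OF linT, of "\<lambda>x. norm (x - x0)"])
    show "\<exists>C. \<forall>\<^sub>F x in at x0. norm (T x u) \<le> C * norm (x - x0)" for u
      using has_derivative_lipschitz_at[OF \<Phi>] by (simp only: T_def)
  qed simp_all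
  have wc: "((\<lambda>x. w x - w x0) \<longlongrightarrow> 0) (at x0)"
    using has_derivative_continuous[OF w] by (simp add: isCont_def LIM_zero)
  \<comment> \<open>The mixed term is a Lipschitz factor times a factor tending to zero.\<close>
  have "((\<lambda>x. T x (w x - w x0)) has_derivative (\<lambda>h. 0)) (at x0)"
    unfolding has_derivative_within_alt2
  proof (intro conjI allI impI)
    fix e :: real assume e: "e > 0"
    have "((\<lambda>x. C * norm (w x - w x0)) \<longlongrightarrow> C * norm (0::'y)) (at x0)"
      by (intro tendsto_intros wc)
    then have "\<forall>\<^sub>F x in at x0. C * norm (w x - w x0) < e"
      using e by (intro order_tendstoD) auto
    then show "\<forall>\<^sub>F y in at x0. norm (T y (w y - w x0) - T x0 (w x0 - w x0) - 0) \<le> e * norm (y - x0)"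
      using C(2)
    proof eventually_elim
      case (elim y)
      have "norm (T y (w y - w x0)) \<le> C * norm (w y - w x0) * norm (y - x0)"
        using elim(2)[rule_format, of "w y - w x0"] by (simp add: algebra_simps)
      also have "\<dots> \<le> e * norm (y - x0)" using elim(1) by (intro mult_right_mono) auto
      finally show ?case by (simp add: T_def)
    qed
  qed simp
  then have "((\<lambda>x. T x (w x - w x0) + \<Phi> x (w x0) + \<Phi> x0 (w x - w x0)) has_derivative
      (\<lambda>h. 0 + \<Phi>' (w x0) h + \<Phi> x0 (w' h - 0))) (at x0)"
    by (rule has_derivative_add[OF has_derivative_add[OF _ \<Phi>]
          bounded_linear.has_derivative[OF lin0 has_derivative_diff[OF w has_derivative_const]]])
  then have D: "((\<lambda>x. T x (w x - w x0) + \<Phi> x (w x0) + \<Phi> x0 (w x - w x0)) has_derivative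
      (\<lambda>h. \<Phi>' (w x0) h + \<Phi> x0 (w' h))) (at x0)" by simp
  have eq: "\<forall>\<^sub>F x in nhds x0. T x (w x - w x0) + \<Phi> x (w x0) + \<Phi> x0 (w x - w x0) = \<Phi> x (w x)"
  proof -
    have "\<forall>\<^sub>F x in nhds x0. bounded_linear (\<Phi> x)"
      using lin lin0 by (auto simp: eventually_at_filter elim: eventually_mono)
    then show ?thesis
    proof eventually_elim
      case (elim x)
      show ?case unfolding T_def bounded_linear.linear[THEN linear_diff, OF elim]
          bounded_linear.linear[THEN linear_diff, OF lin0] by simp
    qed
  qed
  then obtain N where N: "open N" "x0 \<in> N"
    "\<And>x. x \<in> N \<Longrightarrow> T x (w x - w x0) + \<Phi> x (w x0) + \<Phi> x0 (w x - w x0) = \<Phi> x (w x)"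
    unfolding eventually_nhds by blast
  show ?thesis by (rule has_derivative_transform_within_open[OF D N])
qed

text \<open>A derivative obeys every Lipschitz bound that holds at the point, with the same constant.\<close>

lemma has_derivative_direction_bound:
  assumes "(f has_derivative f') (at x0)"
    and K: "\<forall>\<^sub>F x in at x0. norm (f x - f x0) \<le> K * norm (x - x0)"
  shows "norm (f' h) \<le> K * norm h"
proof (cases "h = 0")
  case True
  then show ?thesis using has_derivative_bounded_linear[OF assms(1)] by (simp add: linear_simps)
next
  case False
  have lim: "((\<lambda>x. norm (f x - f x0 - f' (x - x0)) / norm (x - x0)) \<longlongrightarrow> 0) (at x0)"
    using assms(1) by (simp add: has_derivative_iff_norm)
  have f': "bounded_linear f'" using assms(1) by (rule has_derivative_bounded_linear)
  have fl: "filterlim (\<lambda>t::real. x0 + t *\<^sub>R h) (at x0) (at 0)"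
    unfolding filterlim_at using False
    by (auto intro!: tendsto_eq_intros simp: eventually_at_filter)
  have 1: "\<forall>\<^sub>F t in at (0::real). norm (f (x0 + t *\<^sub>R h) - f x0) \<le> K * norm (t *\<^sub>R h)"
    using fl K unfolding filterlim_iff by fastforce
  have 2: "((\<lambda>t::real. norm (f (x0 + t *\<^sub>R h) - f x0 - f' (t *\<^sub>R h)) / norm (t *\<^sub>R h)) \<longlongrightarrow> 0) (at 0)"
    using filterlim_compose[OF lim fl] by simp
  show ?thesis
  proof (rule field_le_epsilon)
    fix e :: real assume "e > 0"
    then have "e / norm h > 0" using False by simp
    then have "\<forall>\<^sub>F t in at (0::real). norm (f (x0 + t *\<^sub>R h) - f x0 - f' (t *\<^sub>R h)) / norm (t *\<^sub>R h) < e / norm h"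
      using order_tendstoD(2)[OF 2] by simp
    then have "\<forall>\<^sub>F t in at (0::real). t \<noteq> 0 \<and> norm (f (x0 + t *\<^sub>R h) - f x0) \<le> K * norm (t *\<^sub>R h) \<and>
        norm (f (x0 + t *\<^sub>R h) - f x0 - f' (t *\<^sub>R h)) / norm (t *\<^sub>R h) < e / norm h"
      using 1 by (auto simp: eventually_at_filter elim: eventually_elim2)
    then obtain t where t: "t \<noteq> 0" "norm (f (x0 + t *\<^sub>R h) - f x0) \<le> K * norm (t *\<^sub>R h)"
        "norm (f (x0 + t *\<^sub>R h) - f x0 - f' (t *\<^sub>R h)) / norm (t *\<^sub>R h) < e / norm h"
      using eventually_happens'[of "at (0::real)"] by auto
    have "norm (f (x0 + t *\<^sub>R h) - f x0 - f' (t *\<^sub>R h)) < \<bar>t\<bar> * e"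
      using t(1,3) False by (simp add: field_simps)
    moreover have "norm (f' (t *\<^sub>R h)) \<le> norm (f (x0 + t *\<^sub>R h) - f x0) + norm (f (x0 + t *\<^sub>R h) - f x0 - f' (t *\<^sub>R h))"
      by norm
    moreover have "norm (f' (t *\<^sub>R h)) = \<bar>t\<bar> * norm (f' h)" using f' by (simp add: linear_simps)
    ultimately have "\<bar>t\<bar> * norm (f' h) \<le> \<bar>t\<bar> * (K * norm h + e)"
      using t(2) by (simp add: algebra_simps)
    then show "norm (f' h) \<le> K * norm h + e" using t(1) by simp
  qed
qed

text \<open>Boundedness survives differentiation with respect to the base point, because the Lipschitz constant of
  the family at the point bounds its derivative.\<close>

lemma bounded_linear_derivative_family:
  fixes \<Phi> :: "'x::real_normed_vector \<Rightarrow> 'y::{real_normed_vector,complete_space} \<Rightarrow> 'z::real_normed_vector"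
  assumes lin: "\<forall>\<^sub>F x in nhds x0. bounded_linear (\<Phi> x)"
    and \<Phi>: "\<And>u. ((\<lambda>x. \<Phi> x u) has_derivative \<Phi>' u) (at x0)"
  shows "bounded_linear (\<lambda>u. \<Phi>' u h)"
proof -
  have lin0: "bounded_linear (\<Phi> x0)" using lin by (rule eventually_nhds_x_imp_x)
  have lin1: "\<forall>\<^sub>F x in at x0. bounded_linear (\<Phi> x)" using lin by (simp add: eventually_at_filter eventually_mono)
  obtain N where N: "open N" "x0 \<in> N" "\<And>x. x \<in> N \<Longrightarrow> bounded_linear (\<Phi> x)"
    using lin unfolding eventually_nhds by blast
  define T where "T = (\<lambda>x u. \<Phi> x u - \<Phi> x0 u)"
  have linT: "\<forall>\<^sub>F x in at x0. bounded_linear (T x)"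
    using lin1 by eventually_elim (unfold T_def, rule bounded_linear_sub[OF _ lin0])
  obtain C where C: "C \<ge> 0" "\<forall>\<^sub>F x in at x0. \<forall>u. norm (T x u) \<le> C * norm (x - x0) * norm u"
  proof (rule uniform_bound_at[OF linT, of "\<lambda>x. norm (x - x0)"])
    show "\<exists>C. \<forall>\<^sub>F x in at x0. norm (T x u) \<le> C * norm (x - x0)" for u
      using has_derivative_lipschitz_at[OF \<Phi>] by (simp only: T_def)
  qed simp_all
  show ?thesis
  proof (rule bounded_linear_intro[where K = "C * norm h"])
    fix u v
    have "((\<lambda>x. \<Phi> x u + \<Phi> x v) has_derivative (\<lambda>h. \<Phi>' u h + \<Phi>' v h)) (at x0)"
      by (intro derivative_intros \<Phi>)
    then have "((\<lambda>x. \<Phi> x (u + v)) has_derivative (\<lambda>h. \<Phi>' u h + \<Phi>' v h)) (at x0)"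
      by (rule has_derivative_transform_within_open[OF _ N(1,2)]) (use N(3) in \<open>simp add: linear_simps\<close>)
    from has_derivative_unique[OF this \<Phi>] show "\<Phi>' (u + v) h = \<Phi>' u h + \<Phi>' v h" by (simp add: fun_eq_iff)
  next
    fix r :: real and u
    have "((\<lambda>x. r *\<^sub>R \<Phi> x u) has_derivative (\<lambda>h. r *\<^sub>R \<Phi>' u h)) (at x0)"
      by (intro derivative_intros \<Phi>)
    then have "((\<lambda>x. \<Phi> x (r *\<^sub>R u)) has_derivative (\<lambda>h. r *\<^sub>R \<Phi>' u h)) (at x0)"
      by (rule has_derivative_transform_within_open[OF _ N(1,2)]) (use N(3) in \<open>simp add: linear_simps\<close>)
    from has_derivative_unique[OF this \<Phi>] show "\<Phi>' (r *\<^sub>R u) h = r *\<^sub>R \<Phi>' u h" by (simp add: fun_eq_iff)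
  next
    fix u
    have "\<forall>\<^sub>F x in at x0. norm (\<Phi> x u - \<Phi> x0 u) \<le> (C * norm u) * norm (x - x0)"
      using C(2) by eventually_elim (auto simp: T_def algebra_simps)
    from has_derivative_direction_bound[OF \<Phi> this] show "norm (\<Phi>' u h) \<le> norm u * (C * norm h)"
      by (simp add: algebra_simps)
  qed
qed

subsection \<open>The classes of k times differentiable maps\<close>

lemma Ck_on_subset: "Ck_on k W f \<Longrightarrow> N \<subseteq> W \<Longrightarrow> Ck_on k N f"
  by (induction k arbitrary: f) (auto intro: continuous_on_subset)

lemma Ck_on_local:
  "(\<And>x. x \<in> W \<Longrightarrow> \<exists>N. open N \<and> x \<in> N \<and> Ck_on k N f) \<Longrightarrow> Ck_on k W f"
proof (induction k arbitrary: f)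
  case 0
  then show ?case
    by (metis Ck_on.simps(1) continuous_at_imp_continuous_on continuous_on_eq_continuous_at)
next
  case (Suc k)
  have *: "\<exists>N. open N \<and> x \<in> N \<and> (\<forall>x\<in>N. f differentiable (at x)) \<and>
      (\<forall>u. Ck_on k N (\<lambda>x. frechet_derivative f (at x) u))" if "x \<in> W" for x
    using Suc.prems[OF that] by simp
  then have "\<forall>x\<in>W. f differentiable (at x)" by blast
  moreover have "Ck_on k W (\<lambda>x. frechet_derivative f (at x) u)" for u
    using * by (intro Suc.IH) blast
  ultimately show ?case by simp
qed

lemma Ck_on_cong:
  "open W \<Longrightarrow> (\<And>x. x \<in> W \<Longrightarrow> f x = g x) \<Longrightarrow> Ck_on k W f \<Longrightarrow> Ck_on k W g"
proof (induction k arbitrary: f g)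
  case 0
  then show ?case by (metis Ck_on.simps(1) continuous_on_eq)
next
  case (Suc k)
  have d: "f differentiable (at x)" if "x \<in> W" for x using Suc.prems that by simp
  have eq: "frechet_derivative f (at x) = frechet_derivative g (at x)" if "x \<in> W" for x
    using frechet_derivative_transform_within_open[OF d[OF that] Suc.prems(1) that Suc.prems(2)] .
  have "Ck_on k W (\<lambda>x. frechet_derivative g (at x) u)" for u
  proof (rule Suc.IH[OF Suc.prems(1)])
    show "frechet_derivative f (at x) u = frechet_derivative g (at x) u" if "x \<in> W" for x
      by (simp only: eq[OF that])
    show "Ck_on k W (\<lambda>x. frechet_derivative f (at x) u)" using Suc.prems(3) by simp
  qed
  moreover have "g differentiable (at x)" if "x \<in> W" for x
    by (rule differentiableI, rule has_derivative_transform_within_open[OF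
          d[OF that, unfolded frechet_derivative_works] Suc.prems(1) that Suc.prems(2)])
  ultimately show ?case by simp
qed

text \<open>Any formula for the derivative may be used to check the next order.\<close>

lemma Ck_on_SucI:
  assumes "open W" "\<And>x. x \<in> W \<Longrightarrow> (f has_derivative f' x) (at x)"
    and "\<And>u. Ck_on k W (\<lambda>x. f' x u)"
  shows "Ck_on (Suc k) W f"
proof -
  have "f' x u = frechet_derivative f (at x) u" if "x \<in> W" for x u
    by (simp only: frechet_derivative_at[OF assms(2)[OF that], symmetric])
  then have "Ck_on k W (\<lambda>x. frechet_derivative f (at x) u)" for u
    by (rule Ck_on_cong[OF assms(1) _ assms(3)[of u]])
  moreover have "\<forall>x\<in>W. f differentiable (at x)" using assms(2) by (blast intro: differentiableI)
  ultimately show ?thesis by simp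
qed

lemma Ck_on_SucD: "Ck_on (Suc k) W f \<Longrightarrow> x \<in> W \<Longrightarrow> (f has_derivative frechet_derivative f (at x)) (at x)"
  by (simp flip: frechet_derivative_works)

lemma Ck_on_Suc_imp: "Ck_on (Suc k) W f \<Longrightarrow> Ck_on k W f"
proof (induction k arbitrary: f)
  case 0
  then show ?case by (auto intro!: continuous_at_imp_continuous_on differentiable_imp_continuous_within)
next
  case (Suc k)
  have "\<forall>x\<in>W. f differentiable (at x)" "\<And>u. Ck_on (Suc k) W (\<lambda>x. frechet_derivative f (at x) u)"
    using Suc.prems unfolding Ck_on.simps(2)[of "Suc k"] by blast+
  then show ?case using Suc.IH unfolding Ck_on.simps(2)[of k W f] by blast
qed

lemma Ck_on_mono: "Ck_on k W f \<Longrightarrow> j \<le> k \<Longrightarrow> Ck_on j W f"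
  by (induction k) (auto simp: le_Suc_eq dest: Ck_on_Suc_imp simp del: Ck_on.simps)

lemma Ck_on_continuous: "Ck_on k W f \<Longrightarrow> continuous_on W f"
  using Ck_on_mono[of k W f 0] by simp

lemma Ck_on_const: "Ck_on k W (\<lambda>x. c)"
  by (induction k arbitrary: c) auto

lemma Ck_on_bounded_linear: "open W \<Longrightarrow> bounded_linear L \<Longrightarrow> Ck_on k W L"
proof (cases k)
  case (Suc j)
  assume "open W" "bounded_linear L"
  then show ?thesis unfolding Suc
    by (intro Ck_on_SucI[where f' = "\<lambda>x. L"] Ck_on_const bounded_linear_imp_has_derivative)
qed (simp add: linear_continuous_on)

lemma Ck_on_linear_compose:
  "open W \<Longrightarrow> bounded_linear L \<Longrightarrow> Ck_on k W f \<Longrightarrow> Ck_on k W (\<lambda>x. L (f x))"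
proof (induction k arbitrary: f)
  case 0
  then show ?case using bounded_linear.continuous_on[of L W f] by simp
next
  case (Suc k)
  show ?case
  proof (rule Ck_on_SucI[OF Suc.prems(1)])
    show "((\<lambda>x. L (f x)) has_derivative (\<lambda>h. L (frechet_derivative f (at x) h))) (at x)" if "x \<in> W" for x
      by (rule bounded_linear.has_derivative[OF Suc.prems(2) Ck_on_SucD[OF Suc.prems(3) that]])
    show "Ck_on k W (\<lambda>x. L (frechet_derivative f (at x) u))" for u
      using Suc.prems(3) by (intro Suc.IH[OF Suc.prems(1,2)]) simp
  qed
qed

lemma Ck_on_add:
  "open W \<Longrightarrow> Ck_on k W f \<Longrightarrow> Ck_on k W g \<Longrightarrow> Ck_on k W (\<lambda>x. f x + g x)"
proof (induction k arbitrary: f g)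
  case 0
  then show ?case by (simp add: continuous_on_add)
next
  case (Suc k)
  show ?case
  proof (rule Ck_on_SucI[OF Suc.prems(1)])
    show "((\<lambda>x. f x + g x) has_derivative (\<lambda>h. frechet_derivative f (at x) h + frechet_derivative g (at x) h)) (at x)" if "x \<in> W" for x
      by (rule has_derivative_add[OF Ck_on_SucD[OF Suc.prems(2) that] Ck_on_SucD[OF Suc.prems(3) that]])
    show "Ck_on k W (\<lambda>x. frechet_derivative f (at x) u + frechet_derivative g (at x) u)" for u
      using Suc.prems(2,3) by (intro Suc.IH[OF Suc.prems(1)]) simp_all
  qed
qed

lemma Ck_on_Pair:
  assumes "open W" "Ck_on k W f" "Ck_on k W g"
  shows "Ck_on k W (\<lambda>x. (f x, g x))"
proof -
  have "Ck_on k W (\<lambda>x. (f x, 0) + (0, g x))"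
    by (rule Ck_on_add[OF assms(1)
          Ck_on_linear_compose[OF assms(1) bounded_linear_Pair[OF bounded_linear_ident bounded_linear_zero] assms(2)]
          Ck_on_linear_compose[OF assms(1) bounded_linear_Pair[OF bounded_linear_zero bounded_linear_ident] assms(3)]])
  then show ?thesis by simp
qed

text \<open>Testing the operators on fixed vectors keeps the induction on the order within one type: the derivative
  of such a family is again such a family, whereas an operator-valued derivative would change the
  target space at each step.\<close>

lemma Ck_on_apply_family:
  fixes \<Phi> :: "'x::real_normed_vector \<Rightarrow> 'y::{real_normed_vector,complete_space} \<Rightarrow> 'z::real_normed_vector"
  assumes "open W"
  shows "(\<And>x. x \<in> W \<Longrightarrow> bounded_linear (\<Phi> x)) \<Longrightarrow> (\<And>u. Ck_on k W (\<lambda>x. \<Phi> x u)) \<Longrightarrow>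
    Ck_on k W w \<Longrightarrow> Ck_on k W (\<lambda>x. \<Phi> x (w x))"
proof (induction k arbitrary: \<Phi> w)
  case 0
  have nh: "\<forall>\<^sub>F y in at x. bounded_linear (\<Phi> y)" if "x \<in> W" for x
    using 0(1) assms that unfolding eventually_at_topological by blast
  have c: "isCont (\<lambda>x. \<Phi> x u) x" "isCont w x" if "x \<in> W" for x u
    using 0(2)[of u] 0(3) assms that by (simp_all add: continuous_on_eq_continuous_at)
  have "isCont (\<lambda>x. \<Phi> x (w x)) x" if "x \<in> W" for x
    by (rule isCont_apply_family[OF nh[OF that] c(1)[OF that] c(2)[OF that]])
  then show ?case by (auto intro: continuous_at_imp_continuous_on)
next
  case (Suc k)
  have nh: "\<forall>\<^sub>F y in nhds x. bounded_linear (\<Phi> y)" if "x \<in> W" for x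
    using Suc.prems(1) assms that unfolding eventually_nhds by blast
  have nh': "\<forall>\<^sub>F y in at x. bounded_linear (\<Phi> y)" if "x \<in> W" for x
    using nh[OF that] by (simp add: eventually_at_filter eventually_mono)
  define \<Phi>' where "\<Phi>' x u = frechet_derivative (\<lambda>x. \<Phi> x u) (at x)" for x u
  have d: "((\<lambda>x. \<Phi> x u) has_derivative \<Phi>' x u) (at x)" if "x \<in> W" for x u
    using Suc.prems(2)[of u] that unfolding \<Phi>'_def by (rule Ck_on_SucD)
  have dw: "(w has_derivative frechet_derivative w (at x)) (at x)" if "x \<in> W" for x
    using Suc.prems(3) that by (rule Ck_on_SucD)
  show ?case
  proof (rule Ck_on_SucI[OF assms])
    show "((\<lambda>x. \<Phi> x (w x)) has_derivative
       (\<lambda>h. \<Phi>' x (w x) h + \<Phi> x (frechet_derivative w (at x) h))) (at x)" if "x \<in> W" for x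
      by (rule has_derivative_apply_family[OF nh'[OF that] Suc.prems(1)[OF that] d[OF that] dw[OF that]])
    have "Ck_on k W (\<lambda>x. \<Phi>' x (w x) h)" for h
    proof (rule Suc.IH)
      show "bounded_linear (\<lambda>u. \<Phi>' x u h)" if "x \<in> W" for x
        by (rule bounded_linear_derivative_family[OF nh[OF that] d[OF that]])
      show "Ck_on k W (\<lambda>x. \<Phi>' x u h)" for u
        using Suc.prems(2)[of u] by (simp add: \<Phi>'_def)
      show "Ck_on k W w" using Suc.prems(3) by (rule Ck_on_Suc_imp)
    qed
    moreover have "Ck_on k W (\<lambda>x. \<Phi> x (frechet_derivative w (at x) h))" for h
      using Suc.prems(3) by (intro Suc.IH[OF Suc.prems(1) Ck_on_Suc_imp[OF Suc.prems(2)]]) simp_all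
    ultimately show "Ck_on k W (\<lambda>x. \<Phi>' x (w x) h + \<Phi> x (frechet_derivative w (at x) h))" for h
      by (rule Ck_on_add[OF assms])
  qed
qed

text \<open>The derivative of the composite applies the family of derivatives of \<open>g\<close> to the directional derivative
  of \<open>f\<close>. Tested on a fixed vector this family is a composite with a directional derivative of \<open>g\<close>,
  to which the induction hypothesis applies.\<close>

lemma Ck_on_compose:
  fixes g :: "'y::{real_normed_vector,complete_space} \<Rightarrow> 'z::real_normed_vector"
  assumes "open W" "open Q"
  shows "f ` W \<subseteq> Q \<Longrightarrow> Ck_on k W f \<Longrightarrow> Ck_on k Q g \<Longrightarrow> Ck_on k W (\<lambda>x. g (f x))"
proof (induction k arbitrary: g)
  case 0
  then show ?case using continuous_on_compose2[of Q g W f] by simp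
next
  case (Suc k)
  have df: "(f has_derivative frechet_derivative f (at x)) (at x)" if "x \<in> W" for x
    using Suc.prems(2) that by (rule Ck_on_SucD)
  have dg: "(g has_derivative frechet_derivative g (at (f x))) (at (f x))" if "x \<in> W" for x
    using Suc.prems(1) that by (intro Ck_on_SucD[OF Suc.prems(3)]) blast
  show ?case
  proof (rule Ck_on_SucI[OF assms(1)])
    show "((\<lambda>x. g (f x)) has_derivative (\<lambda>h. frechet_derivative g (at (f x)) (frechet_derivative f (at x) h))) (at x)"
      if "x \<in> W" for x using diff_chain_at[OF df[OF that] dg[OF that]] by (simp add: o_def)
    show "Ck_on k W (\<lambda>x. frechet_derivative g (at (f x)) (frechet_derivative f (at x) h))" for h
    proof (rule Ck_on_apply_family[OF assms(1)])
      show "bounded_linear (frechet_derivative g (at (f x)))" if "x \<in> W" for x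
        using dg[OF that] by (rule has_derivative_bounded_linear)
      show "Ck_on k W (\<lambda>x. frechet_derivative g (at (f x)) u)" for u
        using Suc.prems(3) by (intro Suc.IH[OF Suc.prems(1) Ck_on_Suc_imp[OF Suc.prems(2)]]) simp
      show "Ck_on k W (\<lambda>x. frechet_derivative f (at x) h)" using Suc.prems(2) by simp
    qed
  qed
qed

subsection \<open>Smooth maps\<close>

lemma smooth_on_subset: "smooth_on W f \<Longrightarrow> N \<subseteq> W \<Longrightarrow> smooth_on N f"
  unfolding smooth_on_def using Ck_on_subset by blast

lemma smooth_on_local:
  "(\<And>x. x \<in> W \<Longrightarrow> \<exists>N. open N \<and> x \<in> N \<and> smooth_on N f) \<Longrightarrow> smooth_on W f"
  unfolding smooth_on_def by (meson Ck_on_local)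

lemma smooth_on_cong: "open W \<Longrightarrow> (\<And>x. x \<in> W \<Longrightarrow> f x = g x) \<Longrightarrow> smooth_on W f \<Longrightarrow> smooth_on W g"
  unfolding smooth_on_def using Ck_on_cong[of W f g] by blast

lemma smooth_on_continuous: "smooth_on W f \<Longrightarrow> continuous_on W f"
  unfolding smooth_on_def using Ck_on_continuous by blast

lemma smooth_on_has_derivative:
  "smooth_on W f \<Longrightarrow> x \<in> W \<Longrightarrow> (f has_derivative frechet_derivative f (at x)) (at x)"
  unfolding smooth_on_def using Ck_on_SucD by blast

lemma smooth_on_deriv: "smooth_on W f \<Longrightarrow> smooth_on W (\<lambda>x. frechet_derivative f (at x) u)"
  unfolding smooth_on_def by (metis Ck_on.simps(2))

lemma smooth_on_const: "smooth_on W (\<lambda>x. c)"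
  unfolding smooth_on_def using Ck_on_const by blast

lemma smooth_on_bounded_linear: "open W \<Longrightarrow> bounded_linear L \<Longrightarrow> smooth_on W L"
  unfolding smooth_on_def using Ck_on_bounded_linear by blast

lemma smooth_on_linear_compose:
  "open W \<Longrightarrow> bounded_linear L \<Longrightarrow> smooth_on W f \<Longrightarrow> smooth_on W (\<lambda>x. L (f x))"
  unfolding smooth_on_def using Ck_on_linear_compose by blast

lemma smooth_on_add: "open W \<Longrightarrow> smooth_on W f \<Longrightarrow> smooth_on W g \<Longrightarrow> smooth_on W (\<lambda>x. f x + g x)"
  unfolding smooth_on_def using Ck_on_add by blast

lemma smooth_on_diff: "open W \<Longrightarrow> smooth_on W f \<Longrightarrow> smooth_on W g \<Longrightarrow> smooth_on W (\<lambda>x. f x - g x)"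
  using smooth_on_add[of W f "\<lambda>x. - g x"]
    smooth_on_linear_compose[of W "\<lambda>y. - y" g, OF _ bounded_linear_minus[OF bounded_linear_ident]] by simp

lemma smooth_on_Pair: "open W \<Longrightarrow> smooth_on W f \<Longrightarrow> smooth_on W g \<Longrightarrow> smooth_on W (\<lambda>x. (f x, g x))"
  unfolding smooth_on_def using Ck_on_Pair by blast

lemma smooth_on_compose:
  fixes g :: "'y::{real_normed_vector,complete_space} \<Rightarrow> 'z::real_normed_vector"
  shows "open W \<Longrightarrow> open Q \<Longrightarrow> f ` W \<subseteq> Q \<Longrightarrow> smooth_on W f \<Longrightarrow> smooth_on Q g \<Longrightarrow> smooth_on W (\<lambda>x. g (f x))"
  unfolding smooth_on_def using Ck_on_compose by blast

lemma smooth_on_blinfun_apply: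
  fixes w :: "'x::real_normed_vector \<Rightarrow> 'y::{real_normed_vector,complete_space}"
  assumes "open W" "smooth_on W A" "smooth_on W w"
  shows "smooth_on W (\<lambda>x. blinfun_apply (A x) (w x))"
  unfolding smooth_on_def
proof
  fix k
  show "Ck_on k W (\<lambda>x. blinfun_apply (A x) (w x))"
  proof (rule Ck_on_apply_family[OF assms(1)])
    show "Ck_on k W (\<lambda>x. blinfun_apply (A x) u)" for u
      using assms(2) by (intro Ck_on_linear_compose[OF assms(1) blinfun.bounded_linear_left]) (simp add: smooth_on_def)
  qed (use assms(3) in \<open>simp_all add: smooth_on_def blinfun.bounded_linear_right\<close>)
qed

lemma Ck_on_mult:
  fixes a b :: "'x::real_normed_vector \<Rightarrow> real"
  assumes "open W" "Ck_on k W a" "Ck_on k W b"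
  shows "Ck_on k W (\<lambda>x. a x * b x)"
proof (rule Ck_on_apply_family[OF assms(1), of "\<lambda>x u. a x * u"])
  show "Ck_on k W (\<lambda>x. a x * u)" for u
    by (rule Ck_on_linear_compose[OF assms(1) bounded_linear_mult_left assms(2)])
qed (use assms(3) in \<open>simp_all add: bounded_linear_mult_right\<close>)

lemma Ck_on_inverse: "Ck_on k (- {0}) (inverse :: real \<Rightarrow> real)"
proof (induction k)
  case 0
  show ?case by (auto intro: continuous_on_inverse)
next
  case (Suc k)
  have o: "open (- {0::real})" by auto
  show ?case
  proof (rule Ck_on_SucI[OF o])
    show "(inverse has_derivative (\<lambda>h. - (inverse x * h * inverse x))) (at x)" if "x \<in> - {0}" for x :: real
      using has_derivative_inverse'[of x UNIV] that by simp
    show "Ck_on k (- {0}) (\<lambda>x. - (inverse x * u * inverse x))" for u :: real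
      by (rule Ck_on_linear_compose[OF o bounded_linear_minus[OF bounded_linear_ident]
            Ck_on_mult[OF o Ck_on_mult[OF o Suc Ck_on_const] Suc]])
  qed
qed

subsection \<open>Second derivatives\<close>

text \<open>The derivative is Lipschitz at the point in the operator norm by uniform boundedness; the mean value
  inequality on a ball integrates this to a quadratic remainder.\<close>

lemma smooth_on_Taylor_quadratic:
  fixes \<psi> :: "'x::{real_normed_vector,complete_space} \<Rightarrow> 'z::real_normed_vector"
  assumes W: "open W" "x0 \<in> W" and \<psi>: "smooth_on W \<psi>"
  shows "\<exists>C. \<forall>\<^sub>F x in at x0. norm (\<psi> x - \<psi> x0 - frechet_derivative \<psi> (at x0) (x - x0)) \<le> C * (norm (x - x0))\<^sup>2"
proof -
  define \<psi>' where "\<psi>' x = frechet_derivative \<psi> (at x)" for x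
  have d: "(\<psi> has_derivative \<psi>' x) (at x)" if "x \<in> W" for x
    using smooth_on_has_derivative[OF \<psi> that] by (simp add: \<psi>'_def)
  have bl: "bounded_linear (\<psi>' x)" if "x \<in> W" for x using d[OF that] by (rule has_derivative_bounded_linear)
  define S where "S = (\<lambda>x u. \<psi>' x u - \<psi>' x0 u)"
  have blS: "bounded_linear (S x)" if "x \<in> W" for x
    unfolding S_def by (rule bounded_linear_sub[OF bl[OF that] bl[OF W(2)]])
  have lin: "\<forall>\<^sub>F x in at x0. bounded_linear (S x)"
    using W blS unfolding eventually_at_topological by blast
  have pw: "\<exists>C. \<forall>\<^sub>F x in at x0. norm (S x u) \<le> C * norm (x - x0)" for u
    using has_derivative_lipschitz_at[OF smooth_on_has_derivative[OF smooth_on_deriv[OF \<psi>, of u] W(2)]]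
    by (simp only: S_def \<psi>'_def)
  obtain C where C: "C \<ge> 0" "\<forall>\<^sub>F x in at x0. \<forall>u. norm (S x u) \<le> C * norm (x - x0) * norm u"
    by (rule uniform_bound_at[OF lin _ pw]) simp_all
  obtain d1 where d1: "d1 > 0" "\<And>x u. x \<noteq> x0 \<Longrightarrow> dist x x0 < d1 \<Longrightarrow> norm (S x u) \<le> C * norm (x - x0) * norm u"
    using C(2) unfolding eventually_at by blast
  obtain d2 where d2: "d2 > 0" "ball x0 d2 \<subseteq> W" using W by (meson open_contains_ball)
  define e where "e = min d1 d2"
  have "norm (\<psi> x - \<psi> x0 - \<psi>' x0 (x - x0)) \<le> C * (norm (x - x0))\<^sup>2" if x: "dist x x0 < e" for x
  proof -
    let ?B = "cball x0 (dist x x0)"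
    have sub: "?B \<subseteq> W" using x d2 by (auto simp: e_def dist_commute)
    have der: "((\<lambda>y. \<psi> y - \<psi>' x0 y) has_derivative S y) (at y within ?B)" if "y \<in> ?B" for y
      using has_derivative_diff[OF d bounded_linear_imp_has_derivative[OF bl[OF W(2)]], of y] sub that
      unfolding S_def by (blast intro: has_derivative_at_withinI)
    have on: "onorm (S y) \<le> C * norm (x - x0)" if y: "y \<in> ?B" for y
    proof (rule onorm_bound)
      show "norm (S y u) \<le> C * norm (x - x0) * norm u" for u
      proof (cases "y = x0")
        case True then show ?thesis using C(1) by (simp add: S_def)
      next
        case False
        have "norm (S y u) \<le> C * norm (y - x0) * norm u"
          using y x by (intro d1(2)[OF False]) (auto simp: e_def dist_commute)
        also have "\<dots> \<le> C * norm (x - x0) * norm u"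
          using y C(1) by (intro mult_right_mono mult_left_mono) (auto simp: dist_norm norm_minus_commute)
        finally show ?thesis .
      qed
    qed (use C(1) in auto)
    have "norm ((\<psi> x - \<psi>' x0 x) - (\<psi> x0 - \<psi>' x0 x0)) \<le> C * norm (x - x0) * norm (x - x0)"
      by (rule differentiable_bound[OF convex_cball der on]) (auto simp: dist_commute)
    moreover have "\<psi>' x0 (x - x0) = \<psi>' x0 x - \<psi>' x0 x0"
      using bl[OF W(2)] by (simp add: bounded_linear.linear linear_diff)
    moreover have "\<psi> x - \<psi> x0 - (\<psi>' x0 x - \<psi>' x0 x0) = (\<psi> x - \<psi>' x0 x) - (\<psi> x0 - \<psi>' x0 x0)" by simp
    ultimately show ?thesis by (simp only: power2_eq_square mult.assoc)
  qed
  moreover have "e > 0" using d1 d2 by (simp add: e_def)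
  ultimately show ?thesis unfolding \<psi>'_def eventually_at by blast
qed

text \<open>Smoothness is formulated by directional derivatives, but the linearised operator of the reduction is a
  derivative of an operator-valued map. In every fixed direction the first-order remainder of the
  derivative is quadratic, and uniform boundedness makes the constant independent of the direction.\<close>

lemma has_derivative_Blinfun_derivative:
  fixes f :: "'x::{real_normed_vector,complete_space} \<Rightarrow> 'z::real_normed_vector"
  assumes W: "open W" "x0 \<in> W" and f: "smooth_on W f"
  defines "f'' \<equiv> (\<lambda>u. frechet_derivative (\<lambda>x. frechet_derivative f (at x) u) (at x0))"
  shows "((\<lambda>x. Blinfun (frechet_derivative f (at x))) has_derivative (\<lambda>h. Blinfun (\<lambda>u. f'' u h))) (at x0)"
    and "\<And>h. bounded_linear (\<lambda>u. f'' u h)"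
proof -
  define f' where "f' x = frechet_derivative f (at x)" for x
  have bl: "bounded_linear (f' x)" if "x \<in> W" for x
    using has_derivative_bounded_linear[OF smooth_on_has_derivative[OF f that]] by (simp add: f'_def)
  have d2: "((\<lambda>x. f' x u) has_derivative f'' u) (at x0)" for u
    using smooth_on_has_derivative[OF smooth_on_deriv[OF f] W(2)] by (simp add: f'_def f''_def)
  have nh: "\<forall>\<^sub>F x in nhds x0. bounded_linear (f' x)"
    using W bl unfolding eventually_nhds by blast
  show bl2: "bounded_linear (\<lambda>u. f'' u h)" for h
    by (rule bounded_linear_derivative_family[OF nh d2])
  define T where "T = (\<lambda>x u. f' x u - f' x0 u - f'' u (x - x0))"
  have blT: "bounded_linear (T x)" if "x \<in> W" for x
    unfolding T_def by (rule bounded_linear_sub[OF bounded_linear_sub[OF bl[OF that] bl[OF W(2)]] bl2])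
  have lin: "\<forall>\<^sub>F x in at x0. bounded_linear (T x)"
    using W blT unfolding eventually_at_topological by blast
  have pw: "\<exists>C. \<forall>\<^sub>F x in at x0. norm (T x u) \<le> C * (norm (x - x0))\<^sup>2" for u
    using smooth_on_Taylor_quadratic[OF W smooth_on_deriv[OF f, of u]]
    by (simp only: T_def f''_def f'_def)
  obtain C where C: "C \<ge> 0" "\<forall>\<^sub>F x in at x0. \<forall>u. norm (T x u) \<le> C * (norm (x - x0))\<^sup>2 * norm u"
    by (rule uniform_bound_at[OF lin _ pw]) simp_all
  obtain K where K: "\<And>h u. norm (f'' u h) \<le> K * norm h * norm u" "K \<ge> 0"
  proof -
    define R where "R = (\<lambda>x u. f' x u - f' x0 u)"
    have linR: "\<forall>\<^sub>F x in at x0. bounded_linear (R x)"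
      using W bounded_linear_sub[OF bl bl[OF W(2)]] unfolding eventually_at_topological R_def by blast
    have pwR: "\<exists>C. \<forall>\<^sub>F x in at x0. norm (R x u) \<le> C * norm (x - x0)" for u
      using has_derivative_lipschitz_at[OF d2] by (simp only: R_def)
    obtain K where K: "K \<ge> 0" "\<forall>\<^sub>F x in at x0. \<forall>u. norm (R x u) \<le> K * norm (x - x0) * norm u"
      by (rule uniform_bound_at[OF linR _ pwR]) simp_all
    have "norm (f'' u h) \<le> (K * norm u) * norm h" for u h
    proof (rule has_derivative_direction_bound[OF d2])
      show "\<forall>\<^sub>F x in at x0. norm (f' x u - f' x0 u) \<le> K * norm u * norm (x - x0)"
        using K(2) by eventually_elim (simp add: R_def algebra_simps)
    qed
    then have "norm (f'' u h) \<le> K * norm h * norm u" for u h by (metis mult.assoc mult.commute)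
    then show ?thesis using K(1) by (rule that)
  qed
  have blD: "bounded_linear (\<lambda>h. Blinfun (\<lambda>u. f'' u h))"
  proof (rule bounded_linear_intro[where K = K])
    have l: "linear (f'' u)" for u by (rule has_derivative_linear[OF d2])
    show "Blinfun (\<lambda>u. f'' u (h + k)) = Blinfun (\<lambda>u. f'' u h) + Blinfun (\<lambda>u. f'' u k)" for h k
      by (rule blinfun_eqI, unfold blinfun.add_left bounded_linear_Blinfun_apply[OF bl2], rule linear_add[OF l])
    show "Blinfun (\<lambda>u. f'' u (r *\<^sub>R h)) = r *\<^sub>R Blinfun (\<lambda>u. f'' u h)" for r h
      by (rule blinfun_eqI, unfold blinfun.scaleR_left bounded_linear_Blinfun_apply[OF bl2], rule linear_scale[OF l])
    show "norm (Blinfun (\<lambda>u. f'' u h)) \<le> norm h * K" for h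
      using K by (intro norm_blinfun_bound) (simp_all add: bounded_linear_Blinfun_apply bl2 mult.commute)
  qed
  show "((\<lambda>x. Blinfun (frechet_derivative f (at x))) has_derivative (\<lambda>h. Blinfun (\<lambda>u. f'' u h))) (at x0)"
    unfolding has_derivative_within_alt2 f'_def[symmetric]
  proof (intro conjI allI impI blD)
    fix e :: real assume e: "e > 0"
    have "((\<lambda>x. C * norm (x - x0)) \<longlongrightarrow> C * norm (x0 - x0)) (at x0)" by (intro tendsto_intros)
    then have "\<forall>\<^sub>F x in at x0. C * norm (x - x0) < e" using e by (intro order_tendstoD) auto
    moreover have "\<forall>\<^sub>F x in at x0. x \<in> W" using W by (auto simp: eventually_at_topological)
    ultimately show "\<forall>\<^sub>F y in at x0. norm (Blinfun (f' y) - Blinfun (f' x0) - Blinfun (\<lambda>u. f'' u (y - x0))) \<le> e * norm (y - x0)"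
      using C(2)
    proof eventually_elim
      case (elim y)
      show ?case
      proof (rule norm_blinfun_bound)
        fix u
        have "norm (T y u) \<le> C * norm (y - x0) * (norm (y - x0) * norm u)"
          using elim(3)[rule_format, of u] by (simp add: power2_eq_square algebra_simps)
        also have "\<dots> \<le> e * (norm (y - x0) * norm u)"
          using elim(1) by (intro mult_right_mono) auto
        finally show "norm (blinfun_apply (Blinfun (f' y) - Blinfun (f' x0) - Blinfun (\<lambda>u. f'' u (y - x0))) u)
            \<le> e * norm (y - x0) * norm u"
          unfolding blinfun.diff_left bounded_linear_Blinfun_apply[OF bl2] bounded_linear_Blinfun_apply[OF bl[OF elim(2)]]
            bounded_linear_Blinfun_apply[OF bl[OF W(2)]] by (simp add: T_def mult.assoc)
      qed (use e in simp)
    qed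
  qed
qed

text \<open>The mean value theorem in the direction \<open>u\<close> turns the second difference into an increment of the
  directional derivative along \<open>u\<close>. The second difference does not distinguish \<open>u\<close> from \<open>w\<close>, and this
  gives the symmetry of the second derivative.\<close>

lemma second_difference_limit:
  fixes f :: "'x::real_normed_vector \<Rightarrow> real"
  assumes d: "\<forall>\<^sub>F x in nhds x0. f differentiable (at x)"
    and \<psi>: "((\<lambda>x. frechet_derivative f (at x) u) has_derivative \<psi>') (at x0)" and e: "e > 0"
  shows "\<forall>\<^sub>F t in at_right 0. \<bar>(f (x0 + t *\<^sub>R u + t *\<^sub>R w) - f (x0 + t *\<^sub>R u) - f (x0 + t *\<^sub>R w) + f x0) / t\<^sup>2 - \<psi>' w\<bar>
    \<le> e * (2 * (norm u + norm w))"
proof -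
  obtain d1 where d1: "d1 > 0" "\<And>x. dist x x0 < d1 \<Longrightarrow> f differentiable (at x)"
    using d by (auto simp: eventually_nhds_metric)
  have l: "linear \<psi>'" using \<psi> by (rule has_derivative_linear)
  define \<phi> where "\<phi> x = frechet_derivative f (at x) u" for x
  obtain d2 where d2: "d2 > 0" "\<And>y. norm (y - x0) < d2 \<Longrightarrow> norm (\<phi> y - \<phi> x0 - \<psi>' (y - x0)) \<le> e * norm (y - x0)"
    using \<psi> e unfolding has_derivative_at_alt \<phi>_def by blast
  define M where "M = norm u + norm w + 1"
  have M: "M > 0" by (simp add: M_def add_nonneg_pos)
  define r where "r = min d1 d2 / M"
  have r: "r > 0" using d1 d2 M by (simp add: r_def)
  have "\<bar>(f (x0 + t *\<^sub>R u + t *\<^sub>R w) - f (x0 + t *\<^sub>R u) - f (x0 + t *\<^sub>R w) + f x0) / t\<^sup>2 - \<psi>' w\<bar>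
    \<le> e * (2 * (norm u + norm w))" if t: "0 < t" "t < r" for t
  proof -
    have small: "norm ((s * t) *\<^sub>R u + c *\<^sub>R w) < min d1 d2" if "0 \<le> s" "s \<le> 1" "0 \<le> c" "c \<le> t" for s c
    proof -
      have "norm ((s * t) *\<^sub>R u + c *\<^sub>R w) \<le> norm ((s * t) *\<^sub>R u) + norm (c *\<^sub>R w)" by (rule norm_triangle_ineq)
      also have "\<dots> = s * (t * norm u) + c * norm w" using that t by simp
      also have "\<dots> \<le> 1 * (t * norm u) + t * norm w" using that t by (intro add_mono mult_right_mono) auto
      also have "\<dots> < t * M" using t by (simp add: M_def algebra_simps)
      also have "\<dots> < r * M" using t M by simp
      finally show ?thesis using M by (simp add: r_def)
    qed
    define q where "q s = f (x0 + (s * t) *\<^sub>R u + t *\<^sub>R w) - f (x0 + (s * t) *\<^sub>R u)" for s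
    have der: "(q has_real_derivative (t * (\<phi> (x0 + (s * t) *\<^sub>R u + t *\<^sub>R w) - \<phi> (x0 + (s * t) *\<^sub>R u)))) (at s)"
      if s: "0 \<le> s" "s \<le> 1" for s
    proof -
      have *: "((\<lambda>s. f (x0 + (s * t) *\<^sub>R u + c *\<^sub>R w)) has_derivative
          (\<lambda>h. h * (t * \<phi> (x0 + (s * t) *\<^sub>R u + c *\<^sub>R w)))) (at s)" if c: "0 \<le> c" "c \<le> t" for c
      proof -
        let ?y = "x0 + (s * t) *\<^sub>R u + c *\<^sub>R w"
        have "dist ?y x0 = norm ((s * t) *\<^sub>R u + c *\<^sub>R w)" by (simp add: dist_norm add.assoc)
        then have "f differentiable (at ?y)" using small[OF s c] by (intro d1(2)) simp
        then have D: "(f has_derivative frechet_derivative f (at ?y)) (at ?y)" by (simp add: frechet_derivative_works)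
        have A: "((\<lambda>s. x0 + (s * t) *\<^sub>R u + c *\<^sub>R w) has_derivative (\<lambda>h. (h * t) *\<^sub>R u)) (at s)"
          by (auto intro!: derivative_eq_intros)
        have "frechet_derivative f (at ?y) ((h * t) *\<^sub>R u) = h * (t * \<phi> ?y)" for h
          using linear_scale[OF has_derivative_linear[OF D]] by (simp add: \<phi>_def)
        then show ?thesis using diff_chain_at[OF A D] by (simp add: o_def)
      qed
      show ?thesis
        using has_derivative_diff[OF *[of t] *[of 0]] t
        by (simp add: q_def[abs_def] has_field_derivative_def right_diff_distrib[symmetric] mult_commute_abs)
    qed
    obtain s where s: "0 < s" "s < 1" "q 1 - q 0 = (1 - 0) * (t * (\<phi> (x0 + (s * t) *\<^sub>R u + t *\<^sub>R w) - \<phi> (x0 + (s * t) *\<^sub>R u)))"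
      using MVT2[of 0 1 q "\<lambda>s. t * (\<phi> (x0 + (s * t) *\<^sub>R u + t *\<^sub>R w) - \<phi> (x0 + (s * t) *\<^sub>R u))"] der by auto
    let ?a = "(s * t) *\<^sub>R u + t *\<^sub>R w" and ?b = "(s * t) *\<^sub>R u"
    have na: "norm ?a \<le> t * (norm u + norm w)"
    proof -
      have "norm ?a \<le> s * (t * norm u) + t * norm w"
        using norm_triangle_ineq[of "(s * t) *\<^sub>R u" "t *\<^sub>R w"] s t by simp
      also have "\<dots> \<le> 1 * (t * norm u) + t * norm w" using s t by (intro add_mono mult_right_mono) auto
      finally show ?thesis by (simp add: algebra_simps)
    qed
    have nb: "norm ?b \<le> t * (norm u + norm w)"
    proof -
      have "norm ?b = s * (t * norm u)" using s t by simp
      also have "\<dots> \<le> 1 * (t * norm u)" using s t by (intro mult_right_mono) auto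
      also have "\<dots> \<le> t * (norm u + norm w)" using t by (simp add: algebra_simps)
      finally show ?thesis .
    qed
    have "\<bar>\<phi> (x0 + ?a) - \<phi> x0 - \<psi>' ?a\<bar> \<le> e * norm ?a"
      using d2(2)[of "x0 + ?a"] small[of s t] s t by (simp add: add.assoc[symmetric])
    moreover have "\<bar>\<phi> (x0 + ?b) - \<phi> x0 - \<psi>' ?b\<bar> \<le> e * norm ?b"
      using d2(2)[of "x0 + ?b"] small[of s 0] s t by simp
    moreover have "e * norm ?a \<le> e * (t * (norm u + norm w))" "e * norm ?b \<le> e * (t * (norm u + norm w))"
      using na nb e by simp_all
    moreover have "\<psi>' ?a - \<psi>' ?b = t * \<psi>' w" by (simp add: linear_add[OF l] linear_scale[OF l])
    ultimately have main: "\<bar>(\<phi> (x0 + ?a) - \<phi> (x0 + ?b)) - t * \<psi>' w\<bar> \<le> t * (e * (2 * (norm u + norm w)))"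
      by (simp add: algebra_simps)
    have "f (x0 + t *\<^sub>R u + t *\<^sub>R w) - f (x0 + t *\<^sub>R u) - f (x0 + t *\<^sub>R w) + f x0 = t * (\<phi> (x0 + ?a) - \<phi> (x0 + ?b))"
      using s(3) by (simp add: q_def add.assoc)
    moreover have "E / t\<^sup>2 - p = (Y - t * p) / t" if "E = t * Y" for E Y p :: real
      using t by (simp add: that power2_eq_square field_simps)
    ultimately have "(f (x0 + t *\<^sub>R u + t *\<^sub>R w) - f (x0 + t *\<^sub>R u) - f (x0 + t *\<^sub>R w) + f x0) / t\<^sup>2 - \<psi>' w
       = ((\<phi> (x0 + ?a) - \<phi> (x0 + ?b)) - t * \<psi>' w) / t"
      by blast
    moreover have "\<bar>X / t\<bar> \<le> B" if "\<bar>X\<bar> \<le> t * B" for X B :: real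
      using t that by (simp add: abs_divide divide_le_eq mult.commute)
    ultimately show ?thesis using main by simp
  qed
  then show ?thesis using r unfolding eventually_at_right_field by blast
qed

lemma second_derivative_symmetric:
  fixes f :: "'x::real_normed_vector \<Rightarrow> real"
  assumes W: "open W" "x0 \<in> W" and f: "smooth_on W f"
  shows "frechet_derivative (\<lambda>x. frechet_derivative f (at x) u) (at x0) w =
    frechet_derivative (\<lambda>x. frechet_derivative f (at x) w) (at x0) u" (is "?A = ?B")
proof -
  have d: "\<forall>\<^sub>F x in nhds x0. f differentiable (at x)"
    using W smooth_on_has_derivative[OF f] unfolding eventually_nhds differentiable_def by blast
  have dd: "((\<lambda>x. frechet_derivative f (at x) u) has_derivative
     frechet_derivative (\<lambda>x. frechet_derivative f (at x) u) (at x0)) (at x0)" for u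
    using smooth_on_has_derivative[OF smooth_on_deriv[OF f] W(2)] .
  have "\<bar>?A - ?B\<bar> \<le> 0 + e" if e: "e > 0" for e
  proof -
    \<comment> \<open>Both limits are approached within a quarter of the tolerance; the summand one avoids division by zero.\<close>
    define c where "c = e / (4 * (norm u + norm w + 1))"
    have N: "norm u + norm w + 1 > 0" by (simp add: add_nonneg_pos)
    have c: "c > 0" using e N by (simp add: c_def)
    let ?q = "\<lambda>u w t. (f (x0 + t *\<^sub>R u + t *\<^sub>R w) - f (x0 + t *\<^sub>R u) - f (x0 + t *\<^sub>R w) + f x0) / t\<^sup>2"
    have "\<forall>\<^sub>F t in at_right 0. \<bar>?q u w t - ?A\<bar> \<le> c * (2 * (norm u + norm w)) \<and> \<bar>?q w u t - ?B\<bar> \<le> c * (2 * (norm w + norm u))"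
      using second_difference_limit[OF d dd c, of u w] second_difference_limit[OF d dd c, of w u]
      by (rule eventually_conj)
    then obtain t where "\<bar>?q u w t - ?A\<bar> \<le> c * (2 * (norm u + norm w))" "\<bar>?q w u t - ?B\<bar> \<le> c * (2 * (norm w + norm u))"
      using eventually_happens'[of "at_right (0::real)"] by auto
    moreover have "?q u w t = ?q w u t" for t by (simp add: algebra_simps)
    ultimately have "\<bar>?A - ?B\<bar> \<le> c * (4 * (norm u + norm w))" by (simp add: algebra_simps)
    also have "\<dots> \<le> c * (4 * (norm u + norm w + 1))" using c by simp
    also have "\<dots> = e" using N by (simp add: c_def field_simps)
    finally show ?thesis by simp
  qed
  then have "\<bar>?A - ?B\<bar> \<le> 0" by (rule field_le_epsilon)
  then show ?thesis by simp
qed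

subsection \<open>Division by a coordinate\<close>

lemma continuous_on_ray_family:
  fixes \<psi> :: "real \<times> real \<Rightarrow> real"
  defines "R d \<equiv> {-d<..<d} \<times> {-d<..<d}"
  assumes "continuous_on (R d) \<psi>"
  shows "continuous_on (R d \<times> {0..1}) (\<lambda>(x, t). t ^ j * \<psi> (fst x, t * snd x))"
proof -
  have "t * s \<in> {-d<..<d}" if "s \<in> {-d<..<d}" "t \<in> {0..1}" for s t :: real
  proof -
    have "\<bar>t * s\<bar> \<le> 1 * \<bar>s\<bar>" unfolding abs_mult using that by (intro mult_right_mono) auto
    then show ?thesis using that by auto
  qed
  then have "continuous_on (R d \<times> {0..1}) (\<lambda>y. \<psi> (fst (fst y), snd y * snd (fst y)))"
    by (intro continuous_on_compose2[OF assms(2)] continuous_intros) (auto simp: R_def)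
  then show ?thesis by (auto simp: case_prod_unfold intro!: continuous_intros)
qed

text \<open>Differentiation under the integral sign. Differentiating with respect to the second variable brings
  down a factor \<open>t\<close>, hence the weight \<open>t ^ j\<close> in the statement.\<close>

lemma ray_average_has_derivative:
  fixes \<psi> :: "real \<times> real \<Rightarrow> real"
  defines "R d \<equiv> {-d<..<d} \<times> {-d<..<d}"
    and "I \<equiv> \<lambda>(j::nat) (\<phi>::real \<times> real \<Rightarrow> real) x. integral {0..1} (\<lambda>t. t ^ j * \<phi> (fst x, t * snd x))"
  assumes \<psi>: "smooth_on (R d) \<psi>" and x: "x \<in> R d"
  shows "(I j \<psi> has_derivative (\<lambda>h. fst h * I j (\<lambda>x. frechet_derivative \<psi> (at x) (1, 0)) x +
      snd h * I (Suc j) (\<lambda>x. frechet_derivative \<psi> (at x) (0, 1)) x)) (at x)"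
proof -
  define \<psi>1 where "\<psi>1 = (\<lambda>x. frechet_derivative \<psi> (at x) (1, 0))"
  define \<psi>2 where "\<psi>2 = (\<lambda>x. frechet_derivative \<psi> (at x) (0, 1))"
  have o: "open (R d)" and cv: "convex (R d)" unfolding R_def by (auto intro: open_Times convex_Times)
  have c: "continuous_on (R d) \<psi>" "continuous_on (R d) \<psi>1" "continuous_on (R d) \<psi>2"
    using smooth_on_continuous[OF \<psi>] smooth_on_continuous[OF smooth_on_deriv[OF \<psi>]]
    by (simp_all add: \<psi>1_def \<psi>2_def)
  have ray: "(fst x, t * snd x) \<in> R d" if "x \<in> R d" "t \<in> {0..1}" for x t
  proof -
    have "\<bar>t * snd x\<bar> \<le> 1 * \<bar>snd x\<bar>" unfolding abs_mult using that by (intro mult_right_mono) auto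
    then show ?thesis using that by (auto simp: R_def)
  qed
  note cr = continuous_on_ray_family[folded R_def]
  have cint: "(\<lambda>t. t ^ i * \<phi> (fst x, t * snd x)) integrable_on {0..1}"
    if "continuous_on (R d) \<phi>" "x \<in> R d" for \<phi> x i
  proof (rule integrable_continuous_real)
    have "continuous_on {0..1} (\<lambda>t. (\<lambda>(x, t). t ^ i * \<phi> (fst x, t * snd x)) (x, t))"
      by (rule continuous_on_compose2[OF cr[OF that(1)]]) (use that(2) in \<open>auto intro!: continuous_intros\<close>)
    then show "continuous_on {0..1} (\<lambda>t. t ^ i * \<phi> (fst x, t * snd x))" by simp
  qed
  define fx where "fx x t = (t ^ j * \<psi>1 (fst x, t * snd x)) *\<^sub>R fst_blinfun +
      (t ^ Suc j * \<psi>2 (fst x, t * snd x)) *\<^sub>R (snd_blinfun :: (real \<times> real) \<Rightarrow>\<^sub>L real)" for x :: "real \<times> real" and t :: real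
  have fxa: "blinfun_apply (fx x t) h = fst h * (t ^ j * \<psi>1 (fst x, t * snd x)) + snd h * (t ^ Suc j * \<psi>2 (fst x, t * snd x))" for x t h
    by (simp add: fx_def blinfun.add_left blinfun.scaleR_left fst_blinfun.rep_eq snd_blinfun.rep_eq)
  have cfx: "continuous_on (R d \<times> cbox 0 1) (\<lambda>(x, t). fx x t)"
    using cr[OF c(2), of j] cr[OF c(3), of "Suc j"]
    unfolding fx_def case_prod_unfold cbox_interval
    by (intro continuous_on_add continuous_on_scaleR continuous_on_const)
  have "((\<lambda>x. integral (cbox 0 1) (\<lambda>t. t ^ j * \<psi> (fst x, t * snd x))) has_derivative integral (cbox 0 1) (fx x)) (at x within R d)"
  proof (rule leibniz_rule[OF _ _ cfx x cv])
    fix x :: "real \<times> real" and t :: real assume xt: "x \<in> R d" "t \<in> cbox 0 1"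
    let ?y = "(fst x, t * snd x)"
    have D: "(\<psi> has_derivative frechet_derivative \<psi> (at ?y)) (at ?y)"
      using ray xt by (intro smooth_on_has_derivative[OF \<psi>]) simp
    have A: "((\<lambda>x. (fst x, t * snd x)) has_derivative (\<lambda>h. (fst h, t * snd h))) (at x)"
      by (auto intro!: derivative_eq_intros)
    have l: "frechet_derivative \<psi> (at ?y) (u, w) = u * \<psi>1 ?y + w * \<psi>2 ?y" for u w
    proof -
      have "(u, w) = u *\<^sub>R (1, 0) + w *\<^sub>R (0, 1)" by simp
      then show ?thesis using linear_add[OF has_derivative_linear[OF D]] linear_scale[OF has_derivative_linear[OF D]]
        by (metis \<psi>1_def \<psi>2_def real_scaleR_def)
    qed
    have "((\<lambda>x. t ^ j * \<psi> (fst x, t * snd x)) has_derivative (\<lambda>h. t ^ j * frechet_derivative \<psi> (at ?y) (fst h, t * snd h))) (at x)"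
      using has_derivative_mult_right[OF diff_chain_at[OF A D], of "t ^ j"] by (simp add: o_def)
    moreover have "(\<lambda>h. t ^ j * frechet_derivative \<psi> (at ?y) (fst h, t * snd h)) = blinfun_apply (fx x t)"
      by (simp add: fun_eq_iff fxa l algebra_simps)
    ultimately show "((\<lambda>x. t ^ j * \<psi> (fst x, t * snd x)) has_derivative blinfun_apply (fx x t)) (at x within R d)"
      by (auto intro: has_derivative_at_withinI)
  next
    fix x :: "real \<times> real" assume "x \<in> R d"
    then show "(\<lambda>t. t ^ j * \<psi> (fst x, t * snd x)) integrable_on cbox 0 1"
      using cint[OF c(1)] by simp
  qed
  then have 1: "(I j \<psi> has_derivative integral (cbox 0 1) (fx x)) (at x)"
    using at_within_open[OF x o] by (simp add: I_def)
  have "fx x integrable_on cbox 0 1"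
    by (rule integrable_continuous, rule continuous_on_compose2[OF cfx, of _ "\<lambda>t. (x, t)", unfolded case_prod_conv])
      (use x in \<open>auto intro!: continuous_intros\<close>)
  then have "blinfun_apply (integral (cbox 0 1) (fx x)) h = fst h * I j \<psi>1 x + snd h * I (Suc j) \<psi>2 x" for h
    using integral_unique[OF has_integral_add[OF
        has_integral_mult_right[OF integrable_integral[OF cint[OF c(2) x, of j]], of "fst h"]
        has_integral_mult_right[OF integrable_integral[OF cint[OF c(3) x, of "Suc j"]], of "snd h"]]]
    by (subst blinfun_apply_integral) (simp_all add: fxa I_def del: power_Suc)
  then have "blinfun_apply (integral (cbox 0 1) (fx x)) = (\<lambda>h. fst h * I j \<psi>1 x + snd h * I (Suc j) \<psi>2 x)" by blast
  with 1 show ?thesis by (simp add: \<psi>1_def \<psi>2_def)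
qed

lemma ray_average_smooth:
  fixes \<psi> :: "real \<times> real \<Rightarrow> real"
  defines "R d \<equiv> {-d<..<d} \<times> {-d<..<d}"
  assumes "smooth_on (R d) \<psi>"
  shows "smooth_on (R d) (\<lambda>x. integral {0..1} (\<lambda>t. t ^ j * \<psi> (fst x, t * snd x)))"
proof -
  define I where "I = (\<lambda>(j::nat) (\<phi>::real \<times> real \<Rightarrow> real) x. integral {0..1} (\<lambda>t. t ^ j * \<phi> (fst x, t * snd x)))"
  have D: "(I j \<phi> has_derivative (\<lambda>h. fst h * I j (\<lambda>x. frechet_derivative \<phi> (at x) (1, 0)) x +
      snd h * I (Suc j) (\<lambda>x. frechet_derivative \<phi> (at x) (0, 1)) x)) (at x)"
    if "smooth_on (R d) \<phi>" "x \<in> R d" for j \<phi> x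
    using ray_average_has_derivative[of d \<phi> x j] that unfolding R_def I_def by blast
  have o: "open (R d)" unfolding R_def by (auto intro: open_Times)
  have "Ck_on k (R d) (I j \<phi>)" if "smooth_on (R d) \<phi>" for k j \<phi>
    using that
  proof (induction k arbitrary: j \<phi>)
    case 0
    have "isCont (I j \<phi>) x" if "x \<in> R d" for x
      using has_derivative_continuous[OF D[OF 0 that]] .
    then show ?case by (simp add: continuous_at_imp_continuous_on)
  next
    case (Suc k)
    show ?case
    proof (rule Ck_on_SucI[OF o D[OF Suc.prems]])
      fix u :: "real \<times> real"
      show "Ck_on k (R d) (\<lambda>x. fst u * I j (\<lambda>x. frechet_derivative \<phi> (at x) (1, 0)) x +
          snd u * I (Suc j) (\<lambda>x. frechet_derivative \<phi> (at x) (0, 1)) x)"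
        by (rule Ck_on_add[OF o Ck_on_linear_compose[OF o bounded_linear_mult_right Suc.IH[OF smooth_on_deriv[OF Suc.prems]]]
              Ck_on_linear_compose[OF o bounded_linear_mult_right Suc.IH[OF smooth_on_deriv[OF Suc.prems]]]])
    qed
  qed
  then show ?thesis using assms(2) by (simp add: smooth_on_def I_def)
qed

text \<open>The integral of the derivative along the segment from \<open>(l, 0)\<close> to \<open>(l, s)\<close> exhibits the factor \<open>s\<close>; the
  quotient is an average along this segment and inherits the smoothness.\<close>

lemma smooth_divide_second:
  fixes \<beta> :: "real \<times> real \<Rightarrow> real"
  defines "R d \<equiv> {-d<..<d} \<times> {-d<..<d}"
  assumes \<beta>: "smooth_on (R d) \<beta>" and zero: "\<And>l. l \<in> {-d<..<d} \<Longrightarrow> \<beta> (l, 0) = 0"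
  obtains g where "smooth_on (R d) g" "\<And>l s. (l, s) \<in> R d \<Longrightarrow> \<beta> (l, s) = s * g (l, s)"
proof
  define g where "g x = integral {0..1} (\<lambda>t. t ^ 0 * frechet_derivative \<beta> (at (fst x, t * snd x)) (0, 1))" for x
  show "smooth_on (R d) g"
    unfolding g_def R_def
    by (rule ray_average_smooth[OF smooth_on_deriv[OF \<beta>[unfolded R_def]]])
  fix l s assume ls: "(l, s) \<in> R d"
  have "((\<lambda>t. frechet_derivative \<beta> (at (l, t * s)) (0, 1) * s) has_integral (\<beta> (l, 1 * s) - \<beta> (l, 0 * s))) {0..1}"
  proof (rule fundamental_theorem_of_calculus)
    fix t :: real assume t: "t \<in> {0..1}"
    have "\<bar>t * s\<bar> \<le> 1 * \<bar>s\<bar>" unfolding abs_mult using t by (intro mult_right_mono) auto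
    then have "(l, t * s) \<in> R d" using ls by (auto simp: R_def)
    then have D: "(\<beta> has_derivative frechet_derivative \<beta> (at (l, t * s))) (at (l, t * s))"
      by (rule smooth_on_has_derivative[OF \<beta>])
    have "((\<lambda>t. (l, t * s)) has_derivative (\<lambda>h. (0, h * s))) (at t)"
      by (auto intro!: derivative_eq_intros)
    from diff_chain_at[OF this D]
    have "((\<lambda>t. \<beta> (l, t * s)) has_derivative (\<lambda>h. frechet_derivative \<beta> (at (l, t * s)) (0, h * s))) (at t)"
      by (simp add: o_def)
    moreover have "frechet_derivative \<beta> (at (l, t * s)) (0, h * s) = h *\<^sub>R (frechet_derivative \<beta> (at (l, t * s)) (0, 1) * s)" for h
      using linear_scale[OF has_derivative_linear[OF D], of "h * s" "(0, 1)"] by simp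
    ultimately show "((\<lambda>t. \<beta> (l, t * s)) has_vector_derivative frechet_derivative \<beta> (at (l, t * s)) (0, 1) * s) (at t within {0..1})"
      by (simp add: has_vector_derivative_def has_derivative_at_withinI)
  qed simp
  from integral_unique[OF this] have "\<beta> (l, s) - \<beta> (l, 0) = integral {0..1} (\<lambda>t. frechet_derivative \<beta> (at (l, t * s)) (0, 1) * s)"
    by simp
  also have "\<dots> = s * g (l, s)" by (simp add: g_def)
  finally show "\<beta> (l, s) = s * g (l, s)" using zero[of l] ls by (simp add: R_def)
qed

subsection \<open>A scalar implicit function theorem\<close>

text \<open>Where the derivative in \<open>l\<close> is positive, the equation is increasing in \<open>l\<close> and changes sign across a
  rectangle, so every \<open>s\<close> has exactly one solution. The formula for the derivative of the solution
  involves the solution itself, and this raises its order of smoothness by one.\<close>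

lemma implicit_function_smooth_pos:
  fixes g :: "real \<times> real \<Rightarrow> real"
  assumes N: "open N" "(0, 0) \<in> N" and g: "smooth_on N g" and g0: "g (0, 0) = 0"
    and pos: "frechet_derivative g (at (0, 0)) (1, 0) > 0" and e: "e > 0"
  obtains r d f where "0 < r" "r < e" "0 < d" "d < e" "smooth_on {-d<..<d} f" "f 0 = (0::real)"
    "\<And>s. s \<in> {-d<..<d} \<Longrightarrow> \<bar>f s\<bar> < r" "{-r<..<r} \<times> {-d<..<d} \<subseteq> N"
    "\<And>s l. s \<in> {-d<..<d} \<Longrightarrow> l \<in> {-r<..<r} \<Longrightarrow> g (l, s) = 0 \<longleftrightarrow> l = f s"
proof -
  define g1 where "g1 = (\<lambda>x. frechet_derivative g (at x) (1, 0))"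
  define g2 where "g2 = (\<lambda>x. frechet_derivative g (at x) (0, 1))"
  have cg: "continuous_on N g" "continuous_on N g1" "continuous_on N g2"
    using smooth_on_continuous[OF g] smooth_on_continuous[OF smooth_on_deriv[OF g]] by (simp_all add: g1_def g2_def)
  have sg: "smooth_on N g1" "smooth_on N g2" using smooth_on_deriv[OF g] by (simp_all add: g1_def g2_def)
  have Dg: "(g has_derivative (\<lambda>h. fst h * g1 x + snd h * g2 x)) (at x)" if "x \<in> N" for x
  proof -
    have D: "(g has_derivative frechet_derivative g (at x)) (at x)" by (rule smooth_on_has_derivative[OF g that])
    have "frechet_derivative g (at x) h = fst h * g1 x + snd h * g2 x" for h
    proof -
      have "h = fst h *\<^sub>R (1, 0) + snd h *\<^sub>R (0, 1)" by (simp add: prod_eq_iff)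
      then show ?thesis using linear_add[OF has_derivative_linear[OF D]] linear_scale[OF has_derivative_linear[OF D]]
        by (metis g1_def g2_def real_scaleR_def)
    qed
    then have "frechet_derivative g (at x) = (\<lambda>h. fst h * g1 x + snd h * g2 x)" by blast
    then show ?thesis using D by simp
  qed
  obtain P where P: "open P" "P \<inter> N = g1 -` {0<..} \<inter> N"
    using cg(2) N(1) unfolding continuous_on_open_invariant by (meson open_greaterThan)
  have "(0, 0) \<in> P \<inter> N" using P N pos by (auto simp: g1_def)
  then obtain e1 where e1: "e1 > 0" "cball (0, 0) e1 \<subseteq> P \<inter> N"
    using P(1) N(1) by (meson open_Int open_contains_cball)
  define r where "r = min (e / 2) (e1 / 2)"
  have r: "0 < r" "r < e" using e e1 by (auto simp: r_def)
  have box: "(l, s) \<in> N \<and> g1 (l, s) > 0" if "\<bar>l\<bar> \<le> r" "\<bar>s\<bar> \<le> r" for l s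
  proof -
    have "norm (l, s) \<le> \<bar>l\<bar> + \<bar>s\<bar>" using norm_Pair_le[of l s] by simp
    also have "\<dots> \<le> e1" using that by (auto simp: r_def)
    finally have "(l, s) \<in> cball (0, 0) e1" by (simp only: zero_prod_def[symmetric] mem_cball_0)
    then have "(l, s) \<in> g1 -` {0<..} \<inter> N" using e1(2) P(2) by blast
    then show ?thesis by simp
  qed
  have D1: "((\<lambda>l. g (l, s)) has_real_derivative g1 (l, s)) (at l)" if "(l, s) \<in> N" for l s
  proof -
    have "((\<lambda>l. (l, s)) has_derivative (\<lambda>h. (h, 0))) (at l)" by (auto intro!: derivative_eq_intros)
    from diff_chain_at[OF this Dg[OF that]] show ?thesis
      by (simp add: o_def has_field_derivative_def mult_commute_abs)
  qed
  have D2: "((\<lambda>s. g (l, s)) has_real_derivative g2 (l, s)) (at s)" if "(l, s) \<in> N" for l s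
  proof -
    have "((\<lambda>s. (l, s)) has_derivative (\<lambda>h. (0, h))) (at s)" by (auto intro!: derivative_eq_intros)
    from diff_chain_at[OF this Dg[OF that]] show ?thesis
      by (simp add: o_def has_field_derivative_def mult_commute_abs)
  qed
  have mono: "g (l, s) < g (l', s)" if "l < l'" "-r \<le> l" "l' \<le> r" "\<bar>s\<bar> \<le> r" for l l' s
    by (rule DERIV_pos_imp_increasing[OF that(1)]) (use that box D1 in \<open>meson abs_le_iff minus_le_iff order_trans\<close>)
  have ev: "\<forall>\<^sub>F s in nhds s0. g (l, s) > 0" if "g (l, s0) > 0" "(l, s0) \<in> N" for l s0
    using DERIV_isCont[OF D2[OF that(2)]] that(1) unfolding isCont_def
    by (metis (mono_tags) eventually_nhds_conv_at order_tendstoD(1))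
  have ev': "\<forall>\<^sub>F s in nhds s0. g (l, s) < 0" if "g (l, s0) < 0" "(l, s0) \<in> N" for l s0
    using DERIV_isCont[OF D2[OF that(2)]] that(1) unfolding isCont_def
    by (metis (mono_tags) eventually_nhds_conv_at order_tendstoD(2))
  have "\<forall>\<^sub>F s in nhds 0. g (r, s) > 0 \<and> g (-r, s) < 0"
    using mono[of 0 r 0] mono[of "-r" 0 0] g0 r box[of r 0] box[of "-r" 0]
    by (intro eventually_conj ev ev') auto
  then obtain d0 where d0: "d0 > 0" "\<And>s. \<bar>s\<bar> < d0 \<Longrightarrow> g (r, s) > 0 \<and> g (-r, s) < 0"
    by (auto simp: eventually_nhds_metric dist_norm)
  define d where "d = min d0 r"
  have d: "d > 0" "d \<le> r" "d \<le> d0" using d0 r by (auto simp: d_def)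
  have "\<exists>l. \<bar>l\<bar> < r \<and> g (l, s) = 0" if s: "\<bar>s\<bar> < d" for s
  proof -
    have "continuous_on {-r..r} (\<lambda>l. g (l, s))"
      using box s d by (intro continuous_at_imp_continuous_on ballI DERIV_isCont[OF D1]) auto
    then obtain l where "-r \<le> l" "l \<le> r" "g (l, s) = 0"
      using IVT'[of "\<lambda>l. g (l, s)" "-r" 0 r] d0(2)[of s] s d r by auto
    then show ?thesis using d0(2)[of s] s d by (intro exI[of _ l]) (auto simp: abs_less_iff less_le)
  qed
  then obtain f where f: "\<And>s. \<bar>s\<bar> < d \<Longrightarrow> \<bar>f s\<bar> < r \<and> g (f s, s) = 0" by metis
  have uniq: "l = f s" if "\<bar>s\<bar> < d" "\<bar>l\<bar> < r" "g (l, s) = 0" for l s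
  proof -
    have "- r \<le> l" "l \<le> r" "- r \<le> f s" "f s \<le> r" "\<bar>s\<bar> \<le> r" using f[OF that(1)] that d by linarith+
    then show ?thesis
      using mono[of l "f s" s] mono[of "f s" l s] f[OF that(1)] that(3) by (cases l "f s" rule: linorder_cases) auto
  qed
  have fc: "isCont f s0" if s0: "\<bar>s0\<bar> < d" for s0
  proof -
    have "(f \<longlongrightarrow> f s0) (at s0)"
    proof (rule tendstoI)
      fix \<epsilon> :: real assume "\<epsilon> > 0"
      define \<epsilon>' where "\<epsilon>' = min (\<epsilon> / 2) (min ((r - f s0) / 2) ((r + f s0) / 2))"
      have fs: "\<bar>f s0\<bar> < r" "g (f s0, s0) = 0" using f[OF s0] by auto
      have \<epsilon>': "\<epsilon>' > 0" "\<epsilon>' < \<epsilon>" "f s0 + \<epsilon>' < r" "f s0 - \<epsilon>' > - r"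
        using \<open>\<epsilon> > 0\<close> fs(1) by (auto simp: \<epsilon>'_def min_def field_simps)
      have "g (f s0 + \<epsilon>', s0) > 0" "g (f s0 - \<epsilon>', s0) < 0"
        using mono[of "f s0" "f s0 + \<epsilon>'" s0] mono[of "f s0 - \<epsilon>'" "f s0" s0] fs \<epsilon>' s0 d by auto
      then have "\<forall>\<^sub>F s in nhds s0. g (f s0 + \<epsilon>', s) > 0 \<and> g (f s0 - \<epsilon>', s) < 0"
        using box[of "f s0 + \<epsilon>'" s0] box[of "f s0 - \<epsilon>'" s0] \<epsilon>' s0 d fs(1)
        by (intro eventually_conj ev ev') auto
      moreover have "\<forall>\<^sub>F s in nhds s0. \<bar>s\<bar> < d"
        using s0 by (intro eventually_nhds_in_open[of "{-d<..<d}", THEN eventually_mono]) auto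
      ultimately have "\<forall>\<^sub>F s in nhds s0. dist (f s) (f s0) < \<epsilon>"
      proof eventually_elim
        case (elim s)
        have "\<not> f s \<ge> f s0 + \<epsilon>'"
        proof
          assume *: "f s \<ge> f s0 + \<epsilon>'"
          have "f s \<le> r" "\<bar>s\<bar> \<le> r" "- r \<le> f s0 + \<epsilon>'" "g (f s, s) = 0"
            using f[OF elim(2)] elim(2) \<epsilon>' d by linarith+
          then show False using mono[of "f s0 + \<epsilon>'" "f s" s] elim(1) * by (cases "f s = f s0 + \<epsilon>'") auto
        qed
        moreover have "\<not> f s \<le> f s0 - \<epsilon>'"
        proof
          assume *: "f s \<le> f s0 - \<epsilon>'"
          have "- r \<le> f s" "\<bar>s\<bar> \<le> r" "f s0 - \<epsilon>' \<le> r" "g (f s, s) = 0"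
            using f[OF elim(2)] elim(2) \<epsilon>' d by linarith+
          then show False using mono[of "f s" "f s0 - \<epsilon>'" s] elim(1) * by (cases "f s = f s0 - \<epsilon>'") auto
        qed
        ultimately show ?case using \<epsilon>'(2) by (auto simp: dist_real_def)
      qed
      then show "\<forall>\<^sub>F s in at s0. dist (f s) (f s0) < \<epsilon>" by (simp add: eventually_nhds_conv_at)
    qed
    then show ?thesis by (simp add: isCont_def)
  qed
  have graph: "(f s, s) \<in> N \<and> g1 (f s, s) > 0" if "\<bar>s\<bar> < d" for s
    using box f that d by (meson less_imp_le order_trans)
  have fd: "(f has_real_derivative (- g2 (f s0, s0) * inverse (g1 (f s0, s0)))) (at s0)" if s0: "\<bar>s0\<bar> < d" for s0
  proof -
    \<comment> \<open>The intermediate point of the mean value theorem for the increment in the first variable.\<close>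
    have "\<exists>\<xi>. \<bar>\<xi> - f s0\<bar> \<le> \<bar>f s - f s0\<bar> \<and> \<bar>\<xi>\<bar> \<le> r \<and> (\<bar>s\<bar> < d \<longrightarrow> g (f s, s) - g (f s0, s) = (f s - f s0) * g1 (\<xi>, s))" for s
    proof (cases "\<bar>s\<bar> < d")
      case True
      have fs: "\<bar>f s\<bar> < r" "\<bar>f s0\<bar> < r" "\<bar>s\<bar> \<le> r" using f[OF True] f[OF s0] True d by auto
      have DD: "((\<lambda>l. g (l, s)) has_real_derivative g1 (l, s)) (at l)" if "\<bar>l\<bar> \<le> r" for l
        using D1 box that fs by blast
      consider "f s = f s0" | "f s < f s0" | "f s0 < f s" by linarith
      then show ?thesis
      proof cases
        case 1 then show ?thesis using fs by (intro exI[of _ "f s0"]) auto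
      next
        case 2
        obtain z where z: "f s < z" "z < f s0" "g (f s0, s) - g (f s, s) = (f s0 - f s) * g1 (z, s)"
        proof -
          have "((\<lambda>l. g (l, s)) has_real_derivative g1 (l, s)) (at l)" if "f s \<le> l" "l \<le> f s0" for l
            by (rule DD) (use that fs in linarith)
          from MVT2[OF 2 this] show ?thesis using that by blast
        qed
        then show ?thesis using fs by (intro exI[of _ z]) (auto simp: algebra_simps)
      next
        case 3
        obtain z where z: "f s0 < z" "z < f s" "g (f s, s) - g (f s0, s) = (f s - f s0) * g1 (z, s)"
        proof -
          have "((\<lambda>l. g (l, s)) has_real_derivative g1 (l, s)) (at l)" if "f s0 \<le> l" "l \<le> f s" for l
            by (rule DD) (use that fs in linarith)
          from MVT2[OF 3 this] show ?thesis using that by blast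
        qed
        then show ?thesis using fs by (intro exI[of _ z]) (auto simp: algebra_simps)
      qed
    qed (use f[OF s0] in \<open>auto intro!: exI[of _ "f s0"]\<close>)
    then obtain \<xi> where \<xi>: "\<And>s. \<bar>\<xi> s - f s0\<bar> \<le> \<bar>f s - f s0\<bar>" "\<And>s. \<bar>\<xi> s\<bar> \<le> r"
      "\<And>s. \<bar>s\<bar> < d \<Longrightarrow> g (f s, s) - g (f s0, s) = (f s - f s0) * g1 (\<xi> s, s)" by metis
    have "((\<lambda>s. \<bar>f s - f s0\<bar>) \<longlongrightarrow> 0) (at s0)"
      using fc[OF s0] by (simp add: isCont_def LIM_zero tendsto_rabs_zero)
    then have "((\<lambda>s. \<xi> s - f s0) \<longlongrightarrow> 0) (at s0)"
      by (rule Lim_null_comparison[rotated]) (use \<xi>(1) in simp)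
    then have \<xi>l: "(\<xi> \<longlongrightarrow> f s0) (at s0)" by (rule LIM_zero_cancel)
    have "isCont g1 (f s0, s0)" using cg(2) N(1) graph[OF s0] by (simp add: continuous_on_eq_continuous_at)
    then have l1: "((\<lambda>s. g1 (\<xi> s, s)) \<longlongrightarrow> g1 (f s0, s0)) (at s0)"
      by (rule isCont_tendsto_compose) (intro tendsto_intros \<xi>l)
    have l2: "((\<lambda>s. (g (f s0, s) - g (f s0, s0)) / (s - s0)) \<longlongrightarrow> g2 (f s0, s0)) (at s0)"
      using D2[of "f s0" s0] graph[OF s0] by (simp add: has_field_derivative_iff)
    have "((\<lambda>s. - ((g (f s0, s) - g (f s0, s0)) / (s - s0)) * inverse (g1 (\<xi> s, s))) \<longlongrightarrow> - g2 (f s0, s0) * inverse (g1 (f s0, s0))) (at s0)"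
      using graph[OF s0] by (intro tendsto_mult tendsto_minus tendsto_inverse l1 l2) auto
    moreover have "\<forall>\<^sub>F s in at s0. - ((g (f s0, s) - g (f s0, s0)) / (s - s0)) * inverse (g1 (\<xi> s, s)) = (f s - f s0) / (s - s0)"
    proof -
      have "\<forall>\<^sub>F s in at s0. s \<in> {-d<..<d} \<and> s \<noteq> s0"
        using s0 by (intro eventually_conj eventually_at_in_open' eventually_neq_at_within) auto
      then show ?thesis
      proof eventually_elim
        case (elim s)
        then have s: "\<bar>s\<bar> < d" by auto
        have "- g (f s0, s) = (f s - f s0) * g1 (\<xi> s, s)" using \<xi>(3)[OF s] f[OF s] by simp
        moreover have "g1 (\<xi> s, s) > 0" using box \<xi>(2) s d by (meson less_imp_le order_trans)
        ultimately show ?case using f[OF s0] elim by (simp add: field_simps)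
      qed
    qed
    ultimately show ?thesis unfolding has_field_derivative_iff by (rule Lim_transform_eventually)
  qed
  have "Ck_on k {-d<..<d} f" for k
  proof (induction k)
    case 0
    then show ?case using fc by (auto intro!: continuous_at_imp_continuous_on)
  next
    case (Suc k)
    let ?Q = "{x \<in> N. g1 x > 0}"
    have "?Q = P \<inter> N" using P(2) by auto
    then have Q: "open ?Q" using P(1) N(1) by (simp add: open_Int)
    have ck: "Ck_on k ?Q g1" "Ck_on k ?Q g2"
      using sg by (auto simp: smooth_on_def intro: Ck_on_subset)
    have oI: "open {-d<..<d}" by simp
    have inv: "Ck_on k ?Q (\<lambda>x. inverse (g1 x))"
      by (rule Ck_on_compose[OF Q _ _ ck(1) Ck_on_inverse]) auto
    have G: "Ck_on k ?Q (\<lambda>x. - g2 x * inverse (g1 x))"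
      by (rule Ck_on_mult[OF Q Ck_on_linear_compose[OF Q bounded_linear_minus[OF bounded_linear_ident] ck(2)] inv])
    have gr: "Ck_on k {-d<..<d} (\<lambda>s. (f s, s))"
      by (rule Ck_on_Pair[OF oI Suc Ck_on_bounded_linear[OF oI bounded_linear_ident]])
    have "Ck_on k {-d<..<d} (\<lambda>s. - g2 (f s, s) * inverse (g1 (f s, s)))"
      by (rule Ck_on_compose[OF oI Q _ gr G]) (use graph in auto)
    then have "Ck_on k {-d<..<d} (\<lambda>s. (- g2 (f s, s) * inverse (g1 (f s, s))) * u)" for u
      by (rule Ck_on_linear_compose[OF oI bounded_linear_mult_left])
    moreover have "(f has_derivative (\<lambda>u. (- g2 (f s, s) * inverse (g1 (f s, s))) * u)) (at s)" if "s \<in> {-d<..<d}" for s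
      by (rule fd[of s, unfolded has_field_derivative_def]) (use that in auto)
    ultimately show ?case by (rule Ck_on_SucI[OF oI, rotated])
  qed
  then have sf: "smooth_on {-d<..<d} f" by (simp add: smooth_on_def)
  show ?thesis
  proof (rule that[OF r d(1) _ sf])
    show "d < e" using d r by simp
    show "f 0 = 0" using uniq[of 0 0] g0 d r by simp
    show "{-r<..<r} \<times> {-d<..<d} \<subseteq> N" using box d by force
  qed (use f uniq in \<open>auto simp: abs_less_iff\<close>)
qed

text \<open>Multiplying the equation by its own derivative at the origin makes that derivative positive.\<close>

lemma implicit_function_smooth:
  fixes g :: "real \<times> real \<Rightarrow> real"
  assumes N: "open N" "(0, 0) \<in> N" and g: "smooth_on N g" and g0: "g (0, 0) = 0"
    and nz: "frechet_derivative g (at (0, 0)) (1, 0) \<noteq> 0" and e: "e > 0"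
  obtains r d f where "0 < r" "r < e" "0 < d" "d < e" "smooth_on {-d<..<d} f" "f 0 = (0::real)"
    "\<And>s. s \<in> {-d<..<d} \<Longrightarrow> \<bar>f s\<bar> < r" "{-r<..<r} \<times> {-d<..<d} \<subseteq> N"
    "\<And>s l. s \<in> {-d<..<d} \<Longrightarrow> l \<in> {-r<..<r} \<Longrightarrow> g (l, s) = 0 \<longleftrightarrow> l = f s"
proof -
  define a where "a = frechet_derivative g (at (0, 0)) (1, 0)"
  have D: "((\<lambda>x. a * g x) has_derivative (\<lambda>h. a * frechet_derivative g (at (0, 0)) h)) (at (0, 0))"
    by (rule has_derivative_mult_right[OF smooth_on_has_derivative[OF g N(2)]])
  have "frechet_derivative (\<lambda>x. a * g x) (at (0, 0)) (1, 0) = a * a"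
    by (subst frechet_derivative_at[OF D, symmetric]) (simp only: a_def)
  then have pos: "frechet_derivative (\<lambda>x. a * g x) (at (0, 0)) (1, 0) > 0"
    using nz by (auto simp: a_def zero_less_mult_iff linorder_neq_iff)
  show ?thesis
  proof (rule implicit_function_smooth_pos[OF N smooth_on_linear_compose[OF N(1) bounded_linear_mult_right g] _ pos e])
    fix r d f
    assume *: "0 < r" "r < e" "0 < d" "d < e" "smooth_on {-d<..<d} f" "f 0 = (0::real)"
      "\<And>s. s \<in> {-d<..<d} \<Longrightarrow> \<bar>f s\<bar> < r" "{-r<..<r} \<times> {-d<..<d} \<subseteq> N"
      "\<And>s l. s \<in> {-d<..<d} \<Longrightarrow> l \<in> {-r<..<r} \<Longrightarrow> a * g (l, s) = 0 \<longleftrightarrow> l = f s"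
    have "g (l, s) = 0 \<longleftrightarrow> l = f s" if "s \<in> {-d<..<d}" "l \<in> {-r<..<r}" for s l
      using *(9)[OF that] nz by (simp add: a_def)
    from that[OF *(1-8) this] show ?thesis .
  qed (use g0 in simp)
qed

lemma linear_real_mult: "L = (*) (L 1)" if "linear L" for L :: "real \<Rightarrow> real"
proof
  fix x show "L x = L 1 * x" using linear_scale[OF that, of x 1] by (simp add: mult.commute)
qed

text \<open>The quadratic tangency of the solution curve is read off from the two-term expansion.\<close>

lemma fold_curve_from_expansion:
  fixes g :: "real \<times> real \<Rightarrow> real"
  assumes N: "open N" "(0, 0) \<in> N" and g: "smooth_on N g" and a: "a \<noteq> 0" and c: "c \<noteq> 0"
    and H: "\<And>\<epsilon>. \<epsilon> > 0 \<Longrightarrow> \<forall>\<^sub>F x in nhds (0, 0). \<bar>g x - (a * fst x + c * (snd x)\<^sup>2)\<bar> \<le> \<epsilon> * (\<bar>fst x\<bar> + (snd x)\<^sup>2)"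
    and e: "e > 0"
  obtains r d f where "0 < r" "r < e" "0 < d" "d < e" "fold_curve d f"
    "\<And>s. s \<in> {-d<..<d} \<Longrightarrow> \<bar>f s\<bar> < r"
    "\<And>s l. s \<in> {-d<..<d} \<Longrightarrow> l \<in> {-r<..<r} \<Longrightarrow> g (l, s) = 0 \<longleftrightarrow> l = f s"
proof -
  have g0: "g (0, 0) = 0"
    using eventually_nhds_x_imp_x[OF H[of 1]] by simp
  have D: "(g has_derivative frechet_derivative g (at (0, 0))) (at (0, 0))"
    by (rule smooth_on_has_derivative[OF g N(2)])
  have "((\<lambda>l. (l, 0::real)) has_derivative (\<lambda>h. (h, 0))) (at (0::real))" by (auto intro!: derivative_eq_intros)
  from diff_chain_at[OF this D] have D1: "((\<lambda>l. g (l, 0)) has_derivative (\<lambda>h. frechet_derivative g (at (0, 0)) (h, 0))) (at 0)"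
    by (simp add: o_def)
  have "((\<lambda>l. g (l, 0)) has_derivative (\<lambda>h. a * h)) (at 0)"
    unfolding has_derivative_within_alt2
  proof (intro conjI allI impI bounded_linear_mult_right)
    fix \<epsilon> :: real assume "\<epsilon> > 0"
    have "filterlim (\<lambda>l. (l, 0::real)) (nhds (0, 0)) (at (0::real))" by (intro tendsto_intros)
    from this[unfolded filterlim_iff, rule_format, OF H[OF \<open>\<epsilon> > 0\<close>]]
    show "\<forall>\<^sub>F y in at 0. norm (g (y, 0) - g (0, 0) - a * (y - 0)) \<le> \<epsilon> * norm (y - 0)"
      by (simp add: g0)
  qed
  from has_derivative_unique[OF D1 this] have "frechet_derivative g (at (0, 0)) (h, 0) = a * h" for h by meson
  then have "frechet_derivative g (at (0, 0)) (1, 0) \<noteq> 0" using a by simp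
  then obtain r d f where f: "0 < r" "r < e" "0 < d" "d < e" "smooth_on {-d<..<d} f" "f 0 = (0::real)"
    "\<And>s. s \<in> {-d<..<d} \<Longrightarrow> \<bar>f s\<bar> < r"
    "\<And>s l. s \<in> {-d<..<d} \<Longrightarrow> l \<in> {-r<..<r} \<Longrightarrow> g (l, s) = 0 \<longleftrightarrow> l = f s"
    by (rule implicit_function_smooth[OF N g g0 _ e]) blast
  have zero: "g (f s, s) = 0" if "s \<in> {-d<..<d}" for s using f(7,8)[OF that] by (auto simp: abs_less_iff)
  have Df: "(f has_real_derivative frechet_derivative f (at s) 1) (at s)" if "s \<in> {-d<..<d}" for s
  proof -
    have "(f has_derivative frechet_derivative f (at s)) (at s)" by (rule smooth_on_has_derivative[OF f(5) that])
    moreover have "frechet_derivative f (at s) = (*) (frechet_derivative f (at s) 1)"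
      by (rule linear_real_mult[OF has_derivative_linear[OF calculation]])
    ultimately show ?thesis unfolding has_field_derivative_def by simp
  qed
  have in0: "0 \<in> {-d<..<d}" using f(3) by simp
  have fc: "(f \<longlongrightarrow> 0) (at 0)" using DERIV_isCont[OF Df[OF in0]] f(6) by (simp add: isCont_def)
  have near: "\<forall>\<^sub>F s in at 0. s \<in> {-d<..<d}"
    using in0 by (intro eventually_at_in_open') auto
  have E: "\<forall>\<^sub>F s in at 0. \<bar>a * f s + c * s\<^sup>2\<bar> \<le> \<epsilon> * (\<bar>f s\<bar> + s\<^sup>2)" if "\<epsilon> > 0" for \<epsilon>
  proof -
    have "filterlim (\<lambda>s. (f s, s)) (nhds (0, 0)) (at 0)" by (intro tendsto_intros fc)
    from this[unfolded filterlim_iff, rule_format, OF H[OF that]] near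
    show ?thesis by eventually_elim (simp add: zero)
  qed
  \<comment> \<open>The expansion with tolerance half the absolute value of a, solved for the curve.\<close>
  define C where "C = (2 * \<bar>c\<bar> + \<bar>a\<bar>) / \<bar>a\<bar>"
  have C: "C \<ge> 0" by (simp add: C_def)
  have b1: "\<forall>\<^sub>F s in at 0. \<bar>f s\<bar> \<le> C * s\<^sup>2"
  proof -
    have "\<bar>a\<bar> / 2 > 0" using a by simp
    from E[OF this] show ?thesis
    proof eventually_elim
      case (elim s)
      have "\<bar>a\<bar> * \<bar>f s\<bar> \<le> \<bar>a * f s + c * s\<^sup>2\<bar> + \<bar>c\<bar> * s\<^sup>2"
        using abs_triangle_ineq4[of "a * f s + c * s\<^sup>2" "c * s\<^sup>2"] by (simp add: abs_mult)
      then have "\<bar>a\<bar> * \<bar>f s\<bar> \<le> (2 * \<bar>c\<bar> + \<bar>a\<bar>) * s\<^sup>2" using elim by (simp add: algebra_simps)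
      then show ?case using a by (simp add: C_def field_simps)
    qed
  qed
  have b2: "\<forall>\<^sub>F s in at 0. \<bar>a * f s + c * s\<^sup>2\<bar> \<le> \<epsilon> * s\<^sup>2" if "\<epsilon> > 0" for \<epsilon>
  proof -
    have "\<epsilon> / (C + 1) > 0" using that C by simp
    from E[OF this] b1 show ?thesis
    proof eventually_elim
      case (elim s)
      have "\<epsilon> / (C + 1) * (\<bar>f s\<bar> + s\<^sup>2) \<le> \<epsilon> / (C + 1) * (C * s\<^sup>2 + s\<^sup>2)"
        using elim(2) that C by (intro mult_left_mono) auto
      also have "\<dots> = \<epsilon> * s\<^sup>2" using C by (simp add: field_simps)
      finally show ?case using elim(1) by simp
    qed
  qed
  have d1: "(f has_real_derivative 0) (at 0)"
    unfolding has_field_derivative_def has_derivative_within_alt2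
  proof (intro conjI allI impI bounded_linear_mult_right)
    fix \<epsilon> :: real assume "\<epsilon> > 0"
    have "((\<lambda>s. C * \<bar>s\<bar>) \<longlongrightarrow> C * \<bar>0\<bar>) (at (0::real))" by (intro tendsto_intros)
    then have "\<forall>\<^sub>F s in at (0::real). C * \<bar>s\<bar> < \<epsilon>" using \<open>\<epsilon> > 0\<close> by (intro order_tendstoD) auto
    then show "\<forall>\<^sub>F y in at 0. norm (f y - f 0 - 0 * (y - 0)) \<le> \<epsilon> * norm (y - 0)"
      using b1
    proof eventually_elim
      case (elim s)
      have "C * s\<^sup>2 = (C * \<bar>s\<bar>) * \<bar>s\<bar>" by (simp add: power2_eq_square flip: abs_mult)
      also have "\<dots> \<le> \<epsilon> * \<bar>s\<bar>" using elim(1) by (intro mult_right_mono) auto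
      finally show ?case using elim(2) f(6) by simp
    qed
  qed
  define f' where "f' s = frechet_derivative f (at s) 1" for s
  have df: "deriv f s = f' s" if "s \<in> {-d<..<d}" for s
    using DERIV_imp_deriv[OF Df[OF that]] by (simp add: f'_def)
  have d0: "f' 0 = 0" using DERIV_unique[OF Df[OF in0] d1] by (simp add: f'_def)
  have Df': "(f' has_derivative frechet_derivative f' (at 0)) (at 0)"
    unfolding f'_def[abs_def] by (rule smooth_on_has_derivative[OF smooth_on_deriv[OF f(5)] in0])
  define b where "b = frechet_derivative f' (at 0) 1"
  have "frechet_derivative f' (at 0) = (*) b"
    unfolding b_def by (rule linear_real_mult[OF has_derivative_linear[OF Df']])
  then have Df'': "(f' has_real_derivative b) (at 0)" using Df' by (simp add: has_field_derivative_def)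
  have "(deriv f has_real_derivative b) (at 0)"
    unfolding has_field_derivative_def
    by (rule has_derivative_transform_within_open[OF Df''[unfolded has_field_derivative_def] open_greaterThanLessThan in0])
      (simp only: df)
  then have dd: "deriv (deriv f) 0 = b" by (rule DERIV_imp_deriv)
  \<comment> \<open>If the second derivative vanished, the curve would be negligible against the square of s, contradicting the expansion.\<close>
  have "b \<noteq> 0"
  proof
    assume "b = 0"
    define \<epsilon> where "\<epsilon> = \<bar>c\<bar> / (2 * (\<bar>a\<bar> + 1))"
    have \<epsilon>: "\<epsilon> > 0" using c by (auto simp: \<epsilon>_def intro!: divide_pos_pos add_nonneg_pos)
    have "\<forall>\<^sub>F s in at 0. norm (f' s - f' 0 - b * (s - 0)) \<le> \<epsilon> * norm (s - 0)"
      using Df'' \<epsilon> unfolding has_field_derivative_def has_derivative_within_alt2 by blast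
    then obtain d2 where d2: "d2 > 0" "\<And>s. s \<noteq> 0 \<Longrightarrow> \<bar>s\<bar> < d2 \<Longrightarrow> \<bar>f' s\<bar> \<le> \<epsilon> * \<bar>s\<bar>"
      using \<open>b = 0\<close> d0 by (auto simp: eventually_at dist_real_def)
    have \<epsilon>2: "\<bar>c\<bar> / 4 > 0" using c by simp
    obtain d3 where d3: "d3 > 0" "\<And>s. s \<noteq> 0 \<Longrightarrow> \<bar>s\<bar> < d3 \<Longrightarrow> \<bar>a * f s + c * s\<^sup>2\<bar> \<le> \<bar>c\<bar> / 4 * s\<^sup>2"
      using b2[OF \<epsilon>2] by (auto simp: eventually_at dist_real_def)
    define s where "s = min d (min d2 d3) / 2"
    have s: "s > 0" "s < d" "s < d2" "s < d3" using f(3) d2 d3 by (auto simp: s_def)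
    obtain z where z: "0 < z" "z < s" "f s - f 0 = (s - 0) * f' z"
      using MVT2[OF s(1), of f f'] Df s by (auto simp: f'_def)
    have "\<bar>f' z\<bar> \<le> \<epsilon> * \<bar>z\<bar>" using z s by (intro d2(2)) auto
    also have "\<dots> \<le> \<epsilon> * s" using z \<epsilon> by simp
    finally have "\<bar>f s\<bar> \<le> s * (\<epsilon> * s)" using z f(6) s by (simp add: abs_mult)
    then have "\<bar>a\<bar> * \<bar>f s\<bar> \<le> \<bar>a\<bar> * (\<epsilon> * s\<^sup>2)" by (intro mult_left_mono) (simp_all add: power2_eq_square algebra_simps)
    also have "\<dots> \<le> (\<bar>a\<bar> + 1) * (\<epsilon> * s\<^sup>2)" using \<epsilon> by (intro mult_right_mono) auto
    also have "\<dots> = \<bar>c\<bar> / 2 * s\<^sup>2"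
    proof -
      have "\<bar>a\<bar> + 1 \<noteq> 0" by (metis abs_ge_zero add_nonneg_pos less_irrefl zero_less_one)
      then show ?thesis by (simp add: \<epsilon>_def field_simps)
    qed
    finally have "\<bar>a\<bar> * \<bar>f s\<bar> \<le> \<bar>c\<bar> / 2 * s\<^sup>2" .
    moreover have "\<bar>a * f s + c * s\<^sup>2\<bar> \<le> \<bar>c\<bar> / 4 * s\<^sup>2" using s by (intro d3(2)) auto
    moreover have "\<bar>c\<bar> * s\<^sup>2 \<le> \<bar>a * f s + c * s\<^sup>2\<bar> + \<bar>a\<bar> * \<bar>f s\<bar>"
      using abs_triangle_ineq4[of "a * f s + c * s\<^sup>2" "a * f s"] by (simp add: abs_mult)
    ultimately have "\<bar>c\<bar> * s\<^sup>2 \<le> 3 / 4 * (\<bar>c\<bar> * s\<^sup>2)" by simp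
    moreover have "\<bar>c\<bar> * s\<^sup>2 > 0" using c s by simp
    ultimately show False by simp
  qed
  then have "fold_curve d f"
    using f(5,6) df[OF in0] d0 dd by (simp add: fold_curve_def)
  then show ?thesis by (rule that[OF f(1-4) _ f(7,8)])
qed

section \<open>Smooth maps between manifolds\<close>

text \<open>The part of an atlas that concerns single charts. Composition and the chain rule use one chart at each
  intermediate point and rest on this part; identities and projections compare two charts at the same
  point and rest on compatibility.\<close>

definition topological_atlas :: "('p::topological_space, 'e::real_normed_vector) chart set \<Rightarrow> bool" where
  "topological_atlas A \<longleftrightarrow> (\<Union>c\<in>A. fst c) = UNIV \<and>
     (\<forall>c\<in>A. open (fst c) \<and> open (snd c ` fst c) \<and>
        homeomorphism (fst c) (snd c ` fst c) (snd c) (chart_inv c))"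

lemma smooth_atlas_topological: "smooth_atlas A \<Longrightarrow> topological_atlas A"
  by (simp add: smooth_atlas_def topological_atlas_def)

lemma chart_inv_model [simp]: "chart_inv (UNIV, \<lambda>x. x) = (\<lambda>x. x)"
  by (simp add: chart_inv_def fun_eq_iff inv_into_f_f[of "\<lambda>x. x" UNIV])

lemma topological_atlas_model: "topological_atlas model_atlas"
  by (simp add: topological_atlas_def model_atlas_def homeomorphism_ident)

lemma chart_at_model [simp]: "chart_at model_atlas p = (UNIV, \<lambda>x. x)"
  by (auto simp: chart_at_def model_atlas_def intro!: some_equality)

context
  fixes A :: "('p::topological_space, 'e::real_normed_vector) chart set"
  assumes A: "topological_atlas A"
begin

lemma chart_at: "chart_at A p \<in> A" "p \<in> fst (chart_at A p)"
proof -
  have "p \<in> (\<Union>c\<in>A. fst c)" using A unfolding topological_atlas_def by simp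
  then have "\<exists>c. c \<in> A \<and> p \<in> fst c" by blast
  then have "chart_at A p \<in> A \<and> p \<in> fst (chart_at A p)" unfolding chart_at_def by (rule someI_ex)
  then show "chart_at A p \<in> A" "p \<in> fst (chart_at A p)" by auto
qed

lemma chart_open: "c \<in> A \<Longrightarrow> open (fst c)"
  using A by (auto simp: topological_atlas_def)

lemma chart_inv_chart: "c \<in> A \<Longrightarrow> p \<in> fst c \<Longrightarrow> chart_inv c (snd c p) = p"
  using A by (auto simp: topological_atlas_def homeomorphism_def)

lemma chart_chart_inv: "c \<in> A \<Longrightarrow> x \<in> snd c ` fst c \<Longrightarrow> snd c (chart_inv c x) = x"
  using A by (auto simp: topological_atlas_def homeomorphism_def)

lemma chart_continuous: "c \<in> A \<Longrightarrow> continuous_on (fst c) (snd c)"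
  using A by (auto simp: topological_atlas_def homeomorphism_def)

lemma chart_inv_continuous: "c \<in> A \<Longrightarrow> continuous_on (snd c ` fst c) (chart_inv c)"
  using A by (auto simp: topological_atlas_def homeomorphism_def)

lemma chart_image_open: "c \<in> A \<Longrightarrow> open T \<Longrightarrow> T \<subseteq> fst c \<Longrightarrow> open (snd c ` T)"
proof -
  assume c: "c \<in> A" and T: "open T" "T \<subseteq> fst c"
  have "openin (top_of_set (fst c)) T" using T by (simp add: open_subset)
  then have "openin (top_of_set (snd c ` fst c)) (snd c ` T)"
    using homeomorphism_imp_open_map[of "fst c" "snd c ` fst c" "snd c" "chart_inv c"] A c
    by (auto simp: topological_atlas_def)
  then show ?thesis using A c by (auto simp: topological_atlas_def intro: openin_open_trans)
qed

end

abbreviation chart_rep ::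
  "('p, 'e) chart \<Rightarrow> ('q, 'f) chart \<Rightarrow> ('p \<Rightarrow> 'q) \<Rightarrow> 'e \<Rightarrow> 'f" where
  "chart_rep c d f \<equiv> snd d \<circ> f \<circ> chart_inv c"

text \<open>A smooth map is smooth near each point of an open domain in any pair of charts around the point and its
  image; the local extensions of the definition disappear.\<close>

lemma smooth_map_localE:
  assumes A: "topological_atlas A" and B: "topological_atlas B"
    and f: "smooth_map A B X f" and X: "open X" "p \<in> X"
    and c: "c \<in> A" "p \<in> fst c" and d: "d \<in> B" "f p \<in> fst d"
  obtains T where "open T" "p \<in> T" "T \<subseteq> X" "T \<subseteq> fst c" "f ` T \<subseteq> fst d" "continuous_on T f"
    "open (snd c ` T)" "smooth_on (snd c ` T) (chart_rep c d f)"
proof -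
  obtain W F where W: "open W" "p \<in> W" "\<forall>x\<in>W \<inter> X. F x = f x" "continuous_on W F"
    "smooth_on (snd c ` {x \<in> fst c \<inter> W. F x \<in> fst d}) (snd d \<circ> F \<circ> chart_inv c)"
  proof -
    obtain W F where *: "open W" "p \<in> W" "\<forall>x\<in>W \<inter> X. F x = f x" "continuous_on W F"
      "\<forall>c\<in>A. \<forall>d\<in>B. smooth_on (snd c ` {x \<in> fst c \<inter> W. F x \<in> fst d}) (snd d \<circ> F \<circ> chart_inv c)"
      using f[unfolded smooth_map_def, rule_format, OF X(2)] by blast
    show ?thesis by (rule that[OF *(1-4) *(5)[rule_format, OF c(1) d(1)]])
  qed
  have "open (W \<inter> F -` fst d)"
    by (rule continuous_open_preimage[OF W(4) W(1) chart_open[OF B d(1)]])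
  define T where "T = fst c \<inter> X \<inter> (W \<inter> F -` fst d)"
  have T: "open T" unfolding T_def
    by (rule open_Int[OF open_Int[OF chart_open[OF A c(1)] X(1)] \<open>open (W \<inter> F -` fst d)\<close>])
  have Ff: "F x = f x" if "x \<in> T" for x using that W(3) by (auto simp: T_def)
  have o: "open (snd c ` T)" by (rule chart_image_open[OF A c(1) T]) (auto simp: T_def)
  have s: "smooth_on (snd c ` T) (snd d \<circ> F \<circ> chart_inv c)"
    by (rule smooth_on_subset[OF W(5)]) (auto simp: T_def)
  show ?thesis
  proof (rule that[OF T])
    show "p \<in> T" using X c d W by (auto simp: T_def)
    show "f ` T \<subseteq> fst d" using Ff by (auto simp: T_def)
    show "continuous_on T f"
      by (rule continuous_on_eq[OF continuous_on_subset[OF W(4)] Ff]) (auto simp: T_def)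
    show "smooth_on (snd c ` T) (chart_rep c d f)"
    proof (rule smooth_on_cong[OF o _ s])
      fix x assume "x \<in> snd c ` T"
      then obtain q where q: "q \<in> T" "x = snd c q" by blast
      then have "chart_inv c x = q" using chart_inv_chart[OF A c(1)] by (simp add: T_def)
      then show "(snd d \<circ> F \<circ> chart_inv c) x = chart_rep c d f x" using Ff[OF q(1)] by simp
    qed
    show "open (snd c ` T)" by (rule o)
  qed (auto simp: T_def)
qed

lemma smooth_mapI:
  assumes A: "topological_atlas A" and X: "open X" "continuous_on X f"
    and loc: "\<And>p c d. p \<in> X \<Longrightarrow> c \<in> A \<Longrightarrow> p \<in> fst c \<Longrightarrow> d \<in> B \<Longrightarrow> f p \<in> fst d \<Longrightarrow>
      \<exists>N. open N \<and> snd c p \<in> N \<and> smooth_on N (chart_rep c d f)"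
  shows "smooth_map A B X f"
  unfolding smooth_map_def
proof
  fix p assume "p \<in> X"
  show "\<exists>W F. open W \<and> p \<in> W \<and> (\<forall>x\<in>W \<inter> X. F x = f x) \<and> continuous_on W F \<and>
        (\<forall>c\<in>A. \<forall>d\<in>B. smooth_on (snd c ` {x \<in> fst c \<inter> W. F x \<in> fst d}) (snd d \<circ> F \<circ> chart_inv c))"
    using X \<open>p \<in> X\<close> by (intro exI[of _ X] exI[of _ f]) (auto intro!: smooth_on_local dest: loc)
qed

lemma smooth_map_continuous:
  fixes A :: "('p::t2_space, 'e::real_normed_vector) chart set"
  assumes f: "smooth_map A B X f" and X: "open X"
  shows "continuous_on X f"
proof (intro continuous_at_imp_continuous_on ballI)
  fix p assume "p \<in> X"
  then obtain W F where W: "open W" "p \<in> W" "\<forall>x\<in>W \<inter> X. F x = f x" "continuous_on W F"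
    using f unfolding smooth_map_def by metis
  then have "continuous_on (W \<inter> X) f"
    by (intro continuous_on_eq[OF continuous_on_subset[OF W(4), of "W \<inter> X"]]) auto
  then show "isCont f p" using W(1,2) X \<open>p \<in> X\<close> by (simp add: continuous_on_eq_continuous_at open_Int)
qed

lemma smooth_map_compose:
  fixes A :: "('p::t2_space, 'e::real_normed_vector) chart set"
    and B :: "('q::t2_space, 'f::{real_normed_vector,complete_space}) chart set"
    and C :: "('r::topological_space, 'h::real_normed_vector) chart set"
  assumes A: "topological_atlas A" and B: "topological_atlas B" and C: "topological_atlas C"
    and f: "smooth_map A B X f" and X: "open X" and g: "smooth_map B C UNIV g"
  shows "smooth_map A C X (\<lambda>x. g (f x))"
proof (rule smooth_mapI[OF A X])
  show "continuous_on X (\<lambda>x. g (f x))"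
    by (rule continuous_on_compose2[OF smooth_map_continuous[OF g] smooth_map_continuous[OF f X]]) auto
  fix p c d assume p: "p \<in> X" "c \<in> A" "p \<in> fst c" "d \<in> C" "g (f p) \<in> fst d"
  let ?b = "chart_at B (f p)"
  note b = chart_at[OF B, of "f p"]
  obtain T where T: "open T" "p \<in> T" "T \<subseteq> X" "T \<subseteq> fst c" "f ` T \<subseteq> fst ?b" "continuous_on T f"
    "open (snd c ` T)" "smooth_on (snd c ` T) (chart_rep c ?b f)"
    using smooth_map_localE[OF A B f X p(1-3) b] .
  obtain S where S: "open S" "f p \<in> S" "S \<subseteq> fst ?b" "g ` S \<subseteq> fst d"
    "open (snd ?b ` S)" "smooth_on (snd ?b ` S) (chart_rep ?b d g)"
    using smooth_map_localE[OF B C g open_UNIV UNIV_I b p(4,5)] by metis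
  let ?T = "T \<inter> f -` S"
  have oT: "open ?T" using T(6,1) S(1) by (rule continuous_open_preimage)
  let ?N = "snd c ` ?T"
  have oN: "open ?N" by (rule chart_image_open[OF A p(2) oT]) (use T in auto)
  have inv: "chart_inv c (snd c q) = q" if "q \<in> T" for q using chart_inv_chart[OF A p(2)] that T(4) by blast
  have "smooth_on ?N (\<lambda>x. chart_rep ?b d g (chart_rep c ?b f x))"
    by (rule smooth_on_compose[OF oN S(5) _ smooth_on_subset[OF T(8)] S(6)]) (auto simp: inv)
  then have "smooth_on ?N (chart_rep c d (\<lambda>x. g (f x)))"
  proof (rule smooth_on_cong[OF oN, rotated])
    fix x assume "x \<in> ?N"
    then obtain q where "q \<in> T" "f q \<in> S" "x = snd c q" by blast
    then show "chart_rep ?b d g (chart_rep c ?b f x) = chart_rep c d (\<lambda>x. g (f x)) x"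
      using S(3) chart_inv_chart[OF B b(1), of "f q"] by (auto simp: inv)
  qed
  then show "\<exists>N. open N \<and> snd c p \<in> N \<and> smooth_on N (chart_rep c d (\<lambda>x. g (f x)))"
    using oN T(2) S(2) by blast
qed

lemma smooth_map_const:
  fixes A :: "('p::t2_space, 'e::real_normed_vector) chart set"
  assumes A: "topological_atlas A" and X: "open X"
  shows "smooth_map A B X (\<lambda>_. q)"
  by (rule smooth_mapI[OF A X continuous_on_const])
    (auto simp: o_def smooth_on_const intro: exI[of _ UNIV])

lemma smooth_map_ident:
  fixes A :: "('p::t2_space, 'e::real_normed_vector) chart set"
  assumes "smooth_atlas A"
  shows "smooth_map A A UNIV (\<lambda>x. x)"
proof (rule smooth_mapI[OF smooth_atlas_topological[OF assms] open_UNIV continuous_on_id])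
  note A = smooth_atlas_topological[OF assms]
  fix p c d assume *: "c \<in> A" "p \<in> fst c" "d \<in> A" "p \<in> fst d"
  have "smooth_on (snd c ` (fst c \<inter> fst d)) (snd d \<circ> chart_inv c)"
    using assms * unfolding smooth_atlas_def by blast
  moreover have "open (snd c ` (fst c \<inter> fst d))"
    by (rule chart_image_open[OF A *(1) open_Int[OF chart_open[OF A *(1)] chart_open[OF A *(3)]]]) simp
  ultimately show "\<exists>N. open N \<and> snd c p \<in> N \<and> smooth_on N (chart_rep c d (\<lambda>x. x))"
    using * by (intro exI[of _ "snd c ` (fst c \<inter> fst d)"]) (auto simp: o_def)
qed

lemma smooth_map_model_iff:
  fixes f :: "'x::real_normed_vector \<Rightarrow> 'y::real_normed_vector"
  assumes X: "open X"
  shows "smooth_map model_atlas model_atlas X f \<longleftrightarrow> smooth_on X f"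
proof
  assume f: "smooth_map model_atlas model_atlas X f"
  show "smooth_on X f"
  proof (rule smooth_on_local)
    fix p assume "p \<in> X"
    have m: "(UNIV, \<lambda>x. x) \<in> model_atlas" by (simp add: model_atlas_def)
    obtain T where T: "p \<in> T" "open ((\<lambda>x. x) ` T)" "smooth_on ((\<lambda>x. x) ` T) (chart_rep (UNIV, \<lambda>x. x) (UNIV, \<lambda>x. x) f)"
      by (rule smooth_map_localE[OF topological_atlas_model topological_atlas_model f X \<open>p \<in> X\<close> m _ m]) simp_all
    then have "open T" "smooth_on T f" by (simp_all add: o_def)
    with T(1)
    show "\<exists>N. open N \<and> p \<in> N \<and> smooth_on N f" by blast
  qed
next
  assume f: "smooth_on X f"
  show "smooth_map model_atlas model_atlas X f"
  proof (rule smooth_mapI[OF topological_atlas_model X smooth_on_continuous[OF f]])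
    fix p :: 'x and c :: "('x, 'x) chart" and d :: "('y, 'y) chart"
    assume "p \<in> X" "c \<in> model_atlas" "d \<in> model_atlas"
    then show "\<exists>N. open N \<and> snd c p \<in> N \<and> smooth_on N (chart_rep c d f)"
      using X f by (intro exI[of _ X]) (simp add: model_atlas_def o_def)
  qed
qed

subsection \<open>Products\<close>

lemma chart_inv_prod:
  assumes "inj_on f U" "inj_on g V" "x \<in> f ` U" "y \<in> g ` V"
  shows "chart_inv (U \<times> V, map_prod f g) (x, y) = (chart_inv (U, f) x, chart_inv (V, g) y)"
proof -
  have i: "inj_on (map_prod f g) (U \<times> V)" using assms by (auto simp: inj_on_def)
  obtain u v where "u \<in> U" "x = f u" "v \<in> V" "y = g v" using assms by blast
  then show ?thesis
    using inv_into_f_f[OF i, of "(u, v)"] assms(1,2) by (simp add: chart_inv_def)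
qed

lemma topological_atlas_inj: "topological_atlas A \<Longrightarrow> c \<in> A \<Longrightarrow> inj_on (snd c) (fst c)"
  by (rule inj_on_inverseI[of _ "chart_inv c"]) (rule chart_inv_chart)

lemma topological_atlas_prod:
  assumes A: "topological_atlas A" and B: "topological_atlas B"
  shows "topological_atlas (prod_atlas A B)"
  unfolding topological_atlas_def
proof (intro conjI ballI)
  show "(\<Union>c\<in>prod_atlas A B. fst c) = UNIV"
  proof -
    have "(p, q) \<in> (\<Union>c\<in>prod_atlas A B. fst c)" for p q
    proof -
      let ?e = "(fst (chart_at A p) \<times> fst (chart_at B q), map_prod (snd (chart_at A p)) (snd (chart_at B q)))"
      have "?e \<in> prod_atlas A B"
        unfolding prod_atlas_def using chart_at(1)[OF A, of p] chart_at(1)[OF B, of q]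
        by (intro image_eqI[where x = "(chart_at A p, chart_at B q)"]) simp_all
      moreover have "(p, q) \<in> fst ?e" using chart_at(2)[OF A, of p] chart_at(2)[OF B, of q] by simp
      ultimately show ?thesis by (rule UN_I)
    qed
    then show ?thesis by fast
  qed
  fix e assume "e \<in> prod_atlas A B"
  then obtain c d where cd: "c \<in> A" "d \<in> B" and e: "e = (fst c \<times> fst d, map_prod (snd c) (snd d))"
    by (auto simp: prod_atlas_def)
  have im: "snd e ` fst e = snd c ` fst c \<times> snd d ` fst d" by (auto simp: e)
  have oc: "open (fst c)" "open (fst d)" "open (snd c ` fst c)" "open (snd d ` fst d)"
    using A B cd by (auto simp: topological_atlas_def)
  show "open (fst e)" using oc by (simp add: e open_Times)
  show "open (snd e ` fst e)" unfolding im using oc by (simp add: open_Times)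
  have inv: "chart_inv e (x, y) = (chart_inv c x, chart_inv d y)" if "x \<in> snd c ` fst c" "y \<in> snd d ` fst d" for x y
    using chart_inv_prod[of "snd c" "fst c" "snd d" "fst d" x y] that topological_atlas_inj[OF A cd(1)] topological_atlas_inj[OF B cd(2)]
    by (simp add: e)
  show "homeomorphism (fst e) (snd e ` fst e) (snd e) (chart_inv e)"
    unfolding homeomorphism_def
  proof (intro conjI ballI)
    show "chart_inv e (snd e x) = x" if xe: "x \<in> fst e" for x
    proof -
      obtain u w where "x = (u, w)" "u \<in> fst c" "w \<in> fst d" using xe by (cases x) (auto simp: e)
      then show ?thesis using inv[of "snd c u" "snd d w"] chart_inv_chart[OF A cd(1)] chart_inv_chart[OF B cd(2)]
        by (simp add: e)
    qed
    then show "chart_inv e ` (snd e ` fst e) = fst e" by (simp add: image_image)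
    show "snd e (chart_inv e y) = y" if "y \<in> snd e ` fst e" for y
      using that \<open>\<And>x. x \<in> fst e \<Longrightarrow> chart_inv e (snd e x) = x\<close> by auto
    show "continuous_on (fst e) (snd e)"
      unfolding e map_prod_def case_prod_unfold snd_conv fst_conv
      by (intro continuous_on_Pair continuous_on_compose2[OF chart_continuous[OF A cd(1)] continuous_on_fst[OF continuous_on_id]]
          continuous_on_compose2[OF chart_continuous[OF B cd(2)] continuous_on_snd[OF continuous_on_id]]) auto
    have "continuous_on (snd e ` fst e) (\<lambda>z. (chart_inv c (fst z), chart_inv d (snd z)))"
      unfolding im
      by (intro continuous_on_Pair continuous_on_compose2[OF chart_inv_continuous[OF A cd(1)] continuous_on_fst[OF continuous_on_id]]
          continuous_on_compose2[OF chart_inv_continuous[OF B cd(2)] continuous_on_snd[OF continuous_on_id]]) auto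
    then show "continuous_on (snd e ` fst e) (chart_inv e)"
      by (rule continuous_on_eq) (use inv im in auto)
  qed simp
qed

lemma smooth_map_Pair:
  fixes A :: "('p::t2_space, 'e::real_normed_vector) chart set"
    and B :: "('q::topological_space, 'f::real_normed_vector) chart set"
    and C :: "('r::topological_space, 'h::real_normed_vector) chart set"
  assumes A: "topological_atlas A" and B: "topological_atlas B" and C: "topological_atlas C"
    and X: "open X" and f: "smooth_map A B X f" and g: "smooth_map A C X g"
  shows "smooth_map A (prod_atlas B C) X (\<lambda>x. (f x, g x))"
proof (rule smooth_mapI[OF A X])
  show "continuous_on X (\<lambda>x. (f x, g x))"
    by (rule continuous_on_Pair[OF smooth_map_continuous[OF f X] smooth_map_continuous[OF g X]])
  fix p c d assume p: "p \<in> X" "c \<in> A" "p \<in> fst c" and d: "d \<in> prod_atlas B C" "(f p, g p) \<in> fst d"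
  obtain b b' where b: "b \<in> B" "b' \<in> C" "d = (fst b \<times> fst b', map_prod (snd b) (snd b'))"
    using d(1) by (auto simp: prod_atlas_def)
  have d': "f p \<in> fst b" "g p \<in> fst b'" using d(2) by (simp_all add: b(3))
  obtain T where T: "p \<in> T" "open (snd c ` T)" "smooth_on (snd c ` T) (chart_rep c b f)"
    by (rule smooth_map_localE[OF A B f X p b(1) d'(1)]) blast
  obtain S where S: "p \<in> S" "open (snd c ` S)" "smooth_on (snd c ` S) (chart_rep c b' g)"
    by (rule smooth_map_localE[OF A C g X p b(2) d'(2)]) blast
  let ?N = "snd c ` T \<inter> snd c ` S"
  have "smooth_on ?N (\<lambda>x. (chart_rep c b f x, chart_rep c b' g x))"
    by (rule smooth_on_Pair[OF open_Int[OF T(2) S(2)] smooth_on_subset[OF T(3)] smooth_on_subset[OF S(3)]]) auto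
  moreover have "chart_rep c d (\<lambda>x. (f x, g x)) = (\<lambda>x. (chart_rep c b f x, chart_rep c b' g x))"
    by (simp add: fun_eq_iff b(3))
  ultimately show "\<exists>N. open N \<and> snd c p \<in> N \<and> smooth_on N (chart_rep c d (\<lambda>x. (f x, g x)))"
    using T S by (intro exI[of _ ?N]) auto
qed

lemma prod_chart_inv:
  assumes A: "topological_atlas A" "c \<in> A" and B: "topological_atlas B" "d \<in> B"
    and x: "x \<in> snd c ` fst c" "y \<in> snd d ` fst d"
  shows "chart_inv (fst c \<times> fst d, map_prod (snd c) (snd d)) (x, y) = (chart_inv c x, chart_inv d y)"
  using chart_inv_prod[OF topological_atlas_inj[OF A] topological_atlas_inj[OF B] x] by simp

lemma smooth_map_fst:
  fixes A :: "('p::t2_space, 'e::{real_normed_vector,complete_space}) chart set"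
    and B :: "('q::t2_space, 'f::{real_normed_vector,complete_space}) chart set"
  assumes sA: "smooth_atlas A" and sB: "smooth_atlas B"
  shows "smooth_map (prod_atlas A B) A UNIV fst" and "smooth_map (prod_atlas A B) B UNIV snd"
proof -
  note A = smooth_atlas_topological[OF sA] and B = smooth_atlas_topological[OF sB]
  note AB = topological_atlas_prod[OF A B]
  show "smooth_map (prod_atlas A B) A UNIV fst"
  proof (rule smooth_mapI[OF AB open_UNIV continuous_on_fst[OF continuous_on_id]])
    fix p e d assume e: "e \<in> prod_atlas A B" "p \<in> fst e" and d: "d \<in> A" "fst p \<in> fst d"
    obtain c c' where c: "c \<in> A" "c' \<in> B" "e = (fst c \<times> fst c', map_prod (snd c) (snd c'))"
      using e(1) by (auto simp: prod_atlas_def)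
    let ?U = "snd c ` (fst c \<inter> fst d)" and ?V = "snd c' ` fst c'"
    have o: "open ?U" "open ?V"
      using chart_image_open[OF A c(1) open_Int[OF chart_open[OF A c(1)] chart_open[OF A d(1)]]]
        chart_image_open[OF B c(2) chart_open[OF B c(2)]] by auto
    have tr: "smooth_on ?U (snd d \<circ> chart_inv c)" using sA c(1) d(1) unfolding smooth_atlas_def by blast
    have "fst ` (?U \<times> ?V) \<subseteq> ?U" by (rule image_subsetI) (simp only: mem_Times_iff)
    from smooth_on_compose[OF open_Times[OF o] o(1) this smooth_on_bounded_linear[OF open_Times[OF o] bounded_linear_fst] tr]
    have "smooth_on (?U \<times> ?V) (\<lambda>z. (snd d \<circ> chart_inv c) (fst z))" .
    then have "smooth_on (?U \<times> ?V) (chart_rep e d fst)"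
    proof (rule smooth_on_cong[OF open_Times[OF o], rotated])
      fix z assume "z \<in> ?U \<times> ?V"
      then have "fst z \<in> snd c ` fst c" "snd z \<in> snd c' ` fst c'" unfolding mem_Times_iff by blast+
      from prod_chart_inv[OF A c(1) B c(2) this]
      show "(snd d \<circ> chart_inv c) (fst z) = chart_rep e d fst z" by (simp add: c(3))
    qed
    moreover have "snd e p \<in> ?U \<times> ?V" using e(2) d(2) by (simp add: c(3) mem_Times_iff)
    ultimately show "\<exists>N. open N \<and> snd e p \<in> N \<and> smooth_on N (chart_rep e d fst)"
      by (intro exI[of _ "?U \<times> ?V"] conjI open_Times[OF o])
  qed
  show "smooth_map (prod_atlas A B) B UNIV snd"
  proof (rule smooth_mapI[OF AB open_UNIV continuous_on_snd[OF continuous_on_id]])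
    fix p e d assume e: "e \<in> prod_atlas A B" "p \<in> fst e" and d: "d \<in> B" "snd p \<in> fst d"
    obtain c c' where c: "c \<in> A" "c' \<in> B" "e = (fst c \<times> fst c', map_prod (snd c) (snd c'))"
      using e(1) by (auto simp: prod_atlas_def)
    let ?U = "snd c ` fst c" and ?V = "snd c' ` (fst c' \<inter> fst d)"
    have o: "open ?U" "open ?V"
      using chart_image_open[OF B c(2) open_Int[OF chart_open[OF B c(2)] chart_open[OF B d(1)]]]
        chart_image_open[OF A c(1) chart_open[OF A c(1)]] by auto
    have tr: "smooth_on ?V (snd d \<circ> chart_inv c')" using sB c(2) d(1) unfolding smooth_atlas_def by blast
    have "snd ` (?U \<times> ?V) \<subseteq> ?V" by (rule image_subsetI) (simp only: mem_Times_iff)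
    from smooth_on_compose[OF open_Times[OF o] o(2) this smooth_on_bounded_linear[OF open_Times[OF o] bounded_linear_snd] tr]
    have "smooth_on (?U \<times> ?V) (\<lambda>z. (snd d \<circ> chart_inv c') (snd z))" .
    then have "smooth_on (?U \<times> ?V) (chart_rep e d snd)"
    proof (rule smooth_on_cong[OF open_Times[OF o], rotated])
      fix z assume "z \<in> ?U \<times> ?V"
      then have "fst z \<in> snd c ` fst c" "snd z \<in> snd c' ` fst c'" unfolding mem_Times_iff by blast+
      from prod_chart_inv[OF A c(1) B c(2) this]
      show "(snd d \<circ> chart_inv c') (snd z) = chart_rep e d snd z" by (simp add: c(3))
    qed
    moreover have "snd e p \<in> ?U \<times> ?V" using e(2) d(2) by (simp add: c(3) mem_Times_iff)
    ultimately show "\<exists>N. open N \<and> snd e p \<in> N \<and> smooth_on N (chart_rep e d snd)"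
      by (intro exI[of _ "?U \<times> ?V"] conjI open_Times[OF o])
  qed
qed

subsection \<open>Tangent maps\<close>

text \<open>Differentiability at a single point, which is what the chain rule needs.\<close>

definition differentiable_map_at ::
  "('p::t2_space, 'e::real_normed_vector) chart set \<Rightarrow> ('q::topological_space, 'f::real_normed_vector) chart set \<Rightarrow>
   ('p \<Rightarrow> 'q) \<Rightarrow> 'p \<Rightarrow> bool" where
  "differentiable_map_at A B f p \<longleftrightarrow> isCont f p \<and>
     chart_rep (chart_at A p) (chart_at B (f p)) f differentiable (at (snd (chart_at A p) p))"

lemma tangent_map_has_derivative:
  "differentiable_map_at A B f p \<Longrightarrow>
   (chart_rep (chart_at A p) (chart_at B (f p)) f has_derivative tangent_map A B f p) (at (snd (chart_at A p) p))"
  unfolding differentiable_map_at_def tangent_map_def frechet_derivative_works by blast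

lemma bounded_linear_tangent_map: "differentiable_map_at A B f p \<Longrightarrow> bounded_linear (tangent_map A B f p)"
  by (rule has_derivative_bounded_linear[OF tangent_map_has_derivative])

lemma smooth_map_differentiable:
  assumes A: "topological_atlas A" and B: "topological_atlas B"
    and f: "smooth_map A B X f" and X: "open X" "p \<in> X"
  shows "differentiable_map_at A B f p"
  unfolding differentiable_map_at_def
proof
  show "isCont f p" using smooth_map_continuous[OF f X(1)] X by (simp add: continuous_on_eq_continuous_at)
  let ?c = "chart_at A p"
  obtain T where T: "p \<in> T" "smooth_on (snd ?c ` T) (chart_rep ?c (chart_at B (f p)) f)"
    by (rule smooth_map_localE[OF A B f X chart_at[OF A] chart_at[OF B]]) blast
  show "chart_rep ?c (chart_at B (f p)) f differentiable (at (snd ?c p))"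
    by (rule differentiableI[OF smooth_on_has_derivative[OF T(2)]]) (use T(1) in blast)
qed

lemma eventually_chart_inv:
  assumes A: "topological_atlas A" and c: "c \<in> A" "p \<in> fst c" and P: "\<forall>\<^sub>F x in nhds p. P x"
  shows "\<forall>\<^sub>F x in nhds (snd c p). P (chart_inv c x)"
proof -
  obtain T where T: "open T" "p \<in> T" "\<forall>x\<in>T. P x" using P unfolding eventually_nhds by blast
  have "open (snd c ` (T \<inter> fst c))"
    by (rule chart_image_open[OF A c(1) open_Int[OF T(1) chart_open[OF A c(1)]]]) simp
  moreover have "P (chart_inv c x)" if "x \<in> snd c ` (T \<inter> fst c)" for x
    using that T(3) chart_inv_chart[OF A c(1)] by auto
  ultimately show ?thesis unfolding eventually_nhds using T(2) c(2) by blast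
qed

lemma has_derivative_transform_eventually:
  assumes "(f has_derivative f') (at x)" "\<forall>\<^sub>F y in nhds x. f y = g y"
  shows "(g has_derivative f') (at x)"
proof -
  obtain T where T: "open T" "x \<in> T" "\<And>y. y \<in> T \<Longrightarrow> f y = g y" using assms(2) unfolding eventually_nhds by blast
  show ?thesis by (rule has_derivative_transform_within_open[OF assms(1) T])
qed

lemma differentiable_map_compose:
  fixes A :: "('p::t2_space, 'e::real_normed_vector) chart set"
    and B :: "('q::t2_space, 'f::real_normed_vector) chart set"
    and C :: "('r::topological_space, 'h::real_normed_vector) chart set"
  assumes A: "topological_atlas A" and B: "topological_atlas B"
    and f: "differentiable_map_at A B f p" and g: "differentiable_map_at B C g (f p)"
  shows "differentiable_map_at A C (\<lambda>x. g (f x)) p" (is ?th1)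
    and "tangent_map A C (\<lambda>x. g (f x)) p = (\<lambda>u. tangent_map B C g (f p) (tangent_map A B f p u))" (is ?th2)
proof -
  let ?c = "chart_at A p" and ?b = "chart_at B (f p)" and ?d = "chart_at C (g (f p))"
  note c = chart_at[OF A, of p] and b = chart_at[OF B, of "f p"]
  have "chart_rep ?c ?b f (snd ?c p) = snd ?b (f p)" using chart_inv_chart[OF A c] by simp
  then have "(chart_rep ?b ?d g has_derivative tangent_map B C g (f p)) (at (chart_rep ?c ?b f (snd ?c p)))"
    using tangent_map_has_derivative[OF g] by simp
  from diff_chain_at[OF tangent_map_has_derivative[OF f] this]
  have D: "(chart_rep ?b ?d g \<circ> chart_rep ?c ?b f has_derivative tangent_map B C g (f p) \<circ> tangent_map A B f p) (at (snd ?c p))" .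
  have "\<forall>\<^sub>F x in nhds p. f x \<in> fst ?b"
  proof -
    have "(f \<longlongrightarrow> f p) (nhds p)"
      using f unfolding differentiable_map_at_def isCont_def tendsto_at_iff_tendsto_nhds by blast
    from topological_tendstoD[OF this chart_open[OF B b(1)] b(2)] show ?thesis .
  qed
  from eventually_chart_inv[OF A c this]
  have ev: "\<forall>\<^sub>F x in nhds (snd ?c p). (chart_rep ?b ?d g \<circ> chart_rep ?c ?b f) x = chart_rep ?c ?d (\<lambda>x. g (f x)) x"
    by eventually_elim (simp add: chart_inv_chart[OF B b(1)])
  note D' = has_derivative_transform_eventually[OF D ev]
  have cont: "isCont (\<lambda>x. g (f x)) p"
    using f g unfolding differentiable_map_at_def by (blast intro: isCont_o2)
  show ?th1 unfolding differentiable_map_at_def by (rule conjI[OF cont differentiableI[OF D']])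
  have "tangent_map B C g (f p) \<circ> tangent_map A B f p = tangent_map A C (\<lambda>x. g (f x)) p"
    unfolding tangent_map_def[of A C] by (rule frechet_derivative_at[OF D'])
  then show ?th2 by (simp add: o_def)
qed

lemma differentiable_map_cong:
  assumes A: "topological_atlas A" and f: "differentiable_map_at A B f p" and fg: "\<forall>\<^sub>F x in nhds p. f x = g x"
  shows "differentiable_map_at A B g p" and "tangent_map A B g p = tangent_map A B f p"
proof -
  let ?c = "chart_at A p" and ?d = "chart_at B (f p)"
  note c = chart_at[OF A, of p]
  have p: "f p = g p" using fg by (rule eventually_nhds_x_imp_x)
  have ev: "\<forall>\<^sub>F x in nhds (snd ?c p). chart_rep ?c ?d f x = chart_rep ?c ?d g x"
    using eventually_chart_inv[OF A c fg] by eventually_elim simp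
  note D = has_derivative_transform_eventually[OF tangent_map_has_derivative[OF f] ev]
  have "isCont g p"
    using f fg unfolding differentiable_map_at_def by (simp add: isCont_cong)
  moreover have "chart_rep ?c (chart_at B (g p)) g differentiable (at (snd ?c p))"
    using differentiableI[OF D] unfolding p .
  ultimately show "differentiable_map_at A B g p"
    unfolding differentiable_map_at_def by blast
  show "tangent_map A B g p = tangent_map A B f p"
    unfolding tangent_map_def[of A B g] p[symmetric] by (rule frechet_derivative_at[OF D, symmetric])
qed

lemma tangent_map_ident:
  assumes A: "topological_atlas A"
  shows "tangent_map A A (\<lambda>x. x) p = (\<lambda>u. u)"
proof -
  let ?c = "chart_at A p"
  note c = chart_at[OF A, of p]
  have "\<forall>\<^sub>F x in nhds (snd ?c p). x \<in> snd ?c ` fst ?c"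
    using chart_image_open[OF A c(1) chart_open[OF A c(1)]] c(2) by (intro eventually_nhds_in_open) auto
  then have ev: "\<forall>\<^sub>F x in nhds (snd ?c p). x = chart_rep ?c ?c (\<lambda>x. x) x"
    by eventually_elim (simp add: chart_chart_inv[OF A c(1)])
  show ?thesis unfolding tangent_map_def
    by (rule frechet_derivative_at[OF has_derivative_transform_eventually[OF has_derivative_ident ev], symmetric])
qed

lemma differentiable_map_model:
  fixes f :: "'x::real_normed_vector \<Rightarrow> 'y::real_normed_vector"
  shows "(f has_derivative f') (at p) \<Longrightarrow> differentiable_map_at model_atlas model_atlas f p"
    and "tangent_map model_atlas model_atlas f p = frechet_derivative f (at p)"
  by (auto simp: differentiable_map_at_def tangent_map_def o_def has_derivative_continuous intro: differentiableI)

lemma velocity_compose: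
  assumes B: "topological_atlas B"
    and c: "differentiable_map_at model_atlas A c t" and A: "topological_atlas A" and f: "differentiable_map_at A B f (c t)"
  shows "velocity B (\<lambda>t. f (c t)) t = tangent_map A B f (c t) (velocity A c t)"
  unfolding velocity_def using differentiable_map_compose(2)[OF topological_atlas_model A c f] by simp

section \<open>The symmetry group and its adjoint representation\<close>

context
  fixes S :: "('a::t2_space, 'g::euclidean_space, 'p::t2_space, 'e::banach) ham_system"
  assumes lie: "lie_group S"
begin

interpretation G: group "grp S" using lie by (simp add: lie_group_def)

lemma carrier_grp [simp]: "carrier (grp S) = UNIV"
  using lie by (simp add: lie_group_def)

lemma smooth_atlas_G: "smooth_atlas (atlG S)"
  using lie by (simp add: lie_group_def)

lemma topological_atlas_G: "topological_atlas (atlG S)"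
  by (rule smooth_atlas_topological[OF smooth_atlas_G])

lemma lexp_add: "lexp S ((s + t) *\<^sub>R \<zeta>) = lexp S (s *\<^sub>R \<zeta>) \<otimes>\<^bsub>grp S\<^esub> lexp S (t *\<^sub>R \<zeta>)"
  and smooth_lexp: "smooth_map model_atlas (atlG S) UNIV (\<lambda>t. lexp S (t *\<^sub>R \<zeta>))"
  and velocity_lexp: "velocity (atlG S) (\<lambda>t. lexp S (t *\<^sub>R \<zeta>)) 0 = \<zeta>"
  using lie unfolding lie_group_def by blast+

lemma lexp_zero [simp]: "lexp S 0 = \<one>\<^bsub>grp S\<^esub>"
proof -
  have "lexp S 0 \<otimes>\<^bsub>grp S\<^esub> lexp S 0 = lexp S 0" using lexp_add[of 0 0 0] by simp
  then show ?thesis using G.l_cancel_one[of "lexp S 0" "lexp S 0"] by simp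
qed

lemma lexp_minus: "lexp S (- (t *\<^sub>R \<zeta>)) = inv\<^bsub>grp S\<^esub> lexp S (t *\<^sub>R \<zeta>)"
  using lexp_add[of "- t" t \<zeta>] by (intro G.inv_equality[symmetric]) simp_all

lemma lie_algebra_zero: "\<one>\<^bsub>grp S\<^esub> \<in> H \<Longrightarrow> 0 \<in> lie_algebra S H"
  by (simp add: lie_algebra_def)

lemma smooth_mult: "smooth_map (prod_atlas (atlG S) (atlG S)) (atlG S) UNIV (\<lambda>(g, k). g \<otimes>\<^bsub>grp S\<^esub> k)"
  and smooth_inv: "smooth_map (atlG S) (atlG S) UNIV (\<lambda>g. inv\<^bsub>grp S\<^esub> g)"
  using lie by (simp_all add: lie_group_def)

lemma smooth_map_mult:
  fixes A :: "('q::t2_space, 'f::real_normed_vector) chart set"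
  assumes A: "topological_atlas A"
    and f: "smooth_map A (atlG S) UNIV f" and g: "smooth_map A (atlG S) UNIV g"
  shows "smooth_map A (atlG S) UNIV (\<lambda>x. f x \<otimes>\<^bsub>grp S\<^esub> g x)"
  using smooth_map_compose[OF A topological_atlas_prod[OF topological_atlas_G topological_atlas_G] topological_atlas_G
      smooth_map_Pair[OF A topological_atlas_G topological_atlas_G open_UNIV f g] open_UNIV smooth_mult]
  by simp

lemma smooth_conj_joint:
  "smooth_map (prod_atlas (atlG S) (atlG S)) (atlG S) UNIV (\<lambda>z. fst z \<otimes>\<^bsub>grp S\<^esub> snd z \<otimes>\<^bsub>grp S\<^esub> inv\<^bsub>grp S\<^esub> (fst z))"
proof -
  note P = topological_atlas_prod[OF topological_atlas_G topological_atlas_G]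
  note F = smooth_map_fst[OF smooth_atlas_G smooth_atlas_G]
  show ?thesis
    by (rule smooth_map_mult[OF P smooth_map_mult[OF P F]
          smooth_map_compose[OF P topological_atlas_G topological_atlas_G F(1) open_UNIV smooth_inv]])
qed

lemma smooth_conj: "smooth_map (atlG S) (atlG S) UNIV (\<lambda>x. g \<otimes>\<^bsub>grp S\<^esub> x \<otimes>\<^bsub>grp S\<^esub> inv\<^bsub>grp S\<^esub> g)"
  by (rule smooth_map_mult[OF topological_atlas_G smooth_map_mult[OF topological_atlas_G
        smooth_map_const[OF topological_atlas_G open_UNIV] smooth_map_ident[OF smooth_atlas_G]]
        smooth_map_const[OF topological_atlas_G open_UNIV]])

lemma differentiable_conj:
  "differentiable_map_at (atlG S) (atlG S) (\<lambda>x. g \<otimes>\<^bsub>grp S\<^esub> x \<otimes>\<^bsub>grp S\<^esub> inv\<^bsub>grp S\<^esub> g) h"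
  by (rule smooth_map_differentiable[OF topological_atlas_G topological_atlas_G smooth_conj open_UNIV UNIV_I])

lemma differentiable_lexp: "differentiable_map_at model_atlas (atlG S) (\<lambda>t. lexp S (t *\<^sub>R \<zeta>)) t"
  by (rule smooth_map_differentiable[OF topological_atlas_model topological_atlas_G smooth_lexp open_UNIV UNIV_I])

lemma bounded_linear_Ad: "bounded_linear (Ad S g)"
  unfolding Ad_def by (rule bounded_linear_tangent_map[OF differentiable_conj])

lemma Ad_one [simp]: "Ad S \<one>\<^bsub>grp S\<^esub> = (\<lambda>\<zeta>. \<zeta>)"
  unfolding Ad_def using tangent_map_ident[OF topological_atlas_G] by simp

lemma Ad_mult: "Ad S (g \<otimes>\<^bsub>grp S\<^esub> k) \<zeta> = Ad S g (Ad S k \<zeta>)"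
proof -
  have eq: "g \<otimes>\<^bsub>grp S\<^esub> k \<otimes>\<^bsub>grp S\<^esub> x \<otimes>\<^bsub>grp S\<^esub> inv\<^bsub>grp S\<^esub> (g \<otimes>\<^bsub>grp S\<^esub> k) =
      g \<otimes>\<^bsub>grp S\<^esub> (k \<otimes>\<^bsub>grp S\<^esub> x \<otimes>\<^bsub>grp S\<^esub> inv\<^bsub>grp S\<^esub> k) \<otimes>\<^bsub>grp S\<^esub> inv\<^bsub>grp S\<^esub> g" for x
    by (simp add: G.inv_mult_group G.m_assoc)
  have one: "k \<otimes>\<^bsub>grp S\<^esub> \<one>\<^bsub>grp S\<^esub> \<otimes>\<^bsub>grp S\<^esub> inv\<^bsub>grp S\<^esub> k = \<one>\<^bsub>grp S\<^esub>" by simp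
  show ?thesis
    unfolding Ad_def eq
    using differentiable_map_compose(2)[OF topological_atlas_G topological_atlas_G
        differentiable_conj[of k] differentiable_conj[of g], of "\<one>\<^bsub>grp S\<^esub>"] unfolding one by simp
qed

lemma Ad_inv [simp]: "Ad S (inv\<^bsub>grp S\<^esub> g) (Ad S g \<zeta>) = \<zeta>" "Ad S g (Ad S (inv\<^bsub>grp S\<^esub> g) \<zeta>) = \<zeta>"
  by (simp_all flip: Ad_mult)

lemma velocity_conj_lexp:
  "velocity (atlG S) (\<lambda>t. g \<otimes>\<^bsub>grp S\<^esub> lexp S (t *\<^sub>R \<zeta>) \<otimes>\<^bsub>grp S\<^esub> inv\<^bsub>grp S\<^esub> g) 0 = Ad S g \<zeta>"
  using velocity_compose[OF topological_atlas_G differentiable_lexp[of \<zeta> 0] topological_atlas_G differentiable_conj[of g]]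
  by (simp add: velocity_lexp Ad_def)

text \<open>A one-parameter group is commutative, so conjugation by its elements fixes it pointwise.\<close>

lemma Ad_lexp_self: "Ad S (lexp S (t *\<^sub>R \<zeta>)) \<zeta> = \<zeta>"
proof -
  have "lexp S (t *\<^sub>R \<zeta>) \<otimes>\<^bsub>grp S\<^esub> lexp S (s *\<^sub>R \<zeta>) \<otimes>\<^bsub>grp S\<^esub> inv\<^bsub>grp S\<^esub> lexp S (t *\<^sub>R \<zeta>) = lexp S (s *\<^sub>R \<zeta>)" for s
    using lexp_add[of t s \<zeta>] lexp_add[of "t + s" "- t" \<zeta>] by (simp add: lexp_minus)
  then show ?thesis using velocity_conj_lexp[of "lexp S (t *\<^sub>R \<zeta>)" \<zeta>] by (simp add: velocity_lexp)
qed

text \<open>In a chart at the identity, the adjoint representation is a partial derivative of conjugation, a smooth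
  map of two variables, and therefore depends smoothly on the group element.\<close>

lemma Ad_differentiable: "differentiable_map_at (atlG S) model_atlas (\<lambda>g. Ad S g \<eta>) \<one>\<^bsub>grp S\<^esub>"
proof -
  define c where "c = chart_at (atlG S) \<one>\<^bsub>grp S\<^esub>"
  define x0 where "x0 = snd c \<one>\<^bsub>grp S\<^esub>"
  have c: "c \<in> atlG S" "\<one>\<^bsub>grp S\<^esub> \<in> fst c" unfolding c_def by (rule chart_at[OF topological_atlas_G])+
  note GG = topological_atlas_prod[OF topological_atlas_G topological_atlas_G]
  let ?cc = "(fst c \<times> fst c, map_prod (snd c) (snd c))"
  let ?m = "\<lambda>z. fst z \<otimes>\<^bsub>grp S\<^esub> snd z \<otimes>\<^bsub>grp S\<^esub> inv\<^bsub>grp S\<^esub> (fst z)"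
  have cc: "?cc \<in> prod_atlas (atlG S) (atlG S)" unfolding prod_atlas_def using c(1)
    by (intro image_eqI[where x = "(c, c)"]) simp_all
  have oneoncc: "(\<one>\<^bsub>grp S\<^esub>, \<one>\<^bsub>grp S\<^esub>) \<in> fst ?cc" using c(2) by simp
  have mone: "?m (\<one>\<^bsub>grp S\<^esub>, \<one>\<^bsub>grp S\<^esub>) \<in> fst c" using c(2) by simp
  obtain T where T: "(\<one>\<^bsub>grp S\<^esub>, \<one>\<^bsub>grp S\<^esub>) \<in> T" "T \<subseteq> fst ?cc" "open (snd ?cc ` T)"
    "smooth_on (snd ?cc ` T) (chart_rep ?cc c ?m)"
    by (rule smooth_map_localE[OF GG topological_atlas_G smooth_conj_joint open_UNIV UNIV_I cc oneoncc c(1) mone]) blast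
  define N where "N = snd ?cc ` T"
  define F where "F = chart_rep ?cc c ?m"
  have N: "open N" "(x0, x0) \<in> N" "smooth_on N F" using T by (force simp: N_def F_def x0_def)+
  have NF: "F (x, y) = snd c (chart_inv c x \<otimes>\<^bsub>grp S\<^esub> chart_inv c y \<otimes>\<^bsub>grp S\<^esub> inv\<^bsub>grp S\<^esub> (chart_inv c x))" if "(x, y) \<in> N" for x y
  proof -
    have "x \<in> snd c ` fst c" "y \<in> snd c ` fst c" using that T(2) by (auto simp: N_def)
    from prod_chart_inv[OF topological_atlas_G c(1) topological_atlas_G c(1) this] show ?thesis
      by (simp add: F_def)
  qed
  \<comment> \<open>Differentiate in the second variable at the coordinates of the identity.\<close>
  define U where "U = {x. (x, x0) \<in> N}"
  have "open ((\<lambda>x. (x, x0)) -` N)" by (rule open_vimage[OF N(1)]) (intro continuous_intros)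
  then have U: "open U" "x0 \<in> U" using N(2) by (simp_all add: U_def vimage_def)
  have AdF: "Ad S (chart_inv c x) \<eta> = frechet_derivative F (at (x, x0)) (0, \<eta>)" if x: "x \<in> U" for x
  proof -
    let ?g = "chart_inv c x"
    have xo: "(x, x0) \<in> N" using x by (simp add: U_def)
    have A: "((\<lambda>y. (x, y)) has_derivative (\<lambda>h. (0, h))) (at x0)" by (auto intro!: derivative_eq_intros)
    from diff_chain_at[OF A smooth_on_has_derivative[OF N(3) xo]]
    have D: "(F \<circ> (\<lambda>y. (x, y)) has_derivative frechet_derivative F (at (x, x0)) \<circ> (\<lambda>h. (0, h))) (at x0)" .
    have "open ((\<lambda>y. (x, y)) -` N)" by (rule open_vimage[OF N(1)]) (intro continuous_intros)
    then have ev: "\<forall>\<^sub>F y in nhds x0. y \<in> (\<lambda>y. (x, y)) -` N" using xo by (intro eventually_nhds_in_open) auto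
    have "\<forall>\<^sub>F y in nhds x0. (F \<circ> (\<lambda>y. (x, y))) y = chart_rep c c (\<lambda>k. ?g \<otimes>\<^bsub>grp S\<^esub> k \<otimes>\<^bsub>grp S\<^esub> inv\<^bsub>grp S\<^esub> ?g) y"
      using ev by eventually_elim (simp add: NF)
    from fun_cong[OF frechet_derivative_at[OF has_derivative_transform_eventually[OF D this]], of \<eta>]
    have eq: "frechet_derivative F (at (x, x0)) (0, \<eta>) =
      frechet_derivative (chart_rep c c (\<lambda>k. ?g \<otimes>\<^bsub>grp S\<^esub> k \<otimes>\<^bsub>grp S\<^esub> inv\<^bsub>grp S\<^esub> ?g)) (at x0) \<eta>"
      by (simp only: comp_def)
    have "?g \<otimes>\<^bsub>grp S\<^esub> \<one>\<^bsub>grp S\<^esub> \<otimes>\<^bsub>grp S\<^esub> inv\<^bsub>grp S\<^esub> ?g = \<one>\<^bsub>grp S\<^esub>" by simp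
    then show ?thesis unfolding Ad_def tangent_map_def eq by (simp only: c_def x0_def)
  qed
  have "smooth_on U (\<lambda>x. frechet_derivative F (at (x, x0)) (0, \<eta>))"
    by (rule smooth_on_compose[OF U(1) N(1) _ smooth_on_Pair[OF U(1) smooth_on_bounded_linear[OF U(1) bounded_linear_ident] smooth_on_const]
          smooth_on_deriv[OF N(3)]]) (auto simp: U_def)
  from smooth_on_has_derivative[OF this U(2)]
  have "((\<lambda>x. frechet_derivative F (at (x, x0)) (0, \<eta>)) has_derivative
     frechet_derivative (\<lambda>x. frechet_derivative F (at (x, x0)) (0, \<eta>)) (at x0)) (at x0)" .
  then have D: "((\<lambda>x. Ad S (chart_inv c x) \<eta>) has_derivative
     frechet_derivative (\<lambda>x. frechet_derivative F (at (x, x0)) (0, \<eta>)) (at x0)) (at x0)"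
    by (rule has_derivative_transform_within_open[OF _ U]) (simp only: AdF)
  have cont: "isCont (\<lambda>g. Ad S g \<eta>) \<one>\<^bsub>grp S\<^esub>"
  proof -
    have "isCont (snd c) \<one>\<^bsub>grp S\<^esub>"
      using chart_continuous[OF topological_atlas_G c(1)] chart_open[OF topological_atlas_G c(1)] c(2)
      by (simp add: continuous_on_eq_continuous_at)
    then have ct: "isCont (\<lambda>g. Ad S (chart_inv c (snd c g)) \<eta>) \<one>\<^bsub>grp S\<^esub>"
      using has_derivative_continuous[OF D] unfolding x0_def by (rule isCont_o2)
    have "\<forall>\<^sub>F g in nhds \<one>\<^bsub>grp S\<^esub>. Ad S (chart_inv c (snd c g)) \<eta> = Ad S g \<eta>"
      using eventually_nhds_in_open[OF chart_open[OF topological_atlas_G c(1)] c(2)]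
      by eventually_elim (simp add: chart_inv_chart[OF topological_atlas_G c(1)])
    from iffD1[OF isCont_cong[OF this] ct] show ?thesis .
  qed
  show ?thesis
    unfolding differentiable_map_at_def comp_def chart_at_model snd_conv c_def[symmetric] x0_def[symmetric]
    by (rule conjI[OF cont differentiableI[OF D]])
qed

lemma Ad_lexp_has_derivative:
  "((\<lambda>t. Ad S (lexp S (t *\<^sub>R \<zeta>)) \<eta>) has_derivative (\<lambda>h. h *\<^sub>R bracket S \<zeta> \<eta>)) (at 0)"
  (is "(?f has_derivative _) _")
  and Ad_conj_lexp_derivative:
  "((\<lambda>t. Ad S (g \<otimes>\<^bsub>grp S\<^esub> lexp S (t *\<^sub>R \<zeta>) \<otimes>\<^bsub>grp S\<^esub> inv\<^bsub>grp S\<^esub> g) \<eta>) has_derivative (\<lambda>h. h *\<^sub>R bracket S (Ad S g \<zeta>) \<eta>)) (at 0)"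
proof -
  have main: "((\<lambda>t. Ad S (c t) \<eta>) has_derivative (\<lambda>h. h *\<^sub>R bracket S w \<eta>)) (at 0)"
    if c: "differentiable_map_at model_atlas (atlG S) c 0" and c0: "c 0 = \<one>\<^bsub>grp S\<^esub>" and w: "velocity (atlG S) c 0 = w" for c w
  proof -
    have d: "differentiable_map_at (atlG S) model_atlas (\<lambda>g. Ad S g \<eta>) (c 0)" unfolding c0 by (rule Ad_differentiable)
    note C = differentiable_map_compose[OF topological_atlas_model topological_atlas_G c d]
    have D: "((\<lambda>t. Ad S (c t) \<eta>) has_derivative tangent_map model_atlas model_atlas (\<lambda>t. Ad S (c t) \<eta>) 0) (at 0)"
      using tangent_map_has_derivative[OF C(1)] by (simp add: comp_def)
    have "tangent_map model_atlas model_atlas (\<lambda>t. Ad S (c t) \<eta>) 0 1 = bracket S w \<eta>"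
      unfolding C(2) using w by (simp add: velocity_def bracket_def c0)
    then have "tangent_map model_atlas model_atlas (\<lambda>t. Ad S (c t) \<eta>) 0 h = h *\<^sub>R bracket S w \<eta>" for h
      using linear_scale[OF has_derivative_linear[OF D], of h 1] by simp
    then have "tangent_map model_atlas model_atlas (\<lambda>t. Ad S (c t) \<eta>) 0 = (\<lambda>h. h *\<^sub>R bracket S w \<eta>)" by blast
    then show ?thesis using D by (simp only:)
  qed
  show "(?f has_derivative (\<lambda>h. h *\<^sub>R bracket S \<zeta> \<eta>)) (at 0)"
    by (rule main[OF differentiable_lexp _ velocity_lexp]) simp
  show "((\<lambda>t. Ad S (g \<otimes>\<^bsub>grp S\<^esub> lexp S (t *\<^sub>R \<zeta>) \<otimes>\<^bsub>grp S\<^esub> inv\<^bsub>grp S\<^esub> g) \<eta>) has_derivative (\<lambda>h. h *\<^sub>R bracket S (Ad S g \<zeta>) \<eta>)) (at 0)"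
    by (rule main[OF differentiable_map_compose(1)[OF topological_atlas_model topological_atlas_G differentiable_lexp differentiable_conj] _ velocity_conj_lexp]) simp
qed

lemma bounded_linear_bracket: "bounded_linear (bracket S \<zeta>)"
proof -
  have "bounded_linear (\<lambda>u. 1 *\<^sub>R bracket S \<zeta> u)"
    by (rule bounded_linear_derivative_family[OF _ Ad_lexp_has_derivative])
      (simp add: bounded_linear_Ad)
  then show ?thesis by simp
qed

lemma bracket_Ad: "bracket S (Ad S g \<zeta>) (Ad S g \<eta>) = Ad S g (bracket S \<zeta> \<eta>)"
proof -
  have "((\<lambda>t. Ad S g (Ad S (lexp S (t *\<^sub>R \<zeta>)) \<eta>)) has_derivative (\<lambda>h. Ad S g (h *\<^sub>R bracket S \<zeta> \<eta>))) (at 0)"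
    by (rule bounded_linear.has_derivative[OF bounded_linear_Ad Ad_lexp_has_derivative])
  moreover have "(\<lambda>t. Ad S (g \<otimes>\<^bsub>grp S\<^esub> lexp S (t *\<^sub>R \<zeta>) \<otimes>\<^bsub>grp S\<^esub> inv\<^bsub>grp S\<^esub> g) (Ad S g \<eta>)) =
      (\<lambda>t. Ad S g (Ad S (lexp S (t *\<^sub>R \<zeta>)) \<eta>))"
    by (simp add: Ad_mult)
  ultimately have "(\<lambda>h. h *\<^sub>R bracket S (Ad S g \<zeta>) (Ad S g \<eta>)) = (\<lambda>h. Ad S g (h *\<^sub>R bracket S \<zeta> \<eta>))"
    using has_derivative_unique[OF Ad_conj_lexp_derivative[of g \<zeta> "Ad S g \<eta>"]] by simp
  from fun_cong[OF this, of 1] show ?thesis by simp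
qed

lemma coAd_apply: "blinfun_apply (coAd S g \<nu>) \<eta> = blinfun_apply \<nu> (Ad S (inv\<^bsub>grp S\<^esub> g) \<eta>)"
  unfolding coAd_def
  by (subst bounded_linear_Blinfun_apply) (auto intro: bounded_linear_compose[OF blinfun.bounded_linear_right bounded_linear_Ad])

lemma coad_apply: "blinfun_apply (coad S \<zeta> \<nu>) \<eta> = blinfun_apply \<nu> (bracket S \<zeta> \<eta>)"
  unfolding coad_def
  by (subst bounded_linear_Blinfun_apply) (auto intro: bounded_linear_compose[OF blinfun.bounded_linear_right bounded_linear_bracket])

lemma coad_coAd: "coad S (Ad S g \<zeta>) (coAd S g \<nu>) = coAd S g (coad S \<zeta> \<nu>)"
proof (rule blinfun_eqI)
  fix \<eta>
  have "bracket S \<zeta> (Ad S (inv\<^bsub>grp S\<^esub> g) \<eta>) = Ad S (inv\<^bsub>grp S\<^esub> g) (bracket S (Ad S g \<zeta>) \<eta>)"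
    by (simp flip: bracket_Ad)
  then show "blinfun_apply (coad S (Ad S g \<zeta>) (coAd S g \<nu>)) \<eta> = blinfun_apply (coAd S g (coad S \<zeta> \<nu>)) \<eta>"
    by (simp add: coad_apply coAd_apply)
qed

text \<open>The homomorphism property carries continuity from the identity to every group element.\<close>

lemma isCont_Ad: "isCont (\<lambda>g. Ad S g \<eta>) g0"
proof -
  have "smooth_map (atlG S) (atlG S) UNIV (\<lambda>g. g \<otimes>\<^bsub>grp S\<^esub> inv\<^bsub>grp S\<^esub> g0)"
    by (rule smooth_map_mult[OF topological_atlas_G smooth_map_ident[OF smooth_atlas_G] smooth_map_const[OF topological_atlas_G open_UNIV]])
  from smooth_map_continuous[OF this open_UNIV]
  have "isCont (\<lambda>g. g \<otimes>\<^bsub>grp S\<^esub> inv\<^bsub>grp S\<^esub> g0) g0" by (simp add: continuous_on_eq_continuous_at)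
  moreover have "isCont (\<lambda>g. Ad S g (Ad S g0 \<eta>)) (g0 \<otimes>\<^bsub>grp S\<^esub> inv\<^bsub>grp S\<^esub> g0)"
    using Ad_differentiable by (simp add: differentiable_map_at_def)
  ultimately have "isCont (\<lambda>g. Ad S (g \<otimes>\<^bsub>grp S\<^esub> inv\<^bsub>grp S\<^esub> g0) (Ad S g0 \<eta>)) g0" by (rule isCont_o2)
  then show ?thesis by (simp add: Ad_mult)
qed

end

section \<open>Relative equilibria as critical points\<close>

context
  fixes S :: "('a::t2_space, 'g::euclidean_space, 'p::t2_space, 'e::banach) ham_system"
  assumes system: "hamiltonian_G_system S"
begin

lemma lie: "lie_group S" using system by (simp add: hamiltonian_G_system_def)

interpretation G: group "grp S" using lie by (simp add: lie_group_def)

lemmas carrier_G [simp] = carrier_grp[OF lie]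
lemmas atlas_G = topological_atlas_G[OF lie]

lemma smooth_atlas_M: "smooth_atlas (atlM S)"
  using system by (simp add: hamiltonian_G_system_def symplectic_manifold_def)

lemma atlas_M: "topological_atlas (atlM S)"
  by (rule smooth_atlas_topological[OF smooth_atlas_M])

lemma group_action_act: "group_action (grp S) UNIV (act S)"
  using system by (simp add: hamiltonian_G_system_def)

lemma act_one [simp]: "act S \<one>\<^bsub>grp S\<^esub> p = p"
  using group_action.id_eq_one[OF group_action_act] by (metis UNIV_I restrict_apply')

lemma act_mult: "act S (g \<otimes>\<^bsub>grp S\<^esub> k) p = act S g (act S k p)"
  using group_action.composition_rule[OF group_action_act, of p g k] by simp

lemma act_inv [simp]: "act S (inv\<^bsub>grp S\<^esub> g) (act S g p) = p" "act S g (act S (inv\<^bsub>grp S\<^esub> g) p) = p"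
  by (simp_all flip: act_mult)

lemma smooth_act_joint: "smooth_map (prod_atlas (atlG S) (atlM S)) (atlM S) UNIV (\<lambda>(g, p). act S g p)"
  and smooth_mom: "smooth_map (atlM S) model_atlas UNIV (mom S)"
  and smooth_ham: "smooth_map (atlM S) model_atlas UNIV (ham S)"
  and mom_form: "dM S (\<lambda>m. mom S m \<zeta>) p u = form S p (inf_gen S \<zeta> p) u"
  and mom_act: "mom S (act S g p) = coAd S g (mom S p)"
  and ham_act: "ham S (act S g p) = ham S p"
  using system unfolding hamiltonian_G_system_def by blast+

lemma form_antisym: "form S p u w = - form S p w u"
proof -
  have "symplectic_manifold S" using system by (simp add: hamiltonian_G_system_def)
  then have "\<forall>p. bounded_bilinear (form S p) \<and> (\<forall>u w. form S p u w = - form S p w u) \<and>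
      (\<forall>u. (\<forall>w. form S p u w = 0) \<longrightarrow> u = 0)"
    unfolding symplectic_manifold_def by (elim conjE)
  then show ?thesis by meson
qed

lemma smooth_map_act:
  fixes A :: "('q::t2_space, 'f::real_normed_vector) chart set"
  assumes A: "topological_atlas A" and f: "smooth_map A (atlG S) UNIV f" and g: "smooth_map A (atlM S) UNIV g"
  shows "smooth_map A (atlM S) UNIV (\<lambda>x. act S (f x) (g x))"
  using smooth_map_compose[OF A topological_atlas_prod[OF atlas_G atlas_M] atlas_M
      smooth_map_Pair[OF A atlas_G atlas_M open_UNIV f g] open_UNIV smooth_act_joint]
  by simp

lemma smooth_act: "smooth_map (atlM S) (atlM S) UNIV (act S g)"
  using smooth_map_act[OF atlas_M smooth_map_const[OF atlas_M open_UNIV] smooth_map_ident[OF smooth_atlas_M], of g] .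

lemma smooth_orbit: "smooth_map model_atlas (atlM S) UNIV (\<lambda>t. act S (lexp S (t *\<^sub>R \<zeta>)) p)"
  by (rule smooth_map_act[OF topological_atlas_model smooth_lexp[OF lie] smooth_map_const[OF topological_atlas_model open_UNIV]])

lemma differentiable_act: "differentiable_map_at (atlM S) (atlM S) (act S g) p"
  by (rule smooth_map_differentiable[OF atlas_M atlas_M smooth_act open_UNIV UNIV_I])

lemma differentiable_orbit: "differentiable_map_at model_atlas (atlM S) (\<lambda>t. act S (lexp S (t *\<^sub>R \<zeta>)) p) t"
  by (rule smooth_map_differentiable[OF topological_atlas_model atlas_M smooth_orbit open_UNIV UNIV_I])

lemma differentiable_ham: "differentiable_map_at (atlM S) model_atlas (ham S) p"
  by (rule smooth_map_differentiable[OF atlas_M topological_atlas_model smooth_ham open_UNIV UNIV_I])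

lemma smooth_mom_component: "smooth_map (atlM S) model_atlas UNIV (\<lambda>m. mom S m \<zeta>)"
proof -
  have "smooth_map model_atlas model_atlas UNIV (\<lambda>\<nu>::'g \<Rightarrow>\<^sub>L real. \<nu> \<zeta>)"
    unfolding smooth_map_model_iff[OF open_UNIV]
    by (rule smooth_on_bounded_linear[OF open_UNIV blinfun.bounded_linear_left])
  from smooth_map_compose[OF atlas_M topological_atlas_model topological_atlas_model smooth_mom open_UNIV this]
  show ?thesis .
qed

lemma differentiable_mom_component: "differentiable_map_at (atlM S) model_atlas (\<lambda>m. mom S m \<zeta>) p"
  by (rule smooth_map_differentiable[OF atlas_M topological_atlas_model smooth_mom_component open_UNIV UNIV_I])

lemma dM_augmented:
  shows "differentiable_map_at (atlM S) model_atlas (augmented S \<zeta>) p"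
    and "dM S (augmented S \<zeta>) p u = dM S (ham S) p u - dM S (\<lambda>m. mom S m \<zeta>) p u"
proof -
  let ?c = "chart_at (atlM S) p" and ?i = "(UNIV, \<lambda>x. x)"
  have "(chart_rep ?c ?i (ham S) has_derivative dM S (ham S) p) (at (snd ?c p))"
    "(chart_rep ?c ?i (\<lambda>m. mom S m \<zeta>) has_derivative dM S (\<lambda>m. mom S m \<zeta>) p) (at (snd ?c p))"
    using tangent_map_has_derivative[OF differentiable_ham[of p]] tangent_map_has_derivative[OF differentiable_mom_component[of \<zeta> p]]
    by (simp_all add: dM_def)
  from has_derivative_diff[OF this]
  have D: "(chart_rep ?c ?i (augmented S \<zeta>) has_derivative (\<lambda>u. dM S (ham S) p u - dM S (\<lambda>m. mom S m \<zeta>) p u)) (at (snd ?c p))"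
    by (simp add: augmented_def comp_def)
  have "isCont (augmented S \<zeta>) p"
    using differentiable_ham[of p] differentiable_mom_component[of \<zeta> p]
    unfolding differentiable_map_at_def augmented_def[abs_def] by (intro continuous_diff) auto
  then show "differentiable_map_at (atlM S) model_atlas (augmented S \<zeta>) p"
    unfolding differentiable_map_at_def chart_at_model by (rule conjI[OF _ differentiableI[OF D]])
  show "dM S (augmented S \<zeta>) p u = dM S (ham S) p u - dM S (\<lambda>m. mom S m \<zeta>) p u"
    unfolding dM_def[of S "augmented S \<zeta>"] tangent_map_def chart_at_model
    using fun_cong[OF frechet_derivative_at[OF D], of u] by simp
qed

lemma dM_inf_gen:
  assumes f: "differentiable_map_at (atlM S) model_atlas f p"
    and D: "((\<lambda>t. f (act S (lexp S (t *\<^sub>R \<zeta>)) p)) has_derivative D) (at 0)"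
  shows "dM S f p (inf_gen S \<zeta> p) = D 1"
proof -
  let ?c = "\<lambda>t. act S (lexp S (t *\<^sub>R \<zeta>)) p"
  have c0: "?c 0 = p" using lexp_zero[OF lie] by simp
  have "velocity model_atlas (\<lambda>t. f (?c t)) 0 = tangent_map (atlM S) model_atlas f (?c 0) (velocity (atlM S) ?c 0)"
    by (rule velocity_compose[OF topological_atlas_model differentiable_orbit atlas_M]) (simp only: c0 f)
  then show ?thesis
    unfolding c0 by (simp add: dM_def inf_gen_def velocity_def differentiable_map_model(2) flip: frechet_derivative_at[OF D])
qed

lemma dM_ham_inf_gen: "dM S (ham S) p (inf_gen S \<zeta> p) = 0"
  using dM_inf_gen[OF differentiable_ham, of \<zeta> p "\<lambda>_. 0"] by (simp add: ham_act)

text \<open>Equivariance gives the derivative of the momentum map along an orbit; the antisymmetry of the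
  form exchanges the two generators.\<close>

lemma dM_mom_inf_gen: "dM S (\<lambda>m. mom S m \<zeta>) p (inf_gen S \<theta> p) = coad S \<zeta> (mom S p) \<theta>"
proof -
  have m: "mom S (act S (lexp S (t *\<^sub>R \<zeta>)) p) \<theta> = mom S p (Ad S (lexp S ((-t) *\<^sub>R \<zeta>)) \<theta>)" for t
    by (simp add: mom_act coAd_apply[OF lie] lexp_minus[OF lie])
  have "((\<lambda>t::real. - t) has_derivative (\<lambda>h. - h)) (at 0)" by (auto intro!: derivative_eq_intros)
  moreover have "((\<lambda>t. Ad S (lexp S (t *\<^sub>R \<zeta>)) \<theta>) has_derivative (\<lambda>h. h *\<^sub>R bracket S \<zeta> \<theta>)) (at (- 0))"
    using Ad_lexp_has_derivative[OF lie] by simp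
  ultimately have "((\<lambda>t. Ad S (lexp S (t *\<^sub>R \<zeta>)) \<theta>) \<circ> (\<lambda>t. - t) has_derivative (\<lambda>h. h *\<^sub>R bracket S \<zeta> \<theta>) \<circ> (\<lambda>h. - h)) (at 0)"
    by (rule diff_chain_at)
  from bounded_linear.has_derivative[OF blinfun.bounded_linear_right this]
  have "((\<lambda>t. mom S (act S (lexp S (t *\<^sub>R \<zeta>)) p) \<theta>) has_derivative (\<lambda>h. mom S p ((- h) *\<^sub>R bracket S \<zeta> \<theta>))) (at 0)"
    by (simp only: m comp_def)
  from dM_inf_gen[OF differentiable_mom_component this]
  have "dM S (\<lambda>m. mom S m \<theta>) p (inf_gen S \<zeta> p) = - mom S p (bracket S \<zeta> \<theta>)"
    by (simp add: blinfun.minus_right)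
  then show ?thesis
    using form_antisym[of p "inf_gen S \<zeta> p" "inf_gen S \<theta> p"] by (simp add: mom_form coad_apply[OF lie])
qed

lemma velocity_orbit: "velocity (atlM S) (\<lambda>t. act S (lexp S (t *\<^sub>R \<zeta>)) p) t = inf_gen S \<zeta> (act S (lexp S (t *\<^sub>R \<zeta>)) p)"
proof -
  let ?c = "\<lambda>t. act S (lexp S (t *\<^sub>R \<zeta>)) p"
  have sh: "((\<lambda>s. s + t) has_derivative (\<lambda>h. h)) (at (0::real))" by (auto intro!: derivative_eq_intros)
  have "velocity (atlM S) (\<lambda>s. ?c (s + t)) 0 = tangent_map model_atlas (atlM S) ?c (0 + t) (velocity model_atlas (\<lambda>s. s + t) 0)"
    by (rule velocity_compose[OF atlas_M differentiable_map_model(1)[OF sh] topological_atlas_model]) (rule differentiable_orbit)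
  also have "velocity model_atlas (\<lambda>s. s + t) 0 = 1"
    by (simp add: velocity_def differentiable_map_model(2) flip: frechet_derivative_at[OF sh])
  finally have "velocity (atlM S) ?c t = velocity (atlM S) (\<lambda>s. ?c (s + t)) 0" by (simp add: velocity_def)
  also have "(\<lambda>s. ?c (s + t)) = (\<lambda>s. act S (lexp S (s *\<^sub>R \<zeta>)) (?c t))"
    by (simp only: lexp_add[OF lie] act_mult)
  finally show ?thesis by (simp only: inf_gen_def)
qed

text \<open>Criticality is transported along the orbit, because a generator is fixed by its own
  one-parameter group.\<close>

lemma critical_along_orbit:
  assumes crit: "\<And>u. dM S (augmented S \<zeta>) p u = 0"
  shows "dM S (augmented S \<zeta>) (act S (lexp S (t *\<^sub>R \<zeta>)) p) u = 0"
proof -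
  let ?g = "lexp S (t *\<^sub>R \<zeta>)" and ?h = "lexp S ((-t) *\<^sub>R \<zeta>)"
  have inv: "?h = inv\<^bsub>grp S\<^esub> ?g" by (simp add: lexp_minus[OF lie])
  have "augmented S \<zeta> (act S ?h m) = augmented S \<zeta> m" for m
  proof -
    have "Ad S (inv\<^bsub>grp S\<^esub> ?h) \<zeta> = \<zeta>" unfolding inv using Ad_lexp_self[OF lie, of t \<zeta>] by simp
    then show ?thesis by (simp add: augmented_def ham_act mom_act coAd_apply[OF lie])
  qed
  then have "dM S (augmented S \<zeta>) (act S ?g p) = tangent_map (atlM S) model_atlas (\<lambda>m. augmented S \<zeta> (act S ?h m)) (act S ?g p)"
    by (simp add: dM_def)
  also have "\<dots> = (\<lambda>u. tangent_map (atlM S) model_atlas (augmented S \<zeta>) (act S ?h (act S ?g p))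
      (tangent_map (atlM S) (atlM S) (act S ?h) (act S ?g p) u))"
    by (rule differentiable_map_compose(2)[OF atlas_M atlas_M differentiable_act dM_augmented(1)])
  also have "\<dots> = (\<lambda>u. 0)"
  proof -
    have "act S ?h (act S ?g p) = p" unfolding inv by (rule act_inv(1))
    then show ?thesis using crit by (simp only: dM_def)
  qed
  finally show ?thesis by (rule fun_cong)
qed

text \<open>At time zero the equation of motion says that the generator and the Hamiltonian have the same pairing
  with all tangent vectors, which is criticality. Conversely criticality propagates along the orbit of
  the one-parameter group, so this orbit is an integral curve.\<close>

theorem relative_equilibrium_iff_critical:
  "relative_equilibrium S p \<zeta> \<longleftrightarrow> (\<forall>u. dM S (augmented S \<zeta>) p u = 0)"
proof
  assume "relative_equilibrium S p \<zeta>"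
  then obtain c where c: "motion S c" "\<forall>t. c t = act S (lexp S (t *\<^sub>R \<zeta>)) p"
    unfolding relative_equilibrium_def by blast
  then have c': "c = (\<lambda>t. act S (lexp S (t *\<^sub>R \<zeta>)) p)" by blast
  have "ham_vector S (c 0) (velocity (atlM S) c 0)" using c(1) by (simp add: motion_def)
  then have "ham_vector S p (inf_gen S \<zeta> p)"
    unfolding c' velocity_orbit using lexp_zero[OF lie] by simp
  then show "\<forall>u. dM S (augmented S \<zeta>) p u = 0"
    by (simp add: ham_vector_def dM_augmented(2) mom_form)
next
  assume crit: "\<forall>u. dM S (augmented S \<zeta>) p u = 0"
  let ?c = "\<lambda>t. act S (lexp S (t *\<^sub>R \<zeta>)) p"
  have "motion S ?c"
    unfolding motion_def velocity_orbit ham_vector_def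
    using smooth_orbit critical_along_orbit[of \<zeta> p] crit by (simp add: dM_augmented(2) mom_form)
  moreover have "?c 0 = p" using lexp_zero[OF lie] by simp
  ultimately show "relative_equilibrium S p \<zeta>" unfolding relative_equilibrium_def by blast
qed

end

section \<open>Symmetric operators with closed range\<close>

text \<open>By the parallelogram law a sequence minimising the distance to the subspace is a Cauchy sequence.\<close>

lemma closed_subspace_projection:
  fixes R :: "'v::{real_inner,complete_space} set"
  assumes R: "closed R" "subspace R"
  shows "\<exists>z\<in>R. \<forall>r\<in>R. (y - z) \<bullet> r = 0"
proof -
  define d where "d = Inf ((\<lambda>r. (norm (y - r))\<^sup>2) ` R)"
  have R0: "0 \<in> R" using R(2) by (rule subspace_0)
  have bdd: "bdd_below ((\<lambda>r. (norm (y - r))\<^sup>2) ` R)" by (rule bdd_belowI[of _ 0]) auto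
  have dle: "d \<le> (norm (y - r))\<^sup>2" if "r \<in> R" for r
    unfolding d_def by (rule cInf_lower[OF _ bdd]) (use that in blast)
  have "\<exists>r\<in>R. (norm (y - r))\<^sup>2 < d + 1 / real (Suc n)" for n
    using cInf_lessD[of "(\<lambda>r. (norm (y - r))\<^sup>2) ` R" "d + 1 / real (Suc n)"] R0 by (auto simp: d_def)
  then obtain r where r: "\<And>n. r n \<in> R" "\<And>n. (norm (y - r n))\<^sup>2 < d + 1 / real (Suc n)" by metis
  have par: "(norm (r m - r n))\<^sup>2 \<le> 2 / real (Suc m) + 2 / real (Suc n)" for m n
  proof -
    let ?m = "(1/2) *\<^sub>R (r m + r n)"
    have "?m \<in> R" using R(2) r(1) by (intro subspace_scale subspace_add)
    then have "4 * d \<le> 4 * (norm (y - ?m))\<^sup>2" using dle by simp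
    moreover have "(norm (r m - r n))\<^sup>2 = 2 * (norm (y - r m))\<^sup>2 + 2 * (norm (y - r n))\<^sup>2 - 4 * (norm (y - ?m))\<^sup>2"
      by (simp add: power2_norm_eq_inner inner_diff_left inner_diff_right inner_add_left inner_add_right inner_commute algebra_simps)
    ultimately show ?thesis using r(2)[of m] r(2)[of n] by simp
  qed
  have "Cauchy r"
    unfolding Cauchy_def dist_norm
  proof (intro allI impI)
    fix e :: real assume e: "e > 0"
    then have "e\<^sup>2 / 4 > 0" by simp
    then obtain M where M: "1 / real (Suc M) < e\<^sup>2 / 4" using reals_Archimedean[of "e\<^sup>2/4"] by (auto simp: inverse_eq_divide)
    have "norm (r m - r n) < e" if mn: "M \<le> m" "M \<le> n" for m n
    proof -
      have "1 / real (Suc m) \<le> 1 / real (Suc M)" "1 / real (Suc n) \<le> 1 / real (Suc M)"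
        using mn by (intro divide_left_mono; simp)+
      then have "(norm (r m - r n))\<^sup>2 < e\<^sup>2" using par[of m n] M by simp
      then show ?thesis using e by (rule power_less_imp_less_base[OF _ less_imp_le])
    qed
    then show "\<exists>M. \<forall>m\<ge>M. \<forall>n\<ge>M. norm (r m - r n) < e" by blast
  qed
  then obtain z where z: "r \<longlonglongrightarrow> z" using Cauchy_convergent convergent_def by blast
  have zR: "z \<in> R" by (rule closed_sequentially[OF R(1) r(1) z])
  have "(\<lambda>n. (norm (y - r n))\<^sup>2) \<longlonglongrightarrow> (norm (y - z))\<^sup>2" by (intro tendsto_intros z)
  moreover have "(\<lambda>n. d + 1 / real (Suc n)) \<longlonglongrightarrow> d"
    using LIMSEQ_inverse_real_of_nat_add[of d] by (simp only: inverse_eq_divide)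
  ultimately have zd: "(norm (y - z))\<^sup>2 \<le> d"
    by (rule LIMSEQ_le) (intro exI[of _ 0] allI impI less_imp_le[OF r(2)])
  have "(y - z) \<bullet> s = 0" if s: "s \<in> R" for s
  proof (cases "s = 0")
    case False
    \<comment> \<open>The minimiser of the quadratic polynomial measuring the distance along the line through s.\<close>
    define t where "t = ((y - z) \<bullet> s) / (s \<bullet> s)"
    have ss: "s \<bullet> s > 0" using False by simp
    have "z + t *\<^sub>R s \<in> R" using R(2) zR s by (intro subspace_add subspace_scale)
    then have "(norm (y - z))\<^sup>2 \<le> (norm (y - (z + t *\<^sub>R s)))\<^sup>2" by (rule order_trans[OF zd dle])
    also have "y - (z + t *\<^sub>R s) = (y - z) - t *\<^sub>R s" by simp
    also have "(norm ((y - z) - t *\<^sub>R s))\<^sup>2 = (norm (y - z))\<^sup>2 - 2 * t * ((y - z) \<bullet> s) + t\<^sup>2 * (s \<bullet> s)"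
    proof -
      have "(norm (u - t *\<^sub>R s))\<^sup>2 = (norm u)\<^sup>2 - 2 * t * (u \<bullet> s) + t\<^sup>2 * (s \<bullet> s)" for u
        using dot_norm_neg[of u "t *\<^sub>R s"] by (simp add: power_mult_distrib power2_norm_eq_inner)
      then show ?thesis .
    qed
    finally have "2 * t * ((y - z) \<bullet> s) \<le> t\<^sup>2 * (s \<bullet> s)" by simp
    moreover have "(y - z) \<bullet> s = t * (s \<bullet> s)" using ss by (simp add: t_def)
    ultimately have "2 * (t\<^sup>2 * (s \<bullet> s)) \<le> t\<^sup>2 * (s \<bullet> s)" by (simp add: power2_eq_square algebra_simps)
    then have "t\<^sup>2 * (s \<bullet> s) \<le> 0" by linarith
    then have "t = 0" using ss by (simp add: mult_le_0_iff)
    then show ?thesis using ss by (simp add: t_def)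
  qed simp
  then show ?thesis using zR by blast
qed

lemma riesz_representation:
  fixes \<phi> :: "'v::{real_inner,complete_space} \<Rightarrow>\<^sub>L real"
  shows "\<exists>a. \<forall>x. \<phi> x = a \<bullet> x"
proof (cases "\<forall>x. \<phi> x = 0")
  case True then show ?thesis by (intro exI[of _ 0]) simp
next
  case False
  then obtain y where y: "\<phi> y \<noteq> 0" by blast
  let ?R = "{x. \<phi> x = 0}"
  have "closed ?R" by (intro closed_Collect_eq continuous_intros)
  moreover have "subspace ?R" by (simp add: subspace_def blinfun.add_right blinfun.scaleR_right)
  ultimately obtain z where z: "\<phi> z = 0" "\<forall>r\<in>?R. (y - z) \<bullet> r = 0"
    using closed_subspace_projection[of ?R y] by blast
  define n where "n = y - z"
  have pn: "\<phi> n \<noteq> 0" using y z(1) by (simp add: n_def blinfun.diff_right)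
  then have n0: "n \<bullet> n \<noteq> 0" by (metis blinfun.zero_right inner_eq_zero_iff)
  have "\<phi> x = ((\<phi> n / (n \<bullet> n)) *\<^sub>R n) \<bullet> x" for x
  proof -
    have "x - (\<phi> x / \<phi> n) *\<^sub>R n \<in> ?R" using pn by (simp add: blinfun.diff_right blinfun.scaleR_right)
    then have "n \<bullet> (x - (\<phi> x / \<phi> n) *\<^sub>R n) = 0" using z(2) by (simp only: n_def)
    then have "n \<bullet> x = (\<phi> x / \<phi> n) * (n \<bullet> n)" by (simp add: inner_diff_right)
    then show ?thesis using pn n0 by simp
  qed
  then show ?thesis by blast
qed

text \<open>Represent functionals by vectors. The part of the representing vector orthogonal to the closed range
  lies in the kernel by symmetry, and there the functional vanishes; so this part is zero.\<close>

lemma symmetric_closed_range: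
  fixes L :: "'v::{real_inner,complete_space} \<Rightarrow> 'v \<Rightarrow>\<^sub>L real"
  assumes L: "linear L" and sym: "\<And>v w. L v w = L w v" and cl: "closed (range L)"
    and \<phi>: "\<And>v. L v = 0 \<Longrightarrow> blinfun_apply \<phi> v = 0"
  shows "\<phi> \<in> range L"
proof -
  let ?R = "{a. blinfun_inner_right a \<in> range L}"
  have J: "bounded_linear (blinfun_inner_right :: 'v \<Rightarrow> _)" by (rule bounded_linear_blinfun_inner_right)
  have "closed (blinfun_inner_right -` range L)"
    by (rule closed_vimage[OF cl linear_continuous_on[OF J]])
  then have c: "closed ?R" by (simp add: vimage_def)
  have sr: "subspace (range L)" by (rule linear_subspace_image[OF L subspace_UNIV])
  have s: "subspace ?R"
    using linear_subspace_vimage[OF bounded_linear.linear[OF J] sr] by (simp add: vimage_def)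
  obtain y where y: "\<And>x. \<phi> x = y \<bullet> x" using riesz_representation by blast
  obtain z where z: "z \<in> ?R" "\<And>r. r \<in> ?R \<Longrightarrow> (y - z) \<bullet> r = 0"
    using closed_subspace_projection[OF c s] by blast
  have "L (y - z) v = 0" for v
  proof -
    obtain b where b: "\<And>x. L v x = b \<bullet> x" using riesz_representation by blast
    have "blinfun_inner_right b = L v" by (rule blinfun_eqI) (simp add: b blinfun_inner_right.rep_eq)
    then have "(y - z) \<bullet> b = 0" by (intro z(2)) auto
    then show ?thesis using sym[of "y - z" v] b by (simp add: inner_commute)
  qed
  then have "L (y - z) = 0" by (simp add: blinfun_eqI)
  then have 1: "y \<bullet> (y - z) = 0" using \<phi> y by metis
  have "(y - z) \<bullet> z = 0" by (rule z(2)[OF z(1)])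
  then have "(y - z) \<bullet> (y - z) = 0" using 1 by (simp add: inner_diff_left inner_diff_right inner_commute)
  then have "y = z" by simp
  moreover have "\<phi> = blinfun_inner_right y" by (rule blinfun_eqI) (simp add: y blinfun_inner_right.rep_eq)
  ultimately show ?thesis using z(1) by simp
qed

text \<open>The vector representing an invariant functional on \<open>E\<close> is unique, hence fixed, because the maps are
  orthogonal.\<close>

lemma invariant_functional_eq_zero:
  fixes E :: "'v::{real_inner,complete_space} set" and \<phi> :: "'v \<Rightarrow>\<^sub>L real"
  assumes E: "closed E" "subspace E"
    and orth: "\<And>k v w. k \<in> K \<Longrightarrow> T k v \<bullet> T k w = v \<bullet> w"
    and TE: "\<And>k. k \<in> K \<Longrightarrow> T k ` E = E"
    and inv: "\<And>k w. k \<in> K \<Longrightarrow> w \<in> E \<Longrightarrow> blinfun_apply \<phi> (T k w) = \<phi> w"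
    and fixed: "\<And>a. a \<in> E \<Longrightarrow> (\<And>k. k \<in> K \<Longrightarrow> T k a = a) \<Longrightarrow> \<phi> a = 0"
    and w: "w \<in> E"
  shows "\<phi> w = 0"
proof -
  obtain y where y: "\<And>x. \<phi> x = y \<bullet> x" using riesz_representation by blast
  obtain a where a: "a \<in> E" "\<And>r. r \<in> E \<Longrightarrow> (y - a) \<bullet> r = 0"
    using closed_subspace_projection[OF E] by blast
  have pa: "\<phi> w = a \<bullet> w" if "w \<in> E" for w using a(2)[OF that] by (simp add: y inner_diff_left)
  have "T k a = a" if k: "k \<in> K" for k
  proof -
    have Ta: "T k a \<in> E" using TE[OF k] a(1) by blast
    have "(T k a - a) \<bullet> w = 0" if "w \<in> E" for w
    proof -
      obtain w' where w': "w' \<in> E" "w = T k w'" using TE[OF k] \<open>w \<in> E\<close> by blast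
      have "T k a \<bullet> w = \<phi> w'" using orth[OF k] pa[OF w'(1)] w'(2) by simp
      also have "\<dots> = a \<bullet> w" using inv[OF k w'(1)] pa[OF \<open>w \<in> E\<close>] w'(2) by simp
      finally show ?thesis by (simp add: inner_diff_left)
    qed
    from this[of "T k a - a"] show ?thesis using subspace_diff[OF E(2) Ta a(1)] by simp
  qed
  then have "\<phi> a = 0" using fixed[OF a(1)] by blast
  then have "a = 0" using pa[OF a(1)] by simp
  then show ?thesis using pa[OF w] by simp
qed

section \<open>Solutions of implicit equations\<close>

lemma filterlim_nhds_zero:
  fixes L :: "'x::real_normed_vector \<Rightarrow> 'y::real_normed_vector"
  assumes "bounded_linear L" and P: "\<forall>\<^sub>F y in nhds 0. P y"
  shows "\<forall>\<^sub>F x in nhds 0. P (L x)"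
proof -
  have "isCont L 0" using linear_continuous_at[OF assms(1)] .
  then have "(L \<longlongrightarrow> 0) (nhds 0)"
    unfolding isCont_def tendsto_at_iff_tendsto_nhds using assms(1) by (simp add: linear_simps)
  then show ?thesis using P by (simp add: filterlim_iff)
qed

lemma implicit_solution_zero: "implicit_solution X Y eqn f \<Longrightarrow> f 0 = 0"
  by (simp add: implicit_solution_def)

text \<open>Smoothness on a subset provides local smooth extensions; the reduced equation is differentiated through
  these, since the implicit functions are only given on a subspace.\<close>

lemma smooth_in_extension:
  assumes "smooth_in X f" "p \<in> X"
  obtains N F where "open N" "p \<in> N" "smooth_on N F" "\<And>x. x \<in> N \<Longrightarrow> x \<in> X \<Longrightarrow> F x = f x"
proof -
  obtain W F where *: "open W" "p \<in> W" "\<forall>x\<in>W \<inter> X. F x = f x"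
    "\<forall>c\<in>model_atlas. \<forall>d\<in>model_atlas. smooth_on (snd c ` {x \<in> fst c \<inter> W. F x \<in> fst d}) (snd d \<circ> F \<circ> chart_inv c)"
    using assms(1)[unfolded smooth_map_def, rule_format, OF assms(2)] by (elim exE conjE)
  have "smooth_on W F"
    using *(4) by (simp add: model_atlas_def comp_def)
  then show ?thesis by (rule that[OF *(1,2)]) (use *(3) in simp)
qed

lemma implicit_solution_extension:
  assumes f: "implicit_solution X Y eqn f" and X: "0 \<in> X"
  obtains N F where "open N" "0 \<in> N" "smooth_on N F" "\<And>x. x \<in> N \<Longrightarrow> x \<in> X \<Longrightarrow> F x = f x"
proof -
  obtain U W where U: "open U" "0 \<in> U" "smooth_in (U \<inter> X) f"
    using f unfolding implicit_solution_def by (elim exE conjE)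
  have 0: "0 \<in> U \<inter> X" using U X by simp
  obtain N F where N: "open N" "0 \<in> N" "smooth_on N F" "\<And>x. x \<in> N \<Longrightarrow> x \<in> U \<inter> X \<Longrightarrow> F x = f x"
    by (rule smooth_in_extension[OF U(3) 0]) blast
  show ?thesis
    by (rule that[OF open_Int[OF N(1) U(1)] _ smooth_on_subset[OF N(3)]]) (use N U in auto)
qed

lemma implicit_solution_tendsto_graph:
  assumes f: "implicit_solution X Y eqn f" and X: "0 \<in> X" and P: "\<forall>\<^sub>F z in nhds 0. P z"
  shows "\<forall>\<^sub>F x in nhds 0. x \<in> X \<longrightarrow> P (x, f x)"
proof -
  obtain N F where N: "open N" "0 \<in> N" "smooth_on N F" "\<And>x. x \<in> N \<Longrightarrow> x \<in> X \<Longrightarrow> F x = f x"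
    by (rule implicit_solution_extension[OF f X]) blast
  have "isCont F 0" using smooth_on_continuous[OF N(3)] N(1,2) by (simp add: continuous_on_eq_continuous_at)
  moreover have "F 0 = 0" using N(4)[OF N(2) X] implicit_solution_zero[OF f] by simp
  ultimately have "(F \<longlongrightarrow> 0) (nhds 0)" unfolding isCont_def tendsto_at_iff_tendsto_nhds by simp
  from tendsto_Pair[OF filterlim_ident this]
  have "((\<lambda>x. (x, F x)) \<longlongrightarrow> 0) (nhds 0)" unfolding zero_prod_def .
  from this[unfolded filterlim_iff, rule_format, OF P] eventually_nhds_in_open[OF N(1,2)]
  show ?thesis by eventually_elim (metis N(4))
qed

lemma implicit_solution_tendsto:
  assumes f: "implicit_solution X Y eqn f" and X: "0 \<in> X" and P: "\<forall>\<^sub>F y in nhds 0. P y"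
  shows "\<forall>\<^sub>F x in nhds 0. x \<in> X \<longrightarrow> P (f x)"
proof -
  have "\<forall>\<^sub>F z in nhds 0. P (snd z)"
    using eventually_compose_filterlim[OF P tendsto_snd[OF filterlim_ident, of 0, unfolded snd_zero]] .
  from implicit_solution_tendsto_graph[OF f X this] show ?thesis by simp
qed

lemma implicit_solution_solves:
  assumes f: "implicit_solution X Y eqn f"
  shows "\<forall>\<^sub>F x in nhds 0. x \<in> X \<longrightarrow> f x \<in> Y \<and> eqn x (f x)"
proof -
  obtain U W where U: "open U" "0 \<in> U" "\<forall>x\<in>U \<inter> X. f x \<in> W \<inter> Y \<and> (\<forall>y\<in>W \<inter> Y. eqn x y \<longleftrightarrow> y = f x)"
    using f unfolding implicit_solution_def by (elim exE conjE)
  from eventually_nhds_in_open[OF U(1,2)] show ?thesis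
    by eventually_elim (use U(3) in simp)
qed

text \<open>Some of the variables may be frozen or regrouped, as long as this is done linearly.\<close>

lemma implicit_solution_linear_substitution:
  fixes L :: "'z::real_normed_vector \<Rightarrow> 'x::{real_normed_vector,complete_space}"
  assumes f: "implicit_solution X Y eqn f" and L: "bounded_linear L" and LX: "\<And>z. z \<in> Z \<Longrightarrow> L z \<in> X"
  shows "implicit_solution Z Y (\<lambda>z. eqn (L z)) (\<lambda>z. f (L z))"
proof -
  obtain U W where U: "open U" "0 \<in> U" "open W" "0 \<in> W" "smooth_in (U \<inter> X) f"
    "\<forall>x\<in>U \<inter> X. f x \<in> W \<inter> Y \<and> (\<forall>y\<in>W \<inter> Y. eqn x y \<longleftrightarrow> y = f x)"
    using f unfolding implicit_solution_def by (elim exE conjE)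
  have L0: "L 0 = 0" using L by (simp add: linear_simps)
  have oL: "open (L -` T)" if "open T" for T
    by (rule open_vimage[OF that linear_continuous_on[OF L]])
  have "smooth_in (L -` U \<inter> Z) (\<lambda>z. f (L z))"
    unfolding smooth_map_def
  proof
    fix p assume p: "p \<in> L -` U \<inter> Z"
    then have Lp: "L p \<in> U \<inter> X" using LX by simp
    obtain N F where N: "open N" "L p \<in> N" "smooth_on N F" "\<And>x. x \<in> N \<Longrightarrow> x \<in> U \<inter> X \<Longrightarrow> F x = f x"
      by (rule smooth_in_extension[OF U(5) Lp]) blast
    have s: "smooth_on (L -` N) (\<lambda>z. F (L z))"
      by (rule smooth_on_compose[OF oL[OF N(1)] N(1) _ smooth_on_bounded_linear[OF oL[OF N(1)] L] N(3)]) blast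
    show "\<exists>W F. open W \<and> p \<in> W \<and> (\<forall>x\<in>W \<inter> (L -` U \<inter> Z). F x = f (L x)) \<and> continuous_on W F \<and>
        (\<forall>c\<in>model_atlas. \<forall>d\<in>model_atlas. smooth_on (snd c ` {x \<in> fst c \<inter> W. F x \<in> fst d}) (snd d \<circ> F \<circ> chart_inv c))"
    proof (intro exI conjI)
      show "open (L -` N)" by (rule oL[OF N(1)])
      show "p \<in> L -` N" using N(2) by simp
      show "\<forall>x\<in>L -` N \<inter> (L -` U \<inter> Z). F (L x) = f (L x)" using N(4) LX by simp
      show "continuous_on (L -` N) (\<lambda>z. F (L z))" by (rule smooth_on_continuous[OF s])
      show "\<forall>c\<in>model_atlas. \<forall>d\<in>model_atlas. smooth_on (snd c ` {x \<in> fst c \<inter> L -` N. F (L x) \<in> fst d}) (snd d \<circ> (\<lambda>z. F (L z)) \<circ> chart_inv c)"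
        using s by (simp add: model_atlas_def comp_def vimage_def)
    qed
  qed
  moreover have "\<forall>z\<in>L -` U \<inter> Z. f (L z) \<in> W \<inter> Y \<and> (\<forall>y\<in>W \<inter> Y. eqn (L z) y \<longleftrightarrow> y = f (L z))"
    using U(6) LX by simp
  moreover have "f (L 0) = 0" using implicit_solution_zero[OF f] L0 by simp
  ultimately show ?thesis
    unfolding implicit_solution_def using oL[OF U(1)] U(2-4) L0
    by (intro conjI exI[of _ "L -` U"] exI[of _ W]) simp_all
qed

text \<open>One neighbourhood has to serve all group elements: the isotropy of the branch is computed with every
  element of the group at the same parameter value.\<close>

definition equicontinuous_at_zero :: "'i set \<Rightarrow> ('i \<Rightarrow> 'x::real_normed_vector \<Rightarrow> 'x) \<Rightarrow> bool" where
  "equicontinuous_at_zero I \<sigma> \<longleftrightarrow>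
     (\<forall>P. (\<forall>\<^sub>F x in nhds 0. P x) \<longrightarrow> (\<forall>\<^sub>F x in nhds 0. \<forall>g\<in>I. P (\<sigma> g x)))"

lemma equicontinuous_at_zeroD:
  "equicontinuous_at_zero I \<sigma> \<Longrightarrow> \<forall>\<^sub>F x in nhds 0. P x \<Longrightarrow> \<forall>\<^sub>F x in nhds 0. \<forall>g\<in>I. P (\<sigma> g x)"
  by (simp add: equicontinuous_at_zero_def)

lemma equicontinuous_at_zero_norm:
  assumes "\<And>g x. g \<in> I \<Longrightarrow> norm (\<sigma> g x) \<le> C * norm x"
  shows "equicontinuous_at_zero I \<sigma>"
  unfolding equicontinuous_at_zero_def
proof (intro allI impI)
  fix P :: "'b \<Rightarrow> bool" assume "\<forall>\<^sub>F x in nhds 0. P x"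
  then obtain d where d: "d > 0" "\<And>x. norm x < d \<Longrightarrow> P x" by (auto simp: eventually_nhds_metric)
  define r where "r = d / (\<bar>C\<bar> + 1)"
  have r: "r > 0" using d by (auto simp: r_def intro!: divide_pos_pos add_nonneg_pos)
  have "P (\<sigma> g x)" if x: "norm x < r" and g: "g \<in> I" for g x
  proof (rule d(2))
    have "norm (\<sigma> g x) \<le> C * norm x" by (rule assms[OF g])
    also have "\<dots> \<le> (\<bar>C\<bar> + 1) * norm x" by (intro mult_right_mono) auto
    also have "\<dots> < (\<bar>C\<bar> + 1) * r" using x by (intro mult_strict_left_mono) auto
    also have "\<dots> = d"
    proof -
      have "\<bar>C\<bar> + 1 \<noteq> 0" by (metis abs_ge_zero add_nonneg_pos less_irrefl zero_less_one)
      then show ?thesis by (simp add: r_def)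
    qed
    finally show "norm (\<sigma> g x) < d" .
  qed
  then show "\<forall>\<^sub>F x in nhds 0. \<forall>g\<in>I. P (\<sigma> g x)"
    using r unfolding eventually_nhds_metric by (auto simp: dist_norm)
qed

lemma equicontinuous_at_zero_prod:
  assumes \<sigma>: "equicontinuous_at_zero I \<sigma>" and \<tau>: "equicontinuous_at_zero I \<tau>"
  shows "equicontinuous_at_zero I (\<lambda>g. map_prod (\<sigma> g) (\<tau> g))"
  unfolding equicontinuous_at_zero_def
proof (intro allI impI)
  fix P :: "'b \<times> 'c \<Rightarrow> bool" assume "\<forall>\<^sub>F x in nhds 0. P x"
  then obtain Q R where Q: "\<forall>\<^sub>F x in nhds 0. Q x" "\<forall>\<^sub>F y in nhds 0. R y" "\<And>x y. Q x \<Longrightarrow> R y \<Longrightarrow> P (x, y)"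
    unfolding zero_prod_def nhds_prod eventually_prod_filter by blast
  have "\<forall>\<^sub>F x in nhds 0. \<forall>g\<in>I. Q (\<sigma> g x)" "\<forall>\<^sub>F y in nhds 0. \<forall>g\<in>I. R (\<tau> g y)"
    by (rule equicontinuous_at_zeroD[OF \<sigma> Q(1)], rule equicontinuous_at_zeroD[OF \<tau> Q(2)])
  then show "\<forall>\<^sub>F x in nhds 0. \<forall>g\<in>I. P (map_prod (\<sigma> g) (\<tau> g) x)"
    unfolding zero_prod_def nhds_prod eventually_prod_filter using Q(3)
    by (intro exI[of _ "\<lambda>x. \<forall>g\<in>I. Q (\<sigma> g x)"] exI[of _ "\<lambda>y. \<forall>g\<in>I. R (\<tau> g y)"]) simp
qed

text \<open>The transformed solution solves the transformed equation and stays in the domain of uniqueness, so it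
  is the solution at the transformed point.\<close>

lemma implicit_solution_equivariant:
  assumes f: "implicit_solution X Y eqn f" and X: "0 \<in> X"
    and \<sigma>: "equicontinuous_at_zero I \<sigma>" "\<And>g x. g \<in> I \<Longrightarrow> x \<in> X \<Longrightarrow> \<sigma> g x \<in> X"
    and \<tau>: "equicontinuous_at_zero I \<tau>" "\<And>g y. g \<in> I \<Longrightarrow> y \<in> Y \<Longrightarrow> \<tau> g y \<in> Y"
    and eqn: "\<forall>\<^sub>F x in nhds 0. \<forall>y g. g \<in> I \<longrightarrow> x \<in> X \<longrightarrow> y \<in> Y \<longrightarrow> y = f x \<longrightarrow> eqn x y \<longrightarrow> eqn (\<sigma> g x) (\<tau> g y)"
  shows "\<forall>\<^sub>F x in nhds 0. x \<in> X \<longrightarrow> (\<forall>g\<in>I. f (\<sigma> g x) = \<tau> g (f x))"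
proof -
  obtain U W where U: "open U" "0 \<in> U" "open W" "0 \<in> W"
    "\<forall>x\<in>U \<inter> X. f x \<in> W \<inter> Y \<and> (\<forall>y\<in>W \<inter> Y. eqn x y \<longleftrightarrow> y = f x)"
    using f unfolding implicit_solution_def by (elim exE conjE)
  have ev: "\<forall>\<^sub>F x in nhds 0. x \<in> X \<longrightarrow> (\<forall>g\<in>I. \<tau> g (f x) \<in> W)"
    by (rule implicit_solution_tendsto[OF f X equicontinuous_at_zeroD[OF \<tau>(1) eventually_nhds_in_open[OF U(3,4)]]])
  from eventually_nhds_in_open[OF U(1,2)] equicontinuous_at_zeroD[OF \<sigma>(1) eventually_nhds_in_open[OF U(1,2)]] ev eqn
  show ?thesis
  proof eventually_elim
    case (elim x)
    show ?case
    proof (intro impI ballI)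
      fix g assume x: "x \<in> X" and g: "g \<in> I"
      have fx: "f x \<in> Y" "eqn x (f x)" using U(5) elim(1) x by simp_all
      then have "eqn (\<sigma> g x) (\<tau> g (f x))" using elim(4) x g by simp
      moreover have "\<tau> g (f x) \<in> W \<inter> Y" using elim(3) \<tau>(2)[OF g fx(1)] x g by simp
      moreover have "\<sigma> g x \<in> U \<inter> X" using elim(2) \<sigma>(2)[OF g x] g by simp
      ultimately show "f (\<sigma> g x) = \<tau> g (f x)" using U(5) by metis
    qed
  qed
qed

section \<open>The slice equations\<close>

locale slice_reduction =
  fixes S :: "('a::t2_space, 'g::euclidean_space, 'p::t2_space, 'e::banach) ham_system"
    and D :: "('a, 'g, 'p, 'm::euclidean_space, 'v::{real_inner, complete_space}) slice_data"
  assumes system: "hamiltonian_G_system S" and proper: "proper_action S"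
    and rel_eq: "relative_equilibrium S (base D) (gen D)"
    and split: "splitting S D" and slice: "slice_mapping S D" and equivariant: "equivariant_slice S D"
    and step1: "step1 S D" and step2: "step2 S D" and step3: "step3 S D"
begin

lemmas lie = lie[OF system]
lemmas atlas_M = atlas_M[OF system]

interpretation G: group "grp S" using lie by (simp add: lie_group_def)

lemma carrier_G [simp]: "carrier (grp S) = UNIV" by (rule carrier_grp[OF lie])

abbreviation "\<Gamma> \<equiv> carrier (Gam S D)"

subsection \<open>The symmetry group of the slice\<close>

lemma Gamma_iff: "g \<in> \<Gamma> \<longleftrightarrow> Ad S g (gen D) = gen D \<and> act S g (base D) = base D"
  by (simp add: Gam_def G_xi_def G_me_def stabilizer_def)

lemma Gamma_one: "\<one>\<^bsub>grp S\<^esub> \<in> \<Gamma>"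
  by (simp add: Gamma_iff Ad_one[OF lie] act_one[OF system])

lemma Gamma_mult: "g \<in> \<Gamma> \<Longrightarrow> k \<in> \<Gamma> \<Longrightarrow> g \<otimes>\<^bsub>grp S\<^esub> k \<in> \<Gamma>"
  by (simp add: Gamma_iff Ad_mult[OF lie] act_mult[OF system])

lemma Gamma_inv: "g \<in> \<Gamma> \<Longrightarrow> inv\<^bsub>grp S\<^esub> g \<in> \<Gamma>"
  unfolding Gamma_iff by (metis Ad_inv(1)[OF lie] act_inv(1)[OF system])

lemma Gamma_subgroup: "subgroup \<Gamma> (grp S)"
  by (rule subgroup.intro) (simp_all add: Gamma_one Gamma_mult Gamma_inv)

lemma Gam_eq: "Gam S D = (grp S)\<lparr>carrier := \<Gamma>\<rparr>"
  by (simp add: Gam_def)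

lemma Gam_mult [simp]: "g \<otimes>\<^bsub>Gam S D\<^esub> k = g \<otimes>\<^bsub>grp S\<^esub> k"
  by (simp add: Gam_def)

lemma Gam_one [simp]: "\<one>\<^bsub>Gam S D\<^esub> = \<one>\<^bsub>grp S\<^esub>"
  by (simp add: Gam_def)

lemma group_Gam: "group (Gam S D)"
  using G.subgroup_imp_group[OF Gamma_subgroup] Gam_eq by simp

lemma Gam_inv: "g \<in> \<Gamma> \<Longrightarrow> inv\<^bsub>Gam S D\<^esub> g = inv\<^bsub>grp S\<^esub> g"
  using G.m_inv_consistent[OF Gamma_subgroup, of g] Gam_eq by simp

lemma lin_action: "group_action (Gam S D) UNIV (lin D)"
  and bounded_linear_lin: "g \<in> \<Gamma> \<Longrightarrow> bounded_linear (lin D g)"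
  and lin_inner: "g \<in> \<Gamma> \<Longrightarrow> lin D g v \<bullet> lin D g w = v \<bullet> w"
  and slice_act: "g \<in> \<Gamma> \<Longrightarrow> (\<eta>, v) \<in> udom D \<Longrightarrow> (coAd_m S D g \<eta>, lin D g v) \<in> udom D"
    "g \<in> \<Gamma> \<Longrightarrow> (\<eta>, v) \<in> udom D \<Longrightarrow> Psi D (coAd_m S D g \<eta>, lin D g v) = act S g (Psi D (\<eta>, v))"
  using equivariant unfolding equivariant_slice_def by (fast | force)+

lemma lin_one [simp]: "lin D \<one>\<^bsub>grp S\<^esub> v = v"
  using group_action.id_eq_one[OF lin_action] by (metis Gam_one UNIV_I restrict_apply')

lemma lin_mult: "g \<in> \<Gamma> \<Longrightarrow> k \<in> \<Gamma> \<Longrightarrow> lin D (g \<otimes>\<^bsub>grp S\<^esub> k) v = lin D g (lin D k v)"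
  using group_action.composition_rule[OF lin_action, of v g k] by simp

lemma lin_inv: "g \<in> \<Gamma> \<Longrightarrow> lin D (inv\<^bsub>grp S\<^esub> g) (lin D g v) = v" "g \<in> \<Gamma> \<Longrightarrow> lin D g (lin D (inv\<^bsub>grp S\<^esub> g) v) = v"
  by (simp_all add: Gamma_inv flip: lin_mult)

lemma norm_lin: "g \<in> \<Gamma> \<Longrightarrow> norm (lin D g v) = norm v"
  by (simp add: norm_eq_sqrt_inner lin_inner)

subsection \<open>The induced actions on the complement and its dual\<close>

definition Ad_m :: "'a \<Rightarrow> 'm \<Rightarrow> 'm" where
  "Ad_m g b = prm D (Ad S g (inm D b))"

lemma prm_inm [simp]: "prm D (inm D b) = b"
  using split by (simp add: splitting_def)

lemma Ad_inm: "g \<in> \<Gamma> \<Longrightarrow> Ad S g (inm D b) = inm D (Ad_m g b)"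
proof -
  assume "g \<in> \<Gamma>"
  then have "Ad S g ` range (inm D) \<subseteq> range (inm D)" using split unfolding splitting_def by blast
  then obtain b' where "Ad S g (inm D b) = inm D b'" by blast
  then show ?thesis by (simp add: Ad_m_def)
qed

lemma Ad_qq: "g \<in> \<Gamma> \<Longrightarrow> \<zeta> \<in> qq D \<Longrightarrow> Ad S g \<zeta> \<in> qq D"
  using split unfolding splitting_def by blast

lemma bounded_linear_Ad_m: "bounded_linear (Ad_m g)"
  unfolding Ad_m_def
  by (intro bounded_linear_compose[OF blinfun.bounded_linear_right] bounded_linear_compose[OF bounded_linear_Ad[OF lie]] blinfun.bounded_linear_right)

lemma Ad_m_inv:
  assumes "g \<in> \<Gamma>"
  shows "Ad_m (inv\<^bsub>grp S\<^esub> g) (Ad_m g b) = b" and "Ad_m g (Ad_m (inv\<^bsub>grp S\<^esub> g) b) = b"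
  unfolding Ad_m_def[of _ "Ad_m _ b"] Ad_inm[OF assms, symmetric] Ad_inm[OF Gamma_inv[OF assms], symmetric]
  by (simp_all add: Ad_inv[OF lie])

lemma coAd_m_apply: "blinfun_apply (coAd_m S D g \<eta>) b = \<eta> (Ad_m (inv\<^bsub>grp S\<^esub> g) b)"
  unfolding coAd_m_def Ad_m_def[symmetric]
  by (subst bounded_linear_Blinfun_apply) (auto intro: bounded_linear_compose[OF blinfun.bounded_linear_right bounded_linear_Ad_m])

lemma coAd_m_inv: "g \<in> \<Gamma> \<Longrightarrow> coAd_m S D (inv\<^bsub>grp S\<^esub> g) (coAd_m S D g \<eta>) = \<eta>" "g \<in> \<Gamma> \<Longrightarrow> coAd_m S D g (coAd_m S D (inv\<^bsub>grp S\<^esub> g) \<eta>) = \<eta>"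
  by (rule blinfun_eqI, simp add: coAd_m_apply Ad_m_inv Gamma_inv)+

lemma compact_G_me: "compact (G_me S D)"
proof -
  have "compact ((\<lambda>(g, p). (p, act S g p)) -` {(base D, base D)})"
  proof -
    have "compactin euclidean {x \<in> topspace euclidean. (\<lambda>(g, p). (p, act S g p)) x \<in> {(base D, base D)}}"
      by (rule compactin_proper_map_preimage[OF proper[unfolded proper_action_def]]) simp
    then show ?thesis by (simp add: vimage_def)
  qed
  then have "compact (fst ` ((\<lambda>(g, p). (p, act S g p)) -` {(base D, base D)}))"
    by (intro compact_continuous_image continuous_intros)
  moreover have "fst ` ((\<lambda>(g, p). (p, act S g p)) -` {(base D, base D)}) = G_me S D"
  proof -
    have "(\<lambda>(g, p). (p, act S g p)) -` {(base D, base D)} = (\<lambda>g. (g, base D)) ` G_me S D"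
      by (auto simp: G_me_def stabilizer_def)
    then show ?thesis by (simp add: image_image)
  qed
  ultimately show ?thesis by simp
qed

text \<open>Properness makes the isotropy group compact, so its adjoint action is uniformly bounded.\<close>

lemma Ad_bounded: "\<exists>C. \<forall>g\<in>\<Gamma>. \<forall>\<zeta>. norm (Ad S g \<zeta>) \<le> C * norm \<zeta>"
proof -
  have "\<exists>C. \<forall>g\<in>G_me S D. norm (Ad S g \<zeta>) \<le> C" for \<zeta>
  proof -
    have "continuous_on (G_me S D) (\<lambda>g. Ad S g \<zeta>)"
      by (intro continuous_at_imp_continuous_on ballI isCont_Ad[OF lie])
    then have "bounded ((\<lambda>g. Ad S g \<zeta>) ` G_me S D)"
      by (intro compact_imp_bounded compact_continuous_image compact_G_me)
    then show ?thesis by (auto simp: bounded_iff)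
  qed
  from banach_steinhaus[OF bounded_linear_Ad[OF lie] this]
  obtain C where "\<forall>g\<in>G_me S D. \<forall>\<zeta>. norm (Ad S g \<zeta>) \<le> C * norm \<zeta>" by blast
  moreover have "\<Gamma> \<subseteq> G_me S D" by (simp add: Gam_def)
  ultimately show ?thesis by blast
qed

lemma equicontinuous_Ad: "equicontinuous_at_zero \<Gamma> (Ad S)"
  using Ad_bounded equicontinuous_at_zero_norm[of \<Gamma> "Ad S"] by blast

lemma Ad_m_bounded: "\<exists>C. \<forall>g\<in>\<Gamma>. \<forall>b. norm (Ad_m g b) \<le> C * norm b"
proof -
  obtain C where C: "\<And>g \<zeta>. g \<in> \<Gamma> \<Longrightarrow> norm (Ad S g \<zeta>) \<le> C * norm \<zeta>" using Ad_bounded by blast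
  have "norm (Ad_m g b) \<le> (norm (prm D) * (\<bar>C\<bar> * norm (inm D))) * norm b" if g: "g \<in> \<Gamma>" for g b
  proof -
    have "norm (Ad_m g b) \<le> norm (prm D) * norm (Ad S g (inm D b))"
      unfolding Ad_m_def by (rule norm_blinfun)
    also have "\<dots> \<le> norm (prm D) * (\<bar>C\<bar> * norm (inm D b))"
      by (intro mult_left_mono order_trans[OF C[OF g] mult_right_mono[OF abs_ge_self]]) simp_all
    also have "\<dots> \<le> norm (prm D) * (\<bar>C\<bar> * (norm (inm D) * norm b))"
      by (intro mult_left_mono norm_blinfun) auto
    finally show ?thesis by (simp add: mult.assoc)
  qed
  then show ?thesis by blast
qed

lemma equicontinuous_Ad_m: "equicontinuous_at_zero \<Gamma> Ad_m"
  using Ad_m_bounded equicontinuous_at_zero_norm[of \<Gamma> Ad_m] by blast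

lemma equicontinuous_lin: "equicontinuous_at_zero \<Gamma> (lin D)"
  by (rule equicontinuous_at_zero_norm[of _ _ 1]) (simp add: norm_lin)

lemma coAd_m_bounded: "\<exists>C. \<forall>g\<in>\<Gamma>. \<forall>\<eta>. norm (coAd_m S D g \<eta>) \<le> C * norm \<eta>"
proof -
  obtain C where C: "\<And>g b. g \<in> \<Gamma> \<Longrightarrow> norm (Ad_m g b) \<le> C * norm b" using Ad_m_bounded by blast
  have "norm (coAd_m S D g \<eta>) \<le> \<bar>C\<bar> * norm \<eta>" if g: "g \<in> \<Gamma>" for g \<eta>
  proof (rule norm_blinfun_bound)
    fix b
    have "norm (blinfun_apply (coAd_m S D g \<eta>) b) \<le> norm \<eta> * norm (Ad_m (inv\<^bsub>grp S\<^esub> g) b)"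
      unfolding coAd_m_apply by (rule norm_blinfun)
    also have "\<dots> \<le> norm \<eta> * (\<bar>C\<bar> * norm b)"
      by (intro mult_left_mono order_trans[OF C[OF Gamma_inv[OF g]] mult_right_mono[OF abs_ge_self]]) simp_all
    finally show "norm (blinfun_apply (coAd_m S D g \<eta>) b) \<le> \<bar>C\<bar> * norm \<eta> * norm b" by (simp add: algebra_simps)
  qed simp
  then show ?thesis by blast
qed

lemma equicontinuous_coAd_m: "equicontinuous_at_zero \<Gamma> (coAd_m S D)"
  using coAd_m_bounded equicontinuous_at_zero_norm[of \<Gamma> "coAd_m S D"] by blast

lemma bounded_linear_coAd_m: "g \<in> \<Gamma> \<Longrightarrow> bounded_linear (coAd_m S D g)"
proof -
  assume g: "g \<in> \<Gamma>"
  obtain C where C: "\<And>\<eta>. norm (coAd_m S D g \<eta>) \<le> C * norm \<eta>" using coAd_m_bounded g by blast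
  show ?thesis
    by (rule bounded_linear_intro[where K = C])
      (rule blinfun_eqI, simp add: coAd_m_apply blinfun.add_left,
       rule blinfun_eqI, simp add: coAd_m_apply blinfun.scaleR_left, use C in \<open>simp add: mult.commute\<close>)
qed

lemma jj_equivariant: "g \<in> \<Gamma> \<Longrightarrow> (\<eta>, v) \<in> udom D \<Longrightarrow> jj S D (coAd_m S D g \<eta>) (lin D g v) = coAd S g (jj S D \<eta> v)"
  by (simp add: jj_def slice_act mom_act[OF system])

lemma HJ_equivariant: "g \<in> \<Gamma> \<Longrightarrow> (\<eta>, v) \<in> udom D \<Longrightarrow>
    HJ S D (Ad S g \<zeta>) (coAd_m S D g \<eta>) (lin D g v) = HJ S D \<zeta> \<eta> v"
  by (simp add: HJ_def jj_equivariant slice_act ham_act[OF system] coAd_apply[OF lie] Ad_inv[OF lie])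

subsection \<open>Smoothness of the slice functions\<close>

lemma open_udom: "open (udom D)" and udom0: "(0, 0) \<in> udom D" and Psi0: "Psi D (0, 0) = base D"
  and Psi_smooth: "smooth_map model_atlas (atlM S) (udom D) (Psi D)" and Psi_inj: "inj_on (Psi D) (udom D)"
  and Psi_inverse_smooth: "smooth_map (atlM S) model_atlas (Psi D ` udom D) (inv_into (udom D) (Psi D))"
  and slice_transversal: "x \<in> udom D \<Longrightarrow> \<exists>b \<gamma> \<delta>. \<gamma> \<in> qq D \<and> u = inf_gen S (inm D b + \<gamma>) (Psi D x) + TPsi S D x \<delta>"
proof -
  show "open (udom D)" "(0, 0) \<in> udom D" "Psi D (0, 0) = base D" "smooth_map model_atlas (atlM S) (udom D) (Psi D)"
    "inj_on (Psi D) (udom D)" "smooth_map (atlM S) model_atlas (Psi D ` udom D) (inv_into (udom D) (Psi D))"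
    using slice by (simp_all add: slice_mapping_def diffeo_onto_image_def)
  assume "x \<in> udom D"
  then have "UNIV = {inf_gen S (inm D b + \<gamma>) (Psi D x) + TPsi S D x \<delta> | b \<gamma> \<delta>. \<gamma> \<in> qq D}"
    using slice by (simp add: slice_mapping_def)
  then have "u \<in> {inf_gen S (inm D b + \<gamma>) (Psi D x) + TPsi S D x \<delta> | b \<gamma> \<delta>. \<gamma> \<in> qq D}" by blast
  then show "\<exists>b \<gamma> \<delta>. \<gamma> \<in> qq D \<and> u = inf_gen S (inm D b + \<gamma>) (Psi D x) + TPsi S D x \<delta>" by blast
qed

text \<open>The slice functions as functions of one variable in the product, where the chain rule and the
  symmetry of second derivatives are available; partial derivatives are values on \<open>(0, w)\<close> and \<open>(\<delta>, 0)\<close>.\<close>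

definition h_slice :: "('m \<Rightarrow>\<^sub>L real) \<times> 'v \<Rightarrow> real" where "h_slice x = ham S (Psi D x)"
definition j_slice :: "('m \<Rightarrow>\<^sub>L real) \<times> 'v \<Rightarrow> 'g \<Rightarrow>\<^sub>L real" where "j_slice x = mom S (Psi D x)"
definition F_slice :: "'g \<Rightarrow> ('m \<Rightarrow>\<^sub>L real) \<times> 'v \<Rightarrow> real" where "F_slice \<zeta> x = h_slice x - j_slice x \<zeta>"

lemma HJ_eq: "HJ S D \<zeta> \<eta> v = F_slice \<zeta> (\<eta>, v)"
  by (simp add: HJ_def F_slice_def h_slice_def j_slice_def jj_def)

lemma smooth_h: "smooth_on (udom D) h_slice"
  using smooth_map_compose[OF topological_atlas_model atlas_M topological_atlas_model Psi_smooth open_udom smooth_ham[OF system]]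
  unfolding smooth_map_model_iff[OF open_udom] h_slice_def[abs_def] .

lemma smooth_j: "smooth_on (udom D) j_slice"
  using smooth_map_compose[OF topological_atlas_model atlas_M topological_atlas_model Psi_smooth open_udom smooth_mom[OF system]]
  unfolding smooth_map_model_iff[OF open_udom] j_slice_def[abs_def] .

lemma smooth_F: "smooth_on (udom D) (F_slice \<zeta>)"
  unfolding F_slice_def[abs_def]
  by (rule smooth_on_diff[OF open_udom smooth_h smooth_on_linear_compose[OF open_udom blinfun.bounded_linear_left smooth_j]])

definition dF :: "'g \<Rightarrow> ('m \<Rightarrow>\<^sub>L real) \<times> 'v \<Rightarrow> ('m \<Rightarrow>\<^sub>L real) \<times> 'v \<Rightarrow> real" where
  "dF \<zeta> x = frechet_derivative (F_slice \<zeta>) (at x)"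

lemma F_has_derivative: "x \<in> udom D \<Longrightarrow> (F_slice \<zeta> has_derivative dF \<zeta> x) (at x)"
  unfolding dF_def by (rule smooth_on_has_derivative[OF smooth_F])

lemma HJ_has_derivative:
  assumes "(\<eta>, v) \<in> udom D"
  shows "(HJ S D \<zeta> \<eta> has_derivative (\<lambda>w. dF \<zeta> (\<eta>, v) (0, w))) (at v)"
    and "((\<lambda>\<eta>. HJ S D \<zeta> \<eta> v) has_derivative (\<lambda>\<delta>. dF \<zeta> (\<eta>, v) (\<delta>, 0))) (at \<eta>)"
proof -
  have A: "((\<lambda>w. (\<eta>, w)) has_derivative (\<lambda>h. (0, h))) (at v)" by (auto intro!: derivative_eq_intros)
  have B: "((\<lambda>\<eta>. (\<eta>, v)) has_derivative (\<lambda>h. (h, 0))) (at \<eta>)" by (auto intro!: derivative_eq_intros)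
  show "(HJ S D \<zeta> \<eta> has_derivative (\<lambda>w. dF \<zeta> (\<eta>, v) (0, w))) (at v)"
    using diff_chain_at[OF A F_has_derivative[OF assms]] by (simp add: comp_def HJ_eq[abs_def])
  show "((\<lambda>\<eta>. HJ S D \<zeta> \<eta> v) has_derivative (\<lambda>\<delta>. dF \<zeta> (\<eta>, v) (\<delta>, 0))) (at \<eta>)"
    using diff_chain_at[OF B F_has_derivative[OF assms]] by (simp add: comp_def HJ_eq)
qed

lemma DV_apply: "(\<eta>, v) \<in> udom D \<Longrightarrow> blinfun_apply (DV S D \<zeta> \<eta> v) w = dF \<zeta> (\<eta>, v) (0, w)"
  unfolding DV_def frechet_derivative_at[OF HJ_has_derivative(1), symmetric]
  by (subst bounded_linear_Blinfun_apply[OF has_derivative_bounded_linear[OF HJ_has_derivative(1)]]) simp_all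

lemma Dm_apply: "(\<eta>, v) \<in> udom D \<Longrightarrow> blinfun_apply (Dm S D \<zeta> \<eta> v) \<delta> = dF \<zeta> (\<eta>, v) (\<delta>, 0)"
  unfolding Dm_def frechet_derivative_at[OF HJ_has_derivative(2), symmetric]
  by (subst bounded_linear_Blinfun_apply[OF has_derivative_bounded_linear[OF HJ_has_derivative(2)]]) simp_all

lemma dF_split: "(\<eta>, v) \<in> udom D \<Longrightarrow> dF \<zeta> (\<eta>, v) (\<delta>, w) = blinfun_apply (Dm S D \<zeta> \<eta> v) \<delta> + blinfun_apply (DV S D \<zeta> \<eta> v) w"
  using linear_add[OF has_derivative_linear[OF F_has_derivative], of "(\<eta>, v)" \<zeta> "(\<delta>, 0)" "(0, w)"]
  by (simp add: DV_apply Dm_apply)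

subsection \<open>Critical points of the augmented Hamiltonian on the slice\<close>

lemma dF_eq_dM:
  assumes x: "x \<in> udom D"
  shows "dF \<zeta> x \<delta> = dM S (augmented S \<zeta>) (Psi D x) (TPsi S D x \<delta>)"
proof -
  have P: "differentiable_map_at model_atlas (atlM S) (Psi D) x"
    by (rule smooth_map_differentiable[OF topological_atlas_model atlas_M Psi_smooth open_udom x])
  have "(\<lambda>x. augmented S \<zeta> (Psi D x)) = F_slice \<zeta>"
    by (simp add: fun_eq_iff F_slice_def h_slice_def j_slice_def augmented_def)
  then show ?thesis
    using fun_cong[OF differentiable_map_compose(2)[OF topological_atlas_model atlas_M P dM_augmented(1)[OF system, of \<zeta> "Psi D x"]], of \<delta>]
    by (simp add: dF_def dM_def TPsi_def differentiable_map_model(2))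
qed

text \<open>By the transversality of the slice it suffices to test criticality on slice directions and on the
  directions generated by \<open>\<mm>\<close> and \<open>\<qq>\<close>. Along the latter the Hamiltonian is constant, and the derivative
  of the momentum is the coadjoint expression in the residual equations.\<close>

lemma relative_equilibrium_on_slice:
  assumes x: "(\<eta>, v) \<in> udom D"
    and DV: "DV S D \<zeta> \<eta> v = 0" and Dm: "Dm S D \<zeta> \<eta> v = 0"
    and q: "\<And>\<theta>. \<theta> \<in> qq D \<Longrightarrow> coad S \<zeta> (jj S D \<eta> v) \<theta> = 0"
    and m: "coad S \<zeta> (jj S D \<eta> v) o\<^sub>L inm D = 0"
  shows "relative_equilibrium S (Psi D (\<eta>, v)) \<zeta>"
  unfolding relative_equilibrium_iff_critical[OF system]
proof
  fix u
  let ?p = "Psi D (\<eta>, v)"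
  obtain b \<gamma> \<delta> where u: "\<gamma> \<in> qq D" "u = inf_gen S (inm D b + \<gamma>) ?p + TPsi S D (\<eta>, v) \<delta>"
    using slice_transversal[OF x] by blast
  have l: "linear (dM S (augmented S \<zeta>) ?p)"
    unfolding dM_def by (rule bounded_linear.linear[OF bounded_linear_tangent_map[OF dM_augmented(1)[OF system]]])
  have "blinfun_apply (coad S \<zeta> (jj S D \<eta> v) o\<^sub>L inm D) b = 0" unfolding m by simp
  then have "coad S \<zeta> (mom S ?p) (inm D b + \<gamma>) = 0"
    using q[OF u(1)] by (simp add: blinfun.add_right jj_def)
  then have 1: "dM S (augmented S \<zeta>) ?p (inf_gen S (inm D b + \<gamma>) ?p) = 0"
    unfolding dM_augmented(2)[OF system] dM_ham_inf_gen[OF system] dM_mom_inf_gen[OF system] by simp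
  have "dF \<zeta> (\<eta>, v) \<delta> = 0" using dF_split[OF x, of \<zeta> "fst \<delta>" "snd \<delta>"] DV Dm by simp
  then have 2: "dM S (augmented S \<zeta>) ?p (TPsi S D (\<eta>, v) \<delta>) = 0" by (simp add: dF_eq_dM[OF x])
  show "dM S (augmented S \<zeta>) ?p u = 0" unfolding u(2) linear_add[OF l] 1 2 by simp
qed

lemma DV_zero_if_relative_equilibrium:
  assumes x: "(\<eta>, v) \<in> udom D" and r: "relative_equilibrium S (Psi D (\<eta>, v)) \<zeta>"
  shows "DV S D \<zeta> \<eta> v = 0"
  by (rule blinfun_eqI)
    (use r in \<open>simp add: DV_apply[OF x] dF_eq_dM[OF x] relative_equilibrium_iff_critical[OF system]\<close>)

subsection \<open>Equivariance of the slice derivatives\<close>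

text \<open>The dual of the linear action on the slice.\<close>

definition dact :: "'a \<Rightarrow> ('v \<Rightarrow>\<^sub>L real) \<Rightarrow> ('v \<Rightarrow>\<^sub>L real)" where
  "dact g \<phi> = Blinfun (\<lambda>w. \<phi> (lin D (inv\<^bsub>grp S\<^esub> g) w))"

lemma dact_apply: "g \<in> \<Gamma> \<Longrightarrow> blinfun_apply (dact g \<phi>) w = \<phi> (lin D (inv\<^bsub>grp S\<^esub> g) w)"
  unfolding dact_def
  by (subst bounded_linear_Blinfun_apply)
    (auto intro: bounded_linear_compose[OF blinfun.bounded_linear_right bounded_linear_lin] Gamma_inv)

lemma bounded_linear_dact: "g \<in> \<Gamma> \<Longrightarrow> bounded_linear (dact g)"
proof -
  assume g: "g \<in> \<Gamma>"
  show ?thesis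
  proof (rule bounded_linear_intro[where K = 1])
    show "dact g (\<phi> + \<psi>) = dact g \<phi> + dact g \<psi>" for \<phi> \<psi>
      by (rule blinfun_eqI) (simp add: dact_apply[OF g] blinfun.add_left)
    show "dact g (r *\<^sub>R \<phi>) = r *\<^sub>R dact g \<phi>" for r \<phi>
      by (rule blinfun_eqI) (simp add: dact_apply[OF g] blinfun.scaleR_left)
    show "norm (dact g \<phi>) \<le> norm \<phi> * 1" for \<phi>
    proof (rule norm_blinfun_bound)
      show "norm (blinfun_apply (dact g \<phi>) w) \<le> norm \<phi> * 1 * norm w" for w
        using norm_blinfun[of \<phi> "lin D (inv\<^bsub>grp S\<^esub> g) w"] by (simp add: dact_apply[OF g] norm_lin Gamma_inv[OF g])
    qed simp
  qed
qed

lemma dF_equivariant: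
  assumes g: "g \<in> \<Gamma>" and x: "(\<eta>, v) \<in> udom D"
  shows "dF (Ad S g \<zeta>) (coAd_m S D g \<eta>, lin D g v) (coAd_m S D g \<delta>, lin D g w) = dF \<zeta> (\<eta>, v) (\<delta>, w)"
proof -
  let ?\<sigma> = "\<lambda>z. (coAd_m S D g (fst z), lin D g (snd z))"
  have "bounded_linear ?\<sigma>"
    by (intro bounded_linear_Pair bounded_linear_compose[OF bounded_linear_coAd_m[OF g] bounded_linear_fst]
        bounded_linear_compose[OF bounded_linear_lin[OF g] bounded_linear_snd])
  then have A: "(?\<sigma> has_derivative ?\<sigma>) (at (\<eta>, v))" by (rule bounded_linear_imp_has_derivative)
  have "?\<sigma> (\<eta>, v) \<in> udom D" using slice_act(1)[OF g x] by simp
  from diff_chain_at[OF A F_has_derivative[OF this]]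
  have 1: "(F_slice (Ad S g \<zeta>) \<circ> ?\<sigma> has_derivative dF (Ad S g \<zeta>) (?\<sigma> (\<eta>, v)) \<circ> ?\<sigma>) (at (\<eta>, v))" .
  have "(F_slice \<zeta> has_derivative dF (Ad S g \<zeta>) (?\<sigma> (\<eta>, v)) \<circ> ?\<sigma>) (at (\<eta>, v))"
  proof (rule has_derivative_transform_within_open[OF 1 open_udom x])
    fix z assume "z \<in> udom D"
    then show "(F_slice (Ad S g \<zeta>) \<circ> ?\<sigma>) z = F_slice \<zeta> z"
      using HJ_equivariant[OF g, of "fst z" "snd z" \<zeta>] by (simp add: HJ_eq)
  qed
  from fun_cong[OF has_derivative_unique[OF this F_has_derivative[OF x]], of "(\<delta>, w)"] show ?thesis by simp
qed

lemma DV_equivariant: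
  assumes g: "g \<in> \<Gamma>" and x: "(\<eta>, v) \<in> udom D"
  shows "DV S D (Ad S g \<zeta>) (coAd_m S D g \<eta>) (lin D g v) = dact g (DV S D \<zeta> \<eta> v)"
proof (rule blinfun_eqI)
  fix w
  have "coAd_m S D g 0 = 0" using bounded_linear_coAd_m[OF g] by (simp add: linear_simps)
  then show "blinfun_apply (DV S D (Ad S g \<zeta>) (coAd_m S D g \<eta>) (lin D g v)) w = blinfun_apply (dact g (DV S D \<zeta> \<eta> v)) w"
    using dF_equivariant[OF g x, of \<zeta> 0 "lin D (inv\<^bsub>grp S\<^esub> g) w"]
    by (simp add: DV_apply[OF slice_act(1)[OF g x]] DV_apply[OF x] dact_apply[OF g] lin_inv[OF g])
qed

lemma Dm_zero_equivariant:
  assumes g: "g \<in> \<Gamma>" and x: "(\<eta>, v) \<in> udom D" and Dm: "Dm S D \<zeta> \<eta> v = 0"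
  shows "Dm S D (Ad S g \<zeta>) (coAd_m S D g \<eta>) (lin D g v) = 0"
proof (rule blinfun_eqI)
  fix \<delta>
  have "lin D g 0 = 0" using bounded_linear_lin[OF g] by (simp add: linear_simps)
  moreover have "dF \<zeta> (\<eta>, v) (coAd_m S D (inv\<^bsub>grp S\<^esub> g) \<delta>, 0) = 0"
    using Dm_apply[OF x, of \<zeta> "coAd_m S D (inv\<^bsub>grp S\<^esub> g) \<delta>"] Dm by simp
  ultimately show "blinfun_apply (Dm S D (Ad S g \<zeta>) (coAd_m S D g \<eta>) (lin D g v)) \<delta> = blinfun_apply 0 \<delta>"
    using dF_equivariant[OF g x, of \<zeta> "coAd_m S D (inv\<^bsub>grp S\<^esub> g) \<delta>" 0]
    by (simp add: Dm_apply[OF slice_act(1)[OF g x]] coAd_m_inv[OF g])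
qed

subsection \<open>The linearised operator\<close>

lemma L_has_derivative: "(DV S D (gen D) 0 has_derivative LL S D) (at 0)"
  and L_symmetric: "blinfun_apply (LL S D v) w = blinfun_apply (LL S D w) v"
proof -
  let ?f = "HJ S D (gen D) 0"
  define U where "U = {v. (0, v) \<in> udom D}"
  have "open ((\<lambda>v. (0, v)) -` udom D)" by (rule open_vimage[OF open_udom]) (intro continuous_intros)
  then have U: "open U" "0 \<in> U" using udom0 by (simp_all add: U_def vimage_def)
  have "smooth_on U (\<lambda>v. F_slice (gen D) (0, v))"
    by (rule smooth_on_compose[OF U(1) open_udom _ smooth_on_Pair[OF U(1) smooth_on_const
            smooth_on_bounded_linear[OF U(1) bounded_linear_ident]] smooth_F]) (auto simp: U_def)
  then have f: "smooth_on U ?f" by (simp add: HJ_eq[abs_def])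
  note D = has_derivative_Blinfun_derivative[OF U f]
  have DV: "DV S D (gen D) 0 = (\<lambda>x. Blinfun (frechet_derivative ?f (at x)))" by (simp add: DV_def fun_eq_iff)
  have LL: "LL S D = (\<lambda>h. Blinfun (\<lambda>u. frechet_derivative (\<lambda>x. frechet_derivative ?f (at x) u) (at 0) h))"
    unfolding LL_def DV by (rule frechet_derivative_at[OF D(1), symmetric])
  show "(DV S D (gen D) 0 has_derivative LL S D) (at 0)" unfolding LL DV by (rule D(1))
  show "blinfun_apply (LL S D v) w = blinfun_apply (LL S D w) v"
    unfolding LL bounded_linear_Blinfun_apply[OF D(2)] by (rule second_derivative_symmetric[OF U f])
qed

lemma bounded_linear_L: "bounded_linear (LL S D)"
  using L_has_derivative by (rule has_derivative_bounded_linear)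

lemma L_equivariant:
  assumes g: "g \<in> \<Gamma>"
  shows "LL S D (lin D g v) = dact g (LL S D v)"
proof -
  have z: "coAd_m S D g 0 = 0" "lin D g 0 = 0"
    using bounded_linear_coAd_m[OF g] bounded_linear_lin[OF g] by (simp_all add: linear_simps)
  have A: "(lin D g has_derivative lin D g) (at 0)" by (rule bounded_linear_imp_has_derivative[OF bounded_linear_lin[OF g]])
  have "(DV S D (gen D) 0 has_derivative LL S D) (at (lin D g 0))" unfolding z by (rule L_has_derivative)
  from diff_chain_at[OF A this]
  have 1: "(DV S D (gen D) 0 \<circ> lin D g has_derivative LL S D \<circ> lin D g) (at 0)" .
  define U where "U = {v. (0, v) \<in> udom D}"
  have "open ((\<lambda>v. (0, v)) -` udom D)" by (rule open_vimage[OF open_udom]) (intro continuous_intros)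
  then have U: "open U" "0 \<in> U" using udom0 by (simp_all add: U_def vimage_def)
  have xi: "Ad S g (gen D) = gen D" using g by (simp add: Gamma_iff)
  have 2: "((\<lambda>v. dact g (DV S D (gen D) 0 v)) has_derivative LL S D \<circ> lin D g) (at 0)"
  proof (rule has_derivative_transform_within_open[OF 1 U])
    fix v assume "v \<in> U"
    then have "(0, v) \<in> udom D" by (simp add: U_def)
    from DV_equivariant[OF g this, of "gen D"]
    show "(DV S D (gen D) 0 \<circ> lin D g) v = dact g (DV S D (gen D) 0 v)" unfolding xi z by simp
  qed
  have "((\<lambda>v. dact g (DV S D (gen D) 0 v)) has_derivative (\<lambda>v. dact g (LL S D v))) (at 0)"
    by (rule bounded_linear.has_derivative[OF bounded_linear_dact[OF g] L_has_derivative])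
  from fun_cong[OF has_derivative_unique[OF 2 this], of v] show ?thesis by simp
qed

lemma subspace_kerL: "subspace (kerL S D)" and closed_kerL: "closed (kerL S D)"
proof -
  interpret L: bounded_linear "LL S D" by (rule bounded_linear_L)
  show "subspace (kerL S D)" by (simp add: subspace_def kerL_def L.add L.scaleR L.zero)
  show "closed (kerL S D)" unfolding kerL_def
    by (intro closed_Collect_eq linear_continuous_on bounded_linear_L continuous_on_const)
qed

lemma lin_kerL: "g \<in> \<Gamma> \<Longrightarrow> w \<in> kerL S D \<Longrightarrow> lin D g w \<in> kerL S D"
  unfolding kerL_def using bounded_linear_dact[of g] by (simp add: L_equivariant linear_simps)

lemma lin_kerL_image: "g \<in> \<Gamma> \<Longrightarrow> lin D g ` kerL S D = kerL S D"
proof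
  assume g: "g \<in> \<Gamma>"
  show "lin D g ` kerL S D \<subseteq> kerL S D" using lin_kerL[OF g] by blast
  show "kerL S D \<subseteq> lin D g ` kerL S D"
  proof
    fix w assume "w \<in> kerL S D"
    then have "lin D (inv\<^bsub>grp S\<^esub> g) w \<in> kerL S D" by (rule lin_kerL[OF Gamma_inv[OF g]])
    then show "w \<in> lin D g ` kerL S D" using lin_inv(2)[OF g, of w] by (metis imageI)
  qed
qed

lemma V2: "internal_sum UNIV (range (LL S D)) (V2 D)" and closed_range_L: "closed (range (LL S D))"
  and V1: "internal_sum UNIV (kerL S D) (V1 D)"
  and lin_V1: "g \<in> \<Gamma> \<Longrightarrow> v \<in> V1 D \<Longrightarrow> lin D g v \<in> V1 D"
  and dact_V2: "g \<in> \<Gamma> \<Longrightarrow> \<phi> \<in> V2 D \<Longrightarrow> dact g \<phi> \<in> V2 D"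
  and v1_solution: "implicit_solution {(\<eta>, v0, \<alpha>). v0 \<in> kerL S D \<and> \<alpha> \<in> lie_algebra S (G_me S D)} (V1 D)
       (\<lambda>(\<eta>, v0, \<alpha>) y. let \<phi> = DV S D (om2 D \<eta> (v0 + y) \<alpha>) \<eta> (v0 + y) in \<phi> - PP S D \<phi> = 0)
       (v1 D)"
proof -
  note s = step3[unfolded step3_def]
  show "internal_sum UNIV (range (LL S D)) (V2 D)" "internal_sum UNIV (kerL S D) (V1 D)" using s by blast+
  show "closed (range (LL S D))" using s unfolding fredholm_def by blast
  show "lin D g v \<in> V1 D" if "g \<in> \<Gamma>" "v \<in> V1 D" using s that by blast
  show "dact g \<phi> \<in> V2 D" if "g \<in> \<Gamma>" "\<phi> \<in> V2 D" using s that unfolding dact_def by blast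
  show "implicit_solution {(\<eta>, v0, \<alpha>). v0 \<in> kerL S D \<and> \<alpha> \<in> lie_algebra S (G_me S D)} (V1 D)
       (\<lambda>(\<eta>, v0, \<alpha>) y. let \<phi> = DV S D (om2 D \<eta> (v0 + y) \<alpha>) \<eta> (v0 + y) in \<phi> - PP S D \<phi> = 0)
       (v1 D)" using s by (elim conjE)
qed

lemma PP_unique:
  assumes a: "a \<in> V2 D" "\<phi> - a \<in> range (LL S D)"
  shows "PP S D \<phi> = a"
  unfolding PP_def
proof (rule the_equality)
  fix b assume b: "b \<in> V2 D \<and> \<phi> - b \<in> range (LL S D)"
  have ss: "subspace (range (LL S D))" "subspace (V2 D)" "range (LL S D) \<inter> V2 D = {0}"
    using V2 by (simp_all add: internal_sum_def)
  have "b - a \<in> V2 D" using b a ss(2) by (simp add: subspace_diff)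
  moreover have "(\<phi> - a) - (\<phi> - b) \<in> range (LL S D)" by (rule subspace_diff[OF ss(1) a(2) conjunct2[OF b]])
  ultimately have "b - a \<in> range (LL S D) \<inter> V2 D" by simp
  then show "b = a" using ss(3) by simp
qed (use a in simp)

lemma PP_mem: "PP S D \<phi> \<in> V2 D" and PP_diff: "\<phi> - PP S D \<phi> \<in> range (LL S D)"
proof -
  have "\<phi> \<in> {y + z | y z. y \<in> range (LL S D) \<and> z \<in> V2 D}" using V2 unfolding internal_sum_def by blast
  then obtain y z where yz: "\<phi> = y + z" "y \<in> range (LL S D)" "z \<in> V2 D" by blast
  then have "PP S D \<phi> = z" by (intro PP_unique) simp_all
  then show "PP S D \<phi> \<in> V2 D" "\<phi> - PP S D \<phi> \<in> range (LL S D)" using yz by simp_all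
qed

text \<open>By symmetry the range annihilates the kernel, so the projection is invisible on the kernel.\<close>

lemma PP_apply_kerL: "w \<in> kerL S D \<Longrightarrow> blinfun_apply (PP S D \<phi>) w = \<phi> w"
proof -
  assume w: "w \<in> kerL S D"
  obtain v where "\<phi> - PP S D \<phi> = LL S D v" using PP_diff[of \<phi>] by blast
  then have "(\<phi> - PP S D \<phi>) w = LL S D w v" using L_symmetric[of v w] by simp
  also have "\<dots> = 0" using w by (simp add: kerL_def)
  finally show ?thesis by (simp add: blinfun.diff_left)
qed

text \<open>A functional vanishing on the kernel lies in the range, which meets \<open>V2 D\<close> only in zero.\<close>

lemma V2_separated: "\<phi> \<in> V2 D \<Longrightarrow> (\<And>w. w \<in> kerL S D \<Longrightarrow> blinfun_apply \<phi> w = 0) \<Longrightarrow> \<phi> = 0"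
proof -
  assume \<phi>: "\<phi> \<in> V2 D" "\<And>w. w \<in> kerL S D \<Longrightarrow> blinfun_apply \<phi> w = 0"
  have "\<phi> \<in> range (LL S D)"
    by (rule symmetric_closed_range[OF bounded_linear.linear[OF bounded_linear_L] L_symmetric closed_range_L])
      (use \<phi>(2) in \<open>simp add: kerL_def\<close>)
  then show ?thesis using V2 \<phi>(1) unfolding internal_sum_def by blast
qed

lemma PP_equivariant:
  assumes g: "g \<in> \<Gamma>"
  shows "PP S D (dact g \<phi>) = dact g (PP S D \<phi>)"
proof (rule PP_unique)
  show "dact g (PP S D \<phi>) \<in> V2 D" by (rule dact_V2[OF g PP_mem])
  obtain v where "\<phi> - PP S D \<phi> = LL S D v" using PP_diff[of \<phi>] by blast
  then have "dact g \<phi> - dact g (PP S D \<phi>) = LL S D (lin D g v)"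
    using bounded_linear_dact[OF g] by (simp add: L_equivariant[OF g] flip: linear_simps(2))
  then show "dact g \<phi> - dact g (PP S D \<phi>) \<in> range (LL S D)" by simp
qed

subsection \<open>The implicitly defined functions at \<open>\<alpha> = 0\<close>\<close>

lemma zero_in_lie_algebra: "0 \<in> lie_algebra S (G_me S D)"
  by (rule lie_algebra_zero[OF lie]) (simp add: G_me_def stabilizer_def act_one[OF system])

lemma gam_solution:
  "implicit_solution UNIV (qq D)
     (\<lambda>(\<eta>, v, b) \<gamma>. \<forall>\<zeta>\<in>qq D. coad S (gen D + inm D b + \<gamma>) (jj S D \<eta> v) \<zeta> = 0)
     (\<lambda>(\<eta>, v, b). gam D (\<eta>, v, 0, b))"
proof -
  let ?L = "\<lambda>z::('m \<Rightarrow>\<^sub>L real) \<times> 'v \<times> 'm. (fst z, fst (snd z), 0::'g, snd (snd z))"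
  have "bounded_linear ?L"
    by (intro bounded_linear_Pair bounded_linear_fst bounded_linear_zero
        bounded_linear_compose[OF bounded_linear_fst bounded_linear_snd] bounded_linear_compose[OF bounded_linear_snd bounded_linear_snd])
  from implicit_solution_linear_substitution[OF step1[unfolded step1_def] this, of UNIV]
  show ?thesis using zero_in_lie_algebra by (simp add: case_prod_unfold)
qed

lemma bet_solution:
  "implicit_solution UNIV UNIV (\<lambda>(\<eta>, v) b. Dm S D (om1 D \<eta> v 0 b) \<eta> v = 0) (\<lambda>(\<eta>, v). bet D (\<eta>, v, 0))"
proof -
  let ?L = "\<lambda>z::('m \<Rightarrow>\<^sub>L real) \<times> 'v. (fst z, snd z, 0::'g)"
  have "bounded_linear ?L"
    by (intro bounded_linear_Pair bounded_linear_fst bounded_linear_zero bounded_linear_snd)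
  from implicit_solution_linear_substitution[OF step2[unfolded step2_def] this, of UNIV]
  show ?thesis using zero_in_lie_algebra by (simp add: case_prod_unfold)
qed

lemma v1_solution0:
  "implicit_solution (UNIV \<times> kerL S D) (V1 D)
     (\<lambda>(\<eta>, v0) y. DV S D (om2 D \<eta> (v0 + y) 0) \<eta> (v0 + y) - PP S D (DV S D (om2 D \<eta> (v0 + y) 0) \<eta> (v0 + y)) = 0)
     (\<lambda>(\<eta>, v0). v1 D (\<eta>, v0, 0))"
proof -
  let ?L = "\<lambda>z::('m \<Rightarrow>\<^sub>L real) \<times> 'v. (fst z, snd z, 0::'g)"
  have "bounded_linear ?L"
    by (intro bounded_linear_Pair bounded_linear_fst bounded_linear_zero bounded_linear_snd)
  from implicit_solution_linear_substitution[OF v1_solution this, of "UNIV \<times> kerL S D"]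
  show ?thesis using zero_in_lie_algebra by (simp add: case_prod_unfold Let_def mem_Times_iff)
qed

lemma zero_mem_domain: "0 \<in> UNIV \<times> kerL S D"
  using subspace_0[OF subspace_kerL] by (simp add: zero_prod_def)

lemma eventually_udom: "\<forall>\<^sub>F z in nhds 0. z \<in> udom D"
  using eventually_nhds_in_open[OF open_udom] udom0 by (simp add: zero_prod_def)

text \<open>The group acts on the triples \<open>(\<eta>, v, b)\<close> and on \<open>\<qq>\<close>, and it fixes the generator; so it permutes the
  solutions of the first equation.\<close>

lemma gam_equivariant:
  "\<forall>\<^sub>F z in nhds 0. \<forall>g\<in>\<Gamma>. case z of (\<eta>, v, b) \<Rightarrow>
     gam D (coAd_m S D g \<eta>, lin D g v, 0, Ad_m g b) = Ad S g (gam D (\<eta>, v, 0, b))"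
proof -
  let ?\<sigma> = "\<lambda>g. map_prod (coAd_m S D g) (map_prod (lin D g) (Ad_m g))"
  let ?eqn = "\<lambda>(\<eta>, v, b) \<gamma>. \<forall>\<zeta>\<in>qq D. coad S (gen D + inm D b + \<gamma>) (jj S D \<eta> v) \<zeta> = 0"
  have \<sigma>: "equicontinuous_at_zero \<Gamma> ?\<sigma>"
    by (intro equicontinuous_at_zero_prod equicontinuous_coAd_m equicontinuous_lin equicontinuous_Ad_m)
  have ud: "\<forall>\<^sub>F z in nhds (0::('m \<Rightarrow>\<^sub>L real) \<times> 'v \<times> 'm). (fst z, fst (snd z)) \<in> udom D"
    by (rule filterlim_nhds_zero[OF _ eventually_udom])
      (intro bounded_linear_Pair bounded_linear_fst bounded_linear_compose[OF bounded_linear_fst bounded_linear_snd])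
  have key: "?eqn (?\<sigma> g z) (Ad S g \<gamma>)"
    if z: "(fst z, fst (snd z)) \<in> udom D" and g: "g \<in> \<Gamma>" and eqn: "?eqn z \<gamma>" for z \<gamma> g
  proof -
    obtain \<eta> v b where [simp]: "z = (\<eta>, v, b)" by (cases z) auto
    have lA: "linear (Ad S g)" by (rule bounded_linear.linear[OF bounded_linear_Ad[OF lie]])
    have gen: "gen D + inm D (Ad_m g b) + Ad S g \<gamma> = Ad S g (gen D + inm D b + \<gamma>)"
      using g by (simp add: linear_add[OF lA] Ad_inm Gamma_iff)
    have "coad S (gen D + inm D (Ad_m g b) + Ad S g \<gamma>) (jj S D (coAd_m S D g \<eta>) (lin D g v)) \<zeta> = 0" if "\<zeta> \<in> qq D" for \<zeta>
      unfolding gen using z eqn Ad_qq[OF Gamma_inv[OF g] that]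
      by (simp add: jj_equivariant[OF g] coad_coAd[OF lie] coAd_apply[OF lie])
    then show ?thesis by simp
  qed
  have "\<forall>\<^sub>F z in nhds 0. \<forall>\<gamma> g. g \<in> \<Gamma> \<longrightarrow> z \<in> UNIV \<longrightarrow> \<gamma> \<in> qq D \<longrightarrow>
      \<gamma> = (\<lambda>(\<eta>, v, b). gam D (\<eta>, v, 0, b)) z \<longrightarrow> ?eqn z \<gamma> \<longrightarrow> ?eqn (?\<sigma> g z) (Ad S g \<gamma>)"
    using ud
  proof eventually_elim
    case (elim z)
    show ?case by (intro allI impI) (rule key[OF elim])
  qed
  from implicit_solution_equivariant[OF gam_solution UNIV_I \<sigma> UNIV_I equicontinuous_Ad Ad_qq this]
  show ?thesis by (rule eventually_mono) (auto simp: map_prod_def case_prod_unfold)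
qed

lemma om1_equivariant:
  "\<forall>\<^sub>F z in nhds 0. \<forall>g\<in>\<Gamma>. case z of (\<eta>, v, b) \<Rightarrow>
     om1 D (coAd_m S D g \<eta>) (lin D g v) 0 (Ad_m g b) = Ad S g (om1 D \<eta> v 0 b)"
  using gam_equivariant
proof (rule eventually_mono, intro ballI)
  fix z and g assume *: "\<forall>g\<in>\<Gamma>. case z of (\<eta>, v, b) \<Rightarrow>
     gam D (coAd_m S D g \<eta>, lin D g v, 0, Ad_m g b) = Ad S g (gam D (\<eta>, v, 0, b))" and g: "g \<in> \<Gamma>"
  have lA: "linear (Ad S g)" by (rule bounded_linear.linear[OF bounded_linear_Ad[OF lie]])
  show "case z of (\<eta>, v, b) \<Rightarrow> om1 D (coAd_m S D g \<eta>) (lin D g v) 0 (Ad_m g b) = Ad S g (om1 D \<eta> v 0 b)"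
    using bspec[OF * g] g by (cases z) (simp add: om1_def linear_add[OF lA] Ad_inm Gamma_iff)
qed

text \<open>The function \<open>bet D\<close> tends to zero at the origin, so local statements about the first step survive the
  substitution of the second.\<close>

lemma eventually_with_bet:
  assumes "\<forall>\<^sub>F z in nhds 0. P z"
  shows "\<forall>\<^sub>F z in nhds 0. P (fst z, snd z, bet D (fst z, snd z, 0))"
proof -
  have "bounded_linear (\<lambda>z::(('m \<Rightarrow>\<^sub>L real) \<times> 'v) \<times> 'm. (fst (fst z), snd (fst z), snd z))"
    by (intro bounded_linear_Pair bounded_linear_snd
        bounded_linear_compose[OF bounded_linear_fst bounded_linear_fst] bounded_linear_compose[OF bounded_linear_snd bounded_linear_fst])
  from filterlim_nhds_zero[OF this assms]
  have "\<forall>\<^sub>F z in nhds (0::(('m \<Rightarrow>\<^sub>L real) \<times> 'v) \<times> 'm). P (fst (fst z), snd (fst z), snd z)" .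
  from implicit_solution_tendsto_graph[OF bet_solution UNIV_I this]
  show ?thesis by (simp add: case_prod_unfold)
qed

lemma bet_equivariant:
  "\<forall>\<^sub>F z in nhds 0. \<forall>g\<in>\<Gamma>. bet D (coAd_m S D g (fst z), lin D g (snd z), 0) = Ad_m g (bet D (fst z, snd z, 0))"
proof -
  let ?\<sigma> = "\<lambda>g. map_prod (coAd_m S D g) (lin D g)"
  let ?eqn = "\<lambda>(\<eta>, v) b. Dm S D (om1 D \<eta> v 0 b) \<eta> v = 0"
  have \<sigma>: "equicontinuous_at_zero \<Gamma> ?\<sigma>"
    by (intro equicontinuous_at_zero_prod equicontinuous_coAd_m equicontinuous_lin)
  from eventually_with_bet[OF om1_equivariant] eventually_udom
  have "\<forall>\<^sub>F z in nhds 0. \<forall>b g. g \<in> \<Gamma> \<longrightarrow> z \<in> UNIV \<longrightarrow> b \<in> UNIV \<longrightarrow>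
      b = (\<lambda>(\<eta>, v). bet D (\<eta>, v, 0)) z \<longrightarrow> ?eqn z b \<longrightarrow> ?eqn (?\<sigma> g z) (Ad_m g b)"
  proof eventually_elim
    case (elim z)
    obtain \<eta> v where z: "z = (\<eta>, v)" by (cases z)
    show ?case
      using elim Dm_zero_equivariant[of _ \<eta> v] by (simp add: z)
  qed
  from implicit_solution_equivariant[OF bet_solution UNIV_I \<sigma> UNIV_I equicontinuous_Ad_m UNIV_I this]
  show ?thesis by (rule eventually_mono) (auto simp: map_prod_def case_prod_unfold)
qed

lemma om2_equivariant:
  "\<forall>\<^sub>F z in nhds 0. \<forall>g\<in>\<Gamma>. om2 D (coAd_m S D g (fst z)) (lin D g (snd z)) 0 = Ad S g (om2 D (fst z) (snd z) 0)"
  using bet_equivariant eventually_with_bet[OF om1_equivariant]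
  by eventually_elim (simp add: om2_def)

lemma eventually_with_v1:
  assumes "\<forall>\<^sub>F z in nhds 0. P z"
  shows "\<forall>\<^sub>F z in nhds 0. snd z \<in> kerL S D \<longrightarrow> P (fst z, snd z + v1 D (fst z, snd z, 0))"
proof -
  have "bounded_linear (\<lambda>z::(('m \<Rightarrow>\<^sub>L real) \<times> 'v) \<times> 'v. (fst (fst z), snd (fst z) + snd z))"
    by (intro bounded_linear_Pair bounded_linear_add bounded_linear_snd
        bounded_linear_compose[OF bounded_linear_fst bounded_linear_fst] bounded_linear_compose[OF bounded_linear_snd bounded_linear_fst])
  from filterlim_nhds_zero[OF this assms]
  have "\<forall>\<^sub>F z in nhds (0::(('m \<Rightarrow>\<^sub>L real) \<times> 'v) \<times> 'v). P (fst (fst z), snd (fst z) + snd z)" .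
  from implicit_solution_tendsto_graph[OF v1_solution0 zero_mem_domain this]
  show ?thesis by (simp add: case_prod_unfold mem_Times_iff)
qed

lemma v1_equivariant:
  "\<forall>\<^sub>F z in nhds 0. snd z \<in> kerL S D \<longrightarrow>
     (\<forall>g\<in>\<Gamma>. v1 D (coAd_m S D g (fst z), lin D g (snd z), 0) = lin D g (v1 D (fst z, snd z, 0)))"
proof -
  let ?\<sigma> = "\<lambda>g. map_prod (coAd_m S D g) (lin D g)"
  let ?\<phi> = "\<lambda>\<eta> v. DV S D (om2 D \<eta> v 0) \<eta> v"
  let ?eqn = "\<lambda>(\<eta>, v0) y. ?\<phi> \<eta> (v0 + y) - PP S D (?\<phi> \<eta> (v0 + y)) = 0"
  have \<sigma>: "equicontinuous_at_zero \<Gamma> ?\<sigma>"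
    by (intro equicontinuous_at_zero_prod equicontinuous_coAd_m equicontinuous_lin)
  have \<sigma>X: "?\<sigma> g z \<in> UNIV \<times> kerL S D" if "g \<in> \<Gamma>" "z \<in> UNIV \<times> kerL S D" for g z
    using that lin_kerL by (cases z) simp
  from eventually_with_v1[OF om2_equivariant] eventually_with_v1[OF eventually_udom]
  have "\<forall>\<^sub>F z in nhds 0. \<forall>y g. g \<in> \<Gamma> \<longrightarrow> z \<in> UNIV \<times> kerL S D \<longrightarrow> y \<in> V1 D \<longrightarrow>
      y = (\<lambda>(\<eta>, v0). v1 D (\<eta>, v0, 0)) z \<longrightarrow> ?eqn z y \<longrightarrow> ?eqn (?\<sigma> g z) (lin D g y)"
  proof eventually_elim
    case (elim z)
    obtain \<eta> v0 where z: "z = (\<eta>, v0)" by (cases z)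
    show ?case
    proof (intro allI impI)
      fix y g
      assume g: "g \<in> \<Gamma>" and zX: "z \<in> UNIV \<times> kerL S D" and y: "y = (\<lambda>(\<eta>, v0). v1 D (\<eta>, v0, 0)) z" and eqn: "?eqn z y"
      have ll: "linear (lin D g)" by (rule bounded_linear.linear[OF bounded_linear_lin[OF g]])
      have k: "v0 \<in> kerL S D" using zX z by simp
      have "om2 D (coAd_m S D g \<eta>) (lin D g (v0 + y)) 0 = Ad S g (om2 D \<eta> (v0 + y) 0)" "(\<eta>, v0 + y) \<in> udom D"
        using elim k g by (simp_all add: z y)
      then have *: "?\<phi> (coAd_m S D g \<eta>) (lin D g (v0 + y)) = dact g (?\<phi> \<eta> (v0 + y))"
        by (simp add: DV_equivariant[OF g])
      have "?\<phi> \<eta> (v0 + y) = PP S D (?\<phi> \<eta> (v0 + y))" using eqn by (simp add: z)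
      then have "?\<phi> (coAd_m S D g \<eta>) (lin D g (v0 + y)) - PP S D (?\<phi> (coAd_m S D g \<eta>) (lin D g (v0 + y))) = 0"
        unfolding * PP_equivariant[OF g] by simp
      then show "?eqn (?\<sigma> g z) (lin D g y)" by (simp add: z linear_add[OF ll])
    qed
  qed
  from implicit_solution_equivariant[OF v1_solution0 zero_mem_domain \<sigma> \<sigma>X equicontinuous_lin lin_V1 this]
  show ?thesis by (rule eventually_mono) (auto simp: map_prod_def case_prod_unfold mem_Times_iff)
qed

lemma reduced_point_properties:
  "\<forall>\<^sub>F z in nhds 0. snd z \<in> kerL S D \<longrightarrow> (case z of (\<eta>, v0) \<Rightarrow>
     let v = v0 + v1 D (\<eta>, v0, 0); \<zeta> = Xi D \<eta> v0 0 in
       (\<eta>, v) \<in> udom D \<and> v1 D (\<eta>, v0, 0) \<in> V1 D \<and>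
       (\<forall>\<theta>\<in>qq D. coad S \<zeta> (jj S D \<eta> v) \<theta> = 0) \<and>
       Dm S D \<zeta> \<eta> v = 0 \<and> DV S D \<zeta> \<eta> v = BB S D \<eta> v0 0 \<and>
       (\<forall>g\<in>\<Gamma>. om2 D (coAd_m S D g \<eta>) (lin D g v) 0 = Ad S g (om2 D \<eta> v 0)) \<and>
       (\<forall>g\<in>\<Gamma>. v1 D (coAd_m S D g \<eta>, lin D g v0, 0) = lin D g (v1 D (\<eta>, v0, 0))))"
proof -
  have 1: "\<forall>\<^sub>F z in nhds 0. \<forall>\<theta>\<in>qq D. coad S (om2 D (fst z) (snd z) 0) (jj S D (fst z) (snd z)) \<theta> = 0"
    using eventually_with_bet[OF implicit_solution_solves[OF gam_solution]]
    by (rule eventually_mono) (simp add: om2_def om1_def)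
  have 2: "\<forall>\<^sub>F z in nhds 0. Dm S D (om2 D (fst z) (snd z) 0) (fst z) (snd z) = 0"
    using implicit_solution_solves[OF bet_solution]
    by (rule eventually_mono) (simp add: case_prod_unfold om2_def)
  from eventually_with_v1[OF 1] eventually_with_v1[OF 2] eventually_with_v1[OF eventually_udom]
    implicit_solution_solves[OF v1_solution0] v1_equivariant eventually_with_v1[OF om2_equivariant]
  show ?thesis
    by eventually_elim (simp add: case_prod_unfold Let_def Xi_def BB_def mem_Times_iff)
qed

end

section \<open>Bifurcation diagrams from leading Taylor terms\<close>

text \<open>Smoothness on some neighbourhood, which composes without bookkeeping of domains.\<close>

definition smooth_near :: "('x::real_normed_vector \<Rightarrow> 'y::real_normed_vector) \<Rightarrow> 'x \<Rightarrow> bool" where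
  "smooth_near f x \<longleftrightarrow> (\<exists>N. open N \<and> x \<in> N \<and> smooth_on N f)"

lemma smooth_nearI: "open N \<Longrightarrow> x \<in> N \<Longrightarrow> smooth_on N f \<Longrightarrow> smooth_near f x"
  unfolding smooth_near_def by (intro exI conjI)

lemma smooth_near_bounded_linear: "bounded_linear L \<Longrightarrow> smooth_near L x"
  by (rule smooth_nearI[OF open_UNIV UNIV_I smooth_on_bounded_linear[OF open_UNIV]])

lemma smooth_near_const: "smooth_near (\<lambda>_. c) x"
  by (rule smooth_nearI[OF open_UNIV UNIV_I smooth_on_const])

lemma smooth_near_cong:
  assumes f: "smooth_near f x" and eq: "\<forall>\<^sub>F y in nhds x. f y = g y"
  shows "smooth_near g x"
proof -
  obtain N where N: "open N" "x \<in> N" "smooth_on N f" using f by (auto simp: smooth_near_def)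
  obtain M where M: "open M" "x \<in> M" "\<forall>y\<in>M. f y = g y" using eq unfolding eventually_nhds by blast
  have o: "open (N \<inter> M)" using N(1) M(1) by (rule open_Int)
  have "smooth_on (N \<inter> M) g"
    by (rule smooth_on_cong[OF o _ smooth_on_subset[OF N(3)]]) (use M(3) in auto)
  then show ?thesis by (rule smooth_nearI[OF o, rotated]) (use N(2) M(2) in simp)
qed

lemma smooth_near_common:
  assumes "smooth_near f x" "smooth_near g x"
  obtains N where "open N" "x \<in> N" "smooth_on N f" "smooth_on N g"
proof -
  obtain N M where N: "open N" "x \<in> N" "smooth_on N f" and M: "open M" "x \<in> M" "smooth_on M g"
    using assms by (auto simp: smooth_near_def)
  show ?thesis
    by (rule that[OF open_Int[OF N(1) M(1)] _ smooth_on_subset[OF N(3)] smooth_on_subset[OF M(3)]]) (use N M in auto)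
qed

lemma smooth_near_Pair:
  assumes "smooth_near f x" "smooth_near g x"
  shows "smooth_near (\<lambda>x. (f x, g x)) x"
proof -
  obtain N where N: "open N" "x \<in> N" "smooth_on N f" "smooth_on N g" by (rule smooth_near_common[OF assms])
  show ?thesis by (rule smooth_nearI[OF N(1,2) smooth_on_Pair[OF N(1,3,4)]])
qed

lemma smooth_near_add:
  assumes "smooth_near f x" "smooth_near g x"
  shows "smooth_near (\<lambda>x. f x + g x) x"
proof -
  obtain N where N: "open N" "x \<in> N" "smooth_on N f" "smooth_on N g" by (rule smooth_near_common[OF assms])
  show ?thesis by (rule smooth_nearI[OF N(1,2) smooth_on_add[OF N(1,3,4)]])
qed

lemma smooth_near_diff:
  assumes "smooth_near f x" "smooth_near g x"
  shows "smooth_near (\<lambda>x. f x - g x) x"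
proof -
  obtain N where N: "open N" "x \<in> N" "smooth_on N f" "smooth_on N g" by (rule smooth_near_common[OF assms])
  show ?thesis by (rule smooth_nearI[OF N(1,2) smooth_on_diff[OF N(1,3,4)]])
qed

lemma smooth_near_blinfun_apply:
  fixes w :: "'x::real_normed_vector \<Rightarrow> 'y::{real_normed_vector,complete_space}"
  assumes "smooth_near A x" "smooth_near w x"
  shows "smooth_near (\<lambda>x. blinfun_apply (A x) (w x)) x"
proof -
  obtain N where N: "open N" "x \<in> N" "smooth_on N A" "smooth_on N w" by (rule smooth_near_common[OF assms])
  show ?thesis by (rule smooth_nearI[OF N(1,2) smooth_on_blinfun_apply[OF N(1,3,4)]])
qed

lemma smooth_near_deriv: "smooth_near f x \<Longrightarrow> smooth_near (\<lambda>x. frechet_derivative f (at x) u) x"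
  unfolding smooth_near_def using smooth_on_deriv by blast

lemma smooth_near_compose:
  fixes g :: "'y::{real_normed_vector,complete_space} \<Rightarrow> 'z::real_normed_vector"
  assumes g: "smooth_near g (f x)" and f: "smooth_near f x"
  shows "smooth_near (\<lambda>x. g (f x)) x"
proof -
  obtain N M where N: "open N" "x \<in> N" "smooth_on N f" and M: "open M" "f x \<in> M" "smooth_on M g"
    using assms by (auto simp: smooth_near_def)
  have o: "open (N \<inter> f -` M)" by (rule continuous_open_preimage[OF smooth_on_continuous[OF N(3)] N(1) M(1)])
  have sub: "f ` (N \<inter> f -` M) \<subseteq> M" by blast
  have sN: "smooth_on (N \<inter> f -` M) f" by (rule smooth_on_subset[OF N(3)]) simp
  show ?thesis
    by (rule smooth_nearI[OF o _ smooth_on_compose[OF o M(1) sub sN M(3)]]) (use N(2) M(2) in simp)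
qed

lemma implicit_solution_smooth_near:
  assumes "implicit_solution UNIV Y eqn f"
  shows "smooth_near f 0"
proof -
  obtain N F where N: "open N" "0 \<in> N" "smooth_on N F" "\<And>x. x \<in> N \<Longrightarrow> x \<in> UNIV \<Longrightarrow> F x = f x"
    by (rule implicit_solution_extension[OF assms UNIV_I]) (rule that)
  have "smooth_on N f" by (rule smooth_on_cong[OF N(1) _ N(3)]) (use N(4) in simp)
  then show ?thesis by (rule smooth_nearI[OF N(1,2)])
qed

lemma smooth_near_square:
  fixes f :: "real \<times> real \<Rightarrow> real"
  assumes "smooth_near f (0, 0)"
  obtains d where "d > 0" "smooth_on ({-d<..<d} \<times> {-d<..<d}) f"
proof -
  obtain N where N: "open N" "(0, 0) \<in> N" "smooth_on N f" using assms by (auto simp: smooth_near_def)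
  obtain A B where AB: "open A" "open B" "0 \<in> A" "0 \<in> B" "A \<times> B \<subseteq> N"
    using open_prod_elim[OF N(1,2)] by (metis mem_Times_iff fst_conv snd_conv)
  obtain a where a: "a > 0" "ball 0 a \<subseteq> A" using AB by (meson open_contains_ball)
  obtain b where b: "b > 0" "ball 0 b \<subseteq> B" using AB by (meson open_contains_ball)
  have "{-min a b<..<min a b} \<times> {-min a b<..<min a b} \<subseteq> ball 0 a \<times> ball 0 b"
    by (auto simp: dist_real_def)
  then have "{-min a b<..<min a b} \<times> {-min a b<..<min a b} \<subseteq> N" using a(2) b(2) AB(5) by blast
  then show ?thesis using a(1) b(1) by (intro that[of "min a b"] smooth_on_subset[OF N(3)]) simp_all
qed

lemma eventually_square:
  assumes "\<forall>\<^sub>F z in nhds (0::real, 0::real). P z"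
  obtains d where "d > 0" "\<And>l s. \<bar>l\<bar> < d \<Longrightarrow> \<bar>s\<bar> < d \<Longrightarrow> P (l, s)"
proof -
  obtain Q R where Q: "\<forall>\<^sub>F l in nhds 0. Q l" "\<forall>\<^sub>F s in nhds 0. R s" "\<And>l s. Q l \<Longrightarrow> R s \<Longrightarrow> P (l, s)"
    using assms unfolding nhds_prod eventually_prod_filter by blast
  obtain a b where a: "a > 0" "\<And>l. \<bar>l\<bar> < a \<Longrightarrow> Q l" and b: "b > 0" "\<And>s. \<bar>s\<bar> < b \<Longrightarrow> R s"
    using Q(1,2) by (auto simp: eventually_nhds_metric dist_real_def)
  then show ?thesis using Q(3) by (intro that[of "min a b"]) simp_all
qed

lemma transversal_path_has_derivative:
  assumes "transversal_path P \<kappa> p"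
  shows "(p has_derivative (\<lambda>h. h *\<^sub>R vector_derivative p (at 0))) (at 0)"
proof -
  have "(p has_derivative frechet_derivative p (at 0)) (at 0)"
    by (rule smooth_on_has_derivative[of UNIV]) (use assms in \<open>simp_all add: transversal_path_def\<close>)
  then have "p differentiable (at 0)" by (rule differentiableI)
  then show ?thesis by (simp add: vector_derivative_works has_vector_derivative_def)
qed

text \<open>Along a transversal path, the leading terms in several parameters turn into leading terms in one
  parameter. The weight is constant for the fold and the coordinate itself for the pitchfork.\<close>

lemma expansion_along_path:
  fixes b :: "'x::real_normed_vector \<Rightarrow> real \<Rightarrow> real" and w :: "real \<Rightarrow> real"
  assumes p: "transversal_path P \<kappa> p"
    and H: "\<And>\<epsilon>. \<epsilon> > 0 \<Longrightarrow> \<forall>\<^sub>F z in nhds (0, 0). fst z \<in> P \<longrightarrow>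
      \<bar>b (fst z) (snd z) - w (snd z) * (blinfun_apply \<kappa> (fst z) + c * (snd z)\<^sup>2)\<bar> \<le> \<epsilon> * (\<bar>w (snd z)\<bar> * (norm (fst z) + (snd z)\<^sup>2))"
    and \<epsilon>: "\<epsilon> > 0"
  shows "\<forall>\<^sub>F z in nhds (0, 0).
      \<bar>b (p (fst z)) (snd z) - w (snd z) * (\<kappa> (vector_derivative p (at 0)) * fst z + c * (snd z)\<^sup>2)\<bar>
        \<le> \<epsilon> * (\<bar>w (snd z)\<bar> * (\<bar>fst z\<bar> + (snd z)\<^sup>2))"
proof -
  define a where "a = blinfun_apply \<kappa> (vector_derivative p (at 0))"
  have p0: "p 0 = 0" and pP: "\<And>l. p l \<in> P" using p by (auto simp: transversal_path_def)
  note D = transversal_path_has_derivative[OF p]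
  obtain M where M: "\<forall>\<^sub>F l in at 0. norm (p l - p 0) \<le> M * norm (l - 0)"
    using has_derivative_lipschitz_at[OF D] by blast
  \<comment> \<open>The bound of the path by its parameter; at least one, so that it also dominates the quadratic term.\<close>
  define m where "m = \<bar>M\<bar> + 1"
  have m: "m \<ge> 1" by (simp add: m_def)
  have Mn: "\<forall>\<^sub>F l in nhds 0. norm (p l) \<le> m * \<bar>l\<bar>"
  proof -
    have "norm (p l) \<le> m * \<bar>l\<bar>" if "norm (p l - p 0) \<le> M * norm (l - 0)" for l
    proof -
      have "M * \<bar>l\<bar> \<le> m * \<bar>l\<bar>" by (rule mult_right_mono) (simp_all add: m_def)
      then show ?thesis using that p0 by simp
    qed
    then show ?thesis using M p0 unfolding eventually_at_filter by (auto elim!: eventually_mono)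
  qed
  have DK: "((\<lambda>l. \<kappa> (p l)) has_derivative (\<lambda>h. \<kappa> (h *\<^sub>R vector_derivative p (at 0)))) (at 0)"
    by (rule bounded_linear.has_derivative[OF blinfun.bounded_linear_right D])
  have "\<epsilon> / 2 > 0" using \<epsilon> by simp
  from DK[unfolded has_derivative_within_alt2, THEN conjunct2, rule_format, OF this]
  have "\<forall>\<^sub>F l in at 0. norm (\<kappa> (p l) - \<kappa> (p 0) - \<kappa> ((l - 0) *\<^sub>R vector_derivative p (at 0))) \<le> \<epsilon> / 2 * norm (l - 0)" .
  then have K: "\<forall>\<^sub>F l in nhds 0. \<bar>\<kappa> (p l) - a * l\<bar> \<le> \<epsilon> / 2 * \<bar>l\<bar>"
    unfolding eventually_at_filter by (rule eventually_mono) (auto simp: p0 a_def blinfun.scaleR_right mult.commute)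
  have "(p \<longlongrightarrow> 0) (nhds 0)"
    using has_derivative_continuous[OF D] unfolding isCont_def tendsto_at_iff_tendsto_nhds by (simp add: p0)
  then have "((\<lambda>z. p (fst z)) \<longlongrightarrow> 0) (nhds (0, 0::real))"
    by (rule filterlim_compose) (use tendsto_fst[OF filterlim_ident[of "nhds (0::real, 0::real)"]] in simp)
  from tendsto_Pair[OF this tendsto_snd[OF filterlim_ident]]
  have pl: "filterlim (\<lambda>z. (p (fst z), snd z)) (nhds (0, 0)) (nhds (0, 0::real))" by simp
  have e1: "\<epsilon> / (2 * m) > 0" using \<epsilon> m by simp
  have H': "\<forall>\<^sub>F z in nhds (0, 0::real). p (fst z) \<in> P \<longrightarrow>
      \<bar>b (p (fst z)) (snd z) - w (snd z) * (\<kappa> (p (fst z)) + c * (snd z)\<^sup>2)\<bar> \<le> \<epsilon> / (2 * m) * (\<bar>w (snd z)\<bar> * (norm (p (fst z)) + (snd z)\<^sup>2))"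
    using pl[unfolded filterlim_iff, rule_format, OF H[OF e1]] by simp
  have f: "filterlim fst (nhds 0) (nhds (0::real, 0::real))"
    using tendsto_fst[OF filterlim_ident[of "nhds (0::real, 0::real)"]] by simp
  from H' f[unfolded filterlim_iff, rule_format, OF Mn] f[unfolded filterlim_iff, rule_format, OF K]
  show ?thesis
  proof eventually_elim
    case (elim z)
    obtain l s where z: "z = (l, s)" by (cases z)
    let ?W = "\<bar>w s\<bar>"
    have "\<bar>w s * (\<kappa> (p l) - a * l)\<bar> \<le> ?W * (\<epsilon> / 2 * \<bar>l\<bar>)"
      unfolding abs_mult using elim(3) by (intro mult_left_mono) (simp_all add: z)
    moreover have "\<bar>b (p l) s - w s * (\<kappa> (p l) + c * s\<^sup>2)\<bar> \<le> ?W * (\<epsilon> / 2 * (\<bar>l\<bar> + s\<^sup>2))"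
    proof -
      have "s\<^sup>2 \<le> m * s\<^sup>2" using m mult_right_mono[of 1 m "s\<^sup>2"] by simp
      then have "norm (p l) + s\<^sup>2 \<le> m * (\<bar>l\<bar> + s\<^sup>2)" using elim(2) by (simp add: z algebra_simps)
      then have "\<epsilon> / (2 * m) * (?W * (norm (p l) + s\<^sup>2)) \<le> \<epsilon> / (2 * m) * (?W * (m * (\<bar>l\<bar> + s\<^sup>2)))"
        using e1 by (intro mult_left_mono) auto
      also have "\<dots> = ?W * (\<epsilon> / 2 * (\<bar>l\<bar> + s\<^sup>2))" using m by (simp add: field_simps)
      finally show ?thesis using elim(1) pP by (simp add: z)
    qed
    moreover have "b (p l) s - w s * (a * l + c * s\<^sup>2) =
        (b (p l) s - w s * (\<kappa> (p l) + c * s\<^sup>2)) + w s * (\<kappa> (p l) - a * l)"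
      by (simp add: algebra_simps)
    ultimately have "\<bar>b (p l) s - w s * (a * l + c * s\<^sup>2)\<bar> \<le> ?W * (\<epsilon> / 2 * (\<bar>l\<bar> + s\<^sup>2)) + ?W * (\<epsilon> / 2 * \<bar>l\<bar>)"
      by linarith
    also have "\<dots> \<le> ?W * (\<epsilon> / 2 * (\<bar>l\<bar> + s\<^sup>2)) + ?W * (\<epsilon> / 2 * (\<bar>l\<bar> + s\<^sup>2))"
      using \<epsilon> by (intro add_left_mono mult_left_mono) auto
    also have "\<dots> = \<epsilon> * (?W * (\<bar>l\<bar> + s\<^sup>2))" by (simp add: algebra_simps)
    finally show ?case by (simp add: z a_def)
  qed
qed

lemma smooth_near_path:
  fixes b :: "'x::{real_normed_vector,complete_space} \<Rightarrow> real \<Rightarrow> real"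
  assumes b: "smooth_near (\<lambda>z. b (fst z) (snd z)) (0, 0)" and p: "transversal_path P \<kappa> p"
  shows "smooth_near (\<lambda>z. b (p (fst z)) (snd z)) (0, 0)"
proof -
  have p0: "p 0 = 0" and sp: "smooth_on UNIV p" using p by (auto simp: transversal_path_def)
  have "smooth_near p (fst (0::real, 0::real))" by (rule smooth_nearI[OF open_UNIV UNIV_I sp])
  from smooth_near_Pair[OF smooth_near_compose[OF this smooth_near_bounded_linear[OF bounded_linear_fst]]
      smooth_near_bounded_linear[OF bounded_linear_snd]]
  have *: "smooth_near (\<lambda>z. (p (fst z), snd z)) (0::real, 0::real)" .
  have "smooth_near (\<lambda>z. b (fst z) (snd z)) (p (fst (0::real, 0::real)), snd (0::real, 0::real))" using b p0 by simp
  from smooth_near_compose[OF this *] show ?thesis by simp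
qed

lemma path_criterion:
  assumes p: "transversal_path P \<kappa> p" and crit: "\<forall>\<^sub>F z in nhds (0, 0). fst z \<in> P \<longrightarrow> Q z"
  shows "\<forall>\<^sub>F z in nhds (0, 0::real). Q (p (fst z), snd z)"
proof -
  have p0: "p 0 = 0" and pP: "\<And>l. p l \<in> P" using p by (auto simp: transversal_path_def)
  have "(p \<longlongrightarrow> 0) (nhds 0)"
    using has_derivative_continuous[OF transversal_path_has_derivative[OF p]] unfolding isCont_def tendsto_at_iff_tendsto_nhds by (simp add: p0)
  then have "((\<lambda>z. p (fst z)) \<longlongrightarrow> 0) (nhds (0, 0::real))"
    by (rule filterlim_compose) (use tendsto_fst[OF filterlim_ident[of "nhds (0::real, 0::real)"]] in simp)
  from tendsto_Pair[OF this tendsto_snd[OF filterlim_ident]]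
  have pl: "filterlim (\<lambda>z. (p (fst z), snd z)) (nhds (0, 0)) (nhds (0, 0::real))" by simp
  from pl[unfolded filterlim_iff, rule_format, OF crit] show ?thesis using pP by simp
qed

text \<open>Along a transversal path the equation has a nonzero derivative in the parameter, so it is solved by the
  parameter as a function of the kernel coordinate, with quadratic tangency.\<close>

theorem saddle_node_of_generic_fold:
  fixes b :: "'x::{real_normed_vector,complete_space} \<Rightarrow> real \<Rightarrow> real"
  assumes b: "smooth_near (\<lambda>z. b (fst z) (snd z)) (0, 0)" and b0: "b 0 0 = 0"
    and crit: "\<forall>\<^sub>F z in nhds (0, 0). fst z \<in> P \<longrightarrow> (z \<in> E \<longleftrightarrow> b (fst z) (snd z) = 0)"
    and gen: "generic_fold P b"
  shows "saddle_node P E"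
proof -
  obtain \<kappa> c where \<kappa>: "\<exists>\<eta>\<in>P. blinfun_apply \<kappa> \<eta> \<noteq> 0" and c: "c \<noteq> 0"
    and o: "(\<lambda>(\<eta>, s). b \<eta> s - (\<kappa> \<eta> + c * s\<^sup>2)) \<in> o[at (0, 0) within P \<times> UNIV](\<lambda>(\<eta>, s). norm \<eta> + s\<^sup>2)"
    using gen unfolding generic_fold_def by blast
  have H: "\<forall>\<^sub>F z in nhds (0, 0). fst z \<in> P \<longrightarrow>
      \<bar>b (fst z) (snd z) - 1 * (\<kappa> (fst z) + c * (snd z)\<^sup>2)\<bar> \<le> \<epsilon> * (\<bar>1\<bar> * (norm (fst z) + (snd z)\<^sup>2))" if "\<epsilon> > 0" for \<epsilon>
    using landau_o.smallD[OF o that] unfolding eventually_at_filter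
    by (rule eventually_mono) (auto simp: case_prod_unfold b0)
  show ?thesis
    unfolding saddle_node_def
  proof (intro exI conjI allI impI)
    show "\<exists>\<eta>\<in>P. blinfun_apply \<kappa> \<eta> \<noteq> 0" by (rule \<kappa>)
    fix p assume p: "transversal_path P \<kappa> p"
    let ?a = "blinfun_apply \<kappa> (vector_derivative p (at 0))"
    have a: "?a \<noteq> 0" using p by (simp add: transversal_path_def)
    obtain N where N: "open N" "(0, 0) \<in> N" "smooth_on N (\<lambda>z. b (p (fst z)) (snd z))"
      using smooth_near_path[OF b p] by (auto simp: smooth_near_def)
    obtain e where e: "e > 0" "\<And>l s. \<bar>l\<bar> < e \<Longrightarrow> \<bar>s\<bar> < e \<Longrightarrow> (p l, s) \<in> E \<longleftrightarrow> b (p l) s = 0"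
      using eventually_square[OF path_criterion[OF p crit]] by auto
    have H2: "\<forall>\<^sub>F x in nhds (0, 0). \<bar>b (p (fst x)) (snd x) - (?a * fst x + c * (snd x)\<^sup>2)\<bar> \<le> \<epsilon> * (\<bar>fst x\<bar> + (snd x)\<^sup>2)" if "\<epsilon> > 0" for \<epsilon>
      using expansion_along_path[OF p H that] by simp
    obtain r d f where f: "0 < r" "r < e" "0 < d" "d < e" "fold_curve d f"
      "\<And>s. s \<in> {-d<..<d} \<Longrightarrow> \<bar>f s\<bar> < r"
      "\<And>s l. s \<in> {-d<..<d} \<Longrightarrow> l \<in> {-r<..<r} \<Longrightarrow> b (p (fst (l, s))) (snd (l, s)) = 0 \<longleftrightarrow> l = f s"
      by (rule fold_curve_from_expansion[OF N a c H2 e(1)], assumption) (rule that)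
    show "saddle_node_diagram (\<lambda>l s. (p l, s) \<in> E)"
      unfolding saddle_node_diagram_def
    proof (intro exI conjI ballI)
      fix s l assume *: "s \<in> {-d<..<d}" "l \<in> {-r<..<r}"
      then have "\<bar>l\<bar> < e" "\<bar>s\<bar> < e" using f(2,4) by auto
      then show "(p l, s) \<in> E \<longleftrightarrow> l = f s" using e(2) f(7)[OF *] by simp
    qed (use f in auto)
  qed
qed

text \<open>The expansion forces \<open>s = 0\<close> to be a solution at all parameter values. After division by \<open>s\<close> the quotient
  has the expansion of a fold, first for \<open>s \<noteq> 0\<close> and then at \<open>s = 0\<close> by continuity.\<close>

theorem pitchfork_of_generic_pitchfork:
  fixes b :: "'x::{real_normed_vector,complete_space} \<Rightarrow> real \<Rightarrow> real"
  assumes b: "smooth_near (\<lambda>z. b (fst z) (snd z)) (0, 0)" and b0: "b 0 0 = 0"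
    and crit: "\<forall>\<^sub>F z in nhds (0, 0). fst z \<in> P \<longrightarrow> (z \<in> E \<longleftrightarrow> b (fst z) (snd z) = 0)"
    and gen: "generic_pitchfork P b"
  shows "pitchfork P E"
proof -
  obtain \<kappa> c where \<kappa>: "\<exists>\<eta>\<in>P. blinfun_apply \<kappa> \<eta> \<noteq> 0" and c: "c \<noteq> 0"
    and o: "(\<lambda>(\<eta>, s). b \<eta> s - s * (\<kappa> \<eta> + c * s\<^sup>2)) \<in> o[at (0, 0) within P \<times> UNIV](\<lambda>(\<eta>, s). s * (norm \<eta> + s\<^sup>2))"
    using gen unfolding generic_pitchfork_def by blast
  have H: "\<forall>\<^sub>F z in nhds (0, 0). fst z \<in> P \<longrightarrow>
      \<bar>b (fst z) (snd z) - snd z * (\<kappa> (fst z) + c * (snd z)\<^sup>2)\<bar> \<le> \<epsilon> * (\<bar>snd z\<bar> * (norm (fst z) + (snd z)\<^sup>2))" if "\<epsilon> > 0" for \<epsilon>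
    using landau_o.smallD[OF o that] unfolding eventually_at_filter
    by (rule eventually_mono) (auto simp: case_prod_unfold b0 abs_mult)
  show ?thesis
    unfolding pitchfork_def
  proof (intro exI conjI allI impI)
    show "\<exists>\<eta>\<in>P. blinfun_apply \<kappa> \<eta> \<noteq> 0" by (rule \<kappa>)
    fix p assume p: "transversal_path P \<kappa> p"
    let ?a = "blinfun_apply \<kappa> (vector_derivative p (at 0))"
    have a: "?a \<noteq> 0" using p by (simp add: transversal_path_def)
    define \<beta> where "\<beta> z = b (p (fst z)) (snd z)" for z
    have H1: "\<forall>\<^sub>F z in nhds (0, 0). \<bar>\<beta> z - snd z * (?a * fst z + c * (snd z)\<^sup>2)\<bar> \<le> \<epsilon> * (\<bar>snd z\<bar> * (\<bar>fst z\<bar> + (snd z)\<^sup>2))" if "\<epsilon> > 0" for \<epsilon>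
      using expansion_along_path[OF p H that] by (simp add: \<beta>_def)
    obtain d1 where d1: "d1 > 0" "smooth_on ({-d1<..<d1} \<times> {-d1<..<d1}) \<beta>"
      using smooth_near_square[OF smooth_near_path[OF b p]] unfolding \<beta>_def[abs_def] by blast
    obtain d2 where d2: "d2 > 0" "\<And>l s. \<bar>l\<bar> < d2 \<Longrightarrow> \<bar>s\<bar> < d2 \<Longrightarrow>
        \<bar>\<beta> (l, s) - s * (?a * l + c * s\<^sup>2)\<bar> \<le> 1 * (\<bar>s\<bar> * (\<bar>l\<bar> + s\<^sup>2))"
      using eventually_square[OF H1[OF zero_less_one]] by auto
    define q where "q = min d1 d2"
    let ?R = "{-q<..<q} \<times> {-q<..<q}"
    have q: "q > 0" using d1 d2 by (simp add: q_def)
    have s\<beta>: "smooth_on ?R \<beta>" by (rule smooth_on_subset[OF d1(2)]) (auto simp: q_def)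
    have \<beta>0: "\<beta> (l, 0) = 0" if "l \<in> {-q<..<q}" for l
      using d2(2)[of l 0] that d2(1) by (auto simp: q_def)
    obtain g where g: "smooth_on ?R g" "\<And>l s. (l, s) \<in> ?R \<Longrightarrow> \<beta> (l, s) = s * g (l, s)"
      by (rule smooth_divide_second[OF s\<beta> \<beta>0], assumption) (rule that)
    have R: "open ?R" "(0, 0) \<in> ?R" using q by (auto intro: open_Times)
    have H2: "\<forall>\<^sub>F z in nhds (0, 0). \<bar>g z - (?a * fst z + c * (snd z)\<^sup>2)\<bar> \<le> \<epsilon> * (\<bar>fst z\<bar> + (snd z)\<^sup>2)" if "\<epsilon> > 0" for \<epsilon>
    proof -
      obtain d3 where d3: "d3 > 0" "\<And>l s. \<bar>l\<bar> < d3 \<Longrightarrow> \<bar>s\<bar> < d3 \<Longrightarrow>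
          \<bar>\<beta> (l, s) - s * (?a * l + c * s\<^sup>2)\<bar> \<le> \<epsilon> * (\<bar>s\<bar> * (\<bar>l\<bar> + s\<^sup>2))"
        using eventually_square[OF H1[OF \<open>\<epsilon> > 0\<close>]] by auto
      define t where "t = min q d3"
      have t: "t > 0" using q d3 by (simp add: t_def)
      have nz: "\<bar>g (l, s) - (?a * l + c * s\<^sup>2)\<bar> \<le> \<epsilon> * (\<bar>l\<bar> + s\<^sup>2)" if "\<bar>l\<bar> < t" "\<bar>s\<bar> < t" "s \<noteq> 0" for l s
      proof -
        have "(l, s) \<in> ?R" using that by (auto simp: t_def)
        then have eq: "\<beta> (l, s) - s * (?a * l + c * s\<^sup>2) = s * (g (l, s) - (?a * l + c * s\<^sup>2))"
          using g(2) by (simp add: right_diff_distrib)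
        have "\<bar>s * (g (l, s) - (?a * l + c * s\<^sup>2))\<bar> \<le> \<epsilon> * (\<bar>s\<bar> * (\<bar>l\<bar> + s\<^sup>2))"
          unfolding eq[symmetric] by (rule d3(2)) (use that in \<open>simp_all add: t_def\<close>)
        then have "\<bar>s\<bar> * \<bar>g (l, s) - (?a * l + c * s\<^sup>2)\<bar> \<le> \<bar>s\<bar> * (\<epsilon> * (\<bar>l\<bar> + s\<^sup>2))"
          by (simp only: abs_mult mult.left_commute)
        then show ?thesis using \<open>s \<noteq> 0\<close> by simp
      qed
      have z: "\<bar>g (l, 0) - (?a * l + c * 0\<^sup>2)\<bar> \<le> \<epsilon> * (\<bar>l\<bar> + 0\<^sup>2)" if "\<bar>l\<bar> < t" for l
      proof -
        have "(l, 0) \<in> ?R" using that q by (auto simp: t_def)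
        then have "isCont g (l, 0)" using smooth_on_continuous[OF g(1)] R(1) by (simp add: continuous_on_eq_continuous_at)
        then have gl: "((\<lambda>s. g (l, s)) \<longlongrightarrow> g (l, 0)) (at 0)"
          by (rule isCont_tendsto_compose) (intro tendsto_intros)
        have 1: "((\<lambda>s. \<bar>g (l, s) - (?a * l + c * s\<^sup>2)\<bar>) \<longlongrightarrow> \<bar>g (l, 0) - (?a * l + c * 0\<^sup>2)\<bar>) (at 0)"
          by (intro tendsto_intros gl)
        have 2: "((\<lambda>s. \<epsilon> * (\<bar>l\<bar> + s\<^sup>2)) \<longlongrightarrow> \<epsilon> * (\<bar>l\<bar> + 0\<^sup>2)) (at 0)" by (intro tendsto_intros)
        have "\<forall>\<^sub>F s in at (0::real). \<bar>g (l, s) - (?a * l + c * s\<^sup>2)\<bar> \<le> \<epsilon> * (\<bar>l\<bar> + s\<^sup>2)"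
          unfolding eventually_at using t nz[OF that] by (intro exI[of _ t]) (simp add: dist_real_def)
        then show ?thesis by (rule tendsto_le[OF trivial_limit_at 2 1])
      qed
      have "\<bar>g z - (?a * fst z + c * (snd z)\<^sup>2)\<bar> \<le> \<epsilon> * (\<bar>fst z\<bar> + (snd z)\<^sup>2)" if "z \<in> {-t<..<t} \<times> {-t<..<t}" for z
        using that nz[of "fst z" "snd z"] z[of "fst z"] by (cases "snd z = 0") (auto simp: abs_less_iff)
      moreover have "\<forall>\<^sub>F z in nhds (0, 0). z \<in> {-t<..<t} \<times> {-t<..<t}"
        using t by (intro eventually_nhds_in_open open_Times) auto
      ultimately show ?thesis by (rule eventually_mono[rotated])
    qed
    obtain e where e: "e > 0" "\<And>l s. \<bar>l\<bar> < e \<Longrightarrow> \<bar>s\<bar> < e \<Longrightarrow> (p l, s) \<in> E \<longleftrightarrow> b (p l) s = 0"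
      using eventually_square[OF path_criterion[OF p crit]] by auto
    have eq: "min e q > 0" using e(1) q by simp
    obtain r d f where f: "0 < r" "r < min e q" "0 < d" "d < min e q" "fold_curve d f"
      "\<And>s. s \<in> {-d<..<d} \<Longrightarrow> \<bar>f s\<bar> < r"
      "\<And>s l. s \<in> {-d<..<d} \<Longrightarrow> l \<in> {-r<..<r} \<Longrightarrow> g (l, s) = 0 \<longleftrightarrow> l = f s"
      by (rule fold_curve_from_expansion[OF R g(1) a c H2 eq], assumption) (rule that)
    show "pitchfork_diagram (\<lambda>l s. (p l, s) \<in> E)"
      unfolding pitchfork_diagram_def
    proof (intro exI conjI ballI)
      fix s l assume *: "s \<in> {-d<..<d}" "l \<in> {-r<..<r}"
      then have "\<bar>l\<bar> < e" "\<bar>s\<bar> < e" "(l, s) \<in> ?R" using f(2,4) by auto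
      then have "(p l, s) \<in> E \<longleftrightarrow> s * g (l, s) = 0" using e(2) g(2) by (simp add: \<beta>_def)
      then show "(p l, s) \<in> E \<longleftrightarrow> s = 0 \<or> l = f s" using f(7)[OF *] by simp
    qed (use f in auto)
  qed
qed

section \<open>Bifurcation along a fixed line\<close>

lemma dim_one_span:
  assumes "dim V = 1"
  obtains b where "V \<subseteq> span {b}"
proof -
  obtain B where B: "V \<subseteq> span B" "card B = dim V" by (rule basis_exists[of V])
  then have "card B = 1" using assms by simp
  then obtain b where "B = {b}" by (rule card_1_singletonE)
  then show ?thesis using that B(1) by simp
qed

context slice_reduction begin

abbreviation "\<tau> \<equiv> (\<lambda>v. TPsi S D (0, 0) (0, v))"

lemma differentiable_Psi: "x \<in> udom D \<Longrightarrow> differentiable_map_at model_atlas (atlM S) (Psi D) x"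
  by (rule smooth_map_differentiable[OF topological_atlas_model atlas_M Psi_smooth open_udom])

lemma linear_TPsi: "linear (TPsi S D (0, 0))"
  unfolding TPsi_def by (rule bounded_linear.linear[OF bounded_linear_tangent_map[OF differentiable_Psi[OF udom0]]])

text \<open>The inverse of the slice mapping extends smoothly to a neighbourhood of the base point, which gives a
  left inverse of the tangent map.\<close>

lemma TPsi_injective:
  assumes "TPsi S D (0, 0) \<delta> = 0"
  shows "\<delta> = 0"
proof -
  have "base D \<in> Psi D ` udom D" using udom0 Psi0 by (metis imageI)
  from Psi_inverse_smooth[unfolded smooth_map_def, rule_format, OF this]
  obtain W F where W: "open W" "base D \<in> W" "\<forall>x\<in>W \<inter> Psi D ` udom D. F x = inv_into (udom D) (Psi D) x" "continuous_on W F"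
    "\<forall>c\<in>atlM S. \<forall>d\<in>model_atlas. smooth_on (snd c ` {x \<in> fst c \<inter> W. F x \<in> fst d}) (snd d \<circ> F \<circ> chart_inv c)"
    by (elim exE conjE)
  let ?c = "chart_at (atlM S) (base D)"
  note c = chart_at[OF atlas_M, of "base D"]
  have "smooth_on (snd ?c ` (fst ?c \<inter> W)) (chart_rep ?c (UNIV, \<lambda>x. x) F)"
    using W(5) c(1) by (simp add: model_atlas_def Int_def)
  moreover have "snd ?c (base D) \<in> snd ?c ` (fst ?c \<inter> W)" using W(2) c(2) by simp
  ultimately have "(chart_rep ?c (UNIV, \<lambda>x. x) F has_derivative frechet_derivative (chart_rep ?c (UNIV, \<lambda>x. x) F) (at (snd ?c (base D)))) (at (snd ?c (base D)))"
    by (rule smooth_on_has_derivative)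
  then have "chart_rep ?c (UNIV, \<lambda>x. x) F differentiable (at (snd ?c (base D)))" by (rule differentiableI)
  moreover have "isCont F (base D)" using W(1,2,4) by (simp add: continuous_on_eq_continuous_at)
  ultimately have F: "differentiable_map_at (atlM S) model_atlas F (Psi D (0, 0))"
    unfolding differentiable_map_at_def chart_at_model Psi0 by (intro conjI)
  note P = differentiable_Psi[OF udom0]
  note C = differentiable_map_compose[OF topological_atlas_model atlas_M P F]
  have "(Psi D \<longlongrightarrow> Psi D (0, 0)) (nhds (0, 0))"
    using P unfolding differentiable_map_at_def isCont_def tendsto_at_iff_tendsto_nhds by blast
  from topological_tendstoD[OF this W(1)] W(2)
  have "\<forall>\<^sub>F x in nhds (0, 0). Psi D x \<in> W" by (simp add: Psi0)
  moreover have "\<forall>\<^sub>F x in nhds (0, 0). x \<in> udom D" by (rule eventually_nhds_in_open[OF open_udom udom0])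
  ultimately have ev: "\<forall>\<^sub>F x in nhds (0, 0). F (Psi D x) = x"
  proof eventually_elim
    case (elim x)
    then show ?case using W(3) inv_into_f_f[OF Psi_inj elim(2)] by simp
  qed
  have "tangent_map model_atlas model_atlas (\<lambda>x. x) (0, 0) = tangent_map model_atlas model_atlas (\<lambda>x. F (Psi D x)) (0, 0)"
    by (rule differentiable_map_cong(2)[OF topological_atlas_model C(1) ev])
  then have "\<delta> = tangent_map (atlM S) model_atlas F (Psi D (0, 0)) (TPsi S D (0, 0) \<delta>)"
    using fun_cong[OF tangent_map_ident[OF topological_atlas_model], of "(0, 0)" \<delta>] unfolding C(2) TPsi_def by metis
  also have "\<dots> = 0"
    unfolding assms using linear_0[OF bounded_linear.linear[OF bounded_linear_tangent_map[OF F]]] .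
  finally show ?thesis .
qed

lemma \<tau>_linear: "linear \<tau>"
proof (rule linearI)
  show "\<tau> (v + w) = \<tau> v + \<tau> w" for v w using linear_add[OF linear_TPsi, of "(0, v)" "(0, w)"] by simp
  show "\<tau> (r *\<^sub>R v) = r *\<^sub>R \<tau> v" for r v using linear_scale[OF linear_TPsi, of r "(0, v)"] by simp
qed

lemma \<tau>_inj: "\<tau> v = \<tau> w \<longleftrightarrow> v = w"
proof
  assume "\<tau> v = \<tau> w"
  then have "\<tau> (v - w) = 0" using linear_diff[OF \<tau>_linear, of v w] by simp
  then have "(0 :: 'm \<Rightarrow>\<^sub>L real, v - w) = 0" by (rule TPsi_injective)
  then show "v = w" by (simp add: zero_prod_def)
qed simp

text \<open>The slice mapping intertwines the linear action with the action on the manifold; differentiate this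
  relation at the base point.\<close>

lemma tact_\<tau>:
  assumes g: "g \<in> \<Gamma>"
  shows "tact S D g (\<tau> v) = \<tau> (lin D g v)"
proof -
  let ?\<sigma> = "\<lambda>z. (coAd_m S D g (fst z), lin D g (snd z))"
  have z: "coAd_m S D g 0 = 0" "lin D g 0 = 0"
    using bounded_linear_coAd_m[OF g] bounded_linear_lin[OF g] by (simp_all add: linear_simps)
  have bl: "bounded_linear ?\<sigma>"
    by (intro bounded_linear_Pair bounded_linear_compose[OF bounded_linear_coAd_m[OF g] bounded_linear_fst]
        bounded_linear_compose[OF bounded_linear_lin[OF g] bounded_linear_snd])
  note D\<sigma> = bounded_linear_imp_has_derivative[OF bl, of "at (0, 0)"]
  note d\<sigma> = differentiable_map_model(1)[OF D\<sigma>]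
  have \<sigma>0: "?\<sigma> (0, 0) = (0, 0)" using z by simp
  have P: "differentiable_map_at model_atlas (atlM S) (Psi D) (?\<sigma> (0, 0))"
    unfolding \<sigma>0 by (rule differentiable_Psi[OF udom0])
  have A: "differentiable_map_at (atlM S) (atlM S) (act S g) (Psi D (0, 0))" by (rule differentiable_act[OF system])
  note C1 = differentiable_map_compose[OF topological_atlas_model topological_atlas_model d\<sigma> P]
  note C2 = differentiable_map_compose[OF topological_atlas_model atlas_M differentiable_Psi[OF udom0] A]
  have "\<forall>\<^sub>F x in nhds (0, 0). x \<in> udom D" by (rule eventually_nhds_in_open[OF open_udom udom0])
  then have "\<forall>\<^sub>F x in nhds (0, 0). Psi D (?\<sigma> x) = act S g (Psi D x)"
    by eventually_elim (metis slice_act(2)[OF g] prod.collapse)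
  from differentiable_map_cong(2)[OF topological_atlas_model C1(1) this]
  have "tangent_map (atlM S) (atlM S) (act S g) (base D) (TPsi S D (0, 0) (0, v)) =
      TPsi S D (0, 0) (tangent_map model_atlas model_atlas ?\<sigma> (0, 0) (0, v))"
    unfolding C1(2) C2(2) TPsi_def \<sigma>0 Psi0 by meson
  moreover have "tangent_map model_atlas model_atlas ?\<sigma> (0, 0) (0, v) = (0, lin D g v)"
    unfolding differentiable_map_model(2) using fun_cong[OF frechet_derivative_at[OF D\<sigma>], of "(0, v)"] z by simp
  ultimately show ?thesis by (simp add: tact_def)
qed

end

text \<open>The subgroup \<open>K\<close> and the unit vector \<open>e\<close> spanning its fixed line in the kernel, as in the bifurcation theorem.\<close>

locale fixed_line_reduction = slice_reduction S D
  for S :: "('a::t2_space, 'g::euclidean_space, 'p::t2_space, 'e::banach) ham_system"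
    and D :: "('a, 'g, 'p, 'm::euclidean_space, 'v::{real_inner, complete_space}) slice_data" +
  fixes V0 :: "'e set" and K :: "'a set" and e :: 'v
  assumes identification: "V0 = (\<lambda>v. TPsi S D (0, 0) (0, v)) ` kerL S D"
    and K_maximal: "maximal_isotropy S D V0 K" and fixed_dim: "dim (fix_T S D V0 K) = 1"
    and rigid: "\<forall>\<^sub>F (\<eta>, v0) in nhds (0, 0).
      \<eta> \<in> fix_m S D K \<and> v0 \<in> fix_kerL S D K \<longrightarrow> rho S D \<eta> v0 0 = 0"
    and e: "e \<in> fix_kerL S D K" "norm e = 1"
begin

interpretation G: group "grp S" using lie by (simp add: lie_group_def)
interpretation Gam: group "Gam S D" by (rule group_Gam)

subsection \<open>The isotropy subgroup and its Weyl group\<close>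

definition stab :: "'v \<Rightarrow> 'a set" where
  "stab v = {g \<in> \<Gamma>. lin D g v = v}"

lemma stabilizer_\<tau>: "stabilizer (Gam S D) (tact S D) (\<tau> v) = stab v"
  by (auto simp: stabilizer_def stab_def tact_\<tau> \<tau>_inj)

lemma \<tau>_mem: "v \<in> kerL S D \<Longrightarrow> v \<noteq> 0 \<Longrightarrow> \<tau> v \<in> V0 - {0}"
  using \<tau>_inj[of v 0] linear_0[OF \<tau>_linear] by (auto simp: identification)

lemma K_eq_stab: "v \<in> kerL S D \<Longrightarrow> v \<noteq> 0 \<Longrightarrow> K \<subseteq> stab v \<Longrightarrow> K = stab v"
  using K_maximal \<tau>_mem[of v] stabilizer_\<tau>[of v] unfolding maximal_isotropy_def by metis

lemma e_nonzero: "e \<noteq> 0" and e_kerL: "e \<in> kerL S D" and lin_e: "k \<in> K \<Longrightarrow> lin D k e = e"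
  using e by (auto simp: fix_kerL_def)

lemma K_Gamma: "K \<subseteq> \<Gamma>"
proof -
  obtain w where "K = stabilizer (Gam S D) (tact S D) w" using K_maximal unfolding maximal_isotropy_def by blast
  then show ?thesis by (auto simp: stabilizer_def)
qed

lemma K_stab_line:
  assumes "s \<noteq> 0"
  shows "K = stab (s *\<^sub>R e)"
proof (rule K_eq_stab)
  show "s *\<^sub>R e \<in> kerL S D" by (rule subspace_scale[OF subspace_kerL e_kerL])
  show "s *\<^sub>R e \<noteq> 0" using assms e_nonzero by simp
  have "lin D k (s *\<^sub>R e) = s *\<^sub>R e" if "k \<in> K" for k
    using linear_scale[OF bounded_linear.linear[OF bounded_linear_lin[of k]], of s e] K_Gamma that lin_e[OF that] by auto
  then show "K \<subseteq> stab (s *\<^sub>R e)" using K_Gamma by (auto simp: stab_def)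
qed

lemma K_stab: "K = stab e"
  using K_stab_line[of 1] by simp

text \<open>The identification of the kernel with \<open>V0\<close> carries the fixed vectors of the linear action to those of
  the tangent action, which span a line.\<close>

lemma fix_kerL_line: "fix_kerL S D K = range (\<lambda>s. s *\<^sub>R e)"
proof
  obtain b where b: "fix_T S D V0 K \<subseteq> span {b}" by (rule dim_one_span[OF fixed_dim])
  have mem: "\<tau> v \<in> span {b}" if "v \<in> fix_kerL S D K" for v
  proof -
    have "\<tau> v \<in> fix_T S D V0 K"
      using that K_Gamma by (auto simp: fix_kerL_def fix_T_def identification tact_\<tau> subset_iff)
    then show ?thesis using b by blast
  qed
  obtain c where c: "\<tau> e = c *\<^sub>R b" using mem[OF e(1)] by (auto simp: span_singleton)
  have "c \<noteq> 0" using c \<tau>_inj[of e 0] linear_0[OF \<tau>_linear] e_nonzero by auto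
  show "fix_kerL S D K \<subseteq> range (\<lambda>s. s *\<^sub>R e)"
  proof
    fix v assume "v \<in> fix_kerL S D K"
    then obtain c' where "\<tau> v = c' *\<^sub>R b" using mem by (auto simp: span_singleton)
    then have "\<tau> v = \<tau> ((c' / c) *\<^sub>R e)" using \<open>c \<noteq> 0\<close> c linear_scale[OF \<tau>_linear, of "c' / c" e] by simp
    then have "v = (c' / c) *\<^sub>R e" by (simp only: \<tau>_inj)
    then show "v \<in> range (\<lambda>s. s *\<^sub>R e)" by blast
  qed
  show "range (\<lambda>s. s *\<^sub>R e) \<subseteq> fix_kerL S D K"
  proof
    fix v assume "v \<in> range (\<lambda>s. s *\<^sub>R e)"
    then obtain s where v: "v = s *\<^sub>R e" by blast
    have "lin D k v = v" if "k \<in> K" for k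
      using linear_scale[OF bounded_linear.linear[OF bounded_linear_lin[of k]], of s e] K_Gamma that lin_e[OF that] v by auto
    then show "v \<in> fix_kerL S D K"
      using subspace_scale[OF subspace_kerL e_kerL] by (simp add: fix_kerL_def v)
  qed
qed

lemma subgroup_K: "subgroup K (Gam S D)"
proof (rule Gam.subgroupI)
  show "K \<subseteq> \<Gamma>" by (rule K_Gamma)
  show "K \<noteq> {}" unfolding K_stab stab_def using Gamma_one lin_one by blast
  show "inv\<^bsub>Gam S D\<^esub> k \<in> K" if "k \<in> K" for k
    using that lin_inv(1)[of k e] by (auto simp: K_stab stab_def Gam_inv Gamma_inv)
  show "k \<otimes>\<^bsub>Gam S D\<^esub> l \<in> K" if "k \<in> K" "l \<in> K" for k l
    using that by (auto simp: K_stab stab_def Gamma_mult lin_mult)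
qed

abbreviation "N \<equiv> normalizer (Gam S D) K"

lemma N_subgroup: "subgroup N (Gam S D)"
  by (rule Gam.normalizer_imp_subgroup[OF K_Gamma])

lemma N_Gamma: "N \<subseteq> \<Gamma>"
  using N_subgroup by (rule subgroup.subset)

text \<open>The normalizer preserves the fixed line and acts on it by isometries, hence by a sign.\<close>

lemma N_sign:
  assumes n: "n \<in> N"
  shows "lin D n e = e \<or> lin D n e = - e"
proof -
  have nG: "n \<in> \<Gamma>" using N_Gamma n by blast
  have eq: "n <#\<^bsub>Gam S D\<^esub> K #>\<^bsub>Gam S D\<^esub> (inv\<^bsub>Gam S D\<^esub> n) = K"
    using n K_Gamma by (simp add: normalizer_def stabilizer_def)
  have "lin D k (lin D n e) = lin D n e" if k: "k \<in> K" for k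
  proof -
    have "k \<in> n <#\<^bsub>Gam S D\<^esub> K #>\<^bsub>Gam S D\<^esub> (inv\<^bsub>Gam S D\<^esub> n)" using eq k by simp
    then obtain l where l: "l \<in> K" "k = n \<otimes>\<^bsub>grp S\<^esub> l \<otimes>\<^bsub>grp S\<^esub> inv\<^bsub>grp S\<^esub> n"
      by (auto simp: l_coset_def r_coset_def Gam_inv[OF nG])
    have lG: "l \<in> \<Gamma>" using l K_Gamma by blast
    have "lin D k (lin D n e) = lin D (n \<otimes>\<^bsub>grp S\<^esub> l \<otimes>\<^bsub>grp S\<^esub> inv\<^bsub>grp S\<^esub> n \<otimes>\<^bsub>grp S\<^esub> n) e"
      unfolding l(2) using nG lG by (simp add: lin_mult Gamma_mult Gamma_inv)
    also have "n \<otimes>\<^bsub>grp S\<^esub> l \<otimes>\<^bsub>grp S\<^esub> inv\<^bsub>grp S\<^esub> n \<otimes>\<^bsub>grp S\<^esub> n = n \<otimes>\<^bsub>grp S\<^esub> l" by (simp add: G.m_assoc)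
    also have "lin D (n \<otimes>\<^bsub>grp S\<^esub> l) e = lin D n e" using nG lG lin_e[OF l(1)] by (simp add: lin_mult)
    finally show ?thesis .
  qed
  then have "lin D n e \<in> fix_kerL S D K" using lin_kerL[OF nG e_kerL] by (simp add: fix_kerL_def)
  then obtain s where s: "lin D n e = s *\<^sub>R e" unfolding fix_kerL_line by blast
  have "\<bar>s\<bar> = 1" using norm_lin[OF nG, of e] e(2) by (simp add: s)
  then show ?thesis using s by (auto simp: abs_if split: if_splits)
qed

text \<open>The sign by which the normalizer acts on the fixed line is a homomorphism, and its kernel is the isotropy
  subgroup of \<open>e\<close>, that is \<open>K\<close>.\<close>

lemma weyl_group_cases:
  "trivial_group (weyl_group S D K) \<or> weyl_group S D K \<cong> integer_mod_group 2"
proof -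
  let ?N = "(Gam S D)\<lparr>carrier := N\<rparr>"
  have gN: "group ?N" by (rule Gam.subgroup_imp_group[OF N_subgroup])
  have nG: "n \<in> \<Gamma>" if "n \<in> N" for n using that N_Gamma by blast
  have KN: "K = {n \<in> N. lin D n e = e}"
  proof -
    have "K \<subseteq> N"
      using subgroup.subset[OF normal_imp_subgroup[OF Gam.subgroup_in_normalizer[OF subgroup_K]]] by simp
    then show ?thesis using K_stab nG by (auto simp: stab_def)
  qed
  show ?thesis
  proof (cases "\<exists>n\<in>N. lin D n e \<noteq> e")
    case True
    define \<phi> where "\<phi> n = (if lin D n e = e then 0 else 1 :: int)" for n
    have mult: "lin D (n \<otimes>\<^bsub>grp S\<^esub> m) e = lin D n (lin D m e)" if "n \<in> N" "m \<in> N" for n m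
      using that nG by (simp add: lin_mult)
    have neg: "lin D n (- e) = - lin D n e" if "n \<in> N" for n
      using bounded_linear_lin[OF nG[OF that]] by (simp add: linear_simps)
    have ne: "e \<noteq> - e"
    proof
      assume "e = - e"
      then have "2 *\<^sub>R e = 0" by (metis add.right_inverse scaleR_2)
      then show False using e_nonzero by simp
    qed
    have hom: "group_hom ?N (integer_mod_group 2) \<phi>"
    proof (rule group_hom.intro[OF gN group_integer_mod_group], unfold group_hom_axioms_def, rule homI)
      show "\<phi> n \<in> carrier (integer_mod_group 2)" for n by (simp add: \<phi>_def carrier_integer_mod_group)
      show "\<phi> (n \<otimes>\<^bsub>?N\<^esub> m) = \<phi> n \<otimes>\<^bsub>integer_mod_group 2\<^esub> \<phi> m" if "n \<in> carrier ?N" "m \<in> carrier ?N" for n m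
        using that N_sign[of n] N_sign[of m] ne by (auto simp: \<phi>_def mult neg)
    qed
    have "\<phi> ` carrier ?N = carrier (integer_mod_group 2)"
    proof -
      obtain n where n: "n \<in> N" "\<phi> n = 1" using True by (auto simp: \<phi>_def)
      have "\<one>\<^bsub>grp S\<^esub> \<in> N" using subgroup.one_closed[OF N_subgroup] by simp
      moreover have "\<phi> \<one>\<^bsub>grp S\<^esub> = 0" by (simp add: \<phi>_def)
      ultimately have "{0, 1} \<subseteq> \<phi> ` N" using n by (metis empty_subsetI image_eqI insert_subset)
      moreover have "\<phi> ` N \<subseteq> {0, 1}" by (auto simp: \<phi>_def)
      moreover have "carrier (integer_mod_group 2) = {0, 1}" by (auto simp: carrier_integer_mod_group)
      ultimately show ?thesis by (simp add: subset_antisym)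
    qed
    from group_hom.FactGroup_iso[OF hom this]
    have "?N Mod kernel ?N (integer_mod_group 2) \<phi> \<cong> integer_mod_group 2" .
    moreover have "kernel ?N (integer_mod_group 2) \<phi> = K"
      by (rule trans[OF _ KN[symmetric]]) (auto simp: kernel_def \<phi>_def split: if_splits)
    ultimately show ?thesis by (simp add: weyl_group_def)
  next
    case False
    \<comment> \<open>All signs are positive: the trivial homomorphism into the group of order one has kernel K.\<close>
    define \<phi> where "\<phi> n = (0 :: int)" for n :: 'a
    have hom: "group_hom ?N (integer_mod_group 1) \<phi>"
      by (rule group_hom.intro[OF gN group_integer_mod_group], unfold group_hom_axioms_def, rule homI)
        (simp_all add: \<phi>_def carrier_integer_mod_group)
    have c1: "carrier (integer_mod_group 1) = {0}" by (auto simp: carrier_integer_mod_group)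
    have "\<phi> ` carrier ?N = carrier (integer_mod_group 1)"
      using subgroup.one_closed[OF N_subgroup] unfolding c1 by (auto simp: \<phi>_def)
    from group_hom.FactGroup_iso[OF hom this]
    have iso: "?N Mod kernel ?N (integer_mod_group 1) \<phi> \<cong> integer_mod_group 1" .
    have ker: "kernel ?N (integer_mod_group 1) \<phi> = K"
      by (rule trans[OF _ KN[symmetric]]) (use False in \<open>auto simp: kernel_def \<phi>_def\<close>)
    have "group (?N Mod K)"
      using normal.factorgroup_is_group[OF group_hom.normal_kernel[OF hom]] ker by simp
    moreover have "trivial_group (integer_mod_group 1)"
      using c1 group_integer_mod_group[of 1] by (simp add: trivial_group_def)
    ultimately have "trivial_group (?N Mod K)"
      using isomorphic_group_triviality[OF iso[unfolded ker]] group_integer_mod_group by blast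
    then show ?thesis by (simp add: weyl_group_def)
  qed
qed

subsection \<open>The reduced equation on the fixed line\<close>

lemma line_kerL: "s *\<^sub>R e \<in> kerL S D"
  by (rule subspace_scale[OF subspace_kerL e_kerL])

lemma line_fix: "s *\<^sub>R e \<in> fix_kerL S D K"
  unfolding fix_kerL_line by blast

lemma lin_line: "k \<in> K \<Longrightarrow> lin D k (s *\<^sub>R e) = s *\<^sub>R e"
  using line_fix[of s] by (simp add: fix_kerL_def)

lemma bounded_linear_line: "bounded_linear (\<lambda>z::('m \<Rightarrow>\<^sub>L real) \<times> real. (fst z, snd z *\<^sub>R e))"
  by (intro bounded_linear_Pair bounded_linear_fst bounded_linear_compose[OF bounded_linear_scaleR_left bounded_linear_snd])

lemma kernel_component_unique:
  assumes "v \<in> kerL S D" "w \<in> kerL S D" "x \<in> V1 D" "y \<in> V1 D" "v + x = w + y"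
  shows "v = w"
proof -
  have s: "subspace (V1 D)" "kerL S D \<inter> V1 D = {0}" using V1 by (simp_all add: internal_sum_def)
  have "v - w \<in> kerL S D" using assms by (simp add: subspace_diff[OF subspace_kerL])
  moreover have "v - w = y - x" using assms(5) by (simp add: algebra_simps)
  then have "v - w \<in> V1 D" using assms by (simp add: subspace_diff[OF s(1)])
  ultimately have "v - w = 0" using s(2) by blast
  then show ?thesis by simp
qed

text \<open>The slice coordinate of the reduced point over the kernel vector \<open>s *\<^sub>R e\<close> with \<open>\<alpha> = 0\<close>.\<close>

definition line_point :: "('m \<Rightarrow>\<^sub>L real) \<Rightarrow> real \<Rightarrow> 'v" where
  "line_point \<eta> s = s *\<^sub>R e + v1 D (\<eta>, s *\<^sub>R e, 0)"

lemma red_point_eq: "red_point D \<eta> (s *\<^sub>R e) 0 = Psi D (\<eta>, line_point \<eta> s)"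
  by (simp add: red_point_def line_point_def)

lemma Xi_eq: "Xi D \<eta> (s *\<^sub>R e) 0 = om2 D \<eta> (line_point \<eta> s) 0"
  by (simp add: Xi_def line_point_def)

text \<open>Everything that the reduction provides at a point of the fixed line close enough to the origin, so that
  the later arguments concern single points.\<close>

definition good_point :: "('m \<Rightarrow>\<^sub>L real) \<Rightarrow> real \<Rightarrow> bool" where
  "good_point \<eta> s \<longleftrightarrow> (let v = line_point \<eta> s; \<zeta> = Xi D \<eta> (s *\<^sub>R e) 0 in
       (\<eta>, v) \<in> udom D \<and> v1 D (\<eta>, s *\<^sub>R e, 0) \<in> V1 D \<and>
       (\<forall>\<theta>\<in>qq D. coad S \<zeta> (jj S D \<eta> v) \<theta> = 0) \<and>
       Dm S D \<zeta> \<eta> v = 0 \<and> DV S D \<zeta> \<eta> v = BB S D \<eta> (s *\<^sub>R e) 0 \<and>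
       (\<forall>g\<in>\<Gamma>. om2 D (coAd_m S D g \<eta>) (lin D g v) 0 = Ad S g (om2 D \<eta> v 0)) \<and>
       (\<forall>g\<in>\<Gamma>. v1 D (coAd_m S D g \<eta>, lin D g (s *\<^sub>R e), 0) = lin D g (v1 D (\<eta>, s *\<^sub>R e, 0))) \<and>
       (\<eta> \<in> fix_m S D K \<longrightarrow> rho S D \<eta> (s *\<^sub>R e) 0 = 0))"

lemma eventually_good_point: "\<forall>\<^sub>F z in nhds (0, 0). good_point (fst z) (snd z)"
proof -
  have "\<forall>\<^sub>F z in nhds 0. fst z \<in> fix_m S D K \<and> snd z \<in> fix_kerL S D K \<longrightarrow> rho S D (fst z) (snd z) 0 = 0"
    using rigid by (simp add: case_prod_unfold zero_prod_def)
  from filterlim_nhds_zero[OF bounded_linear_line this] filterlim_nhds_zero[OF bounded_linear_line reduced_point_properties]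
  show ?thesis
    unfolding zero_prod_def[symmetric]
    by eventually_elim (simp add: good_point_def line_kerL Let_def line_point_def line_fix)
qed

context
  fixes \<eta> s
  assumes good: "good_point \<eta> s" and \<eta>: "\<eta> \<in> fix_m S D K"
begin

lemma good_facts:
  shows "(\<eta>, line_point \<eta> s) \<in> udom D" "v1 D (\<eta>, s *\<^sub>R e, 0) \<in> V1 D"
    "\<theta> \<in> qq D \<Longrightarrow> coad S (Xi D \<eta> (s *\<^sub>R e) 0) (jj S D \<eta> (line_point \<eta> s)) \<theta> = 0"
    "Dm S D (Xi D \<eta> (s *\<^sub>R e) 0) \<eta> (line_point \<eta> s) = 0"
    "DV S D (Xi D \<eta> (s *\<^sub>R e) 0) \<eta> (line_point \<eta> s) = BB S D \<eta> (s *\<^sub>R e) 0"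
    "g \<in> \<Gamma> \<Longrightarrow> om2 D (coAd_m S D g \<eta>) (lin D g (line_point \<eta> s)) 0 = Ad S g (om2 D \<eta> (line_point \<eta> s) 0)"
    "g \<in> \<Gamma> \<Longrightarrow> v1 D (coAd_m S D g \<eta>, lin D g (s *\<^sub>R e), 0) = lin D g (v1 D (\<eta>, s *\<^sub>R e, 0))"
    "rho S D \<eta> (s *\<^sub>R e) 0 = 0"
  using good \<eta> by (auto simp: good_point_def Let_def)

lemma coAd_m_fixed: "k \<in> K \<Longrightarrow> coAd_m S D k \<eta> = \<eta>"
  using \<eta> by (simp add: fix_m_def)

lemma lin_line_point: "k \<in> K \<Longrightarrow> lin D k (line_point \<eta> s) = line_point \<eta> s"
proof -
  assume k: "k \<in> K"
  then have kG: "k \<in> \<Gamma>" using K_Gamma by blast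
  have "lin D k (v1 D (\<eta>, s *\<^sub>R e, 0)) = v1 D (\<eta>, s *\<^sub>R e, 0)"
    using good_facts(7)[OF kG] by (simp add: coAd_m_fixed[OF k] lin_line[OF k])
  then show ?thesis
    unfolding line_point_def
    using linear_add[OF bounded_linear.linear[OF bounded_linear_lin[OF kG]]] lin_line[OF k] by simp
qed

lemma DV_invariant:
  assumes k: "k \<in> K"
  shows "dact k (DV S D (Xi D \<eta> (s *\<^sub>R e) 0) \<eta> (line_point \<eta> s)) = DV S D (Xi D \<eta> (s *\<^sub>R e) 0) \<eta> (line_point \<eta> s)"
proof -
  have kG: "k \<in> \<Gamma>" using k K_Gamma by blast
  have "Ad S k (Xi D \<eta> (s *\<^sub>R e) 0) = Xi D \<eta> (s *\<^sub>R e) 0"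
    unfolding Xi_eq using good_facts(6)[OF kG] by (simp add: coAd_m_fixed[OF k] lin_line_point[OF k])
  then show ?thesis
    using DV_equivariant[OF kG good_facts(1), of "Xi D \<eta> (s *\<^sub>R e) 0"]
    by (simp add: coAd_m_fixed[OF k] lin_line_point[OF k])
qed

text \<open>The value of the bifurcation map is an invariant functional, and an invariant functional on the
  kernel is represented by a fixed vector; so it is determined by its value at \<open>e\<close>.\<close>

lemma BB_zero_iff: "bK S D e \<eta> s = 0 \<longleftrightarrow> BB S D \<eta> (s *\<^sub>R e) 0 = 0"
proof
  assume b: "bK S D e \<eta> s = 0"
  let ?\<phi> = "BB S D \<eta> (s *\<^sub>R e) 0"
  have "?\<phi> \<in> V2 D" unfolding BB_def by (rule PP_mem)
  moreover have "?\<phi> w = 0" if "w \<in> kerL S D" for w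
  proof (rule invariant_functional_eq_zero[OF closed_kerL subspace_kerL _ _ _ _ that])
    show "lin D k v \<bullet> lin D k w = v \<bullet> w" if "k \<in> K" for k v w using that K_Gamma lin_inner by blast
    show "lin D k ` kerL S D = kerL S D" if "k \<in> K" for k using that K_Gamma lin_kerL_image by blast
    show "?\<phi> (lin D k w) = ?\<phi> w" if k: "k \<in> K" for k w
    proof -
      have kG: "k \<in> \<Gamma>" using k K_Gamma by blast
      have "dact k ?\<phi> = ?\<phi>" using DV_invariant[OF k] by (simp only: good_facts(5))
      then have "?\<phi> (lin D k w) = dact k ?\<phi> (lin D k w)" by simp
      also have "\<dots> = ?\<phi> w" using lin_inv(1)[OF kG] by (simp add: dact_apply[OF kG])
      finally show ?thesis .
    qed
    show "?\<phi> a = 0" if "a \<in> kerL S D" "\<And>k. k \<in> K \<Longrightarrow> lin D k a = a" for a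
    proof -
      have "a \<in> fix_kerL S D K" using that by (simp add: fix_kerL_def)
      then obtain t where "a = t *\<^sub>R e" unfolding fix_kerL_line by blast
      then show ?thesis using b by (simp add: bK_def blinfun.scaleR_right)
    qed
  qed
  ultimately show "?\<phi> = 0" by (rule V2_separated)
qed (simp add: bK_def)

lemma rel_eq_iff_bK: "(\<eta>, s) \<in> rel_eq_set S D K e \<longleftrightarrow> bK S D e \<eta> s = 0"
proof
  assume "(\<eta>, s) \<in> rel_eq_set S D K e"
  then have "relative_equilibrium S (Psi D (\<eta>, line_point \<eta> s)) (Xi D \<eta> (s *\<^sub>R e) 0)"
    by (simp add: rel_eq_set_def red_point_eq)
  from DV_zero_if_relative_equilibrium[OF good_facts(1) this]
  show "bK S D e \<eta> s = 0" by (simp add: BB_zero_iff good_facts(5))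
next
  assume "bK S D e \<eta> s = 0"
  then have "DV S D (Xi D \<eta> (s *\<^sub>R e) 0) \<eta> (line_point \<eta> s) = 0" by (simp add: BB_zero_iff good_facts(5))
  moreover have "coad S (Xi D \<eta> (s *\<^sub>R e) 0) (jj S D \<eta> (line_point \<eta> s)) o\<^sub>L inm D = 0"
    using good_facts(8) by (simp add: rho_def line_point_def)
  ultimately have "relative_equilibrium S (Psi D (\<eta>, line_point \<eta> s)) (Xi D \<eta> (s *\<^sub>R e) 0)"
    using relative_equilibrium_on_slice[OF good_facts(1) _ good_facts(4) good_facts(3)] by blast
  then show "(\<eta>, s) \<in> rel_eq_set S D K e" using \<eta> by (simp add: rel_eq_set_def red_point_eq)
qed

text \<open>The slice mapping is injective and equivariant, so the isotropy is that of \<open>\<eta>\<close> and of the slice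
  coordinate. The kernel component of the latter has isotropy \<open>K\<close>, and \<open>K\<close> fixes the other
  component by equivariance of the implicit function.\<close>

lemma red_point_isotropy:
  assumes s: "s \<noteq> 0"
  shows "stabilizer (Gam S D) (act S) (red_point D \<eta> (s *\<^sub>R e) 0) = K"
proof
  have act: "act S g (red_point D \<eta> (s *\<^sub>R e) 0) = red_point D \<eta> (s *\<^sub>R e) 0 \<longleftrightarrow>
      coAd_m S D g \<eta> = \<eta> \<and> lin D g (line_point \<eta> s) = line_point \<eta> s" if g: "g \<in> \<Gamma>" for g
    unfolding red_point_eq slice_act(2)[OF g good_facts(1), symmetric]
    using inj_on_eq_iff[OF Psi_inj slice_act(1)[OF g good_facts(1)] good_facts(1)] by simp
  show "stabilizer (Gam S D) (act S) (red_point D \<eta> (s *\<^sub>R e) 0) \<subseteq> K"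
  proof
    fix g assume "g \<in> stabilizer (Gam S D) (act S) (red_point D \<eta> (s *\<^sub>R e) 0)"
    then have g: "g \<in> \<Gamma>" "lin D g (line_point \<eta> s) = line_point \<eta> s" using act by (auto simp: stabilizer_def)
    have "lin D g (s *\<^sub>R e) + lin D g (v1 D (\<eta>, s *\<^sub>R e, 0)) = s *\<^sub>R e + v1 D (\<eta>, s *\<^sub>R e, 0)"
      using g(2) unfolding line_point_def
      using linear_add[OF bounded_linear.linear[OF bounded_linear_lin[OF g(1)]]] by simp
    then have "lin D g (s *\<^sub>R e) = s *\<^sub>R e"
      by (rule kernel_component_unique[OF lin_kerL[OF g(1) line_kerL] line_kerL lin_V1[OF g(1) good_facts(2)] good_facts(2)])
    then show "g \<in> K" using K_stab_line[OF s] g(1) by (simp add: stab_def)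
  qed
  show "K \<subseteq> stabilizer (Gam S D) (act S) (red_point D \<eta> (s *\<^sub>R e) 0)"
    using act K_Gamma coAd_m_fixed lin_line_point by (auto simp: stabilizer_def subset_iff)
qed

lemma red_point_ne_base:
  assumes s: "s \<noteq> 0"
  shows "red_point D \<eta> (s *\<^sub>R e) 0 \<noteq> base D"
proof
  assume "red_point D \<eta> (s *\<^sub>R e) 0 = base D"
  then have "Psi D (\<eta>, line_point \<eta> s) = Psi D (0, 0)" by (simp add: red_point_eq Psi0)
  then have "(\<eta>, line_point \<eta> s) = (0, 0)" by (rule inj_onD[OF Psi_inj _ good_facts(1) udom0])
  then have "line_point \<eta> s = 0" by (rule Pair_inject)
  then have "s *\<^sub>R e + v1 D (\<eta>, s *\<^sub>R e, 0) = 0 + 0" by (simp only: line_point_def add_0_right)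
  moreover have "0 \<in> V1 D" using V1 by (simp add: internal_sum_def subspace_0)
  ultimately have "s *\<^sub>R e = 0"
    using kernel_component_unique[OF line_kerL subspace_0[OF subspace_kerL] good_facts(2)] by blast
  then show False using s e_nonzero by simp
qed

end

lemma base_in_rel_eq_set: "(0, 0) \<in> rel_eq_set S D K e" and red_point_zero: "red_point D 0 (0 *\<^sub>R e) 0 = base D"
proof -
  have v: "v1 D (0, 0, 0) = 0" and b: "bet D (0, 0, 0) = 0" and g: "gam D (0, 0, 0, 0) = 0"
    using implicit_solution_zero[OF v1_solution0] implicit_solution_zero[OF bet_solution] implicit_solution_zero[OF gam_solution]
    by (simp_all add: zero_prod_def)
  show r: "red_point D 0 (0 *\<^sub>R e) 0 = base D" by (simp add: red_point_def v Psi0)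
  have x: "Xi D 0 (0 *\<^sub>R e) 0 = gen D" by (simp add: Xi_def om2_def om1_def v b g)
  have "coAd_m S D k 0 = 0" if "k \<in> K" for k
    using bounded_linear_coAd_m[of k] that K_Gamma by (auto simp: linear_simps)
  then show "(0, 0) \<in> rel_eq_set S D K e"
    using rel_eq r x by (simp add: rel_eq_set_def fix_m_def)
qed

lemma bK_criterion: "\<forall>\<^sub>F z in nhds (0, 0). fst z \<in> fix_m S D K \<longrightarrow> (z \<in> rel_eq_set S D K e \<longleftrightarrow> bK S D e (fst z) (snd z) = 0)"
  using eventually_good_point by eventually_elim (simp add: rel_eq_iff_bK[symmetric])

lemma bK_zero: "bK S D e 0 0 = 0"
  using eventually_nhds_x_imp_x[OF bK_criterion] base_in_rel_eq_set by (simp add: rel_eq_set_def)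

subsection \<open>Smoothness of the reduced equation\<close>

lemma smooth_line_point: "smooth_near (\<lambda>z. line_point (fst z) (snd z)) (0, 0)"
proof -
  obtain M F where M: "open M" "0 \<in> M" "smooth_on M F"
    "\<And>x. x \<in> M \<Longrightarrow> x \<in> UNIV \<times> kerL S D \<Longrightarrow> F x = (\<lambda>(\<eta>, v0). v1 D (\<eta>, v0, 0)) x"
    by (rule implicit_solution_extension[OF v1_solution0 zero_mem_domain]) (rule that)
  have F: "smooth_near F (fst (0::'m \<Rightarrow>\<^sub>L real, 0::real), snd (0::'m \<Rightarrow>\<^sub>L real, 0::real) *\<^sub>R e)"
    using smooth_nearI[OF M(1,2,3)] by (simp add: zero_prod_def)
  note l = smooth_near_bounded_linear[OF bounded_linear_line]
  have "smooth_near (\<lambda>z. snd z *\<^sub>R e + F (fst z, snd z *\<^sub>R e)) (0::'m \<Rightarrow>\<^sub>L real, 0::real)"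
    by (rule smooth_near_add[OF smooth_near_bounded_linear[OF bounded_linear_compose[OF bounded_linear_scaleR_left bounded_linear_snd]]
          smooth_near_compose[OF F l]])
  moreover have "\<forall>\<^sub>F z in nhds (0::'m \<Rightarrow>\<^sub>L real, 0::real). snd z *\<^sub>R e + F (fst z, snd z *\<^sub>R e) = line_point (fst z) (snd z)"
    using filterlim_nhds_zero[OF bounded_linear_line eventually_nhds_in_open[OF M(1,2)]]
    unfolding zero_prod_def[symmetric]
    by eventually_elim (simp add: M(4) line_kerL line_point_def)
  ultimately show ?thesis by (rule smooth_near_cong)
qed

lemma line_point_zero: "line_point 0 0 = 0"
  using implicit_solution_zero[OF v1_solution0] by (simp add: line_point_def zero_prod_def)

lemma smooth_Xi_line: "smooth_near (\<lambda>z. Xi D (fst z) (snd z *\<^sub>R e) 0) (0, 0)"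
proof -
  have lp: "smooth_near (\<lambda>z. (fst z, line_point (fst z) (snd z))) (0, 0)"
    by (rule smooth_near_Pair[OF smooth_near_bounded_linear[OF bounded_linear_fst] smooth_line_point])
  have b: "smooth_near (\<lambda>(\<eta>, v). bet D (\<eta>, v, 0)) (fst (0, 0::real), line_point (fst (0, 0::real)) (snd (0::'m \<Rightarrow>\<^sub>L real, 0)))"
    using implicit_solution_smooth_near[OF bet_solution] by (simp add: line_point_zero zero_prod_def)
  note bl = smooth_near_compose[OF b lp]
  have b0: "bet D (0, 0, 0) = 0" using implicit_solution_zero[OF bet_solution] by (simp add: zero_prod_def)
  have bl': "smooth_near (\<lambda>z. bet D (fst z, line_point (fst z) (snd z), 0)) (0, 0)"
    using bl by simp
  have t: "smooth_near (\<lambda>z. (fst z, line_point (fst z) (snd z), bet D (fst z, line_point (fst z) (snd z), 0))) (0, 0)"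
    by (rule smooth_near_Pair[OF smooth_near_bounded_linear[OF bounded_linear_fst] smooth_near_Pair[OF smooth_line_point bl']])
  have g: "smooth_near (\<lambda>(\<eta>, v, b). gam D (\<eta>, v, 0, b))
      ((\<lambda>z. (fst z, line_point (fst z) (snd z), bet D (fst z, line_point (fst z) (snd z), 0))) (0, 0))"
    using implicit_solution_smooth_near[OF gam_solution] by (simp add: line_point_zero b0 zero_prod_def)
  have gl: "smooth_near (\<lambda>z. gam D (fst z, line_point (fst z) (snd z), 0, bet D (fst z, line_point (fst z) (snd z), 0))) (0, 0)"
    using smooth_near_compose[OF g t] by simp
  have i: "smooth_near (\<lambda>z. inm D (bet D (fst z, line_point (fst z) (snd z), 0))) (0, 0)"
    by (rule smooth_near_compose[OF smooth_near_bounded_linear[OF blinfun.bounded_linear_right] bl'])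
  have "smooth_near (\<lambda>z. gen D + 0 + inm D (bet D (fst z, line_point (fst z) (snd z), 0)) +
      gam D (fst z, line_point (fst z) (snd z), 0, bet D (fst z, line_point (fst z) (snd z), 0))) (0, 0)"
    by (rule smooth_near_add[OF smooth_near_add[OF smooth_near_const i] gl])
  then show ?thesis by (simp add: Xi_eq om2_def om1_def)
qed

text \<open>The projection does not change values on the kernel, so the scalar equation is a directional derivative of
  the slice functions, and its smoothness follows from theirs by composition.\<close>

lemma bK_formula:
  assumes "good_point \<eta> s"
  shows "bK S D e \<eta> s = frechet_derivative h_slice (at (\<eta>, line_point \<eta> s)) (0, e) -
     frechet_derivative j_slice (at (\<eta>, line_point \<eta> s)) (0, e) (Xi D \<eta> (s *\<^sub>R e) 0)"
proof -
  let ?x = "(\<eta>, line_point \<eta> s)" and ?\<zeta> = "Xi D \<eta> (s *\<^sub>R e) 0"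
  have x: "?x \<in> udom D" using assms by (simp add: good_point_def Let_def)
  have "bK S D e \<eta> s = DV S D ?\<zeta> \<eta> (line_point \<eta> s) e"
    by (simp add: bK_def BB_def PP_apply_kerL[OF e_kerL] line_point_def)
  also have "\<dots> = dF ?\<zeta> ?x (0, e)" by (rule DV_apply[OF x])
  also have "\<dots> = frechet_derivative h_slice (at ?x) (0, e) - frechet_derivative j_slice (at ?x) (0, e) ?\<zeta>"
  proof -
    have "((\<lambda>x. h_slice x - j_slice x ?\<zeta>) has_derivative
        (\<lambda>h. frechet_derivative h_slice (at ?x) h - frechet_derivative j_slice (at ?x) h ?\<zeta>)) (at ?x)"
      by (rule has_derivative_diff[OF smooth_on_has_derivative[OF smooth_h x]
            bounded_linear.has_derivative[OF blinfun.bounded_linear_left smooth_on_has_derivative[OF smooth_j x]]])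
    from fun_cong[OF frechet_derivative_at[OF this], of "(0, e)"]
    show ?thesis by (simp add: dF_def F_slice_def[abs_def])
  qed
  finally show ?thesis .
qed

lemma smooth_bK: "smooth_near (\<lambda>z. bK S D e (fst z) (snd z)) (0, 0)"
proof -
  have lp: "smooth_near (\<lambda>z. (fst z, line_point (fst z) (snd z))) (0, 0)"
    by (rule smooth_near_Pair[OF smooth_near_bounded_linear[OF bounded_linear_fst] smooth_line_point])
  have z: "(\<lambda>z. (fst z, line_point (fst z) (snd z))) (0, 0) = (0, 0)" by (simp add: line_point_zero)
  have h: "smooth_near (\<lambda>x. frechet_derivative h_slice (at x) (0, e)) ((\<lambda>z. (fst z, line_point (fst z) (snd z))) (0, 0))"
    unfolding z by (rule smooth_near_deriv[OF smooth_nearI[OF open_udom udom0 smooth_h]])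
  have j: "smooth_near (\<lambda>x. frechet_derivative j_slice (at x) (0, e)) ((\<lambda>z. (fst z, line_point (fst z) (snd z))) (0, 0))"
    unfolding z by (rule smooth_near_deriv[OF smooth_nearI[OF open_udom udom0 smooth_j]])
  have "smooth_near (\<lambda>z. frechet_derivative h_slice (at (fst z, line_point (fst z) (snd z))) (0, e) -
     frechet_derivative j_slice (at (fst z, line_point (fst z) (snd z))) (0, e) (Xi D (fst z) (snd z *\<^sub>R e) 0)) (0, 0)"
    by (rule smooth_near_diff[OF smooth_near_compose[OF h lp] smooth_near_blinfun_apply[OF smooth_near_compose[OF j lp] smooth_Xi_line]])
  moreover have "\<forall>\<^sub>F z in nhds (0, 0). frechet_derivative h_slice (at (fst z, line_point (fst z) (snd z))) (0, e) -
     frechet_derivative j_slice (at (fst z, line_point (fst z) (snd z))) (0, e) (Xi D (fst z) (snd z *\<^sub>R e) 0) = bK S D e (fst z) (snd z)"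
    using eventually_good_point by eventually_elim (simp only: bK_formula)
  ultimately show ?thesis by (rule smooth_near_cong)
qed

subsection \<open>The bifurcating branch\<close>

lemma line_transversal_path:
  assumes "\<eta>0 \<in> fix_m S D K" "blinfun_apply \<kappa> \<eta>0 \<noteq> 0"
  shows "transversal_path (fix_m S D K) \<kappa> (\<lambda>l. l *\<^sub>R \<eta>0)"
  unfolding transversal_path_def
proof (intro conjI)
  show "smooth_on UNIV (\<lambda>l. l *\<^sub>R \<eta>0)" by (rule smooth_on_bounded_linear[OF open_UNIV bounded_linear_scaleR_left])
  have "coAd_m S D k (l *\<^sub>R \<eta>0) = l *\<^sub>R \<eta>0" if "k \<in> K" for k l
    using linear_scale[OF bounded_linear.linear[OF bounded_linear_coAd_m[of k]], of l \<eta>0] that K_Gamma assms(1)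
    by (auto simp: fix_m_def)
  then show "range (\<lambda>l. l *\<^sub>R \<eta>0) \<subseteq> fix_m S D K" by (auto simp: fix_m_def)
  have "((\<lambda>l. l *\<^sub>R \<eta>0) has_vector_derivative \<eta>0) (at 0)" by (auto intro!: derivative_eq_intros)
  then show "blinfun_apply \<kappa> (vector_derivative (\<lambda>l. l *\<^sub>R \<eta>0) (at 0)) \<noteq> 0"
    using assms(2) by (simp add: vector_derivative_at)
qed simp

text \<open>The kernel coordinate itself parametrises the branch, so it vanishes only at the bifurcation point.\<close>

lemma branch_from_fold_curve:
  assumes d: "d > 0" and f: "fold_curve d f" and \<eta>0: "range (\<lambda>l. l *\<^sub>R \<eta>0) \<subseteq> fix_m S D K"
    and sol: "\<And>s. s \<in> {-d<..<d} \<Longrightarrow> (f s *\<^sub>R \<eta>0, s) \<in> rel_eq_set S D K e"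
  shows "branch_bifurcates S D K e"
proof -
  have sf: "smooth_on {-d<..<d} f" and f0: "f 0 = 0" using f by (simp_all add: fold_curve_def)
  have in0: "0 \<in> {-d<..<d}" using d by simp
  have "isCont f 0" using smooth_on_continuous[OF sf] in0 by (simp add: continuous_on_eq_continuous_at)
  then have "isCont (\<lambda>t. (f t *\<^sub>R \<eta>0, t)) 0" by (intro continuous_intros) 
  then have lim: "((\<lambda>t. (f t *\<^sub>R \<eta>0, t)) \<longlongrightarrow> (0, 0)) (nhds 0)"
    using tendsto_at_iff_tendsto_nhds[of "\<lambda>t. (f t *\<^sub>R \<eta>0, t)" 0] by (simp add: isCont_def f0)
  have "\<forall>\<^sub>F t in nhds 0. good_point (f t *\<^sub>R \<eta>0) t"
    using lim[unfolded filterlim_iff, rule_format, OF eventually_good_point] by simp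
  then obtain c where c: "c > 0" "\<And>t. \<bar>t\<bar> < c \<Longrightarrow> good_point (f t *\<^sub>R \<eta>0) t"
    by (auto simp: eventually_nhds_metric dist_real_def)
  define \<epsilon> where "\<epsilon> = min c d"
  have sub: "{-\<epsilon><..<\<epsilon>} \<subseteq> {-d<..<d}" by (auto simp: \<epsilon>_def)
  have fixm: "f t *\<^sub>R \<eta>0 \<in> fix_m S D K" for t using \<eta>0 by blast
  show ?thesis
    unfolding branch_bifurcates_def
  proof (intro exI[of _ \<epsilon>] exI[of _ "\<lambda>t. f t *\<^sub>R \<eta>0"] exI[of _ "\<lambda>t. t"] conjI ballI impI)
    show "\<epsilon> > 0" using c d by (simp add: \<epsilon>_def)
    show "smooth_on {-\<epsilon><..<\<epsilon>} (\<lambda>t. f t *\<^sub>R \<eta>0)"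
      by (rule smooth_on_linear_compose[OF _ bounded_linear_scaleR_left smooth_on_subset[OF sf sub]]) simp
    show "smooth_on {-\<epsilon><..<\<epsilon>} (\<lambda>t. t)" by (rule smooth_on_bounded_linear[OF _ bounded_linear_ident]) simp
    show "f 0 *\<^sub>R \<eta>0 = 0" by (simp add: f0)
    show "red_point D (f 0 *\<^sub>R \<eta>0) (0 *\<^sub>R e) 0 = base D" using red_point_zero by (simp add: f0)
    fix t assume t: "t \<in> {-\<epsilon><..<\<epsilon>}"
    show "(f t *\<^sub>R \<eta>0, t) \<in> rel_eq_set S D K e" using sol t sub by blast
    have good: "good_point (f t *\<^sub>R \<eta>0) t" using t by (intro c(2)) (auto simp: \<epsilon>_def)
    assume "t \<noteq> 0"
    then show "t \<noteq> 0" "red_point D (f t *\<^sub>R \<eta>0) (t *\<^sub>R e) 0 \<noteq> base D"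
      "stabilizer (Gam S D) (act S) (red_point D (f t *\<^sub>R \<eta>0) (t *\<^sub>R e) 0) = K"
      using red_point_ne_base[OF good fixm] red_point_isotropy[OF good fixm] by blast+
  qed simp
qed

lemma branch_of_saddle_node:
  assumes "saddle_node (fix_m S D K) (rel_eq_set S D K e)"
  shows "branch_bifurcates S D K e"
proof -
  obtain \<kappa> \<eta>0 where k: "\<eta>0 \<in> fix_m S D K" "blinfun_apply \<kappa> \<eta>0 \<noteq> 0"
    and dia: "\<And>p. transversal_path (fix_m S D K) \<kappa> p \<Longrightarrow> saddle_node_diagram (\<lambda>l s. (p l, s) \<in> rel_eq_set S D K e)"
    using assms unfolding saddle_node_def by blast
  note path = line_transversal_path[OF k]
  obtain d r f where f: "d > 0" "r > 0" "fold_curve d f"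
    "\<forall>s\<in>{-d<..<d}. \<bar>f s\<bar> < r \<and> (\<forall>l\<in>{-r<..<r}. (l *\<^sub>R \<eta>0, s) \<in> rel_eq_set S D K e \<longleftrightarrow> l = f s)"
    using dia[OF path] unfolding saddle_node_diagram_def by blast
  show ?thesis
  proof (rule branch_from_fold_curve[OF f(1,3)])
    show "range (\<lambda>l. l *\<^sub>R \<eta>0) \<subseteq> fix_m S D K" using path by (simp add: transversal_path_def)
    fix s assume "s \<in> {-d<..<d}"
    note sol = bspec[OF f(4) this]
    then have "f s \<in> {-r<..<r}" by auto
    then show "(f s *\<^sub>R \<eta>0, s) \<in> rel_eq_set S D K e" using sol by blast
  qed
qed

lemma branch_of_pitchfork:
  assumes "pitchfork (fix_m S D K) (rel_eq_set S D K e)"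
  shows "branch_bifurcates S D K e"
proof -
  obtain \<kappa> \<eta>0 where k: "\<eta>0 \<in> fix_m S D K" "blinfun_apply \<kappa> \<eta>0 \<noteq> 0"
    and dia: "\<And>p. transversal_path (fix_m S D K) \<kappa> p \<Longrightarrow> pitchfork_diagram (\<lambda>l s. (p l, s) \<in> rel_eq_set S D K e)"
    using assms unfolding pitchfork_def by blast
  note path = line_transversal_path[OF k]
  obtain d r f where f: "d > 0" "r > 0" "fold_curve d f"
    "\<forall>s\<in>{-d<..<d}. \<bar>f s\<bar> < r \<and> (\<forall>l\<in>{-r<..<r}. (l *\<^sub>R \<eta>0, s) \<in> rel_eq_set S D K e \<longleftrightarrow> s = 0 \<or> l = f s)"
    using dia[OF path] unfolding pitchfork_diagram_def by blast
  show ?thesis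
  proof (rule branch_from_fold_curve[OF f(1,3)])
    show "range (\<lambda>l. l *\<^sub>R \<eta>0) \<subseteq> fix_m S D K" using path by (simp add: transversal_path_def)
    fix s assume "s \<in> {-d<..<d}"
    note sol = bspec[OF f(4) this]
    then have "f s \<in> {-r<..<r}" by auto
    then show "(f s *\<^sub>R \<eta>0, s) \<in> rel_eq_set S D K e" using sol by blast
  qed
qed

end

theorem theorem5p1:
  fixes S :: "('a::t2_space, 'g::euclidean_space, 'p::t2_space, 'e::banach) ham_system"
    and D :: "('a, 'g, 'p, 'm::euclidean_space, 'v::{real_inner, complete_space}) slice_data"
    and V0 :: "'e set" and K :: "'a set" and e :: 'v
  assumes system: "hamiltonian_G_system S" "proper_action S"
    and rel_eq: "relative_equilibrium S (base D) (gen D)"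
    and V0: "subspace V0" "V0 \<noteq> {0}"
      "internal_sum (second_variation_kernel S (gen D) (base D))
         ((\<lambda>\<zeta>. inf_gen S \<zeta> (base D)) ` lie_algebra S (G_mu S D)) V0"
    and slice: "splitting S D" "slice_mapping S D" "equivariant_slice S D"
    and reduction: "step1 S D" "step2 S D" "step3 S D"
    and identification: "V0 = (\<lambda>v. TPsi S D (0, 0) (0, v)) ` kerL S D"
    and K: "maximal_isotropy S D V0 K" "dim (fix_T S D V0 K) = 1"
    and rigid: "\<forall>\<^sub>F (\<eta>, v0) in nhds (0, 0).
      \<eta> \<in> fix_m S D K \<and> v0 \<in> fix_kerL S D K \<longrightarrow> rho S D \<eta> v0 0 = 0"
    and e: "e \<in> fix_kerL S D K" "norm e = 1"
    and generic:
      "trivial_group (weyl_group S D K) \<longrightarrow> generic_fold (fix_m S D K) (bK S D e)"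
      "weyl_group S D K \<cong> integer_mod_group 2 \<longrightarrow> generic_pitchfork (fix_m S D K) (bK S D e)"
  shows "branch_bifurcates S D K e \<and>
    (trivial_group (weyl_group S D K) \<longrightarrow>
       saddle_node (fix_m S D K) (rel_eq_set S D K e)) \<and>
    (weyl_group S D K \<cong> integer_mod_group 2 \<longrightarrow>
       pitchfork (fix_m S D K) (rel_eq_set S D K e))"
proof -
  interpret fixed_line_reduction S D V0 K e
    by unfold_locales (rule system rel_eq slice reduction identification K rigid e)+
  have fold: "saddle_node (fix_m S D K) (rel_eq_set S D K e)" if "trivial_group (weyl_group S D K)"
    using saddle_node_of_generic_fold[OF smooth_bK bK_zero bK_criterion] generic(1) that by blast
  have fork: "pitchfork (fix_m S D K) (rel_eq_set S D K e)" if "weyl_group S D K \<cong> integer_mod_group 2"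
    using pitchfork_of_generic_pitchfork[OF smooth_bK bK_zero bK_criterion] generic(2) that by blast
  have "branch_bifurcates S D K e"
    using weyl_group_cases fold fork branch_of_saddle_node branch_of_pitchfork by blast
  then show ?thesis using fold fork by blast
qed

end
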